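(* Let $d\ge 2$, let $H<\mathrm{Sym}(\{0,1,\ldots,d-1\})$ be a transitive permutation group, and let $m\ge 1$. Let $a_1,\ldots,a_m$ be independent Haar-random elements of $W(H)$ and put $\Gamma=\langle a_1,\ldots,a_m\rangle<W(H)$. Then almost surely the following holds for every non-cyclic finitely generated subgroup $\Delta<\Gamma$, with a fixed finite generating set $\underline{w}$ of $\Delta$ and $Y_n(\Delta)=\mathcal{G}(\Delta,\underline{w},L(n))$: (1) there is a number $M=M(\Delta)$ such that for every $n$ the graph $Y_n(\Delta)$ has at most $M$ connected components; (2) if $d=2$, the collection of all connected components of the graphs $Y_n(\Delta)$, $n\ge 0$, is a family of expander graphs, i.e. there is $\alpha>0$ such that every such connected component $C$ satisfies $h(C)\ge\alpha$.
   Context: $T=T_d$ is the rooted $d$-ary tree: vertices are finite words over $\{0,\ldots,d-1\}$, the root is the empty word, and $L(n)$ (the $n$-th level) is the set of words of length $n$. Automorphisms act on the right, $v\mapsto v^g$. For a vertex $v$, $T_v$ is the subtree of descendants of $v$ and $\tau_v:T_v\to T$ deletes the first $|v|$ letters. The local cocycle is $\beta(g,v)=\tau_v^{-1}g\,\tau_{v^g}\in\mathrm{Aut}(T)$, and $\overline{\beta(g,v)}\in\mathrm{Sym}(d)$ is its action on the first level. $W(H)=\{g\in\mathrm{Aut}(T):\overline{\beta(g,v)}\in H\ \forall v\}$ (the infinite iterated wreath product of $H$); it is a compact profinite group with Haar probability measure. For a group $\Delta$ acting on a set $X$ and a finite $S\subset\Delta$, the Schreier graph $\mathcal{G}(\Delta,S,X)$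 has vertex set $X$ and, for each $x\in X$ and $s\in S\cup S^{-1}$, a directed edge from $x$ to $x^s$ (with $(x,s)$ and $(x^s,s^{-1})$ mutually inverse); it is $2|S|$-regular. The Cheeger constant of a finite regular graph $X$ is $h(X)=\inf_{A}\frac{e(A,\overline{A})}{\min\{|A|,|\overline A|\}}$ over nonempty proper vertex subsets $A$, where $e(A,\overline A)$ is the number of edges between $A$ and its complement. *)

theory Defs
  imports
    "HOL-Probability.Probability"
    "HOL-Algebra.Elementary_Groups"
    "HOL-Combinatorics.Permutations"
    "Graph_Theory.Digraph_Component"
begin

section \<open>Permutation groups acting on the right\<close>

text \<open>
  Permutations act on the right, \<open>x \<mapsto> x\<^sup>g\<close>, so the product \<open>g \<otimes> h\<close> means ``first \<open>g\<close>, then \<open>h\<close>''.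
  A permutation of \<open>X\<close> is a function that is the identity outside \<open>X\<close> (library notion
  \<open>permutes\<close>), so equality of permutations is equality of functions.
\<close>

definition perm_group :: "'a set \<Rightarrow> ('a \<Rightarrow> 'a) monoid" where
  "perm_group X = \<lparr>carrier = {p. p permutes X}, monoid.mult = (\<lambda>g h. h \<circ> g), one = id\<rparr>"

definition transitive_on :: "('a \<Rightarrow> 'a) set \<Rightarrow> 'a set \<Rightarrow> bool" where
  "transitive_on H X \<longleftrightarrow> (\<forall>x\<in>X. \<forall>y\<in>X. \<exists>h\<in>H. h x = y)"


section \<open>The rooted $d$-ary tree and its automorphisms\<close>

definition tree_verts :: "nat \<Rightarrow> nat list set" where
  "tree_verts d = lists {..<d}"

definition level :: "nat \<Rightarrow> nat \<Rightarrow> nat list set" where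
  "level d n = {v \<in> tree_verts d. length v = n}"

definition tree_adj :: "nat list \<Rightarrow> nat list \<Rightarrow> bool" where
  "tree_adj u v \<longleftrightarrow> (\<exists>x. v = u @ [x] \<or> u = v @ [x])"

definition tree_aut :: "nat \<Rightarrow> (nat list \<Rightarrow> nat list) set" where
  "tree_aut d = {g. g permutes tree_verts d \<and> g [] = [] \<and>
     (\<forall>u\<in>tree_verts d. \<forall>v\<in>tree_verts d. tree_adj (g u) (g v) \<longleftrightarrow> tree_adj u v)}"

text \<open>
  The local cocycle \<open>\<beta>(g,v) = \<tau>\<^sub>v\<inverse> g \<tau>\<^bsub>v^g\<^esub>\<close>, read from left to right: prepend \<open>v\<close>, apply \<open>g\<close>,
  delete the first \<open>|v\<^sup>g|\<close> letters.
\<close>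

definition cocycle :: "(nat list \<Rightarrow> nat list) \<Rightarrow> nat list \<Rightarrow> nat list \<Rightarrow> nat list" where
  "cocycle g v w = drop (length (g v)) (g (v @ w))"

text \<open>
  The action on the first level, a letter \<open>x\<close> being identified with the one-letter word \<open>[x]\<close>.
\<close>

definition first_level_action :: "(nat list \<Rightarrow> nat list) \<Rightarrow> nat \<Rightarrow> nat" where
  "first_level_action g x = hd (g [x])"

definition wreath :: "nat \<Rightarrow> (nat \<Rightarrow> nat) set \<Rightarrow> (nat list \<Rightarrow> nat list) set" where
  "wreath d H = {g \<in> tree_aut d. \<forall>v\<in>tree_verts d. first_level_action (cocycle g v) \<in> H}"

definition wreath_group :: "nat \<Rightarrow> (nat \<Rightarrow> nat) set \<Rightarrow> (nat list \<Rightarrow> nat list) monoid" where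
  "wreath_group d H = (perm_group (tree_verts d))\<lparr>carrier := wreath d H\<rparr>"

text \<open>The profinite topology on \<open>W(H)\<close> is the topology of pointwise convergence on vertices.\<close>

definition wreath_topology :: "nat \<Rightarrow> (nat \<Rightarrow> nat) set \<Rightarrow> (nat list \<Rightarrow> nat list) topology" where
  "wreath_topology d H =
     subtopology (product_topology (\<lambda>_. discrete_topology UNIV) UNIV) (wreath d H)"


section \<open>Haar probability measure\<close>

definition borel_of :: "'a topology \<Rightarrow> 'a measure" where
  "borel_of T = sigma (topspace T) {U. openin T U}"

text \<open>
  \<open>\<mu>\<close> is a Haar probability measure on the group \<open>G\<close> with topology \<open>T\<close>.  Regularity is not demanded
  separately: it is automatic for finite Borel measures on a compact metrizable group.
\<close>

definition haar_prob :: "('a, 'b) monoid_scheme \<Rightarrow> 'a topology \<Rightarrow> 'a measure \<Rightarrow> bool" where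
  "haar_prob G T \<mu> \<longleftrightarrow> prob_space \<mu> \<and> space \<mu> = topspace T \<and> sets \<mu> = sets (borel_of T) \<and>
     (\<forall>g\<in>carrier G. \<forall>A\<in>sets \<mu>. emeasure \<mu> ((\<lambda>x. g \<otimes>\<^bsub>G\<^esub> x) ` A) = emeasure \<mu> A)"


section \<open>Schreier graphs and the Cheeger constant\<close>

definition generating_set :: "('a, 'b) monoid_scheme \<Rightarrow> 'a set \<Rightarrow> bool" where
  "generating_set G S \<longleftrightarrow> S \<subseteq> carrier G \<and> generate G S = carrier G"

definition finitely_generated :: "('a, 'b) monoid_scheme \<Rightarrow> bool" where
  "finitely_generated G \<longleftrightarrow> (\<exists>S. finite S \<and> generating_set G S)"

text \<open>
  The Schreier graph of \<open>G\<close> acting on \<open>X\<close> by \<open>act\<close>.  For every \<open>x \<in> X\<close> and \<open>s \<in> S\<close> there are the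
  directed edges \<open>(x, s, True)\<close> from \<open>x\<close> to \<open>x\<^sup>s\<close> and \<open>(x, s, False)\<close> from \<open>x\<close> to \<open>x\<close> acted on by the
  inverse of \<open>s\<close>; the edges \<open>(x, s, True)\<close> and \<open>(x\<^sup>s, s, False)\<close> are mutually inverse.  The Boolean
  tag keeps \<open>S\<close> and \<open>S\<inverse>\<close> formally disjoint, so that the graph is \<open>2|S|\<close>-regular even when \<open>S\<close>
  contains involutions or pairs of inverse elements.
\<close>

definition schreier_graph ::
  "('g, 'b) monoid_scheme \<Rightarrow> ('x \<Rightarrow> 'g \<Rightarrow> 'x) \<Rightarrow> 'g set \<Rightarrow> 'x set \<Rightarrow> ('x, 'x \<times> 'g \<times> bool) pre_digraph"
where
  "schreier_graph G act S X =
     \<lparr>verts = X, arcs = X \<times> S \<times> UNIV, tail = (\<lambda>(x, s, b). x),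
      head = (\<lambda>(x, s, b). act x (if b then s else inv\<^bsub>G\<^esub> s))\<rparr>"

text \<open>
  The graphs above are symmetric, every edge coming with its inverse, so their connected components
  are the strongly connected components of the library, as induced subgraphs.
\<close>

abbreviation graph_components :: "('v, 'e) pre_digraph \<Rightarrow> ('v, 'e) pre_digraph set" where
  "graph_components X \<equiv> pre_digraph.sccs X"

text \<open>
  An undirected edge is a pair of mutually inverse directed edges; exactly one of the two leads from
  \<open>A\<close> to its complement if the undirected edge joins \<open>A\<close> to its complement.
\<close>

definition boundary_edges :: "('v, 'e) pre_digraph \<Rightarrow> 'v set \<Rightarrow> nat" where
  "boundary_edges X A = card {e \<in> arcs X. tail X e \<in> A \<and> head X e \<in> verts X - A}"

text \<open>
  The value is an extended real so that the infimum over the empty family, which occurs for a graph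
  with a single vertex, is \<open>\<infinity>\<close>.
\<close>

definition cheeger :: "('v, 'e) pre_digraph \<Rightarrow> ereal" where
  "cheeger X = (INF A \<in> {A. A \<noteq> {} \<and> A \<subset> verts X}.
     ereal (real (boundary_edges X A) / real (min (card A) (card (verts X - A)))))"

text \<open>\<open>Y\<^sub>n(\<Delta>)\<close> with respect to the generating set \<open>w\<close>.\<close>

definition level_graph ::
  "nat \<Rightarrow> (nat list \<Rightarrow> nat list, 'b) monoid_scheme \<Rightarrow> (nat list \<Rightarrow> nat list) set \<Rightarrow> nat \<Rightarrow>
    (nat list, nat list \<times> (nat list \<Rightarrow> nat list) \<times> bool) pre_digraph"
where
  "level_graph d \<Delta> w n = schreier_graph \<Delta> (\<lambda>v g. g v) w (level d n)"

end

(* An element of W(H) is determined by its portrait, a labelling of the tree vertices by independent uniform elements of H.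
   If closed words g_1, ..., g_M at a vertex v cross edges e_1, ..., e_M of the Schreier graph in a triangular pattern (e_j exactly
   once in g_j and never in g_k for k > j), then conditionally on the level of v their cocycles at v are again independent and
   Haar-distributed.  Now M independent Haar elements with M large are transitive on all levels, and for d = 2 have a
   spectral gap on all of them, outside an event of probability exponentially small in M: the first by counting invariant sets of
   fibres, the second by counting connected sets with small edge boundary and lifting functions level by level.  Two Haar
   elements have large orbits on deep levels, so the chords of spanning trees of these orbits supply many words in triangular
   position; hence almost surely two Haar elements generate such a group on every subtree below some level.

   For a non-cyclic finitely generated Delta, the coset graph of Delta in Gamma contains a finite subgraph with more edges than
   vertices and without leaves.  In its product with a level of large girth some edge can be crossed exactly once by a closed
   path, and some reduced closed path avoids it; going deeper, this yields two words of Delta, up to conjugation, in triangular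
   position at every vertex of a level.  There are countably many patterns, so almost surely the previous paragraph applies to all
   of them: finitely many subtrees cover a level such that Delta contains elements acting transitively, and with a gap for d = 2, on
   each of them.  The number of subtrees bounds the number of orbits.  A set with intermediate density on some subtree has large
   boundary there, and otherwise its densities on two subtrees in one orbit differ, so an element mapping one to the other sees
   a large boundary. *)

theory Submission
 imports Defs
begin

section \<open>Words acting on sets\<close>

text \<open>Two Haar elements may both act trivially on the first level, so for them goodness itself
  fails with positive probability, and a union bound over the \<open>d ^ k\<close> vertices of a
  level is hopeless with two words. It succeeds with many: the failure probability
  \<open>\<epsilon>good M\<close> decays geometrically in \<open>M\<close>, so \<open>M\<close>
  proportional to \<open>k\<close> beats \<open>d ^ k\<close>, and orbits on level \<open>k\<close>
  only have to exceed this linear size. Randomness is handled on finite levels. A Haar family is a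
  random configuration whose truncations are uniform, and independence comes from resampling the
  label of an edge which the configuration itself selects. Triangular position is exactly what lets
  the labels be resampled one after another. The absence of short closed words is needed early and
  often: it makes short paths trees, so that an edge can be crossed exactly once. For expansion,
  \<open>d = 2\<close> matters because functions on a level split into lifts from the level above
  and functions odd under exchanging siblings. Every label is the identity or the exchange and
  respects this splitting, so the constant of the gap is the same on all levels.\<close>

definition linv :: "nat \<times> bool \<Rightarrow> nat \<times> bool" where
 "linv l = (fst l, \<not> snd l)"

definition winv :: "(nat \<times> bool) list \<Rightarrow> (nat \<times> bool) list" where
 "winv w = rev (map linv w)"

definition reduced :: "(nat \<times> bool) list \<Rightarrow> bool" where
 "reduced w \<longleftrightarrow> successively (\<lambda>a b. b \<noteq> linv a) w"

text \<open>A letter is the index of a generator together with \<open>True\<close> for the generator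
  and \<open>False\<close> for its inverse.\<close>

definition letters :: "nat \<Rightarrow> (nat \<times> bool) set" where
 "letters m = {..<m} \<times> UNIV"

fun wk :: "(nat \<times> bool \<Rightarrow> 'v \<Rightarrow> 'v) \<Rightarrow> (nat \<times> bool) list \<Rightarrow> 'v \<Rightarrow> 'v" where
 "wk st [] v = v"
| "wk st (l # w) v = wk st w (st l v)"

text \<open>An undirected edge is named by its generator and by the origin of its positively
  oriented copy, so that both directions of traversal give the same name.\<close>

definition edg :: "(nat \<times> bool \<Rightarrow> 'v \<Rightarrow> 'v) \<Rightarrow> nat \<times> bool \<Rightarrow> 'v \<Rightarrow> nat \<times> 'v" where
 "edg st l v = (fst l, if snd l then v else st l v)"

fun tr :: "(nat \<times> bool \<Rightarrow> 'v \<Rightarrow> 'v) \<Rightarrow> (nat \<times> bool) list \<Rightarrow> 'v \<Rightarrow> (nat \<times> 'v) list" where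
 "tr st [] v = []"
| "tr st (l # w) v = edg st l v # tr st w (st l v)"

definition sym_act :: "(nat \<times> bool \<Rightarrow> 'v \<Rightarrow> 'v) \<Rightarrow> 'v set \<Rightarrow> bool" where
 "sym_act st V \<longleftrightarrow> (\<forall>l. \<forall>v\<in>V. st l v \<in> V \<and> st (linv l) (st l v) = v)"

lemma linv_linv [simp]: "linv (linv l) = l"
 by (simp add: linv_def)

lemma linv_neq [simp]: "linv l \<noteq> l" "l \<noteq> linv l"
 by (metis linv_def snd_conv)+

lemma fst_linv [simp]: "fst (linv l) = fst l" and snd_linv [simp]: "snd (linv l) \<longleftrightarrow> \<not> snd l"
 by (simp_all add: linv_def)

lemma linv_letters [simp]: "linv l \<in> letters m \<longleftrightarrow> l \<in> letters m"
 by (cases l) (auto simp: letters_def linv_def)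

lemma finite_letters [simp]: "finite (letters m)"
 by (simp add: letters_def)

lemma card_letters: "card (letters m) = 2 * m"
 by (simp add: letters_def card_cartesian_product)

lemma winv_simps [simp]: "winv [] = []" "length (winv w) = length w" "winv (winv w) = w"
 "winv (u @ w) = winv w @ winv u" "winv (l # w) = winv w @ [linv l]" "winv w = [] \<longleftrightarrow> w = []"
 by (simp_all add: winv_def rev_map o_def)

lemma set_winv: "set (winv w) = linv ` set w"
 by (simp add: winv_def)

lemma set_winv_letters [simp]: "set (winv w) \<subseteq> letters m \<longleftrightarrow> set w \<subseteq> letters m"
 by (auto simp: set_winv)

lemma hd_winv: "w \<noteq> [] ==> hd (winv w) = linv (last w)"
 by (simp add: winv_def hd_rev last_map)

lemma reduced_Nil [simp]: "reduced []" and reduced_single [simp]: "reduced [l]"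
 by (simp_all add: reduced_def)

lemma reduced_append: "reduced (u @ w) \<longleftrightarrow> reduced u \<and> reduced w \<and> (u = [] \<or> w = [] \<or> hd w \<noteq> linv (last u))"
 by (simp add: reduced_def successively_append_iff)

lemma reduced_Cons: "reduced (l # w) \<longleftrightarrow> reduced w \<and> (w = [] \<or> hd w \<noteq> linv l)"
 using reduced_append[of "[l]" w] by simp

lemma reduced_winv [simp]: "reduced (winv w) \<longleftrightarrow> reduced w"
proof -
 have *: "reduced w ==> reduced (winv w)" for w
 proof (induction w)
  case (Cons l w)
  then show ?case
   by (cases w) (auto simp: reduced_append reduced_Cons hd_winv)
 qed simp
 from *[of w] *[of "winv w"] show ?thesis by auto
qed

lemma wk_append [simp]: "wk st (u @ w) v = wk st w (wk st u v)"
 by (induction u arbitrary: v) auto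

lemma tr_append [simp]: "tr st (u @ w) v = tr st u v @ tr st w (wk st u v)"
 by (induction u arbitrary: v) auto

lemma length_tr [simp]: "length (tr st w v) = length w"
 by (induction w arbitrary: v) auto

lemma sym_actD:
 assumes "sym_act st V" "v \<in> V"
 shows "st l v \<in> V" "st (linv l) (st l v) = v" "st l (st (linv l) v) = v"
proof -
 show a: "st l v \<in> V" "st (linv l) (st l v) = v" using assms unfolding sym_act_def by blast+
 have "st (linv (linv l)) (st (linv l) v) = v" using assms unfolding sym_act_def by blast
 then show "st l (st (linv l) v) = v" by simp
qed

lemma sym_act_wk: "sym_act st V ==> v \<in> V ==> wk st w v \<in> V"
 by (induction w arbitrary: v) (auto simp: sym_actD)

lemma wk_winv: "sym_act st V ==> v \<in> V ==> wk st (winv w) (wk st w v) = v"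
 by (induction w arbitrary: v) (auto simp: sym_actD)

lemma wk_winv': "sym_act st V ==> v \<in> V ==> wk st w (wk st (winv w) v) = v"
 using wk_winv[of st V v "winv w"] by simp

lemma wk_inj: "sym_act st V ==> u \<in> V ==> v \<in> V ==> wk st w u = wk st w v \<longleftrightarrow> u = v"
 by (metis wk_winv)

lemma st_inj: "sym_act st V ==> u \<in> V ==> v \<in> V ==> st l u = st l v \<longleftrightarrow> u = v"
 by (metis sym_actD(2))

lemma edg_linv: "sym_act st V ==> v \<in> V ==> edg st (linv l) (st l v) = edg st l v"
 by (auto simp: edg_def sym_actD)

lemma tr_winv: "sym_act st V ==> v \<in> V ==> tr st (winv w) (wk st w v) = rev (tr st w v)"
 by (induction w arbitrary: v) (auto simp: sym_actD wk_winv edg_linv)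

lemma edg_eq_iff:
 assumes "sym_act st V" "u \<in> V" "v \<in> V"
 shows "edg st l u = edg st k v \<longleftrightarrow> (l = k \<and> u = v) \<or> (l = linv k \<and> u = st k v)"
proof -
 have 1: "l = k \<longleftrightarrow> fst l = fst k \<and> snd l = snd k" "l = linv k \<longleftrightarrow> fst l = fst k \<and> snd l \<noteq> snd k"
  by (auto simp: prod_eq_iff)
 show ?thesis
 proof (cases "fst l = fst k")
  case True
  show ?thesis
  proof (cases "snd l = snd k")
   case s: True
   then have "l = k" using True 1 by blast
   then show ?thesis using st_inj[OF assms, of k] by (auto simp: edg_def)
  next
   case False
   then have l: "l = linv k" using True 1 by blast
   have "st (linv k) u = v \<longleftrightarrow> u = st k v"
    using sym_actD(2)[OF assms(1,3), of k] sym_actD(3)[OF assms(1,2), of k] by metis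
   then show ?thesis unfolding l by (auto simp: edg_def)
  qed
 next
  case False
  then show ?thesis by (auto simp: edg_def)
 qed
qed

lemma wk_pow: "wk st (concat (replicate k w)) v = (wk st w ^^ k) v"
 by (induction k arbitrary: v) (auto simp: funpow_swap1)

definition girth_gt :: "(nat \<times> bool \<Rightarrow> 'v \<Rightarrow> 'v) \<Rightarrow> nat \<Rightarrow> 'v set \<Rightarrow> nat \<Rightarrow> bool" where
 "girth_gt st m V n \<longleftrightarrow> (\<forall>v\<in>V. \<forall>w. reduced w \<and> w \<noteq> [] \<and> set w \<subseteq> letters m \<and> length w \<le> n --> wk st w v \<noteq> v)"

text \<open>Cancel the longest common suffix \<open>t\<close>. The remaining words end in different
  letters, so one followed by the inverse of the other stays reduced; injectivity of the letters
  keeps the endpoints equal.\<close>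

lemma reduced_words_distinct_ends:
 assumes sym: "sym_act st V" and neq: "w1 \<noteq> w2" and v: "v \<in> V"
  and red: "reduced w1" "reduced w2" and eq: "wk st w1 v = wk st w2 v"
 obtains a b t where "w1 = a @ t" "w2 = b @ t" "reduced (a @ winv b)" "a @ winv b \<noteq> []" "wk st (a @ winv b) v = v"
 using neq red eq
proof (induction "length w1 + length w2" arbitrary: w1 w2 thesis rule: less_induct)
 case less
 show ?case
 proof (cases "w1 \<noteq> [] \<and> w2 \<noteq> [] \<and> last w1 = last w2")
  case True
  then obtain u1 u2 l where u: "w1 = u1 @ [l]" "w2 = u2 @ [l]"
   by (metis append_butlast_last_id)
  have "wk st u1 v = wk st u2 v"
   using less.prems(5) u st_inj[OF sym sym_act_wk[OF sym v] sym_act_wk[OF sym v]] by simp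
  moreover have "u1 \<noteq> u2" "reduced u1" "reduced u2" using less.prems u by (auto simp: reduced_append)
  ultimately obtain a b t where "u1 = a @ t" "u2 = b @ t" "reduced (a @ winv b)" "a @ winv b \<noteq> []" "wk st (a @ winv b) v = v"
   using less.hyps[of u1 u2] u by auto
  then show ?thesis using less.prems(1)[of a "t @ [l]" b] u by auto
 next
  case False
  have "reduced (w1 @ winv w2)"
   using less.prems False by (auto simp: reduced_append hd_winv)
    (metis hd_winv linv_linv winv_simps(6))
  moreover have "w1 @ winv w2 \<noteq> []" using less.prems by auto
  moreover have "wk st (w1 @ winv w2) v = v" using less.prems(5) wk_winv[OF sym v, of w2] by simp
  ultimately show ?thesis using less.prems(1)[of w1 "[]" w2] by simp
 qed
qed

lemma girth_inj:
 assumes sym: "sym_act st V" and g: "girth_gt st m V (2 * n)" and v: "v \<in> V"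
  and "reduced w1" "reduced w2" "set w1 \<subseteq> letters m" "set w2 \<subseteq> letters m" "length w1 \<le> n" "length w2 \<le> n"
  and eq: "wk st w1 v = wk st w2 v"
 shows "w1 = w2"
proof (rule ccontr)
 assume "w1 \<noteq> w2"
 then obtain a b t where "w1 = a @ t" "w2 = b @ t" "reduced (a @ winv b)" "a @ winv b \<noteq> []" "wk st (a @ winv b) v = v"
  using reduced_words_distinct_ends[OF sym _ v] assms by metis
 moreover have "set (a @ winv b) \<subseteq> letters m" "length (a @ winv b) \<le> 2 * n"
  using assms calculation by (auto simp: set_winv)
 ultimately show False using g v unfolding girth_gt_def by blast
qed

section \<open>Spanning trees\<close>

definition reach :: "(nat \<times> bool \<Rightarrow> 'v \<Rightarrow> 'v) \<Rightarrow> (nat \<times> 'v) set \<Rightarrow> 'v \<Rightarrow> 'v set" where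
 "reach st E u = {wk st w u | w. set (tr st w u) \<subseteq> E}"

lemma reach_self [simp]: "u \<in> reach st E u"
 unfolding reach_def by (auto intro!: exI[of _ "[]"])

lemma reach_step: "y \<in> reach st E u ==> edg st l y \<in> E ==> st l y \<in> reach st E u"
 unfolding reach_def by clarsimp (rule_tac x = "w @ [l]" in exI, simp)

lemma reach_subset: "sym_act st V ==> u \<in> V ==> reach st E u \<subseteq> V"
 by (auto simp: reach_def sym_act_wk)

lemma reach_closed_subset:
 assumes "u \<in> S" and "\<And>y l. y \<in> S ==> edg st l y \<in> E ==> st l y \<in> S"
 shows "reach st E u \<subseteq> S"
proof -
 have "wk st w u \<in> S" if "set (tr st w u) \<subseteq> E" "u \<in> S" for w u
  using that by (induction w arbitrary: u) (auto intro: assms(2))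
 then show ?thesis using assms(1) by (auto simp: reach_def)
qed

text \<open>The tree grows by one vertex at a time, and \<open>\<tau>\<close> spells the tree paths.
  The last property says that a tree edge changes the path word by one letter at its end, which is
  what makes detours along tree edges cancel.\<close>

lemma spanning_tree:
 assumes sym: "sym_act st V" and uV: "u \<in> V" and fin: "finite (reach st E u)"
 obtains T \<tau> where "T \<subseteq> E" "finite T" "Suc (card T) = card (reach st E u)" "\<tau> u = []"
  "\<And>y. y \<in> reach st E u ==> wk st (\<tau> y) u = y"
  "\<And>y. y \<in> reach st E u ==> set (tr st (\<tau> y) u) \<subseteq> T"
  "\<And>y l. y \<in> reach st E u ==> edg st l y \<in> T ==> \<tau> (st l y) = \<tau> y @ [l] \<or> \<tau> y = \<tau> (st l y) @ [linv l]"
proof -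
 let ?R = "reach st E u"
 \<comment> \<open>The last conjunct ranges over all of \<open>V\<close>: both ends of each tree
   edge lie in \<open>Os\<close>. Therefore an edge that leaves \<open>Os\<close> is new, and the
   count of edges keeps step with the count of vertices.\<close>
 define Q where "Q Os T \<tau> \<longleftrightarrow> u \<in> Os \<and> Os \<subseteq> ?R \<and> T \<subseteq> E \<and> finite T \<and> Suc (card T) = card Os \<and> \<tau> u = [] \<and>
  (\<forall>y\<in>Os. wk st (\<tau> y) u = y \<and> set (tr st (\<tau> y) u) \<subseteq> T) \<and>
  (\<forall>y\<in>V. \<forall>l. edg st l y \<in> T --> y \<in> Os \<and> st l y \<in> Os \<and> (\<tau> (st l y) = \<tau> y @ [l] \<or> \<tau> y = \<tau> (st l y) @ [linv l]))"
  for Os T \<tau>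
 have RV: "?R \<subseteq> V" by (rule reach_subset[OF sym uV])
 have ex: "\<exists>Os T \<tau>. card Os = k \<and> Q Os T \<tau>" if "1 \<le> k" "k \<le> card ?R" for k
  using that
 proof (induction k)
  case (Suc k)
  show ?case
  proof (cases "k = 0")
   case True
   have "Q {u} {} (\<lambda>_. [])" by (auto simp: Q_def)
   then show ?thesis using True by (intro exI[of _ "{u}"] exI) auto
  next
   case False
   then obtain Os T \<tau> where Os: "card Os = k" "Q Os T \<tau>" using Suc by auto
   then have sub: "Os \<subseteq> ?R" "u \<in> Os" by (auto simp: Q_def)
   then have "Os \<noteq> ?R" using Os Suc by auto
   then obtain y l where yl: "y \<in> Os" "edg st l y \<in> E" "st l y \<notin> Os"
    using reach_closed_subset[of u Os st E] sub by blast
   define y' where "y' = st l y"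
   have yV: "y \<in> V" "y' \<in> V" "y' \<in> ?R" using yl sub RV reach_step[of y st E u l] y'_def by auto
   define \<tau>' where "\<tau>' = \<tau>(y' := \<tau> y @ [l])"
   have finO: "finite Os" using finite_subset[OF sub(1) fin] .
   have "Q (insert y' Os) (insert (edg st l y) T) \<tau>'"
    unfolding Q_def
   proof (intro conjI ballI allI impI)
    have Q: "Q Os T \<tau>" by fact
    have y'O: "y' \<notin> Os" using yl by (simp add: y'_def)
    show "u \<in> insert y' Os" "insert y' Os \<subseteq> ?R" "insert (edg st l y) T \<subseteq> E" "finite (insert (edg st l y) T)"
     using Q yV yl by (auto simp: Q_def)
    have "edg st l y \<notin> T" using Q y'O yV(1) unfolding Q_def y'_def by blast
    then show "Suc (card (insert (edg st l y) T)) = card (insert y' Os)"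
     using Q y'O finO by (auto simp: Q_def)
    show "\<tau>' u = []" using Q y'O by (auto simp: \<tau>'_def Q_def)
    fix z assume z: "z \<in> insert y' Os"
    show "wk st (\<tau>' z) u = z" "set (tr st (\<tau>' z) u) \<subseteq> insert (edg st l y) T"
     using z Q yl by (auto simp: \<tau>'_def Q_def y'_def split: if_splits)
   next
    fix z k assume z: "z \<in> V" "edg st k z \<in> insert (edg st l y) T"
    have Q: "Q Os T \<tau>" by fact
    have y'O: "y' \<notin> Os" using yl by (simp add: y'_def)
    have st': "st (linv l) y' = y" using sym yV by (simp add: y'_def sym_actD)
    consider "edg st k z \<in> T" | "k = l" "z = y" | "k = linv l" "z = y'"
     using z edg_eq_iff[OF sym z(1) yV(1), of k l] by (auto simp: y'_def)
    then have "z \<in> insert y' Os \<and> st k z \<in> insert y' Os \<and> (\<tau>' (st k z) = \<tau>' z @ [k] \<or> \<tau>' z = \<tau>' (st k z) @ [linv k])"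
    proof cases
     case 1
     then have zz: "z \<in> Os" "st k z \<in> Os" "\<tau> (st k z) = \<tau> z @ [k] \<or> \<tau> z = \<tau> (st k z) @ [linv k]"
      using Q z(1) unfolding Q_def by blast+
     then have "z \<noteq> y'" "st k z \<noteq> y'" using y'O by metis+
     then show ?thesis using zz by (simp add: \<tau>'_def)
    next
     case 2
     then show ?thesis using yl y'O by (auto simp: \<tau>'_def y'_def)
    next
     case 3
     then show ?thesis using yl y'O st' by (auto simp: \<tau>'_def)
    qed
    then show "z \<in> insert y' Os" "st k z \<in> insert y' Os" "\<tau>' (st k z) = \<tau>' z @ [k] \<or> \<tau>' z = \<tau>' (st k z) @ [linv k]"
     by auto
   qed
   then show ?thesis using finO yl Os by (intro exI[of _ "insert y' Os"] exI conjI) (auto simp: y'_def)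
  qed
 qed simp
 have "1 \<le> card ?R" using fin by (metis One_nat_def Suc_leI card_gt_0_iff empty_iff reach_self)
 then obtain Os T \<tau> where Os: "card Os = card ?R" "Q Os T \<tau>" using ex[of "card ?R"] by auto
 then have "Os = ?R" using card_subset_eq[OF fin] by (auto simp: Q_def)
 with Os(2) show ?thesis
  using that[of T \<tau>] RV by (auto simp: Q_def subset_iff)
qed

section \<open>Portraits of tree automorphisms\<close>

text \<open>
 An automorphism is encoded by its portrait, which assigns to a vertex \<open>v\<close> the permutation of the letters
 at \<open>v\<close>.  A configuration holds the portraits of a tuple of automorphisms, indexed by edges
 \<open>(i, v)\<close> of the Schreier graphs; it is also defined at lists that are not vertices of the tree.
\<close>

abbreviation "finv \<equiv> inv_into UNIV"

fun pact :: "(nat list \<Rightarrow> nat \<Rightarrow> nat) \<Rightarrow> nat list \<Rightarrow> nat list" where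
 "pact p [] = []"
| "pact p (x # v) = p [] x # pact (\<lambda>w. p (x # w)) v"

fun pinv :: "(nat list \<Rightarrow> nat \<Rightarrow> nat) \<Rightarrow> nat list \<Rightarrow> nat list" where
 "pinv p [] = []"
| "pinv p (y # v) = finv (p []) y # pinv (\<lambda>w. p (finv (p []) y # w)) v"

lemma length_pact [simp]: "length (pact p v) = length v"
 by (induction p v rule: pact.induct) auto

lemma length_pinv [simp]: "length (pinv p v) = length v"
 by (induction p v rule: pinv.induct) auto

lemma pact_append: "pact p (v @ w) = pact p v @ pact (\<lambda>u. p (v @ u)) w"
 by (induction p v rule: pact.induct) auto

lemma pinv_append: "pinv p (v @ w) = pinv p v @ pinv (\<lambda>u. p (pinv p v @ u)) w"
 by (induction p v rule: pinv.induct) auto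

lemma pinv_pact: "(\<And>w. bij (p w)) ==> pinv p (pact p v) = v"
 by (induction p v rule: pact.induct) (auto simp: bij_is_inj)

lemma pact_pinv: "(\<And>w. bij (p w)) ==> pact p (pinv p v) = v"
 by (induction p v rule: pinv.induct) (auto simp: bij_is_surj surj_f_inv_f)

type_synonym config = "nat \<times> nat list \<Rightarrow> nat \<Rightarrow> nat"

definition stp :: "config \<Rightarrow> nat \<times> bool \<Rightarrow> nat list \<Rightarrow> nat list" where
 "stp s l v = (if snd l then pact (\<lambda>w. s (fst l, w)) v else pinv (\<lambda>w. s (fst l, w)) v)"

text \<open>The label belongs to the undirected edge and is inverted when the edge is crossed
  backwards.\<close>

definition lhol :: "config \<Rightarrow> nat \<times> bool \<Rightarrow> nat list \<Rightarrow> nat \<Rightarrow> nat" where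
 "lhol s l v = (if snd l then s (edg (stp s) l v) else finv (s (edg (stp s) l v)))"

text \<open>Holonomy of a path: the product of the labels met on the way. It is the permutation with
  which the word sends the children of \<open>v\<close> to the children of the endpoint.\<close>

fun whol :: "config \<Rightarrow> (nat \<times> bool) list \<Rightarrow> nat list \<Rightarrow> nat \<Rightarrow> nat" where
 "whol s [] v = id"
| "whol s (l # w) v = whol s w (stp s l v) \<circ> lhol s l v"

abbreviation wks :: "config \<Rightarrow> (nat \<times> bool) list \<Rightarrow> nat list \<Rightarrow> nat list" where
 "wks s \<equiv> wk (stp s)"

lemma length_stp [simp]: "length (stp s l v) = length v"
 by (simp add: stp_def)

lemma length_wks [simp]: "length (wks s w v) = length v"
 by (induction w arbitrary: v) auto

text \<open>The action is defined by recursion from the root, while all later arguments add a letter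
  at the bottom; this equation turns the recursion around.\<close>

lemma stp_snoc: "stp s l (v @ [x]) = stp s l v @ [lhol s l v x]"
 by (auto simp: stp_def lhol_def edg_def pact_append pinv_append)

lemma wks_snoc: "wks s w (v @ [x]) = wks s w v @ [whol s w v x]"
 by (induction w arbitrary: v x) (auto simp: stp_snoc)

lemma whol_append: "whol s (u @ w) v = whol s w (wks s u v) \<circ> whol s u v"
 by (induction u arbitrary: v) (auto simp: comp_assoc)

lemma take_stp: "take k (stp s l v) = stp s l (take k v)"
proof (induction v rule: rev_induct)
 case (snoc x v)
 then show ?case by (cases "k \<le> length v") (auto simp: stp_snoc)
qed (simp add: stp_def)

lemma take_wks: "take k (wks s w v) = wks s w (take k v)"
 by (induction w arbitrary: v) (auto simp: take_stp)

lemma wks_Nil [simp]: "wks s w [] = []"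
 using length_wks[of s w "[]"] by (simp del: length_wks)

lemma length_edg_stp [simp]: "length (snd (edg (stp s) l v)) = length v"
 by (auto simp: edg_def)

lemma length_tr_stp: "q \<in> set (tr (stp s) w v) ==> length (snd q) = length v"
 by (induction w arbitrary: v) auto

lemma level_iff: "v \<in> level d n \<longleftrightarrow> set v \<subseteq> {..<d} \<and> length v = n"
 by (auto simp: level_def tree_verts_def)

lemma level_snoc: "v @ [x] \<in> level d (Suc n) \<longleftrightarrow> v \<in> level d n \<and> x < d"
 by (auto simp: level_iff)

lemma level_SucE: assumes "v \<in> level d (Suc n)"
 obtains u x where "v = u @ [x]" "u \<in> level d n" "x < d"
 using assms by (cases v rule: rev_cases) (auto simp: level_iff)

lemma level_Suc: "level d (Suc n) = (\<lambda>(v, x). v @ [x]) ` (level d n \<times> {..<d})"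
 by (auto simp: level_snoc image_iff elim!: level_SucE)

lemma finite_level [simp]: "finite (level d n)"
proof -
 have "level d n = {xs. set xs \<subseteq> {..<d} \<and> length xs = n}" by (auto simp: level_iff)
 then show ?thesis using finite_lists_length_eq[of "{..<d}" n] by simp
qed

lemma card_level [simp]: "card (level d n) = d ^ n"
proof -
 have "level d n = {xs. set xs \<subseteq> {..<d} \<and> length xs = n}" by (auto simp: level_iff)
 then show ?thesis using card_lists_length_eq[of "{..<d}" n] by simp
qed

lemma level_0 [simp]: "level d 0 = {[]}"
 by (auto simp: level_iff)

section \<open>Letter groups, and configurations truncated to finitely many levels\<close>

locale letter_group =
 fixes d :: nat and H :: "(nat \<Rightarrow> nat) set"
 assumes d2: "2 \<le> d"
  and H_permutes: "h \<in> H ==> h permutes {..<d}"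
  and H_id: "id \<in> H"
  and H_comp: "g \<in> H ==> h \<in> H ==> g \<circ> h \<in> H"
  and H_inv: "h \<in> H ==> finv h \<in> H"
  and H_trans: "x < d ==> y < d ==> \<exists>h\<in>H. h x = y"
begin

definition valid :: "config \<Rightarrow> bool" where
 "valid s \<longleftrightarrow> (\<forall>q. s q \<in> H)"

lemma validD: "valid s ==> s q \<in> H"
 unfolding valid_def by blast

lemma finite_H [simp]: "finite H"
 using finite_subset[of H "{p. p permutes {..<d}}"] finite_permutations[of "{..<d}"] H_permutes by auto

lemma card_H_pos: "0 < card H"
 using H_id card_gt_0_iff by fastforce

lemma H_ne [simp]: "H \<noteq> {}"
 using H_id by auto

lemma H_bij: "h \<in> H ==> bij h"
 using H_permutes permutes_bij by blast

lemma H_less [simp]: "h \<in> H ==> h x < d \<longleftrightarrow> x < d"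
 using H_permutes[of h] permutes_in_image[of h "{..<d}" x] by simp

lemma valid_upd: "valid s ==> h \<in> H ==> valid (s(q := h))"
 by (auto simp: valid_def)

lemma lhol_in_H: "valid s ==> lhol s l v \<in> H"
 by (auto simp: lhol_def validD H_inv)

lemma whol_in_H: "valid s ==> whol s w v \<in> H"
 by (induction w arbitrary: v) (auto simp: H_id H_comp lhol_in_H)

lemma stp_level: "valid s ==> v \<in> level d n ==> stp s l v \<in> level d n"
proof (induction v arbitrary: n rule: rev_induct)
 case (snoc x v)
 obtain n' where n': "n = Suc n'" using snoc.prems by (cases n) (auto simp: level_iff)
 show ?case using snoc lhol_in_H[of s l v] unfolding n' stp_snoc level_snoc by simp
qed (auto simp: level_iff stp_def)

lemma sym_act_stp: "valid s ==> sym_act (stp s) UNIV"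
 unfolding sym_act_def stp_def linv_def using pinv_pact pact_pinv H_bij validD by auto

lemma sym_act_level: "valid s ==> sym_act (stp s) (level d n)"
 using sym_act_stp[of s] stp_level[of s] unfolding sym_act_def by blast

lemma wks_level: "valid s ==> v \<in> level d n ==> wks s w v \<in> level d n"
 using sym_act_wk[OF sym_act_level] .

lemma edg_level: "valid s ==> v \<in> level d n ==> snd (edg (stp s) l v) \<in> level d n"
 using stp_level by (auto simp: edg_def)

lemma tr_level: "valid s ==> v \<in> level d n ==> set w \<subseteq> letters m ==> set (tr (stp s) w v) \<subseteq> {..<m} \<times> level d n"
proof (induction w arbitrary: v)
 case (Cons l w)
 then show ?case using edg_level[of s v n l] stp_level[of s v n l]
  by (auto simp: letters_def edg_def)
qed simp

definition Ind :: "nat \<Rightarrow> nat \<Rightarrow> (nat \<times> nat list) set" where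
 "Ind m N = {..<m} \<times> (\<Union>n<N. level d n)"

text \<open>Labels outside the finite index set are \<open>id\<close>, so a truncation is itself a
  configuration defined on all edges.\<close>

definition Cfg :: "nat \<Rightarrow> nat \<Rightarrow> config set" where
 "Cfg m N = PiE_dflt (Ind m N) id (\<lambda>_. H)"

definition restr :: "nat \<Rightarrow> nat \<Rightarrow> config \<Rightarrow> config" where
 "restr m N s = (\<lambda>q. if q \<in> Ind m N then s q else id)"

lemma finite_Ind [simp]: "finite (Ind m N)"
 by (auto simp: Ind_def)

lemma Ind_iff: "(i, v) \<in> Ind m N \<longleftrightarrow> i < m \<and> v \<in> level d (length v) \<and> length v < N"
 by (auto simp: Ind_def level_iff)

lemma Ind_mono: "N \<le> N' ==> Ind m N \<subseteq> Ind m N'"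
 by (auto simp: Ind_iff)

lemma finite_Cfg [simp]: "finite (Cfg m N)"
 unfolding Cfg_def by (intro finite_PiE_dflt) auto

lemma id_Cfg: "(\<lambda>_. id) \<in> Cfg m N"
 by (auto simp: Cfg_def PiE_dflt_def H_id)

lemma card_Cfg: "card (Cfg m N) = card H ^ card (Ind m N)"
 unfolding Cfg_def by (simp add: card_PiE_dflt)

lemma card_Cfg_pos [simp]: "0 < card (Cfg m N)"
 by (simp add: card_Cfg card_H_pos)

lemma Cfg_ne [simp]: "Cfg m N \<noteq> {}"
 using id_Cfg by blast

lemma valid_Cfg: "s \<in> Cfg m N ==> valid s"
 unfolding Cfg_def PiE_dflt_def valid_def using H_id by force

lemma restr_Cfg: "valid s ==> restr m N s \<in> Cfg m N"
 by (auto simp: Cfg_def PiE_dflt_def restr_def valid_def)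

lemma valid_restr: "valid s ==> valid (restr m N s)"
 by (rule valid_Cfg[OF restr_Cfg])

lemma restr_id: "s \<in> Cfg m N ==> restr m N s = s"
 by (auto simp: Cfg_def PiE_dflt_def restr_def)

lemma restr_restr: "N \<le> N' ==> restr m N (restr m N' s) = restr m N s"
 using Ind_mono by (fastforce simp: restr_def)

lemma restr_upd: "q \<notin> Ind m N ==> restr m N (s(q := h)) = restr m N s"
 by (auto simp: restr_def)

lemma Cfg_upd: "s \<in> Cfg m N ==> q \<in> Ind m N ==> h \<in> H ==> s(q := h) \<in> Cfg m N"
 by (auto simp: Cfg_def PiE_dflt_def)

lemma Cfg_in_H: "s \<in> Cfg m N ==> s q \<in> H"
 by (rule validD[OF valid_Cfg])

text \<open>\<open>dep m N f\<close>: the function \<open>f\<close> only depends on the action of the first \<open>m\<close> automorphisms on level \<open>N\<close>.\<close>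

definition dep :: "nat \<Rightarrow> nat \<Rightarrow> (config \<Rightarrow> 'b) \<Rightarrow> bool" where
 "dep m N f \<longleftrightarrow> (\<forall>s. valid s --> f (restr m N s) = f s)"

lemma depD: "dep m N f ==> valid s ==> f (restr m N s) = f s"
 by (simp add: dep_def)

lemma dep_mono: "dep m N f ==> N \<le> N' ==> dep m N' f"
 unfolding dep_def
proof (intro allI impI)
 fix s assume *: "\<forall>s. valid s --> f (restr m N s) = f s" "N \<le> N'" "valid s"
 have "f (restr m N (restr m N' s)) = f (restr m N' s)" "f (restr m N s) = f s"
  using * valid_restr by auto
 then show "f (restr m N' s) = f s" using restr_restr[OF *(2)] by simp
qed

lemma dep_upd: "dep m N f ==> valid s ==> h \<in> H ==> q \<notin> Ind m N ==> f (s(q := h)) = f s"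
 using depD[of m N f s] depD[of m N f "s(q := h)"] by (simp add: restr_upd valid_upd)

text \<open>The action on level \<open>n\<close> reads only labels at vertices strictly shorter than
  \<open>n\<close>. Hence \<open>n \<le> N\<close> is enough here, whereas the holonomy at level
  \<open>n\<close> reads one level more.\<close>

lemma stp_restr:
 assumes "valid s" "v \<in> level d n" "n \<le> N" "l \<in> letters m"
 shows "stp (restr m N s) l v = stp s l v"
 using assms(2,3)
proof (induction v arbitrary: n rule: rev_induct)
 case (snoc x v)
 obtain n' where n': "n = Suc n'" using snoc by (cases n) (auto simp: level_iff)
 then have v: "v \<in> level d n'" using snoc by (simp add: level_snoc)
 then have eq: "stp (restr m N s) l v = stp s l v" using snoc n' by auto
 have "snd (edg (stp s) l v) \<in> level d n'" using edg_level[OF assms(1) v] .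
 then have "edg (stp s) l v \<in> Ind m N"
  using assms(4) snoc n' by (cases "edg (stp s) l v") (auto simp: Ind_def letters_def edg_def)
 moreover have "edg (stp (restr m N s)) l v = edg (stp s) l v" using eq by (simp add: edg_def)
 ultimately have "lhol (restr m N s) l v = lhol s l v" by (simp add: lhol_def restr_def)
 then show ?case by (simp add: stp_snoc eq)
qed (simp add: stp_def)

lemma wks_restr:
 assumes "valid s" "v \<in> level d n" "n \<le> N" "set w \<subseteq> letters m"
 shows "wks (restr m N s) w v = wks s w v"
 using assms(2,4) by (induction w arbitrary: v) (auto simp: stp_restr[OF assms(1) _ assms(3)] stp_level[OF assms(1)])

lemma tr_restr:
 assumes "valid s" "v \<in> level d n" "n \<le> N" "set w \<subseteq> letters m"
 shows "tr (stp (restr m N s)) w v = tr (stp s) w v"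
 using assms(2,4) by (induction w arbitrary: v)
  (auto simp: stp_restr[OF assms(1) _ assms(3)] stp_level[OF assms(1)] edg_def)

lemma whol_restr:
 assumes "valid s" "v \<in> level d n" "n < N" "set w \<subseteq> letters m"
 shows "whol (restr m N s) w v = whol s w v"
 using assms(2,4)
proof (induction w arbitrary: v)
 case (Cons l w)
 have eq: "stp (restr m N s) l v = stp s l v" using stp_restr[OF assms(1) Cons(2)] assms Cons by auto
 have "snd (edg (stp s) l v) \<in> level d n" using edg_level[OF assms(1) Cons(2)] .
 then have "edg (stp s) l v \<in> Ind m N"
  using assms(3) Cons.prems by (cases "edg (stp s) l v") (auto simp: Ind_def letters_def edg_def)
 moreover have "edg (stp (restr m N s)) l v = edg (stp s) l v" using eq by (simp add: edg_def)
 ultimately have "lhol (restr m N s) l v = lhol s l v" by (simp add: lhol_def restr_def)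
 then show ?case using Cons eq stp_level[OF assms(1) Cons(2)] by simp
qed simp

section \<open>Averages over finite levels\<close>

definition EE :: "nat \<Rightarrow> nat \<Rightarrow> (config \<Rightarrow> real) \<Rightarrow> real" where
 "EE m N f = (\<Sum>s\<in>Cfg m N. f s) / card (Cfg m N)"

lemma EE_mono: "(\<And>s. s \<in> Cfg m N ==> f s \<le> g s) ==> EE m N f \<le> EE m N g"
 unfolding EE_def by (intro divide_right_mono sum_mono) auto

lemma EE_cong: "(\<And>s. s \<in> Cfg m N ==> f s = g s) ==> EE m N f = EE m N g"
 unfolding EE_def by (simp cong: sum.cong)

lemma EE_add: "EE m N (\<lambda>s. f s + g s) = EE m N f + EE m N g"
 by (simp add: EE_def sum.distrib add_divide_distrib)

lemma EE_diff: "EE m N (\<lambda>s. f s - g s) = EE m N f - EE m N g"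
 by (simp add: EE_def sum_subtractf diff_divide_distrib)

lemma EE_cmult: "EE m N (\<lambda>s. c * f s) = c * EE m N f"
 by (simp add: EE_def sum_distrib_left)

lemma EE_sum: "EE m N (\<lambda>s. \<Sum>a\<in>A. f a s) = (\<Sum>a\<in>A. EE m N (f a))"
 unfolding EE_def by (subst sum.swap) (simp add: sum_divide_distrib)

lemma EE_const [simp]: "EE m N (\<lambda>_. c) = c"
 by (simp add: EE_def)

lemma EE_nonneg: "(\<And>s. s \<in> Cfg m N ==> 0 \<le> f s) ==> 0 \<le> EE m N f"
 unfolding EE_def by (intro divide_nonneg_nonneg sum_nonneg) auto

text \<open>Exchanging the label at \<open>e s\<close> with the fresh element \<open>h\<close> is an
  involution of \<open>Cfg m N \<times> H\<close>. The resampled edge may depend on the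
  configuration as long as changing its label does not change the choice.\<close>

lemma EE_resample:
 assumes e: "\<And>s. s \<in> Cfg m N ==> e s \<in> Ind m N"
  and inv: "\<And>s h. s \<in> Cfg m N ==> h \<in> H ==> e (s(e s := h)) = e s"
 shows "EE m N f = EE m N (\<lambda>s. (\<Sum>h\<in>H. f (s(e s := h))) / card H)"
proof -
 have "(\<Sum>(s,h)\<in>Cfg m N \<times> H. f (s(e s := h))) = (\<Sum>(s,h)\<in>Cfg m N \<times> H. f s)"
  by (rule sum.reindex_bij_witness[of _ "\<lambda>(s,h). (s(e s := h), s (e s))" "\<lambda>(s,h). (s(e s := h), s (e s))"])
    (auto simp: inv e Cfg_upd Cfg_in_H)
 then have "(\<Sum>s\<in>Cfg m N. \<Sum>h\<in>H. f (s(e s := h))) = card H * (\<Sum>s\<in>Cfg m N. f s)"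
  by (simp add: sum.cartesian_product[symmetric] sum_distrib_left)
 then show ?thesis by (simp add: EE_def sum_divide_distrib[symmetric])
qed

text \<open>Given everything that decides \<open>F\<close>, \<open>\<phi>\<close> and
  \<open>g\<close>, the labels on \<open>F s\<close> are independent and uniform. The edges of
  \<open>J\<close> are averaged one at a time; a factor that has been averaged is absorbed into the
  weight, which is why the induction is general in \<open>g\<close>.\<close>

lemma EE_prod:
 assumes fin: "finite J" and J: "J \<subseteq> Ind m N"
  and F: "\<And>s. s \<in> Cfg m N ==> F s \<subseteq> J"
  and inv: "\<And>s q h. s \<in> Cfg m N ==> q \<in> J ==> h \<in> H ==>
   F (s(q := h)) = F s \<and> \<phi> (s(q := h)) = \<phi> s \<and> g (s(q := h)) = g s"
 shows "EE m N (\<lambda>s. g s * (\<Prod>q\<in>F s. \<phi> s q (s q))) =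
  EE m N (\<lambda>s. g s * (\<Prod>q\<in>F s. (\<Sum>h\<in>H. \<phi> s q h) / card H))"
proof -
 have "EE m N (\<lambda>s. g s * (\<Prod>q\<in>F s \<inter> Q. \<phi> s q (s q))) =
  EE m N (\<lambda>s. g s * (\<Prod>q\<in>F s \<inter> Q. (\<Sum>h\<in>H. \<phi> s q h) / card H))"
  if "finite Q" "Q \<subseteq> J" and
   "\<And>s q h. s \<in> Cfg m N ==> q \<in> J ==> h \<in> H ==> g (s(q := h)) = g s" for Q g
  using that
 proof (induction Q arbitrary: g)
  case (insert q Q)
  then have q: "q \<in> Ind m N" "q \<in> J" using J by auto
  define g' where "g' s = g s * (if q \<in> F s then (\<Sum>h\<in>H. \<phi> s q h) / card H else 1)" for s
  let ?f = "\<lambda>s. g s * (\<Prod>q\<in>F s \<inter> insert q Q. \<phi> s q (s q))"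
  have "EE m N ?f = EE m N (\<lambda>s. (\<Sum>h\<in>H. ?f (s(q := h))) / card H)"
   by (rule EE_resample) (use q in auto)
  also have "\<dots> = EE m N (\<lambda>s. g' s * (\<Prod>q\<in>F s \<inter> Q. \<phi> s q (s q)))"
  proof (rule EE_cong)
   fix s assume s: "s \<in> Cfg m N"
   have "?f (s(q := h)) = g s * (\<Prod>q\<in>F s \<inter> Q. \<phi> s q (s q)) * (if q \<in> F s then \<phi> s q h else 1)"
    if "h \<in> H" for h
   proof -
    have "(\<Prod>q'\<in>F s \<inter> Q. \<phi> s q' ((s(q := h)) q')) = (\<Prod>q\<in>F s \<inter> Q. \<phi> s q (s q))"
     using insert.hyps by (intro prod.cong) auto
    then have *: "(\<Prod>q'\<in>F s \<inter> insert q Q. \<phi> s q' ((s(q := h)) q')) =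
      (\<Prod>q\<in>F s \<inter> Q. \<phi> s q (s q)) * (if q \<in> F s then \<phi> s q h else 1)"
     using insert.hyps by (simp add: Int_insert_right)
    have i: "F (s(q := h)) = F s" "\<phi> (s(q := h)) = \<phi> s" "g (s(q := h)) = g s"
     using inv[OF s q(2) that] insert.prems(2)[OF s q(2) that] by (auto simp only: fun_upd_def)
    show ?thesis unfolding i * by simp
   qed
   then have "(\<Sum>h\<in>H. ?f (s(q := h))) = (\<Sum>h\<in>H. g s * (\<Prod>q\<in>F s \<inter> Q. \<phi> s q (s q)) * (if q \<in> F s then \<phi> s q h else 1))"
    by (intro sum.cong) auto
   also have "\<dots> = g s * (\<Prod>q\<in>F s \<inter> Q. \<phi> s q (s q)) * (if q \<in> F s then (\<Sum>h\<in>H. \<phi> s q h) else card H)"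
    by (auto simp only: sum_distrib_left[symmetric] if_True if_False sum_constant mult_1_right split: if_split)
   finally show "(\<Sum>h\<in>H. ?f (s(q := h))) / card H = g' s * (\<Prod>q\<in>F s \<inter> Q. \<phi> s q (s q))"
    by (simp add: g'_def)
  qed
  also have "\<dots> = EE m N (\<lambda>s. g' s * (\<Prod>q\<in>F s \<inter> Q. (\<Sum>h\<in>H. \<phi> s q h) / card H))"
  proof (rule insert.IH)
   show "Q \<subseteq> J" using insert.prems by auto
   show "g' (s(q := h)) = g' s" if "s \<in> Cfg m N" "q \<in> J" "h \<in> H" for s q h
    using inv[OF that] insert.prems(2)[OF that] unfolding g'_def fun_upd_def by simp
  qed
  also have "\<dots> = EE m N (\<lambda>s. g s * (\<Prod>q\<in>F s \<inter> insert q Q. (\<Sum>h\<in>H. \<phi> s q h) / card H))"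
  proof (rule EE_cong)
   fix s assume "s \<in> Cfg m N"
   then show "g' s * (\<Prod>q\<in>F s \<inter> Q. (\<Sum>h\<in>H. \<phi> s q h) / card H) = g s * (\<Prod>q\<in>F s \<inter> insert q Q. (\<Sum>h\<in>H. \<phi> s q h) / card H)"
    using insert.hyps by (simp add: g'_def Int_insert_right)
  qed
  finally show ?case .
 qed simp
 from this[of J g] have "EE m N (\<lambda>s. g s * (\<Prod>q\<in>F s \<inter> J. \<phi> s q (s q))) =
  EE m N (\<lambda>s. g s * (\<Prod>q\<in>F s \<inter> J. (\<Sum>h\<in>H. \<phi> s q h) / card H))"
  using fin inv by auto
 moreover have FJ: "F s \<inter> J = F s" if "s \<in> Cfg m N" for s using F[OF that] by auto
 have "EE m N (\<lambda>s. g s * (\<Prod>q\<in>F s \<inter> J. \<phi> s q (s q))) = EE m N (\<lambda>s. g s * (\<Prod>q\<in>F s. \<phi> s q (s q)))"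
  by (rule EE_cong) (simp add: FJ)
 moreover have "EE m N (\<lambda>s. g s * (\<Prod>q\<in>F s \<inter> J. (\<Sum>h\<in>H. \<phi> s q h) / card H)) =
   EE m N (\<lambda>s. g s * (\<Prod>q\<in>F s. (\<Sum>h\<in>H. \<phi> s q h) / card H))"
  by (rule EE_cong) (simp add: FJ)
 ultimately show ?thesis by simp
qed

lemma EE_indep:
 assumes fin: "finite J" and J: "J \<subseteq> Ind m N"
  and F: "\<And>s. s \<in> Cfg m N ==> F s \<subseteq> J"
  and inv: "\<And>s q h. s \<in> Cfg m N ==> q \<in> J ==> h \<in> H ==>
   F (s(q := h)) = F s \<and> B (s(q := h)) = B s \<and> g (s(q := h)) = g s"
 shows "EE m N (\<lambda>s. g s * of_bool (\<forall>q\<in>F s. s q \<in> B s q)) =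
  EE m N (\<lambda>s. g s * (\<Prod>q\<in>F s. real (card (B s q \<inter> H)) / card H))"
proof -
 have p: "(\<Prod>q\<in>Q. of_bool (P q)) = (of_bool (\<forall>q\<in>Q. P q) :: real)" if "finite Q" for Q and P :: "'q \<Rightarrow> bool"
  using that by (induction Q) auto
 have "EE m N (\<lambda>s. g s * of_bool (\<forall>q\<in>F s. s q \<in> B s q)) = EE m N (\<lambda>s. g s * (\<Prod>q\<in>F s. of_bool (s q \<in> B s q)))"
 proof (rule EE_cong)
  fix s assume "s \<in> Cfg m N"
  then have "finite (F s)" using F fin finite_subset by blast
  then show "g s * of_bool (\<forall>q\<in>F s. s q \<in> B s q) = g s * (\<Prod>q\<in>F s. of_bool (s q \<in> B s q))" by (simp only: p)
 qed
 also have "\<dots> = EE m N (\<lambda>s. g s * (\<Prod>q\<in>F s. (\<Sum>h\<in>H. of_bool (h \<in> B s q)) / card H))"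
  by (rule EE_prod[OF fin J F, where \<phi> = "\<lambda>s q h. of_bool (h \<in> B s q)"]) (use inv in simp_all)
 also have "\<dots> = EE m N (\<lambda>s. g s * (\<Prod>q\<in>F s. real (card (B s q \<inter> H)) / card H))"
  by (simp add: sum_of_bool_eq Int_commute)
 finally show ?thesis .
qed

text \<open>Left multiplication by an element that carries one point to another matches the fibres
  of \<open>h \<mapsto> h x\<close>, so transitivity makes all of them equally large.\<close>

lemma card_H_point:
 assumes "x < d" "y < d"
 shows "real (card {h\<in>H. h x = y}) = card H / d"
proof -
 have eq: "card {h\<in>H. h x = y'} = card {h\<in>H. h x = y}" if y'd: "y' < d" for y'
 proof -
  obtain k where k: "k \<in> H" "k y' = y" using H_trans[of y' y] y'd assms(2) by blast
  have ki: "finv k (k z) = z" "k (finv k z) = z" for z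
   using H_bij[OF k(1)] by (simp_all add: bij_is_inj bij_is_surj surj_f_inv_f)
  show ?thesis
   by (rule bij_betw_same_card[of "\<lambda>h. k \<circ> h"], rule bij_betw_byWitness[of _ "\<lambda>h. finv k \<circ> h"])
     (use k ki H_comp H_inv k(2)[symmetric] in \<open>auto simp: fun_eq_iff\<close>)
 qed
 have "H = (\<Union>y'<d. {h\<in>H. h x = y'})" using assms by auto
 then have "card H = card (\<Union>y'<d. {h\<in>H. h x = y'})" by simp
 also have "\<dots> = (\<Sum>y'<d. card {h\<in>H. h x = y'})"
  by (rule card_UN_disjoint) auto
 also have "\<dots> = d * card {h\<in>H. h x = y}" using eq by simp
 finally show ?thesis using d2 by simp
qed

lemma card_H_inv_point:
 assumes "x < d" "y < d"
 shows "real (card {h\<in>H. finv h x = y}) = card H / d"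
proof -
 have "{h\<in>H. finv h x = y} = {h\<in>H. h y = x}"
  using H_bij by (auto simp: bij_is_inj bij_is_surj surj_f_inv_f)
 then show ?thesis using card_H_point[OF assms(2,1)] by simp
qed

end

section \<open>Short words have no fixed points on deep levels\<close>

lemma tr_split_first:
 assumes "e \<in> set (tr st w v)"
 obtains u l t where "w = u @ l # t" "edg st l (wk st u v) = e" "e \<notin> set (tr st u v)"
 using assms
proof (induction w arbitrary: v thesis)
 case (Cons k w)
 show ?case
 proof (cases "edg st k v = e")
  case True
  then show ?thesis using Cons.prems(1)[of "[]" k w] by simp
 next
  case False
  then have "e \<in> set (tr st w (st k v))" using Cons.prems(2) by simp
  then obtain u l t where "w = u @ l # t" "edg st l (wk st u (st k v)) = e" "e \<notin> set (tr st u (st k v))"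
   using Cons.IH[of "st k v"] by blast
  then show ?thesis using Cons.prems(1)[of "k # u" l t] False by simp
 qed
qed simp

lemma tr_split_once:
 assumes "count_list (tr st w v) e = 1"
 obtains u l t where "w = u @ l # t" "edg st l (wk st u v) = e" "e \<notin> set (tr st u v)"
  "e \<notin> set (tr st t (st l (wk st u v)))"
proof -
 have "e \<in> set (tr st w v)" using assms by (metis count_notin zero_neq_one)
 then obtain u l t where *: "w = u @ l # t" "edg st l (wk st u v) = e" "e \<notin> set (tr st u v)"
  by (rule tr_split_first)
 then have "count_list (tr st t (st l (wk st u v))) e = 0" using assms by (simp add: count_notin)
 then show ?thesis using that * by (simp add: count_list_0_iff)
qed

text \<open>A second crossing would cut the closed path into a shorter closed one: in the same
  direction after the prefix \<open>l # u\<close>, in the opposite direction around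
  \<open>u\<close>. Both have length at most \<open>n\<close>, and an empty \<open>u\<close> in the
  second case contradicts reducedness.\<close>

lemma closed_first_edge_once:
 assumes sym: "sym_act st V" and g: "girth_gt st m V n" and v: "v \<in> V"
  and w: "reduced (l # t)" "set (l # t) \<subseteq> letters m" "length t \<le> n" "wk st (l # t) v = v"
 shows "edg st l v \<notin> set (tr st t (st l v))"
proof
 assume "edg st l v \<in> set (tr st t (st l v))"
 then obtain u k r where t: "t = u @ k # r" "edg st k (wk st u (st l v)) = edg st l v"
  by (rule tr_split_first)
 have V: "st l v \<in> V" "wk st u (st l v) \<in> V" using sym v by (auto simp: sym_actD sym_act_wk)
 from t(2) consider "k = l" "wk st u (st l v) = v" | "k = linv l" "wk st u (st l v) = st l v"
  using edg_eq_iff[OF sym V(2) v] by auto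
 then show False
 proof cases
  case 1
  have "reduced (l # u)" using w(1) t(1) by (auto simp: reduced_append reduced_Cons hd_append split: if_splits)
  moreover have "set (l # u) \<subseteq> letters m" "length (l # u) \<le> n" using w t by auto
  ultimately show False using g v 1 unfolding girth_gt_def by (metis list.discI wk.simps(2))
 next
  case 2
  have u: "reduced u" using w(1) t(1) by (auto simp: reduced_append reduced_Cons)
  show False
  proof (cases "u = []")
   case True
   then show False using w(1) t(1) 2 by (auto simp: reduced_Cons)
  next
   case False
   moreover have "set u \<subseteq> letters m" "length u \<le> n" using w t by auto
   ultimately show False using g V(1) 2 u unfolding girth_gt_def by blast
  qed
 qed
qed

text \<open>The label at a vertex first matters for its children, so vertices of the same depth
  still move as before.\<close>

lemma stp_off:
 assumes "\<And>p. p \<noteq> q ==> s' p = s p" "length v \<le> length (snd q)"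
 shows "stp s' l v = stp s l v"
 using assms(2)
proof (induction v rule: rev_induct)
 case (snoc x v)
 then have eq: "stp s' l v = stp s l v" by simp
 then have e: "edg (stp s') l v = edg (stp s) l v" by (simp add: edg_def)
 have "edg (stp s) l v \<noteq> q" using snoc.prems length_edg_stp[of s l v] by auto
 then have "lhol s' l v = lhol s l v" using e assms(1) by (simp add: lhol_def)
 then show ?case by (simp add: stp_snoc eq)
qed (simp add: stp_def)

lemma stp_upd: "length v \<le> length (snd q) ==> stp (s(q := h)) l v = stp s l v"
 by (rule stp_off[of q]) auto

lemma edg_upd: "length v \<le> length (snd q) ==> edg (stp (s(q := h))) l v = edg (stp s) l v"
 by (simp add: edg_def stp_upd)

lemma wks_upd: "length v \<le> length (snd q) ==> wks (s(q := h)) w v = wks s w v"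
 by (induction w arbitrary: v) (auto simp: stp_upd)

lemma tr_upd: "length v \<le> length (snd q) ==> tr (stp (s(q := h))) w v = tr (stp s) w v"
 by (induction w arbitrary: v) (auto simp: stp_upd edg_upd)

lemma whol_upd:
 "length v \<le> length (snd q) ==> q \<notin> set (tr (stp s) w v) ==> whol (s(q := h)) w v = whol s w v"
 by (induction w arbitrary: v) (auto simp: stp_upd edg_upd lhol_def)

lemma whol_upd_once:
 assumes "w = u @ l # t" "edg (stp s) l (wks s u v) = e" "e \<notin> set (tr (stp s) u v)"
  "e \<notin> set (tr (stp s) t (stp s l (wks s u v)))"
 shows "whol (s(e := h)) w v = whol s t (stp s l (wks s u v)) \<circ> (if snd l then h else finv h) \<circ> whol s u v"
proof -
 have len: "length (snd e) = length v" using assms(2) by (metis length_edg_stp length_wks)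
 show ?thesis
  using assms by (auto simp: whol_append len wks_upd stp_upd whol_upd lhol_def edg_upd fun_eq_iff)
qed

context letter_group
begin

text \<open>The holonomy is \<open>A \<circ> h \<circ> U\<close> or
  \<open>A \<circ> finv h \<circ> U\<close>, with outer factors that do not see the label
  \<open>h\<close> of the edge; a uniform label therefore makes the image of \<open>x\<close>
  uniform.\<close>

lemma card_hol_once:
 assumes s: "valid s" and once: "count_list (tr (stp s) w v) e = 1" and xy: "x < d" "y < d"
 shows "real (card {h\<in>H. whol (s(e := h)) w v x = y}) = card H / d"
proof -
 obtain u l t where ult: "w = u @ l # t" "edg (stp s) l (wks s u v) = e" "e \<notin> set (tr (stp s) u v)"
  "e \<notin> set (tr (stp s) t (stp s l (wks s u v)))"
  using tr_split_once[OF once] .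
 define A where "A = whol s t (stp s l (wks s u v))"
 have AH: "A \<in> H" and UH: "whol s u v \<in> H" using whol_in_H[OF s] by (auto simp: A_def)
 have inv: "A z = y \<longleftrightarrow> z = finv A y" for z
  using H_bij[OF AH] by (metis bij_inv_eq_iff)
 have lt: "whol s u v x < d" "finv A y < d" using xy UH H_inv[OF AH] by auto
 have "{h\<in>H. whol (s(e := h)) w v x = y} = {h\<in>H. (if snd l then h else finv h) (whol s u v x) = finv A y}"
  using inv by (simp add: whol_upd_once[OF ult] A_def[symmetric])
 then show ?thesis using card_H_point[OF lt] card_H_inv_point[OF lt] by (cases "snd l") simp_all
qed

lemma girth_level_mono:
 assumes s: "valid s" and g: "girth_gt (stp s) m (level d n) k" and n: "n \<le> n'"
 shows "girth_gt (stp s) m (level d n') k"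
 unfolding girth_gt_def
proof (intro ballI allI impI)
 fix v w assume v: "v \<in> level d n'" and w: "reduced w \<and> w \<noteq> [] \<and> set w \<subseteq> letters m \<and> length w \<le> k"
 have "take n v \<in> level d n" using v n set_take_subset[of n v] by (auto simp: level_iff)
 then have "wks s w (take n v) \<noteq> take n v" using g w unfolding girth_gt_def by blast
 then show "wks s w v \<noteq> v" using take_wks[of n s w v] by metis
qed

lemma dep_girth: "n \<le> N ==> dep m N (\<lambda>s. girth_gt (stp s) m (level d n) k)"
 unfolding dep_def girth_gt_def using wks_restr[of _ _ n N _ m] by simp

definition red_words :: "nat \<Rightarrow> nat \<Rightarrow> (nat \<times> bool) list set" where
 "red_words m k = {w. set w \<subseteq> letters m \<and> length w = k \<and> reduced w}"

lemma finite_red_words [simp]: "finite (red_words m k)"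
 using finite_lists_length_eq[of "letters m" k] by (rule finite_subset[rotated]) (auto simp: red_words_def)

definition closed_words :: "nat \<Rightarrow> nat \<Rightarrow> nat \<Rightarrow> config \<Rightarrow> (nat list \<times> (nat \<times> bool) list) set" where
 "closed_words m k n s = {(v, w). v \<in> level d n \<and> w \<in> red_words m k \<and> wks s w v = v}"

definition ncl :: "nat \<Rightarrow> nat \<Rightarrow> nat \<Rightarrow> config \<Rightarrow> real" where
 "ncl m k n s = real (card (closed_words m k n s))"

lemma closed_words_subset: "closed_words m k n s \<subseteq> level d n \<times> red_words m k"
 by (auto simp: closed_words_def)

lemma finite_closed_words [simp]: "finite (closed_words m k n s)"
 by (rule finite_subset[OF closed_words_subset]) simp

lemma ncl_le: "ncl m k n s \<le> card (level d n \<times> red_words m k)"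
 unfolding ncl_def of_nat_le_iff by (rule card_mono[OF _ closed_words_subset]) simp

lemma ncl_sum: "ncl m k n s = (\<Sum>(v, w)\<in>level d n \<times> red_words m k. of_bool (wks s w v = v))"
proof -
 have "closed_words m k n s = (level d n \<times> red_words m k) \<inter> {p. wks s (snd p) (fst p) = fst p}"
  by (auto simp: closed_words_def)
 then show ?thesis unfolding ncl_def by (simp add: sum_of_bool_eq split_beta)
qed

lemma ncl_Suc_sum: "ncl m k (Suc n) s =
 (\<Sum>(v, w)\<in>level d n \<times> red_words m k. of_bool (wks s w v = v) * (\<Sum>x<d. of_bool (whol s w v x = x)))"
proof -
 have "ncl m k (Suc n) s = (\<Sum>v\<in>level d (Suc n). \<Sum>w\<in>red_words m k. of_bool (wks s w v = v))"
  by (simp only: ncl_sum sum.cartesian_product)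
 also have "\<dots> = (\<Sum>p\<in>level d n \<times> {..<d}. \<Sum>w\<in>red_words m k. of_bool (wks s w (fst p @ [snd p]) = fst p @ [snd p]))"
  unfolding level_Suc by (subst sum.reindex) (auto simp: inj_on_def o_def split_beta)
 also have "\<dots> = (\<Sum>v\<in>level d n. \<Sum>x<d. \<Sum>w\<in>red_words m k. of_bool (wks s w (v @ [x]) = v @ [x]))"
  by (subst sum.cartesian_product[where A = "level d n" and B = "{..<d}"]) (simp only: case_prod_unfold)
 also have "\<dots> = (\<Sum>v\<in>level d n. \<Sum>x<d. \<Sum>w\<in>red_words m k. of_bool (wks s w v = v) * of_bool (whol s w v x = x))"
  by (intro sum.cong refl) (simp add: wks_snoc)
 also have "\<dots> = (\<Sum>v\<in>level d n. \<Sum>w\<in>red_words m k. \<Sum>x<d. of_bool (wks s w v = v) * of_bool (whol s w v x = x))"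
  by (intro sum.cong refl sum.swap)
 also have "\<dots> = (\<Sum>v\<in>level d n. \<Sum>w\<in>red_words m k. of_bool (wks s w v = v) * (\<Sum>x<d. of_bool (whol s w v x = x)))"
  by (simp only: sum_distrib_left)
 finally show ?thesis by (simp only: sum.cartesian_product)
qed

lemma ncl_upd: "length (snd q) = n ==> ncl m k n (s(q := h)) = ncl m k n s"
 unfolding ncl_sum by (intro sum.cong refl) (auto simp: wks_upd level_iff)

lemma girth_upd: "length (snd q) \<ge> n ==> girth_gt (stp (s(q := h))) m (level d n) k = girth_gt (stp s) m (level d n) k"
 unfolding girth_gt_def by (simp add: wks_upd level_iff)

text \<open>Once shorter closed words are excluded, a closed word crosses its first edge once. Each
  of the \<open>d\<close> children of a closed vertex then returns with probability
  \<open>1 / d\<close>, so a closed pair has one closed lift on average. The weight \<open>g\<close>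
  may depend on everything that labels at depth \<open>n\<close> do not influence.\<close>

lemma ncl_martingale:
 assumes n1: "n1 \<le> n" "n < N"
  and B: "B = (\<lambda>s. girth_gt (stp s) m (level d n1) k)"
  and g: "\<And>s q h. s \<in> Cfg m N ==> length (snd q) = n ==> h \<in> H ==> g (s(q := h)) = g s"
 shows "EE m N (\<lambda>s. of_bool (B s) * g s * (ncl m (Suc k) (Suc n) s - ncl m (Suc k) n s)) = 0"
proof -
 let ?P = "level d n \<times> red_words m (Suc k)"
 define f where "f p s = of_bool (B s) * g s * of_bool (wks s (snd p) (fst p) = fst p) *
  ((\<Sum>x<d. of_bool (whol s (snd p) (fst p) x = x)) - 1)" for p s
 have "EE m N (\<lambda>s. of_bool (B s) * g s * (ncl m (Suc k) (Suc n) s - ncl m (Suc k) n s)) = EE m N (\<lambda>s. \<Sum>p\<in>?P. f p s)"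
 proof (rule EE_cong)
  fix s assume "s \<in> Cfg m N"
  show "of_bool (B s) * g s * (ncl m (Suc k) (Suc n) s - ncl m (Suc k) n s) = (\<Sum>p\<in>?P. f p s)"
  proof -
   have "ncl m (Suc k) (Suc n) s - ncl m (Suc k) n s = (\<Sum>p\<in>?P. of_bool (wks s (snd p) (fst p) = fst p) *
     ((\<Sum>x<d. of_bool (whol s (snd p) (fst p) x = x)) - 1))"
    by (simp only: ncl_Suc_sum ncl_sum[of m "Suc k" n s] sum_subtractf[symmetric] split_beta right_diff_distrib mult_1_right)
   then show ?thesis by (simp only: f_def sum_distrib_left mult.assoc)
  qed
 qed
 also have "\<dots> = (\<Sum>p\<in>?P. EE m N (f p))" by (rule EE_sum)
 also have "\<dots> = 0"
 proof (rule sum.neutral, safe)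
  fix v w assume v: "v \<in> level d n" and w: "w \<in> red_words m (Suc k)"
  then obtain l t where lt: "w = l # t" by (cases w) (auto simp: red_words_def)
  define e where "e s = edg (stp s) l v" for s
  have wl: "length t = k" "reduced w" "set w \<subseteq> letters m" using w lt by (auto simp: red_words_def)
  have len: "length (snd (e s)) = n" for s using v by (simp add: e_def level_iff)
  have "EE m N (f (v, w)) = EE m N (\<lambda>s. (\<Sum>h\<in>H. f (v, w) (s(e s := h))) / card H)"
  proof (rule EE_resample)
   fix s assume s: "s \<in> Cfg m N"
   have "set (tr (stp s) w v) \<subseteq> {..<m} \<times> level d n" using tr_level[OF valid_Cfg[OF s] v wl(3)] .
   then show "e s \<in> Ind m N" using n1 unfolding lt e_def Ind_def by auto
   show "e (s(e s := h)) = e s" for h using len v by (simp add: e_def edg_upd level_iff)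
  qed
  also have "\<dots> = EE m N (\<lambda>s. 0)"
  proof (rule EE_cong)
   fix s assume s: "s \<in> Cfg m N"
   have vs: "valid s" using valid_Cfg[OF s] .
   have inv: "f (v, w) (s(e s := h)) = of_bool (B s) * g s * of_bool (wks s w v = v) *
     ((\<Sum>x<d. of_bool (whol (s(e s := h)) w v x = x)) - 1)" if h: "h \<in> H" for h
   proof -
    have "B (s(e s := h)) = B s" unfolding B using girth_upd[of n1 "e s"] len n1 by simp
    moreover have "g (s(e s := h)) = g s" using g[OF s len h] .
    moreover have "wks (s(e s := h)) w v = wks s w v" using wks_upd[of v "e s"] len[of s] v by (simp add: level_iff)
    ultimately show ?thesis by (simp add: f_def)
   qed
   show "(\<Sum>h\<in>H. f (v, w) (s(e s := h))) / card H = 0"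
   proof (cases "B s \<and> wks s w v = v")
    case True
    then have "girth_gt (stp s) m (level d n) k" using girth_level_mono[OF vs _ n1(1)] B by blast
    then have "e s \<notin> set (tr (stp s) t (stp s l v))"
     using closed_first_edge_once[OF sym_act_level[OF vs] _ v, of m k l t] True wl lt unfolding e_def by blast
    then have once: "count_list (tr (stp s) w v) (e s) = 1" by (simp add: lt e_def count_notin)
    have "(\<Sum>h\<in>H. of_bool (whol (s(e s := h)) w v x = x)) = card H / d" if "x < d" for x
     using card_hol_once[OF vs once that that] by (simp add: sum_of_bool_eq Int_def)
    then have "(\<Sum>h\<in>H. (\<Sum>x<d. of_bool (whol (s(e s := h)) w v x = x)) - (1::real)) = 0"
     unfolding sum_subtractf using d2 by (subst sum.swap) simp
    then show ?thesis using inv by (simp add: sum_distrib_left[symmetric])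
   next
    case False
    then show ?thesis using inv by auto
   qed
  qed
  finally show "EE m N (f (v, w)) = 0" by simp
 qed
 finally show ?thesis .
qed

lemma whol_id: "(\<And>q. q \<in> set (tr (stp s) w v) ==> s q = id) ==> whol s w v = id"
 by (induction w arbitrary: v) (auto simp: lhol_def)

lemma ncl_Suc_eq_0: "ncl m k n s = 0 ==> ncl m k (Suc n) s = 0"
proof -
 assume "ncl m k n s = 0"
 then have "closed_words m k n s = {}" by (simp add: ncl_def)
 then have "wks s w v \<noteq> v" if "v \<in> level d n" "w \<in> red_words m k" for v w
  using that by (auto simp: closed_words_def)
 then show ?thesis unfolding ncl_Suc_sum by (intro sum.neutral) auto
qed

lemma ncl_nonneg [simp]: "0 \<le> ncl m k n s"
 by (simp add: ncl_def)

lemma ncl_pos: "0 < ncl m k n s ==> 1 \<le> ncl m k n s"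
 by (simp add: ncl_def)

text \<open>\<open>1.4\<close> is a lower bound for the square root of two, and half the square of
  \<open>0.4\<close> is \<open>0.08\<close>, above \<open>1 / 16\<close>.\<close>

lemma sqrt_gap:
 fixes z D :: real
 assumes "1 \<le> z" "2 \<le> D"
 shows "1 / 16 \<le> 1 / (2 * sqrt z) * (sqrt (D * z) - sqrt z)\<^sup>2"
proof -
 have D: "1.4 \<le> sqrt D" using assms by (intro real_le_rsqrt) (simp add: power2_eq_square)
 have "(0.4::real)\<^sup>2 \<le> (sqrt D - 1)\<^sup>2" using D by (intro power_mono) auto
 moreover have "1 \<le> sqrt z" using assms by simp
 ultimately have "(0.4::real)\<^sup>2 * 1 \<le> (sqrt D - 1)\<^sup>2 * sqrt z" by (intro mult_mono) auto
 moreover have "1 / (2 * sqrt z) * (sqrt (D * z) - sqrt z)\<^sup>2 = (sqrt D - 1)\<^sup>2 * sqrt z / 2"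
 proof -
  have "sqrt (D * z) - sqrt z = (sqrt D - 1) * sqrt z" using assms by (simp add: real_sqrt_mult algebra_simps)
  then show ?thesis using assms by (simp add: power_mult_distrib power2_eq_square)
 qed
 ultimately show ?thesis by (simp add: power2_eq_square)
qed

text \<open>The square root of a martingale decreases in mean, and here by a definite amount while
  the count lies between 1 and \<open>K\<close>: with a probability bounded below all labels on the
  closed paths are the identity, the count is multiplied by \<open>d\<close>, and the second-order
  term of the square root is at least \<open>1 / 16\<close>.\<close>

lemma ncl_sqrt_step:
 assumes n1: "n1 \<le> n" "n < N"
  and B: "B = (\<lambda>s. girth_gt (stp s) m (level d n1) k)"
 shows "EE m N (\<lambda>s. of_bool (B s) * sqrt (ncl m (Suc k) (Suc n) s)) \<le> EE m N (\<lambda>s. of_bool (B s) * sqrt (ncl m (Suc k) n s))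
   - (1 / 16) * (1 / card H) ^ (K * Suc k) * EE m N (\<lambda>s. of_bool (B s \<and> 0 < ncl m (Suc k) n s \<and> ncl m (Suc k) n s \<le> real K))"
proof -
 let ?z = "ncl m (Suc k) n" and ?Z = "ncl m (Suc k) (Suc n)"
 \<comment> \<open>When the count is 0, division by zero makes \<open>g\<close> vanish, in agreement
   with the count remaining 0.\<close>
 define g where "g s = 1 / (2 * sqrt (?z s))" for s
 define E where "E s = (\<Union>(v, w)\<in>closed_words m (Suc k) n s. set (tr (stp s) w v))" for s
 define u where "u s = (of_bool (B s \<and> 0 < ?z s \<and> ?z s \<le> real K) :: real)" for s
 let ?J = "{..<m} \<times> level d n"
 have Esub: "E s \<subseteq> ?J" if "s \<in> Cfg m N" for s
 proof
  fix q assume "q \<in> E s"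
  then obtain v w where "v \<in> level d n" "set w \<subseteq> letters m" "q \<in> set (tr (stp s) w v)"
   unfolding E_def closed_words_def red_words_def by blast
  then show "q \<in> ?J" using tr_level[OF valid_Cfg[OF that], of v n w m] by blast
 qed
 have cardE: "real (card (E s)) \<le> ?z s * Suc k" for s
 proof -
  have "card (E s) \<le> (\<Sum>p\<in>closed_words m (Suc k) n s. card (set (tr (stp s) (snd p) (fst p))))"
   unfolding E_def split_beta by (rule card_UN_le) simp
  also have "\<dots> \<le> (\<Sum>p\<in>closed_words m (Suc k) n s. Suc k)"
  proof (rule sum_mono)
   fix p assume "p \<in> closed_words m (Suc k) n s"
   then have "length (tr (stp s) (snd p) (fst p)) = Suc k" by (auto simp: closed_words_def red_words_def)
   then show "card (set (tr (stp s) (snd p) (fst p))) \<le> Suc k" using card_length[of "tr (stp s) (snd p) (fst p)"] by simp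
  qed
  finally have "card (E s) \<le> card (closed_words m (Suc k) n s) * Suc k" by simp
  then have "real (card (E s)) \<le> real (card (closed_words m (Suc k) n s) * Suc k)" by (simp only: of_nat_le_iff)
  then show ?thesis unfolding ncl_def by (simp only: of_nat_mult)
 qed
 have cl_upd: "closed_words m (Suc k) n (s(q := h)) = closed_words m (Suc k) n s" if "q \<in> ?J" for s q h
  using that unfolding closed_words_def by (auto simp: wks_upd level_iff)
 have Eupd: "E (s(q := h)) = E s" if "q \<in> ?J" for s q h
  unfolding E_def cl_upd[OF that] using that
  by (intro SUP_cong refl) (auto simp: closed_words_def tr_upd level_iff)
 have uupd: "u (s(q := h)) = u s" if "q \<in> ?J" for s q h
 proof -
  have "length (snd q) = n" using that by (auto simp: level_iff)
  then show ?thesis unfolding u_def B using ncl_upd girth_upd[of n1 q] n1 by simp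
 qed
 \<comment> \<open>The closed paths use at most \<open>K * Suc k\<close> edges, and each label is
   the identity with probability \<open>1 / card H\<close>. These labels influence neither the set
   of edges nor \<open>u\<close>.\<close>
 have low: "(1 / card H) ^ (K * Suc k) * EE m N u \<le> EE m N (\<lambda>s. u s * of_bool (\<forall>q\<in>E s. s q \<in> {id}))"
 proof -
  have "EE m N (\<lambda>s. u s * of_bool (\<forall>q\<in>E s. s q \<in> {id})) = EE m N (\<lambda>s. u s * (\<Prod>q\<in>E s. real (card ({id} \<inter> H)) / card H))"
  proof (rule EE_indep[where J = ?J])
   show "?J \<subseteq> Ind m N" using n1 by (auto simp: Ind_def)
  qed (use Esub Eupd uupd in auto)
  moreover have "EE m N (\<lambda>s. (1 / card H) ^ (K * Suc k) * u s) \<le> \<dots>"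
  proof (rule EE_mono)
   fix s assume s: "s \<in> Cfg m N"
   have p: "(\<Prod>q\<in>E s. real (card ({id} \<inter> H)) / card H) = (1 / card H) ^ card (E s)"
    using H_id by simp
   have "(1 / real (card H)) ^ (K * Suc k) \<le> (1 / card H) ^ card (E s)" if "u s \<noteq> 0"
   proof (rule power_decreasing)
    have "?z s \<le> K" using that by (auto simp: u_def)
    then have "real (card (E s)) \<le> real (K * Suc k)"
     using cardE[of s] mult_right_mono[of "?z s" K "Suc k"] unfolding of_nat_mult by linarith
    then show "card (E s) \<le> K * Suc k" by linarith
   qed (use card_H_pos in \<open>auto simp: Suc_le_eq\<close>)
   then show "(1 / card H) ^ (K * Suc k) * u s \<le> u s * (\<Prod>q\<in>E s. real (card ({id} \<inter> H)) / card H)"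
    unfolding p by (cases "u s = 0") (auto simp: u_def)
  qed
  ultimately show ?thesis by (simp only: EE_cmult)
 qed
 have "EE m N (\<lambda>s. (1 / 16) * (u s * of_bool (\<forall>q\<in>E s. s q \<in> {id}))) \<le>
   EE m N (\<lambda>s. of_bool (B s) * g s * (sqrt (?Z s) - sqrt (?z s))\<^sup>2)"
 proof (rule EE_mono)
  fix s assume s: "s \<in> Cfg m N"
  show "(1 / 16) * (u s * of_bool (\<forall>q\<in>E s. s q \<in> {id})) \<le> of_bool (B s) * g s * (sqrt (?Z s) - sqrt (?z s))\<^sup>2"
  proof (cases "u s \<noteq> 0 \<and> (\<forall>q\<in>E s. s q \<in> {id})")
   case True
   have "?Z s = real d * ?z s"
    unfolding ncl_Suc_sum ncl_sum[of m "Suc k" n s] sum_distrib_left[of "real d"]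
   proof (rule sum.cong[OF refl])
    fix p assume "p \<in> level d n \<times> red_words m (Suc k)"
    then obtain v w where vw: "p = (v, w)" "v \<in> level d n" "w \<in> red_words m (Suc k)" by auto
    have "of_bool (wks s w v = v) * (\<Sum>x<d. of_bool (whol s w v x = x)) = real d * of_bool (wks s w v = v)"
    proof (cases "wks s w v = v")
     case c: True
     have "whol s w v = id"
     proof (rule whol_id)
      fix q assume "q \<in> set (tr (stp s) w v)"
      moreover have "(v, w) \<in> closed_words m (Suc k) n s" using vw c by (simp add: closed_words_def)
      ultimately have "q \<in> E s" unfolding E_def by (intro UN_I[of "(v, w)"]) auto
      then show "s q = id" using True by auto
     qed
     then show ?thesis using c by simp
    qed simp
    then show "(case p of (v, w) \<Rightarrow> of_bool (wks s w v = v) * (\<Sum>x<d. of_bool (whol s w v x = x))) =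
     real d * (case p of (v, w) \<Rightarrow> of_bool (wks s w v = v))" by (simp add: vw(1) del: sum_of_bool_eq)
   qed
   moreover have "1 \<le> ?z s" "B s" using True ncl_pos by (auto simp: u_def)
   moreover have "u s = 1" using True by (auto simp: u_def)
   ultimately show ?thesis using sqrt_gap[of "?z s" "real d"] d2 True by (simp add: g_def)
  next
   case False
   have "0 \<le> of_bool (B s) * g s * (sqrt (?Z s) - sqrt (?z s))\<^sup>2" by (simp add: g_def)
   then show ?thesis using False by auto
  qed
 qed
 with low have sq: "(1 / 16) * ((1 / card H) ^ (K * Suc k) * EE m N u) \<le> EE m N (\<lambda>s. of_bool (B s) * g s * (sqrt (?Z s) - sqrt (?z s))\<^sup>2)"
  by (simp only: EE_cmult)
 have "EE m N (\<lambda>s. of_bool (B s) * sqrt (?Z s)) = EE m N (\<lambda>s. of_bool (B s) * sqrt (?z s) +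
   of_bool (B s) * g s * (?Z s - ?z s) - of_bool (B s) * g s * (sqrt (?Z s) - sqrt (?z s))\<^sup>2)"
 proof (rule EE_cong)
  fix s
  \<comment> \<open>Exact expansion to second order:
    \<open>b = a + (b^2 - a^2) / (2 a) - (b - a)^2 / (2 a)\<close> for the two roots
    \<open>a\<close> and \<open>b\<close>. The linear term averages to 0 by the martingale
    property.\<close>
  have "sqrt (?Z s) = sqrt (?z s) + g s * (?Z s - ?z s) - g s * (sqrt (?Z s) - sqrt (?z s))\<^sup>2"
  proof (cases "?z s = 0")
   case True
   then show ?thesis using ncl_Suc_eq_0 by (simp add: g_def)
  next
   case False
   then have "0 < ?z s" using ncl_nonneg[of m "Suc k" n s] by linarith
   define a b where "a = sqrt (?z s)" and "b = sqrt (?Z s)"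
   have ab: "0 < a" "?z s = a\<^sup>2" "?Z s = b\<^sup>2" using \<open>0 < ?z s\<close> by (auto simp: a_def b_def)
   show ?thesis unfolding a_def[symmetric] b_def[symmetric] g_def ab(2,3) using ab(1)
    by (simp add: power2_eq_square field_simps)
  qed
  then have "of_bool (B s) * sqrt (?Z s) = of_bool (B s) * (sqrt (?z s) + g s * (?Z s - ?z s) - g s * (sqrt (?Z s) - sqrt (?z s))\<^sup>2)"
   by simp
  then show "of_bool (B s) * sqrt (?Z s) = of_bool (B s) * sqrt (?z s) +
   of_bool (B s) * g s * (?Z s - ?z s) - of_bool (B s) * g s * (sqrt (?Z s) - sqrt (?z s))\<^sup>2"
   by (simp add: algebra_simps)
 qed
 moreover have "EE m N (\<lambda>s. of_bool (B s) * g s * (?Z s - ?z s)) = 0"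
  by (rule ncl_martingale[OF n1 B]) (simp add: g_def ncl_upd)
 ultimately show ?thesis using sq unfolding u_def by (simp add: EE_add EE_diff)
qed

text \<open>If closed words of the new length survived \<open>T\<close> further levels with
  probability \<open>p\<close>, every one of these levels would lower the mean square root of their
  number by about \<open>c * p\<close>; but it starts below \<open>R + 1\<close> and stays
  nonnegative.\<close>

lemma girth_lim: "0 < \<epsilon> ==> \<exists>n. \<forall>N\<ge>n. EE m N (\<lambda>s. of_bool (\<not> girth_gt (stp s) m (level d n) k)) < \<epsilon>"
proof (induction k arbitrary: \<epsilon>)
 case 0
 then show ?case by (intro exI[of _ 0]) (auto simp: girth_gt_def)
next
 case (Suc k)
 obtain n1 where n1: "\<And>N. N \<ge> n1 ==> EE m N (\<lambda>s. of_bool (\<not> girth_gt (stp s) m (level d n1) k)) < \<epsilon> / 2"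
  using Suc.IH[of "\<epsilon> / 2"] Suc.prems by auto
 define B where "B = (\<lambda>s. girth_gt (stp s) m (level d n1) k)"
 define R where "R = real (card (level d n1 \<times> red_words m (Suc k)))"
 have R0: "0 \<le> R" by (simp add: R_def)
 \<comment> \<open>By Markov's inequality the count exceeds \<open>K\<close> with probability at
   most \<open>R / K\<close>, which becomes smaller than \<open>\<epsilon> / 4\<close>.\<close>
 obtain K :: nat where K: "4 * R / \<epsilon> < K" using reals_Archimedean2 by blast
 have K0: "0 < real K" using K R0 Suc.prems by (metis divide_nonneg_pos le_less_trans mult_nonneg_nonneg zero_le_numeral)
 define c where "c = (1 / 16) * (1 / real (card H)) ^ (K * Suc k)"
 have c: "0 < c" using card_H_pos by (simp add: c_def)
 \<comment> \<open>So many levels that the total loss \<open>c * T * (\<epsilon> / 4)\<close> would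
   exceed the initial bound \<open>R + 1\<close>.\<close>
 obtain T :: nat where T: "4 * (R + 1) / (\<epsilon> * c) < T" using reals_Archimedean2 by blast
 have T0: "0 < real T" using T R0 Suc.prems c
  by (metis add_nonneg_pos divide_pos_pos le_less_trans less_eq_real_def mult_pos_pos zero_less_numeral zero_less_one)
 show ?case
 proof (intro exI[of _ "n1 + T"] allI impI)
  fix N assume N: "n1 + T \<le> N"
  let ?z = "ncl m (Suc k)"
  define p where "p = EE m N (\<lambda>s. of_bool (B s \<and> 0 < ?z (n1 + T) s))"
  have mart: "EE m N (\<lambda>s. of_bool (B s) * ?z (n1 + j) s) \<le> R" if "j \<le> T" for j
   using that
  proof (induction j)
   case 0
   have "EE m N (\<lambda>s. of_bool (B s) * ?z (n1 + 0) s) \<le> EE m N (\<lambda>_. R)"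
    by (rule EE_mono) (use ncl_le[of m "Suc k" n1] in \<open>auto simp: R_def\<close>)
   then show ?case by simp
  next
   case (Suc j)
   have "EE m N (\<lambda>s. of_bool (B s) * 1 * (?z (Suc (n1 + j)) s - ?z (n1 + j) s)) = 0"
    by (rule ncl_martingale[OF _ _ B_def]) (use Suc N in auto)
   then show ?case using Suc by (simp add: right_diff_distrib EE_diff)
  qed
  have big: "p - R / K \<le> EE m N (\<lambda>s. of_bool (B s \<and> 0 < ?z (n1 + j) s \<and> ?z (n1 + j) s \<le> K))" if j: "j < T" for j
  proof -
   have zmono: "0 < ?z (n1 + T) s ==> 0 < ?z (n1 + j) s" for s
   proof -
    have "?z (n1 + j) s = 0 ==> ?z (n1 + j + i) s = 0" for i by (induction i) (auto simp: ncl_Suc_eq_0)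
    from this[of "T - j"] show "0 < ?z (n1 + T) s ==> 0 < ?z (n1 + j) s"
     using j ncl_nonneg[of m "Suc k" "n1 + j" s] by (auto simp: less_eq_real_def)
   qed
   have "p \<le> EE m N (\<lambda>s. of_bool (B s \<and> 0 < ?z (n1 + j) s \<and> ?z (n1 + j) s \<le> K) + (1 / K) * (of_bool (B s) * ?z (n1 + j) s))"
    unfolding p_def
   proof (rule EE_mono)
    fix s
    show "of_bool (B s \<and> 0 < ?z (n1 + T) s) \<le>
      of_bool (B s \<and> 0 < ?z (n1 + j) s \<and> ?z (n1 + j) s \<le> K) + (1 / K) * (of_bool (B s) * ?z (n1 + j) s)"
     using zmono[of s] K0 ncl_nonneg[of m "Suc k" "n1 + j" s]
     by (cases "?z (n1 + j) s \<le> K") (auto simp: field_simps)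
   qed
   also have "\<dots> \<le> EE m N (\<lambda>s. of_bool (B s \<and> 0 < ?z (n1 + j) s \<and> ?z (n1 + j) s \<le> K)) + R / K"
    unfolding EE_add EE_cmult using mart[of j] j K0 by (simp add: divide_right_mono)
   finally show ?thesis by simp
  qed
  have desc: "EE m N (\<lambda>s. of_bool (B s) * sqrt (?z (n1 + j) s)) \<le> R + 1 - c * j * (p - R / K)" if "j \<le> T" for j
   using that
  proof (induction j)
   case 0
   have "EE m N (\<lambda>s. of_bool (B s) * sqrt (?z (n1 + 0) s)) \<le> EE m N (\<lambda>_. R + 1)"
   proof (rule EE_mono)
    fix s
    have z: "0 \<le> ?z n1 s" "?z n1 s \<le> R" using ncl_le[of m "Suc k" n1 s] by (auto simp: R_def)
    have "?z n1 s \<le> (R + 1)\<^sup>2" using z R0 mult_nonneg_nonneg[OF R0 R0]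
     unfolding power2_eq_square distrib_left distrib_right by linarith
    then have "sqrt (?z n1 s) \<le> R + 1" using R0 by (simp add: real_le_lsqrt)
    then show "of_bool (B s) * sqrt (?z (n1 + 0) s) \<le> R + 1" using R0 by simp
   qed
   then show ?case by simp
  next
   case (Suc j)
   have "EE m N (\<lambda>s. of_bool (B s) * sqrt (?z (Suc (n1 + j)) s)) \<le> EE m N (\<lambda>s. of_bool (B s) * sqrt (?z (n1 + j) s))
     - c * EE m N (\<lambda>s. of_bool (B s \<and> 0 < ?z (n1 + j) s \<and> ?z (n1 + j) s \<le> K))"
    unfolding c_def by (rule ncl_sqrt_step[OF _ _ B_def]) (use Suc N in auto)
   moreover have "c * (p - R / K) \<le> c * EE m N (\<lambda>s. of_bool (B s \<and> 0 < ?z (n1 + j) s \<and> ?z (n1 + j) s \<le> K))"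
    using big[of j] Suc c by (intro mult_left_mono) auto
   ultimately show ?case using Suc by (simp add: algebra_simps)
  qed
  have "0 \<le> EE m N (\<lambda>s. of_bool (B s) * sqrt (?z (n1 + T) s))" by (rule EE_nonneg) simp
  then have "c * T * (p - R / K) \<le> R + 1" using desc[of T] by simp
  then have "p - R / K \<le> (R + 1) / (c * T)" using c T0 by (simp add: field_simps)
  moreover have "(R + 1) / (c * T) < \<epsilon> / 4" using T c T0 Suc.prems by (simp add: field_simps)
  moreover have "R / K < \<epsilon> / 4" using K K0 Suc.prems by (simp add: field_simps)
  ultimately have p: "p < \<epsilon> / 2" by linarith
  have "EE m N (\<lambda>s. of_bool (\<not> girth_gt (stp s) m (level d (n1 + T)) (Suc k))) \<le>
    EE m N (\<lambda>s. of_bool (\<not> B s) + of_bool (B s \<and> 0 < ?z (n1 + T) s))"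
  proof (rule EE_mono)
   fix s assume s: "s \<in> Cfg m N"
   show "of_bool (\<not> girth_gt (stp s) m (level d (n1 + T)) (Suc k)) \<le> (of_bool (\<not> B s) + of_bool (B s \<and> 0 < ?z (n1 + T) s) :: real)"
   proof (cases "B s \<and> \<not> girth_gt (stp s) m (level d (n1 + T)) (Suc k)")
    case True
    then have g: "girth_gt (stp s) m (level d (n1 + T)) k"
     using girth_level_mono[OF valid_Cfg[OF s]] unfolding B_def by auto
    from True obtain v w where vw: "v \<in> level d (n1 + T)" "reduced w" "w \<noteq> []" "set w \<subseteq> letters m" "length w \<le> Suc k" "wks s w v = v"
     by (auto simp: girth_gt_def)
    then have "\<not> length w \<le> k" using g by (auto simp: girth_gt_def)
    then have "(v, w) \<in> closed_words m (Suc k) (n1 + T) s" using vw by (auto simp: closed_words_def red_words_def)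
    then have "closed_words m (Suc k) (n1 + T) s \<noteq> {}" by auto
    then have "0 < ?z (n1 + T) s" by (simp add: ncl_def card_gt_0_iff)
    then show ?thesis by simp
   qed auto
  qed
  also have "\<dots> < \<epsilon>" using n1[of N] N p by (simp add: EE_add p_def B_def)
  finally show "EE m N (\<lambda>s. of_bool (\<not> girth_gt (stp s) m (level d (n1 + T)) (Suc k))) < \<epsilon>" .
 qed
qed

end

section \<open>Haar-distributed families\<close>

lemma tr_take:
 "n \<le> length v ==> map (\<lambda>q. (fst q, take n (snd q))) (tr (stp s) w v) = tr (stp s) w (take n v)"
 by (induction w arbitrary: v) (auto simp: edg_def take_stp)

text \<open>A path can be traced back to its start from any of its edges, once the position of the
  edge in the word is known, because that position also fixes the direction of crossing.\<close>

lemma tr_nth_inj: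
 assumes sym: "sym_act st V" and "i < length w" "a \<in> V" "b \<in> V" "tr st w a ! i = tr st w b ! i"
 shows "a = b"
 using assms(2-)
proof (induction w arbitrary: i a b)
 case (Cons l w)
 show ?case
 proof (cases i)
  case 0
  then have e: "edg st l a = edg st l b" using Cons.prems by simp
  have "l \<noteq> linv l" by simp
  then show ?thesis using edg_eq_iff[OF sym Cons.prems(2,3), of l l] e by blast
 next
  case (Suc k)
  then have "st l a = st l b"
   using Cons.prems Cons.IH[of k "st l a" "st l b"] sym by (auto simp: sym_actD)
  then show ?thesis using st_inj[OF sym Cons.prems(2,3)] by blast
 qed
qed simp

lemma count_list_1_nth_eq:
 assumes "count_list xs x = 1" "i < length xs" "j < length xs" "xs ! i = x" "xs ! j = x"
 shows "i = j"
proof -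
 have "card {i. i < length xs \<and> x = xs ! i} = 1"
  using assms(1) by (simp add: count_list_eq_length_filter length_filter_conv_card)
 then obtain k where k: "{i. i < length xs \<and> x = xs ! i} = {k}" by (metis One_nat_def card_1_singletonE)
 have "i \<in> {i. i < length xs \<and> x = xs ! i}" "j \<in> {i. i < length xs \<and> x = xs ! i}"
  using assms(2-5) by simp_all
 then show ?thesis unfolding k by simp
qed

text \<open>The portraits of the cocycles at \<open>v\<close> of the elements spelled by the words
  \<open>g j\<close>. They describe the action on the subtree at \<open>v\<close> when these words
  fix \<open>v\<close>.\<close>

definition derv :: "config \<Rightarrow> (nat \<Rightarrow> (nat \<times> bool) list) \<Rightarrow> nat list \<Rightarrow> config" where
 "derv s g v = (\<lambda>(j, w). whol s (g j) (v @ w))"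

definition subw :: "(nat \<Rightarrow> (nat \<times> bool) list) \<Rightarrow> (nat \<times> bool) list \<Rightarrow> (nat \<times> bool) list" where
 "subw g x = concat (map (\<lambda>l. if snd l then g (fst l) else winv (g (fst l))) x)"

text \<open>
 The triangular crossing pattern: conditionally on level \<open>length v\<close>, the cocycles at \<open>v\<close> of such closed words
 are independent and Haar-distributed, because \<open>e j\<close> contributes exactly one free factor to the \<open>j\<close>-th word.
\<close>

definition tri :: "config \<Rightarrow> nat \<Rightarrow> (nat \<Rightarrow> (nat \<times> bool) list) \<Rightarrow> nat list \<Rightarrow> (nat \<Rightarrow> nat \<times> nat list) \<Rightarrow> bool" where
 "tri s M g v e \<longleftrightarrow> (\<forall>j<M. wks s (g j) v = v \<and> count_list (tr (stp s) (g j) v) (e j) = 1 \<and>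
   (\<forall>k<M. j < k --> e j \<notin> set (tr (stp s) (g k) v)))"

context letter_group
begin

lemma valid_derv: "valid s ==> valid (derv s g v)"
 unfolding valid_def derv_def using whol_in_H[unfolded valid_def] by auto

lemma stp_Nil [simp]: "stp s l [] = []"
 by (simp add: stp_def)

lemma stp_derv_True:
 assumes "wks s (g j) v = v"
 shows "wks s (g j) (v @ w) = v @ stp (derv s g v) (j, True) w"
proof (induction w rule: rev_induct)
 case (snoc x w)
 show ?case
  using snoc unfolding append.assoc[symmetric] stp_snoc wks_snoc
  by (simp add: lhol_def edg_def derv_def)
qed (use assms in simp)

lemma stp_derv:
 assumes s: "valid s" and g: "wks s (g j) v = v"
 shows "wks s (if b then g j else winv (g j)) (v @ w) = v @ stp (derv s g v) (j, b) w"
proof (cases b)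
 case True
 then show ?thesis using stp_derv_True[of s g j v w] g by simp
next
 case False
 define u where "u = stp (derv s g v) (j, False) w"
 have "stp (derv s g v) (j, True) u = w"
  using sym_actD(2)[OF sym_act_stp[OF valid_derv[OF s]] UNIV_I, where l = "(j, False)" and v = w] by (simp add: u_def linv_def)
 then have "wks s (g j) (v @ u) = v @ w" using stp_derv_True[of s g j v u] g by simp
 then have "wks s (winv (g j)) (v @ w) = v @ u"
  using wk_winv[OF sym_act_stp[OF s], of "v @ u" "g j"] by simp
 then show ?thesis using False by (simp add: u_def)
qed

text \<open>This carries words in the cocycles back to words in the original generators, and so lets
  constructions inside a subtree be iterated.\<close>

lemma wks_subw:
 assumes s: "valid s" and g: "\<And>j. j < M ==> wks s (g j) v = v" and x: "set x \<subseteq> letters M"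
 shows "wks s (subw g x) (v @ w) = v @ wks (derv s g v) x w"
 using x
proof (induction x arbitrary: w)
 case (Cons l x)
 then have "fst l < M" by (auto simp: letters_def)
 then show ?case
  using Cons stp_derv[where s = s and g = g and j = "fst l" and v = v and b = "snd l" and w = w, OF s g[of "fst l"]]
  by (simp add: subw_def)
qed (simp add: subw_def)

lemma set_subw: "(\<And>j. j < M ==> set (g j) \<subseteq> letters m) ==> set x \<subseteq> letters M ==> set (subw g x) \<subseteq> letters m"
proof (induction x)
 case (Cons l x)
 then have "fst l < M" by (auto simp: letters_def)
 then have "set (g (fst l)) \<subseteq> letters m" using Cons.prems by blast
 moreover have "set (subw g x) \<subseteq> letters m" using Cons by simp
 ultimately show ?case by (simp add: subw_def)
qed (simp add: subw_def)

lemma dep_tri: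
 assumes "v \<in> level d n" "n \<le> N" "\<And>j. j < M ==> set (g j) \<subseteq> letters m"
 shows "dep m N (\<lambda>s. tri s M g v e)"
 unfolding dep_def tri_def using wks_restr[OF _ assms(1,2)] tr_restr[OF _ assms(1,2)] assms(3) by auto

lemma card_hol_eq_once:
 assumes s: "valid s" and once: "count_list (tr (stp s) w v) e = 1" and y: "y \<in> H"
 shows "card {h\<in>H. whol (s(e := h)) w v = y} = 1"
proof -
 obtain u l t where ult: "w = u @ l # t" "edg (stp s) l (wks s u v) = e" "e \<notin> set (tr (stp s) u v)"
  "e \<notin> set (tr (stp s) t (stp s l (wks s u v)))"
  using tr_split_once[OF once] .
 define A U where "A = whol s t (stp s l (wks s u v))" and "U = whol s u v"
 have AH: "A \<in> H" and UH: "U \<in> H" using whol_in_H[OF s] by (auto simp: A_def U_def)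
 have bij: "bij A" "bij U" using H_bij[OF AH] H_bij[OF UH] by simp_all
 define z where "z = finv A \<circ> y \<circ> finv U"
 have zH: "z \<in> H" unfolding z_def by (intro H_comp H_inv AH UH y)
 have eq: "A \<circ> h \<circ> U = y \<longleftrightarrow> h = z" for h
 proof
  assume "A \<circ> h \<circ> U = y"
  then have "z = finv A \<circ> (A \<circ> h \<circ> U) \<circ> finv U" by (simp add: z_def)
  also have "\<dots> = h" using bij by (auto simp: fun_eq_iff bij_is_inj bij_is_surj surj_f_inv_f)
  finally show "h = z" by simp
 next
  assume "h = z"
  then show "A \<circ> h \<circ> U = y" using bij by (auto simp: z_def fun_eq_iff bij_is_inj bij_is_surj surj_f_inv_f)
 qed
 have "{h\<in>H. whol (s(e := h)) w v = y} = {h\<in>H. (if snd l then h else finv h) = z}"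
  using eq by (simp add: whol_upd_once[OF ult] A_def[symmetric] U_def[symmetric])
 also have "\<dots> = {if snd l then z else finv z}"
 proof (cases "snd l")
  case False
  have "finv h = z \<longleftrightarrow> h = finv z" if "h \<in> H" for h
   using inv_inv_eq[OF H_bij[OF that]] inv_inv_eq[OF H_bij[OF zH]] by auto
  then show ?thesis using False H_inv[OF zH] by auto
 qed (use zH in auto)
 finally show ?thesis by simp
qed

text \<open>The prescribed labels are removed one by one. Among those of greatest depth take one
  with the least word index \<open>j\<close>, and resample the unique lift of \<open>e j\<close>
  crossed by its path. Shallower holonomies use only shallower edges, words of larger index avoid
  \<open>e j\<close> altogether, and the word \<open>g j\<close> started at a different vertex of
  the same depth crosses a different lift.\<close>

lemma EE_tri:
 assumes m: "0 < m" and v: "v \<in> level d n" and g: "\<And>j. j < M ==> set (g j) \<subseteq> letters m"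
  and \<Psi>: "dep m n \<Psi>" "\<And>s. valid s ==> \<Psi> s ==> tri s M g v e" and c: "valid c"
  and F: "F \<subseteq> Ind M t"
 shows "EE m (n + t) (\<lambda>s. of_bool (\<Psi> s \<and> (\<forall>p\<in>F. derv s g v p = c p))) =
  (1 / card H) ^ card F * EE m (n + t) (\<lambda>s. of_bool (\<Psi> s))"
 using F
proof (induction "card F" arbitrary: F)
 case 0
 have "finite F" using 0 finite_subset[OF _ finite_Ind] by blast
 then show ?case using 0 by simp
next
 case (Suc f)
 have fin: "finite F" using Suc.prems finite_subset[OF _ finite_Ind] by blast
 then have ne: "F \<noteq> {}" using Suc.hyps by auto
 define L where "L = Max ((\<lambda>p. length (snd p)) ` F)"
 have L: "length (snd p) \<le> L" if "p \<in> F" for p using that fin by (simp add: L_def)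
 define F1 where "F1 = {p\<in>F. length (snd p) = L}"
 have "L \<in> (\<lambda>p. length (snd p)) ` F" unfolding L_def using fin ne by (intro Max_in) auto
 then obtain p where "p \<in> F" "length (snd p) = L" by blast
 then have "p \<in> F1" by (simp add: F1_def)
 then have F1: "F1 \<noteq> {}" by blast
 have F1f: "finite F1" using fin by (simp add: F1_def)
 define j where "j = Min (fst ` F1)"
 have jmin: "j \<le> fst p" if "p \<in> F1" for p using that F1f by (simp add: j_def)
 have "j \<in> fst ` F1" unfolding j_def using F1 F1f by (intro Min_in) auto
 then obtain w where p0: "(j, w) \<in> F" "length w = L" by (auto simp: F1_def)
 have jM: "j < M" and w: "w \<in> level d L" "L < t" using p0 Suc.prems by (auto simp: Ind_iff)
 have vw: "v @ w \<in> level d (n + L)" using v w by (auto simp: level_iff)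
 have lv: "length v = n" using v by (simp add: level_iff)
 define pr where "pr q = (fst q, take n (snd q))" for q :: "nat \<times> nat list"
 define T where "T s = tr (stp s) (g j) (v @ w)" for s
 have prT: "map pr (tr (stp s) (g k) (v @ u)) = tr (stp s) (g k) v" for s k u
  using tr_take[of n "v @ u" s "g k"] lv by (simp add: pr_def[abs_def])
 \<comment> \<open>A dummy edge of the right depth for configurations outside \<open>\<Psi>\<close>,
   so that resampling is defined on all of \<open>Cfg\<close>.\<close>
 define q0 :: "nat \<times> nat list" where "q0 = (0, replicate (n + L) 0)"
 define e' where "e' s = (if \<Psi> s then hd (filter (\<lambda>q. pr q = e j) (T s)) else q0)" for s
 have fl: "length (filter (\<lambda>q. pr q = e j) (T s)) = 1" if "valid s" "\<Psi> s" for s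
 proof -
  have "count_list (map pr (T s)) (e j) = 1" using \<Psi>(2)[OF that] jM unfolding tri_def T_def prT by blast
  moreover have "(\<lambda>q. e j = pr q) = (\<lambda>q. pr q = e j)" by auto
  ultimately show ?thesis by (simp add: count_list_eq_length_filter filter_map o_def)
 qed
 have e'T: "e' s \<in> set (T s) \<and> pr (e' s) = e j \<and> count_list (T s) (e' s) = 1" if s\<Psi>: "valid s" "\<Psi> s" for s
 proof -
  obtain q where q: "filter (\<lambda>q. pr q = e j) (T s) = [q]" using fl[OF s\<Psi>] by (cases "filter (\<lambda>q. pr q = e j) (T s)") auto
  then have "e' s = q" using s\<Psi> by (simp add: e'_def)
  moreover have "q \<in> set (filter (\<lambda>q. pr q = e j) (T s))" by (simp add: q)
  then have qT: "q \<in> set (T s)" "pr q = e j" by simp_all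
  moreover have "count_list xs q = count_list (filter (\<lambda>q. pr q = e j) xs) q" for xs
   using qT(2) by (induction xs) auto
  then have "count_list (T s) q = count_list [q] q" unfolding q[symmetric] .
  ultimately show ?thesis using qT by simp
 qed
 have e'lv: "e' s \<in> {..<m} \<times> level d (n + L)" if "valid s" for s
 proof (cases "\<Psi> s")
  case True
  then have "e' s \<in> set (T s)" using e'T that by blast
  then show ?thesis using tr_level[OF that vw g[OF jM]] by (auto simp: T_def)
 next
  case False
  then show ?thesis using m d2 by (auto simp: e'_def q0_def level_iff)
 qed
 have e'len: "length (snd (e' s)) = n + L" if "valid s" for s using e'lv[OF that] by (auto simp: level_iff)
 have \<Psi>upd: "\<Psi> (s(e' s := h)) = \<Psi> s" if "valid s" "h \<in> H" for s h
 proof (rule dep_upd[OF \<Psi>(1) that])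
  show "e' s \<notin> Ind m n" using e'len[OF that(1)] by (cases "e' s") (auto simp: Ind_iff)
 qed
 have e'upd: "e' (s(e' s := h)) = e' s" if "valid s" "h \<in> H" for s h
 proof -
  have "T (s(e' s := h)) = T s" unfolding T_def using e'len[OF that(1)] w lv p0 by (simp add: tr_upd)
  then have "e' (s(e' s := h)) = (if \<Psi> s then hd (filter (\<lambda>q. pr q = e j) (T s)) else q0)"
   by (simp only: e'_def[of "s(e' s := h)"] \<Psi>upd[OF that])
  then show ?thesis by (simp only: e'_def[of s])
 qed
 define F' where "F' = F - {(j, w)}"
 have other: "derv (s(e' s := h)) g v p = derv s g v p" if s: "valid s" "\<Psi> s" and p: "p \<in> F'" for s h p
 proof -
  obtain k u where ku: "p = (k, u)" by (cases p)
  have pF: "(k, u) \<in> F" "(k, u) \<noteq> (j, w)" using p ku by (auto simp: F'_def)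
  then have kM: "k < M" and lu: "length u \<le> L" using Suc.prems L[of "(k, u)"] by (auto simp: Ind_iff)
  have "e' s \<notin> set (tr (stp s) (g k) (v @ u))"
  proof
   assume in_tr: "e' s \<in> set (tr (stp s) (g k) (v @ u))"
   then have "length (snd (e' s)) = length (v @ u)" by (rule length_tr_stp)
   then have len: "length u = L" using e'len[OF s(1)] lv by simp
   then have "(k, u) \<in> F1" using pF by (simp add: F1_def)
   then have jk: "j \<le> k" using jmin by fastforce
   have "pr (e' s) \<in> set (map pr (tr (stp s) (g k) (v @ u)))" using in_tr by simp
   then have "e j \<in> set (tr (stp s) (g k) v)" using e'T[OF s] by (simp add: prT del: set_map)
   then have "k = j" using \<Psi>(2)[OF s] jM kM jk unfolding tri_def by (metis le_neq_implies_less)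
   \<comment> \<open>Both paths spell \<open>g j\<close>, and \<open>e j\<close> occurs at a single
     position of it; so they meet the lift at the same position and must start at the same
     vertex.\<close>
   then obtain i where i: "i < length (g j)" "tr (stp s) (g j) (v @ u) ! i = e' s"
    using in_tr by (auto simp: in_set_conv_nth)
   obtain i' where i': "i' < length (g j)" "tr (stp s) (g j) (v @ w) ! i' = e' s"
    using e'T[OF s] by (auto simp: in_set_conv_nth T_def)
   have "tr (stp s) (g j) v ! i = pr (tr (stp s) (g j) (v @ u) ! i)" "tr (stp s) (g j) v ! i' = pr (tr (stp s) (g j) (v @ w) ! i')"
    using i(1) i'(1) arg_cong[OF prT[of s j u], of "\<lambda>xs. xs ! i"] arg_cong[OF prT[of s j w], of "\<lambda>xs. xs ! i'"] by simp_all
   then have "tr (stp s) (g j) v ! i = e j" "tr (stp s) (g j) v ! i' = e j"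
    using i(2) i'(2) e'T[OF s] by simp_all
   then have "i = i'" using \<Psi>(2)[OF s] jM i i' count_list_1_nth_eq[of "tr (stp s) (g j) v" "e j" i i'] by (auto simp: tri_def)
   then have "v @ u = v @ w" using tr_nth_inj[OF sym_act_stp[OF s(1)] i(1), of "v @ u" "v @ w"] i i' by simp
   then show False using pF \<open>k = j\<close> by simp
  qed
  then show ?thesis using lu lv e'len[OF s(1)] by (simp add: derv_def ku whol_upd)
 qed
 let ?f = "\<lambda>F s. (of_bool (\<Psi> s \<and> (\<forall>p\<in>F. derv s g v p = c p)) :: real)"
 have "EE m (n + t) (?f F) = EE m (n + t) (\<lambda>s. (\<Sum>h\<in>H. ?f F (s(e' s := h))) / card H)"
 proof (rule EE_resample)
  fix s assume "s \<in> Cfg m (n + t)"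
  then have "valid s" by (rule valid_Cfg)
  then show "e' s \<in> Ind m (n + t)" "h \<in> H ==> e' (s(e' s := h)) = e' s" for h
   using e'lv[of s] w e'upd by (cases "e' s", auto simp: Ind_iff level_iff)
 qed
 also have "\<dots> = EE m (n + t) (\<lambda>s. (1 / card H) * ?f F' s)"
 proof (rule EE_cong)
  fix s assume "s \<in> Cfg m (n + t)"
  then have s: "valid s" by (rule valid_Cfg)
  show "(\<Sum>h\<in>H. ?f F (s(e' s := h))) / card H = (1 / card H) * ?f F' s"
  proof (cases "\<Psi> s")
   case True
   have Fd: "F = insert (j, w) F'" using p0 by (auto simp: F'_def)
   have "?f F (s(e' s := h)) = ?f F' s * of_bool (whol (s(e' s := h)) (g j) (v @ w) = c (j, w))" if "h \<in> H" for h
    using \<Psi>upd[OF s that] other[OF s True] True unfolding Fd by (auto simp: derv_def)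
   then have "(\<Sum>h\<in>H. ?f F (s(e' s := h))) = ?f F' s * (\<Sum>h\<in>H. of_bool (whol (s(e' s := h)) (g j) (v @ w) = c (j, w)))"
    by (simp only: sum_distrib_left cong: sum.cong)
   also have "(\<Sum>h\<in>H. of_bool (whol (s(e' s := h)) (g j) (v @ w) = c (j, w))) = (1::real)"
    using card_hol_eq_once[OF s, of "g j" "v @ w" "e' s" "c (j, w)"] e'T[OF s True] validD[OF c]
    by (simp add: T_def sum_of_bool_eq Int_def)
   finally have "(\<Sum>h\<in>H. ?f F (s(e' s := h))) = ?f F' s" by (simp only: mult_1_right)
   then show ?thesis by (simp only:) simp
  next
   case False
   then have "?f F (s(e' s := h)) = 0" if "h \<in> H" for h using \<Psi>upd[OF s that] by simp
   then have "(\<Sum>h\<in>H. ?f F (s(e' s := h))) = 0" by (intro sum.neutral) blast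
   then show ?thesis using False by (simp only:) simp
  qed
 qed
 also have "\<dots> = (1 / card H) * EE m (n + t) (?f F')" by (rule EE_cmult)
 also have "EE m (n + t) (?f F') = (1 / card H) ^ card F' * EE m (n + t) (\<lambda>s. of_bool (\<Psi> s))"
 proof (rule Suc.hyps(1))
  show "f = card F'" using Suc.hyps(2) p0 fin by (simp add: F'_def)
  show "F' \<subseteq> Ind M t" using Suc.prems by (auto simp: F'_def)
 qed
 also have "card F' = f" using Suc.hyps(2) p0 fin by (simp add: F'_def)
 finally show ?case by (simp add: Suc.hyps(2)[symmetric])
qed

text \<open>Only the uniformity of all truncations is recorded, over an arbitrary probability space;
  in this form the notion passes to conditional measures.\<close>

definition haar :: "'w measure \<Rightarrow> nat \<Rightarrow> ('w \<Rightarrow> config) \<Rightarrow> bool" where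
 "haar M m S \<longleftrightarrow> prob_space M \<and> (\<forall>\<omega>\<in>space M. valid (S \<omega>)) \<and>
  (\<forall>N. \<forall>c\<in>Cfg m N. {\<omega>\<in>space M. restr m N (S \<omega>) = c} \<in> sets M \<and>
   measure M {\<omega>\<in>space M. restr m N (S \<omega>) = c} = 1 / card (Cfg m N))"

lemma haar_event:
 assumes h: "haar M m S" and dep: "dep m N \<Phi>"
 shows "{\<omega>\<in>space M. \<Phi> (S \<omega>)} \<in> sets M" "measure M {\<omega>\<in>space M. \<Phi> (S \<omega>)} = EE m N (\<lambda>s. of_bool (\<Phi> s))"
proof -
 interpret prob_space M using h by (simp add: haar_def)
 let ?A = "\<lambda>c. {\<omega>\<in>space M. restr m N (S \<omega>) = c}"
 have A: "?A c \<in> sets M" "measure M (?A c) = 1 / card (Cfg m N)" if "c \<in> Cfg m N" for c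
  using h that by (auto simp: haar_def)
 have eq: "{\<omega>\<in>space M. \<Phi> (S \<omega>)} = (\<Union>c\<in>{c\<in>Cfg m N. \<Phi> c}. ?A c)"
 proof -
  have "\<Phi> (S \<omega>) \<longleftrightarrow> restr m N (S \<omega>) \<in> {c\<in>Cfg m N. \<Phi> c}" if "\<omega> \<in> space M" for \<omega>
   using h that depD[OF dep, of "S \<omega>"] restr_Cfg[of "S \<omega>" m N] by (auto simp: haar_def)
  then show ?thesis by auto
 qed
 show "{\<omega>\<in>space M. \<Phi> (S \<omega>)} \<in> sets M" unfolding eq using A by (intro sets.finite_UN) auto
 have "measure M {\<omega>\<in>space M. \<Phi> (S \<omega>)} = (\<Sum>c\<in>{c\<in>Cfg m N. \<Phi> c}. measure M (?A c))"
  unfolding eq by (intro finite_measure_finite_Union) (use A in \<open>auto simp: disjoint_family_on_def\<close>)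
 also have "\<dots> = EE m N (\<lambda>s. of_bool (\<Phi> s))"
  using A by (simp add: EE_def sum_of_bool_eq Int_def)
 finally show "measure M {\<omega>\<in>space M. \<Phi> (S \<omega>)} = EE m N (\<lambda>s. of_bool (\<Phi> s))" .
qed

text \<open>The restart property: after conditioning on a triangular pattern, everything proved for
  Haar families applies to the cocycles, on the conditioned probability space.\<close>

lemma haar_derv:
 assumes h: "haar M0 m S" and v: "v \<in> level d n" and g: "\<And>j. j < M ==> set (g j) \<subseteq> letters m" and m: "0 < m"
  and \<Psi>: "dep m n \<Psi>" "\<And>s. valid s ==> \<Psi> s ==> tri s M g v e"
  and A: "A = {\<omega>\<in>space M0. \<Psi> (S \<omega>)}" and pos: "0 < measure M0 A"
 shows "haar (uniform_measure M0 A) M (\<lambda>\<omega>. derv (S \<omega>) g v)"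
 unfolding haar_def
proof (intro conjI ballI allI)
 interpret prob_space M0 using h by (simp add: haar_def)
 have vS: "valid (S \<omega>)" if "\<omega> \<in> space M0" for \<omega> using h that by (simp add: haar_def)
 have AS: "A \<in> sets M0" unfolding A by (rule haar_event(1)[OF h \<Psi>(1)])
 have em: "emeasure M0 A \<noteq> 0" "emeasure M0 A < \<infinity>" using pos by (auto simp: emeasure_eq_measure)
 show "prob_space (uniform_measure M0 A)" using em by (intro prob_space_uniform_measure) auto
 show "valid (derv (S \<omega>) g v)" if "\<omega> \<in> space (uniform_measure M0 A)" for \<omega>
  using that vS valid_derv by simp
 fix t c assume c: "c \<in> Cfg M t"
 let ?\<Phi> = "\<lambda>s. \<forall>p\<in>Ind M t. derv s g v p = c p"
 have eq: "restr M t s' = c \<longleftrightarrow> (\<forall>p\<in>Ind M t. s' p = c p)" for s'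
  using c by (auto simp: restr_def fun_eq_iff Cfg_def PiE_dflt_def)
 have dep\<Phi>: "dep m (n + t) ?\<Phi>"
 proof -
  have "whol (restr m (n + t) s) (g j) (v @ w) = whol s (g j) (v @ w)" if "valid s" "(j, w) \<in> Ind M t" for s j w
  proof (rule whol_restr[OF that(1), of _ "n + length w"])
   show "v @ w \<in> level d (n + length w)" using v that by (auto simp: level_iff Ind_iff)
  qed (use that g in \<open>auto simp: Ind_iff\<close>)
  then show ?thesis unfolding dep_def derv_def by fastforce
 qed
 have dep2: "dep m (n + t) (\<lambda>s. \<Psi> s \<and> ?\<Phi> s)"
  using dep\<Phi> dep_mono[OF \<Psi>(1), of "n + t"] unfolding dep_def by auto
 have ev: "{\<omega> \<in> space M0. restr M t (derv (S \<omega>) g v) = c} = {\<omega>\<in>space M0. ?\<Phi> (S \<omega>)}" unfolding eq ..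
 show meas: "{\<omega> \<in> space (uniform_measure M0 A). restr M t (derv (S \<omega>) g v) = c} \<in> sets (uniform_measure M0 A)"
  using haar_event(1)[OF h dep\<Phi>] by (simp add: ev)
 have "measure (uniform_measure M0 A) {\<omega> \<in> space M0. restr M t (derv (S \<omega>) g v) = c} =
   measure M0 (A \<inter> {\<omega>\<in>space M0. ?\<Phi> (S \<omega>)}) / measure M0 A"
  unfolding ev by (rule measure_uniform_measure) (use em haar_event(1)[OF h dep\<Phi>] in auto)
 also have "A \<inter> {\<omega>\<in>space M0. ?\<Phi> (S \<omega>)} = {\<omega>\<in>space M0. \<Psi> (S \<omega>) \<and> ?\<Phi> (S \<omega>)}" by (auto simp: A)
 also have "measure M0 \<dots> = EE m (n + t) (\<lambda>s. of_bool (\<Psi> s \<and> ?\<Phi> s))" by (rule haar_event(2)[OF h dep2])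
 also have "\<dots> = (1 / card H) ^ card (Ind M t) * EE m (n + t) (\<lambda>s. of_bool (\<Psi> s))"
  by (rule EE_tri[OF m v g \<Psi> valid_Cfg[OF c] subset_refl])
 also have "EE m (n + t) (\<lambda>s. of_bool (\<Psi> s)) = measure M0 A"
  unfolding A by (rule haar_event(2)[symmetric, OF h dep_mono[OF \<Psi>(1)]]) simp
 finally show "measure (uniform_measure M0 A) {\<omega> \<in> space (uniform_measure M0 A). restr M t (derv (S \<omega>) g v) = c} =
   1 / real (card (Cfg M t))"
  using pos by (simp add: card_Cfg power_divide)
qed

end

section \<open>Almost sure disappearance of short closed words\<close>

context letter_group
begin

lemma haar_prob_space: "haar M m S ==> prob_space M"
 by (simp add: haar_def)

lemma haar_valid: "haar M m S ==> \<omega> \<in> space M ==> valid (S \<omega>)"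
 by (simp add: haar_def)

lemma haar_girth:
 assumes h: "haar M m S"
 shows "AE \<omega> in M. \<forall>k. \<exists>n. girth_gt (stp (S \<omega>)) m (level d n) k"
proof -
 interpret prob_space M using h by (rule haar_prob_space)
 have "AE \<omega> in M. \<exists>n. girth_gt (stp (S \<omega>)) m (level d n) k" for k
 proof -
  let ?B = "\<lambda>n. {\<omega>\<in>space M. \<not> girth_gt (stp (S \<omega>)) m (level d n) k}"
  have dep: "dep m n (\<lambda>s. \<not> girth_gt (stp s) m (level d n) k)" for n
   using dep_girth[of n n m k] unfolding dep_def by blast
  have meas: "?B n \<in> sets M" for n by (rule haar_event(1)[OF h dep])
  have "(\<Inter>n. ?B n) \<in> sets M" using meas by blast
  moreover have "measure M (\<Inter>n. ?B n) \<le> \<epsilon>" if pos: "0 < \<epsilon>" for \<epsilon>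
  proof -
   obtain n where n: "EE m n (\<lambda>s. of_bool (\<not> girth_gt (stp s) m (level d n) k)) < \<epsilon>"
    using girth_lim[OF pos, of m k] by blast
   have "measure M (\<Inter>n. ?B n) \<le> measure M (?B n)" using meas by (intro finite_measure_mono) auto
   also have "\<dots> < \<epsilon>" using haar_event(2)[OF h dep, of n] n by simp
   finally show ?thesis by simp
  qed
  then have "measure M (\<Inter>n. ?B n) \<le> 0" by (rule field_le_epsilon[of _ 0, simplified])
  then have "measure M (\<Inter>n. ?B n) = 0" by (simp add: measure_le_0_iff)
  ultimately have "(\<Inter>n. ?B n) \<in> null_sets M" by (simp add: null_sets_def emeasure_eq_measure)
  then show ?thesis by (rule AE_I') auto
 qed
 then show ?thesis by (simp add: AE_all_countable)
qed

section \<open>Many independent Haar elements act transitively\<close>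

definition conn :: "nat \<Rightarrow> nat \<Rightarrow> config \<Rightarrow> bool" where
 "conn M n s \<longleftrightarrow> (\<forall>u\<in>level d n. \<forall>v\<in>level d n. \<exists>w. set w \<subseteq> letters M \<and> wks s w u = v)"

lemma dep_conn: "n \<le> N ==> dep M N (conn M n)"
 unfolding dep_def conn_def using wks_restr[of _ _ n N _ M] by (metis (no_types, lifting))

lemma conn_0: "conn M 0 s"
 by (auto simp: conn_def intro!: exI[of _ "[]"])

text \<open>Let \<open>k\<close> move a point of \<open>A\<close> out of \<open>A\<close>. Then
  \<open>h \<mapsto> h \<circ> k\<close> carries the elements that map \<open>A\<close> onto
  \<open>A'\<close> injectively to elements that do not.\<close>

lemma card_H_image:
 assumes A: "A \<subseteq> {..<d}" "A \<noteq> {}" "A \<noteq> {..<d}"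
 shows "real (card ({h. h ` A = A'} \<inter> H)) / card H \<le> 1 / 2"
proof -
 obtain x y where xy: "x \<in> A" "y < d" "y \<notin> A" using A by blast
 obtain k where k: "k \<in> H" "k x = y" using H_trans[of x y] xy A by blast
 let ?B = "{h. h ` A = A'} \<inter> H"
 have inj: "inj_on (\<lambda>h. h \<circ> k) ?B"
 proof (rule inj_onI)
  fix a b assume "a \<circ> k = b \<circ> k"
  then show "a = b" using bij_is_surj[OF H_bij[OF k(1)]] by (metis fun.inj_map_strong surj_fun_eq surjD comp_surj o_inv_distrib fun_eq_iff comp_apply)
 qed
 have "(\<lambda>h. h \<circ> k) ` ?B \<subseteq> H - ?B"
 proof safe
  fix h assume h: "h \<in> H"
  then show "h \<circ> k \<in> H" using k H_comp by simp
  assume "(h \<circ> k) ` A = h ` A"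
  then have "h (k x) \<in> h ` A" using xy by (metis comp_apply image_eqI)
  then have "k x \<in> A" using bij_is_inj[OF H_bij[OF h]] by (simp add: inj_image_mem_iff)
  then show False using k xy by simp
 qed
 then have "card ?B \<le> card (H - ?B)" using inj by (intro card_inj_on_le[of "\<lambda>h. h \<circ> k"]) auto
 moreover have "card (H - ?B) = card H - card ?B" by (intro card_Diff_subset) auto
 moreover have "card ?B \<le> card H" by (intro card_mono) auto
 ultimately have "2 * card ?B \<le> card H" by linarith
 then have "2 * real (card ?B) \<le> card H" by (metis of_nat_le_iff of_nat_mult of_nat_numeral)
 then show ?thesis using card_H_pos by (simp add: field_simps)
qed

text \<open>An orbit one level deeper meets the children of each vertex in a set of letters. These
  sets correspond under the labels, hence have equal size by transitivity on level \<open>n\<close>;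
  as the orbit is neither empty nor everything, no set is empty or full.\<close>

lemma not_conn_family:
 assumes s: "valid s" and c: "conn M n s" "\<not> conn M (Suc n) s"
 obtains A where "A \<in> level d n \<rightarrow>\<^sub>E (Pow {..<d} - {{}, {..<d}})"
  "\<And>i v. i < M ==> v \<in> level d n ==> s (i, v) ` A v = A (stp s (i, True) v)"
proof -
 from c(2) obtain u v where uv: "u \<in> level d (Suc n)" "v \<in> level d (Suc n)" "\<And>w. set w \<subseteq> letters M ==> wks s w u \<noteq> v"
  unfolding conn_def by blast
 define Os where "Os = {wks s w u | w. set w \<subseteq> letters M}"
 define A where "A = (\<lambda>y\<in>level d n. {x. x < d \<and> y @ [x] \<in> Os})"
 have step: "stp s l y \<in> Os" if "y \<in> Os" "l \<in> letters M" for y l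
 proof -
  obtain w where "y = wks s w u" "set w \<subseteq> letters M" using \<open>y \<in> Os\<close> by (auto simp: Os_def)
  then have "stp s l y = wks s (w @ [l]) u" "set (w @ [l]) \<subseteq> letters M" using that by auto
  then show ?thesis unfolding Os_def by blast
 qed
 have step': "stp s l y \<in> Os \<longleftrightarrow> y \<in> Os" if "l \<in> letters M" for y l
  using step[of y l] step[of "stp s l y" "linv l"] that sym_actD(2)[OF sym_act_stp[OF s] UNIV_I, of l y] by auto
 have wstep: "wks s w y \<in> Os \<longleftrightarrow> y \<in> Os" if "set w \<subseteq> letters M" for y w
  using that by (induction w arbitrary: y) (auto simp: step')
 have inv: "s (i, y) ` A y = A (stp s (i, True) y)" if iy: "i < M" "y \<in> level d n" for i y
 proof -
  have l: "(i, True) \<in> letters M" using iy by (simp add: letters_def)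
  have y': "stp s (i, True) y \<in> level d n" using stp_level[OF s] iy by blast
  have st: "stp s (i, True) (y @ [x]) = stp s (i, True) y @ [s (i, y) x]" for x
   by (simp add: stp_snoc lhol_def edg_def)
  have sH: "s (i, y) \<in> H" using s by (rule validD)
  have "s (i, y) x \<in> A (stp s (i, True) y) \<longleftrightarrow> x \<in> A y" for x
   using step'[OF l, of "y @ [x]"] y' iy sH by (simp add: A_def st)
  then show ?thesis using bij_is_surj[OF H_bij[OF sH]] by (auto simp: image_iff) (metis surjD)
 qed
 have sub: "A y \<subseteq> {..<d}" if "y \<in> level d n" for y using that by (auto simp: A_def)
 have card_eq: "card (A (wks s w y)) = card (A y)" if "set w \<subseteq> letters M" "y \<in> level d n" for w y
  using that
 proof (induction w arbitrary: y)
  case (Cons l w)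
  have l': "stp s l y \<in> level d n" using stp_level[OF s] Cons by blast
  have iM: "fst l < M" using Cons by (auto simp: letters_def)
  have "card (A (stp s l y)) = card (A y)"
  proof (cases "snd l")
   case True
   then have "l = (fst l, True)" by (simp add: prod_eq_iff)
   then have "A (stp s l y) = s (fst l, y) ` A y" using inv[OF iM Cons.prems(2)] by metis
   then show ?thesis using card_image[OF inj_on_subset[OF bij_is_inj[OF H_bij[OF validD[OF s]]] subset_UNIV]] by simp
  next
   case False
   then have "linv l = (fst l, True)" by (simp add: linv_def)
   then have "A y = s (fst l, stp s l y) ` A (stp s l y)" using inv[OF iM l'] sym_actD(2)[OF sym_act_stp[OF s] UNIV_I, of l y] by metis
   then show ?thesis using card_image[OF inj_on_subset[OF bij_is_inj[OF H_bij[OF validD[OF s]]] subset_UNIV]] by simp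
  qed
  then show ?case using Cons l' by simp
 qed simp
 obtain u0 x0 where u0: "u = u0 @ [x0]" "u0 \<in> level d n" "x0 < d" using uv(1) by (rule level_SucE)
 obtain v0 z0 where v0: "v = v0 @ [z0]" "v0 \<in> level d n" "z0 < d" using uv(2) by (rule level_SucE)
 have "u \<in> Os" unfolding Os_def by (auto intro!: exI[of _ "[]"])
 then have x0: "x0 \<in> A u0" using u0 by (simp add: A_def)
 have "v \<notin> Os" using uv(3) by (auto simp: Os_def)
 then have z0: "z0 \<notin> A v0" using v0 by (simp add: A_def)
 have finA: "finite (A y)" if "y \<in> level d n" for y using sub[OF that] finite_subset by blast
 have 1: "A y \<noteq> {}" if y: "y \<in> level d n" for y
 proof -
  obtain w where w: "set w \<subseteq> letters M" "wks s w y = u0" using c(1) y u0(2) unfolding conn_def by blast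
  then have "card (A y) = card (A u0)" using card_eq[OF w(1) y] by simp
  then show ?thesis using x0 finA[OF u0(2)] by (metis card_0_eq card.empty empty_iff)
 qed
 have 2: "A y \<noteq> {..<d}" if y: "y \<in> level d n" for y
 proof
  assume "A y = {..<d}"
  obtain w where w: "set w \<subseteq> letters M" "wks s w y = v0" using c(1) y v0(2) unfolding conn_def by blast
  then have "card (A v0) = card {..<d}" using card_eq[OF w(1) y] \<open>A y = {..<d}\<close> by simp
  then have "A v0 = {..<d}" using sub[OF v0(2)] by (intro card_subset_eq) auto
  then show False using z0 v0 by simp
 qed
 show thesis
 proof (rule that[OF _ inv])
  show "A \<in> level d n \<rightarrow>\<^sub>E (Pow {..<d} - {{}, {..<d}})"
   using sub 1 2 by (auto simp: A_def)
 qed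
qed

text \<open>Union bound: at most \<open>2 ^ d\<close> sets of letters at each vertex, and each of
  the \<open>M * d ^ n\<close> labels matches the sets at its two ends with probability at most one
  half.\<close>

lemma EE_not_conn:
 assumes "n < N"
 shows "EE M N (\<lambda>s. of_bool (conn M n s \<and> \<not> conn M (Suc n) s)) \<le> (2 ^ d) ^ (d ^ n) * (1 / 2) ^ (M * d ^ n)"
proof -
 let ?Fam = "level d n \<rightarrow>\<^sub>E (Pow {..<d} - {{}, {..<d}})"
 let ?J = "{..<M} \<times> level d n"
 define B where "B A s = (\<lambda>(i, v). {h. h ` A v = A (stp s (i, True) v)})" for A :: "nat list \<Rightarrow> nat set" and s
 have fin: "finite ?Fam" by (intro finite_PiE) auto
 have "EE M N (\<lambda>s. of_bool (conn M n s \<and> \<not> conn M (Suc n) s)) \<le> EE M N (\<lambda>s. \<Sum>A\<in>?Fam. 1 * of_bool (\<forall>q\<in>?J. s q \<in> B A s q))"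
 proof (rule EE_mono)
  fix s assume s: "s \<in> Cfg M N"
  show "of_bool (conn M n s \<and> \<not> conn M (Suc n) s) \<le> (\<Sum>A\<in>?Fam. 1 * of_bool (\<forall>q\<in>?J. s q \<in> B A s q) :: real)"
  proof (cases "conn M n s \<and> \<not> conn M (Suc n) s")
   case True
   then obtain A where A: "A \<in> ?Fam" "\<And>i v. i < M ==> v \<in> level d n ==> s (i, v) ` A v = A (stp s (i, True) v)"
    using not_conn_family[OF valid_Cfg[OF s]] by metis
   have le: "(1::real) * of_bool (\<forall>q\<in>?J. s q \<in> B A s q) \<le> (\<Sum>A\<in>?Fam. 1 * of_bool (\<forall>q\<in>?J. s q \<in> B A s q))"
    by (rule member_le_sum[OF A(1) _ fin]) simp
   have "\<forall>q\<in>?J. s q \<in> B A s q" using A(2) by (auto simp: B_def)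
   then have e: "(1::real) * of_bool (\<forall>q\<in>?J. s q \<in> B A s q) = 1" by simp
   have "(1::real) \<le> (\<Sum>A\<in>?Fam. 1 * of_bool (\<forall>q\<in>?J. s q \<in> B A s q))" using le unfolding e .
   then show ?thesis using True by (simp del: sum_of_bool_eq)
  next
   case False
   have "0 \<le> (\<Sum>A\<in>?Fam. 1 * of_bool (\<forall>q\<in>?J. s q \<in> B A s q) :: real)" by (rule sum_nonneg) simp
   moreover have "of_bool (conn M n s \<and> \<not> conn M (Suc n) s) = (0::real)"
    unfolding of_bool_eq_0_iff by (rule False)
   ultimately show ?thesis by (simp only:)
  qed
 qed
 also have "\<dots> = (\<Sum>A\<in>?Fam. EE M N (\<lambda>s. 1 * of_bool (\<forall>q\<in>?J. s q \<in> B A s q)))" by (rule EE_sum)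
 also have "\<dots> \<le> (\<Sum>A\<in>?Fam. (1 / 2) ^ (M * d ^ n))"
 proof (rule sum_mono)
  fix A assume A: "A \<in> ?Fam"
  have "EE M N (\<lambda>s. 1 * of_bool (\<forall>q\<in>?J. s q \<in> B A s q)) = EE M N (\<lambda>s. 1 * (\<Prod>q\<in>?J. real (card (B A s q \<inter> H)) / card H))"
  proof (rule EE_indep[where J = ?J])
   show "?J \<subseteq> Ind M N" using assms by (auto simp: Ind_def)
   fix s q h assume "q \<in> ?J"
   then have "length (snd q) = n" by (auto simp: level_iff)
   then have "B A (s(q := h)) (i, v) = B A s (i, v)" if "v \<in> level d n" for i v
    using that by (simp add: B_def stp_upd level_iff)
   \<comment> \<open>Off level \<open>n\<close> an extensional family has its default value. Since
     the action keeps lengths, resampling cannot change \<open>B\<close> there either.\<close>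
   moreover have "B A (s(q := h)) (i, v) = B A s (i, v)" if "v \<notin> level d n" for i v
   proof -
    have A0: "A v = undefined" using A that by auto
    show ?thesis
    proof (cases "length v = n")
     case True
     then show ?thesis using \<open>length (snd q) = n\<close> by (simp add: B_def stp_upd)
    next
     case False
     then have "A (stp (s(q := h)) (i, True) v) = undefined" "A (stp s (i, True) v) = undefined"
      using A by (auto simp: level_iff intro!: PiE_arb[OF A])
     then show ?thesis by (simp add: B_def)
    qed
   qed
   ultimately have "B A (s(q := h)) (i, v) = B A s (i, v)" for i v by blast
   then have "B A (s(q := h)) = B A s" by (intro ext) (metis prod.collapse)
   then show "?J = ?J \<and> B A (s(q := h)) = B A s \<and> (1::real) = 1" by blast
  qed auto
  also have "\<dots> \<le> EE M N (\<lambda>s. (1 / 2) ^ (M * d ^ n))"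
  proof (rule EE_mono)
   fix s
   have "(\<Prod>q\<in>?J. real (card (B A s q \<inter> H)) / card H) \<le> (\<Prod>q\<in>?J. 1 / 2)"
   proof (rule prod_mono)
    fix q assume "q \<in> ?J"
    then obtain i v where q: "q = (i, v)" "v \<in> level d n" by (cases q) auto
    have "A v \<in> Pow {..<d} - {{}, {..<d}}" by (rule PiE_mem[OF A q(2)])
    then have "A v \<subseteq> {..<d}" "A v \<noteq> {}" "A v \<noteq> {..<d}" by simp_all
    then have "real (card (B A s q \<inter> H)) / card H \<le> 1 / 2"
     unfolding B_def q(1) split_conv by (rule card_H_image)
    then show "0 \<le> real (card (B A s q \<inter> H)) / card H \<and> real (card (B A s q \<inter> H)) / card H \<le> 1 / 2" by simp
   qed
   then show "1 * (\<Prod>q\<in>?J. real (card (B A s q \<inter> H)) / card H) \<le> (1 / 2) ^ (M * d ^ n)"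
    by (simp add: card_cartesian_product)
  qed
  finally show "EE M N (\<lambda>s. 1 * of_bool (\<forall>q\<in>?J. s q \<in> B A s q)) \<le> (1 / 2) ^ (M * d ^ n)" by simp
 qed
 also have "\<dots> = real (card ?Fam) * (1 / 2) ^ (M * d ^ n)" by simp
 also have "\<dots> \<le> (2 ^ d) ^ (d ^ n) * (1 / 2) ^ (M * d ^ n)"
 proof (rule mult_right_mono)
  have "card (Pow {..<d} - {{}, {..<d}}) \<le> card (Pow {..<d})" by (intro card_mono) auto
  then have "card (Pow {..<d} - {{}, {..<d}}) \<le> 2 ^ d" by (simp add: card_Pow)
  then have "card ?Fam \<le> (2 ^ d) ^ (d ^ n)" by (simp add: card_PiE power_mono)
  then have "real (card ?Fam) \<le> real ((2 ^ d) ^ (d ^ n))" by (simp only: of_nat_le_iff)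
  then show "real (card ?Fam) \<le> (2 ^ d) ^ (d ^ n)" by simp
 qed simp
 finally show ?thesis .
qed

text \<open>Level \<open>n\<close> contributes at most \<open>(1 / 2) ^ ((M - d) * d ^ n)\<close>,
  and \<open>n < d ^ n\<close> bounds the sum over all levels by twice
  \<open>(1 / 2) ^ (M - d)\<close>.\<close>

lemma haar_conn:
 assumes h: "haar M0 M S" and M: "d < M"
 shows "{\<omega>\<in>space M0. \<not> (\<forall>n. conn M n (S \<omega>))} \<in> sets M0"
  "measure M0 {\<omega>\<in>space M0. \<not> (\<forall>n. conn M n (S \<omega>))} \<le> 2 * (1 / 2) ^ (M - d)"
proof -
 interpret prob_space M0 using h by (rule haar_prob_space)
 let ?A = "\<lambda>n. {\<omega>\<in>space M0. conn M n (S \<omega>) \<and> \<not> conn M (Suc n) (S \<omega>)}"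
 have dep: "dep M (Suc n) (\<lambda>s. conn M n s \<and> \<not> conn M (Suc n) s)" for n
  using dep_conn[of n "Suc n" M] dep_conn[of "Suc n" "Suc n" M] by (simp add: dep_def)
 have meas: "?A n \<in> sets M0" for n by (rule haar_event(1)[OF h dep])
 have eq: "{\<omega>\<in>space M0. \<not> (\<forall>n. conn M n (S \<omega>))} = (\<Union>n. ?A n)"
 proof -
  have *: "\<exists>n. conn M n s \<and> \<not> conn M (Suc n) s" if "\<not> conn M k s" for s k
   using that by (induction k) (auto simp: conn_0)
  have "(\<not> (\<forall>n. conn M n s)) \<longleftrightarrow> (\<exists>n. conn M n s \<and> \<not> conn M (Suc n) s)" for s
   using *[of _ s] by auto
  then show ?thesis by auto
 qed
 show "{\<omega>\<in>space M0. \<not> (\<forall>n. conn M n (S \<omega>))} \<in> sets M0" unfolding eq using meas by blast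
 have bd: "measure M0 (?A n) \<le> (1 / 2) ^ (M - d) * (1 / 2) ^ n" for n
 proof -
  have "measure M0 (?A n) = EE M (Suc n) (\<lambda>s. of_bool (conn M n s \<and> \<not> conn M (Suc n) s))"
   by (rule haar_event(2)[OF h dep])
  also have "\<dots> \<le> (2 ^ d) ^ (d ^ n) * (1 / 2) ^ (M * d ^ n)" by (rule EE_not_conn) simp
  also have "\<dots> = (1 / 2) ^ ((M - d) * d ^ n)"
  proof -
   have "(1 / 2 :: real) ^ (M * d ^ n) = (1 / 2) ^ ((M - d) * d ^ n) * (1 / 2) ^ (d * d ^ n)"
    using M by (simp add: power_add[symmetric] distrib_right[symmetric])
   moreover have "(2 ^ d :: real) ^ (d ^ n) * (1 / 2) ^ (d * d ^ n) = 1"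
    by (simp add: power_mult[symmetric] power_mult_distrib[symmetric])
   ultimately show ?thesis by simp
  qed
  also have "\<dots> \<le> (1 / 2) ^ ((M - d) + n)"
  proof (rule power_decreasing)
   have "n < d ^ n" using d2 by (intro power_gt_expt) auto
   then have "(M - d) * (n + 1) \<le> (M - d) * d ^ n" by (intro mult_le_mono) auto
   moreover have "n \<le> (M - d) * n" using M by (cases "M - d") auto
   ultimately show "M - d + n \<le> (M - d) * d ^ n" unfolding add_mult_distrib2 by linarith
  qed auto
  finally show ?thesis by (simp add: power_add)
 qed
 have sum: "(\<lambda>n. (1 / 2 :: real) ^ (M - d) * (1 / 2) ^ n) sums ((1 / 2) ^ (M - d) * 2)"
  using geometric_sums[of "1 / 2 :: real"] by (intro sums_mult) simp
 have sm: "summable (\<lambda>n. measure M0 (?A n))"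
  by (rule summable_comparison_test[OF _ sums_summable[OF sum]]) (use bd in auto)
 have "measure M0 (\<Union>n. ?A n) \<le> (\<Sum>n. measure M0 (?A n))"
  using meas sm by (intro finite_measure_subadditive_countably) auto
 also have "\<dots> \<le> (\<Sum>n. (1 / 2) ^ (M - d) * (1 / 2) ^ n)" by (intro suminf_le bd sm sums_summable[OF sum])
 also have "\<dots> = 2 * (1 / 2) ^ (M - d)" using sums_unique[OF sum] by simp
 finally show "measure M0 {\<omega>\<in>space M0. \<not> (\<forall>n. conn M n (S \<omega>))} \<le> 2 * (1 / 2) ^ (M - d)" unfolding eq .
qed

end

section \<open>Spectral gaps from edge boundaries\<close>

text \<open>Discrete coarea argument. Subtracting the least positive value \<open>c\<close> on the
  support lowers the left side by \<open>c\<close> times the size of the support and the right side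
  by \<open>c\<close> times its boundary.\<close>

lemma layer_cake:
 fixes g :: "'v \<Rightarrow> real"
 assumes fin: "finite V" "finite E" and g: "\<And>v. 0 \<le> g v"
  and ends: "\<And>e. e \<in> E ==> a e \<in> V \<and> b e \<in> V"
  and bd: "\<And>U. U \<subseteq> {v\<in>V. 0 < g v} ==> U \<noteq> {} ==> card U \<le> card {e\<in>E. (a e \<in> U) \<noteq> (b e \<in> U)}"
 shows "(\<Sum>v\<in>V. g v) \<le> (\<Sum>e\<in>E. \<bar>g (a e) - g (b e)\<bar>)"
 using g bd
proof (induction "card {v\<in>V. 0 < g v}" arbitrary: g rule: less_induct)
 case less
 let ?U = "{v\<in>V. 0 < g v}"
 show ?case
 proof (cases "?U = {}")
  case True
  then have "g v = 0" if "v \<in> V" for v using less.prems(1)[of v] that by force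
  then show ?thesis by (simp add: sum_nonneg)
 next
  case False
  define c where "c = Min (g ` ?U)"
  have "c \<in> g ` ?U" unfolding c_def using fin False by (intro Min_in) auto
  then obtain v0 where v0: "v0 \<in> ?U" "g v0 = c" by auto
  have c: "0 < c" "\<And>v. v \<in> ?U ==> c \<le> g v" using v0 fin by (auto simp: c_def)
  define g' where "g' v = (if v \<in> ?U then g v - c else 0)" for v
  have gg: "g v = g' v + c * of_bool (v \<in> ?U)" if "v \<in> V" for v
   using that less.prems(1)[of v] by (auto simp: g'_def)
  have sub: "{v\<in>V. 0 < g' v} \<subset> ?U" using v0 by (auto simp: g'_def)
  have "(\<Sum>v\<in>V. g' v) \<le> (\<Sum>e\<in>E. \<bar>g' (a e) - g' (b e)\<bar>)"
  proof (rule less.hyps)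
   show "card {v\<in>V. 0 < g' v} < card ?U" using fin by (intro psubset_card_mono sub) auto
   show "0 \<le> g' v" for v using c(2) by (auto simp: g'_def)
   show "card U \<le> card {e\<in>E. (a e \<in> U) \<noteq> (b e \<in> U)}" if "U \<subseteq> {v\<in>V. 0 < g' v}" "U \<noteq> {}" for U
    using less.prems(2)[of U] that sub by blast
  qed
  moreover have "c * card ?U \<le> c * card {e\<in>E. (a e \<in> ?U) \<noteq> (b e \<in> ?U)}"
   using less.prems(2)[OF subset_refl False] c by simp
  moreover have "(\<Sum>v\<in>V. g v) = (\<Sum>v\<in>V. g' v) + c * card ?U"
  proof -
   have "(\<Sum>v\<in>V. g v) = (\<Sum>v\<in>V. g' v + c * of_bool (v \<in> ?U))" by (intro sum.cong gg) auto
   also have "\<dots> = (\<Sum>v\<in>V. g' v) + c * card (V \<inter> {v. v \<in> ?U})"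
    using fin by (simp only: sum.distrib sum_distrib_left[symmetric] sum_of_bool_eq)
   also have "V \<inter> {v. v \<in> ?U} = ?U" by auto
   finally show ?thesis .
  qed
  moreover have "(\<Sum>e\<in>E. \<bar>g (a e) - g (b e)\<bar>) = (\<Sum>e\<in>E. \<bar>g' (a e) - g' (b e)\<bar>) + c * card {e\<in>E. (a e \<in> ?U) \<noteq> (b e \<in> ?U)}"
  proof -
   have "\<bar>g (a e) - g (b e)\<bar> = \<bar>g' (a e) - g' (b e)\<bar> + c * of_bool ((a e \<in> ?U) \<noteq> (b e \<in> ?U))" if "e \<in> E" for e
   proof -
    have "a e \<in> V" "b e \<in> V" using ends[OF that] by auto
    then show ?thesis using gg[of "a e"] gg[of "b e"] c by (auto simp: g'_def)
   qed
   then have "(\<Sum>e\<in>E. \<bar>g (a e) - g (b e)\<bar>) = (\<Sum>e\<in>E. \<bar>g' (a e) - g' (b e)\<bar> + c * of_bool ((a e \<in> ?U) \<noteq> (b e \<in> ?U)))"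
    by (intro sum.cong) auto
   also have "\<dots> = (\<Sum>e\<in>E. \<bar>g' (a e) - g' (b e)\<bar>) + c * card (E \<inter> {e. (a e \<in> ?U) \<noteq> (b e \<in> ?U)})"
    using fin by (simp only: sum.distrib sum_distrib_left[symmetric] sum_of_bool_eq)
   also have "E \<inter> {e. (a e \<in> ?U) \<noteq> (b e \<in> ?U)} = {e\<in>E. (a e \<in> ?U) \<noteq> (b e \<in> ?U)}" by auto
   finally show ?thesis .
  qed
  ultimately show ?thesis by linarith
 qed
qed

text \<open>Cheeger's inequality with a Dirichlet condition: apply the coarea bound to the square of
  \<open>f\<close>, factor the difference of squares, and use Cauchy-Schwarz. Isoperimetry is
  assumed for subsets of the support only, since later it will be available for sections and not for
  arbitrary sets.\<close>

lemma cheeger_support: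
 fixes f :: "'v \<Rightarrow> real"
 assumes fin: "finite V" "finite E" and f: "\<And>v. 0 \<le> f v"
  and ends: "\<And>e. e \<in> E ==> a e \<in> V \<and> b e \<in> V"
  and deg: "(\<Sum>e\<in>E. (f (a e))\<^sup>2) = D * (\<Sum>v\<in>V. (f v)\<^sup>2)" "(\<Sum>e\<in>E. (f (b e))\<^sup>2) = D * (\<Sum>v\<in>V. (f v)\<^sup>2)"
  and bd: "\<And>U. U \<subseteq> {v\<in>V. 0 < f v} ==> U \<noteq> {} ==> card U \<le> card {e\<in>E. (a e \<in> U) \<noteq> (b e \<in> U)}"
 shows "(\<Sum>v\<in>V. (f v)\<^sup>2) \<le> 4 * D * (\<Sum>e\<in>E. (f (a e) - f (b e))\<^sup>2)"
proof -
 define X where "X = (\<Sum>v\<in>V. (f v)\<^sup>2)"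
 define Y where "Y = (\<Sum>e\<in>E. (f (a e) - f (b e))\<^sup>2)"
 have "X \<le> (\<Sum>e\<in>E. \<bar>(f (a e))\<^sup>2 - (f (b e))\<^sup>2\<bar>)"
  unfolding X_def
 proof (rule layer_cake[OF fin])
  fix U assume "U \<subseteq> {v \<in> V. 0 < (f v)\<^sup>2}" "U \<noteq> {}"
  moreover have "{v \<in> V. 0 < (f v)\<^sup>2} = {v\<in>V. 0 < f v}" using f by (auto simp: less_eq_real_def)
  ultimately show "card U \<le> card {e\<in>E. (a e \<in> U) \<noteq> (b e \<in> U)}" using bd[of U] by simp
 qed (use ends in auto)
 also have "\<dots> = (\<Sum>e\<in>E. \<bar>f (a e) - f (b e)\<bar> * \<bar>f (a e) + f (b e)\<bar>)"
  by (intro sum.cong) (auto simp: abs_mult[symmetric] power2_eq_square algebra_simps)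
 finally have 1: "X \<le> (\<Sum>e\<in>E. \<bar>f (a e) - f (b e)\<bar> * \<bar>f (a e) + f (b e)\<bar>)" .
 have X0: "0 \<le> X" by (simp add: X_def sum_nonneg)
 have Y0: "0 \<le> Y" by (simp add: Y_def sum_nonneg)
 have "X\<^sup>2 \<le> (\<Sum>e\<in>E. \<bar>f (a e) - f (b e)\<bar> * \<bar>f (a e) + f (b e)\<bar>)\<^sup>2"
  using 1 X0 by (intro power_mono)
 also have "\<dots> \<le> (\<Sum>e\<in>E. \<bar>f (a e) - f (b e)\<bar>\<^sup>2) * (\<Sum>e\<in>E. \<bar>f (a e) + f (b e)\<bar>\<^sup>2)"
  by (rule Cauchy_Schwarz_ineq_sum)
 also have "\<dots> \<le> Y * (4 * D * X)"
 proof -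
  have "(\<Sum>e\<in>E. \<bar>f (a e) + f (b e)\<bar>\<^sup>2) \<le> (\<Sum>e\<in>E. 2 * (f (a e))\<^sup>2 + 2 * (f (b e))\<^sup>2)"
  proof (rule sum_mono)
   fix e
   have "0 \<le> (f (a e) - f (b e))\<^sup>2" by simp
   then show "\<bar>f (a e) + f (b e)\<bar>\<^sup>2 \<le> 2 * (f (a e))\<^sup>2 + 2 * (f (b e))\<^sup>2"
    by (simp add: power2_eq_square algebra_simps)
  qed
  also have "\<dots> = 4 * D * X" using deg by (simp add: sum.distrib sum_distrib_left[symmetric] X_def)
  finally have "(\<Sum>e\<in>E. \<bar>f (a e) + f (b e)\<bar>\<^sup>2) \<le> 4 * D * X" .
  then show ?thesis using Y0 unfolding Y_def by (simp add: mult_left_mono)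
 qed
 finally have "X * X \<le> (4 * D * Y) * X" by (simp add: power2_eq_square algebra_simps)
 then have "X \<le> 4 * D * Y \<or> X = 0" using X0 by (metis less_eq_real_def mult_le_cancel_right not_le)
 moreover have "0 \<le> 4 * D * Y" if "X = 0"
 proof -
  have "f v = 0" if "v \<in> V" for v using \<open>X = 0\<close> fin that unfolding X_def by (simp add: sum_nonneg_eq_0_iff)
  then have "Y = 0" unfolding Y_def using ends by (intro sum.neutral) auto
  then show ?thesis by simp
 qed
 ultimately show ?thesis unfolding X_def Y_def by auto
qed

section \<open>Counting connected sets\<close>

fun vis :: "(nat \<times> bool \<Rightarrow> 'v \<Rightarrow> 'v) \<Rightarrow> (nat \<times> bool) list \<Rightarrow> 'v \<Rightarrow> 'v set" where
 "vis st [] v = {v}"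
| "vis st (l # w) v = insert v (vis st w (st l v))"

lemma vis_append: "vis st (u @ w) v = vis st u v \<union> vis st w (wk st u v)"
proof (induction u arbitrary: v)
 case Nil
 show ?case by (cases w) auto
qed auto

lemma vis_split: "y \<in> vis st w v ==> \<exists>a b. w = a @ b \<and> wk st a v = y"
proof (induction w arbitrary: v)
 case (Cons l w)
 show ?case
 proof (cases "y = v")
  case True
  then show ?thesis by (intro exI[of _ "[]"] exI[of _ "l # w"]) simp
 next
  case False
  then have "y \<in> vis st w (st l v)" using Cons.prems by simp
  then obtain a b where "w = a @ b" "wk st a (st l v) = y" using Cons.IH by blast
  then show ?thesis by (intro exI[of _ "l # a"] exI[of _ b]) simp
 qed
qed simp

definition step_conn :: "(nat \<times> bool \<Rightarrow> 'v \<Rightarrow> 'v) \<Rightarrow> nat \<Rightarrow> 'v set \<Rightarrow> bool" where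
 "step_conn st m U \<longleftrightarrow> (\<forall>W. W \<subset> U \<and> W \<noteq> {} --> (\<exists>y\<in>W. \<exists>l\<in>letters m. st l y \<in> U - W))"

text \<open>A closed walk around a spanning tree, grown by inserting a detour to one new vertex and
  back. It has two letters per tree edge.\<close>

lemma conn_covering_word:
 assumes sym: "sym_act st V" and U: "finite U" "x \<in> U" "U \<subseteq> V" "step_conn st m U"
 shows "\<exists>w. set w \<subseteq> letters m \<and> length w = 2 * (card U - 1) \<and> vis st w x = U"
proof -
 have "\<exists>W w. W \<subseteq> U \<and> card W = Suc k \<and> set w \<subseteq> letters m \<and> length w = 2 * k \<and> vis st w x = W \<and> wk st w x = x"
  if "Suc k \<le> card U" for k
  using that
 proof (induction k)
  case 0
  then show ?case using U by (intro exI[of _ "{x}"] exI[of _ "[]"]) auto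
 next
  case (Suc k)
  then obtain W w where Ww: "W \<subseteq> U" "card W = Suc k" "set w \<subseteq> letters m" "length w = 2 * k" "vis st w x = W" "wk st w x = x"
   by auto
  then have "W \<subset> U" "W \<noteq> {}" using Suc.prems by auto
  then obtain y l where yl: "y \<in> W" "l \<in> letters m" "st l y \<in> U - W" using U(4) unfolding step_conn_def by blast
  obtain a b where ab: "w = a @ b" "wk st a x = y" using vis_split[of y st w x] yl Ww by blast
  have yV: "y \<in> V" using yl Ww U by blast
  have sl: "st (linv l) (st l y) = y" using sym_actD(2)[OF sym yV] .
  have "vis st (a @ l # linv l # b) x = insert (st l y) W"
  proof -
   have "y \<in> vis st b y" by (cases b) auto
   then show ?thesis using Ww(5) ab sl by (auto simp: vis_append)
  qed
  moreover have "wk st (a @ l # linv l # b) x = x" using Ww(6) ab sl by simp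
  moreover have "card (insert (st l y) W) = Suc (Suc k)" using yl Ww finite_subset[OF Ww(1) U(1)] by simp
  ultimately show ?case using Ww yl ab
   by (intro exI[of _ "insert (st l y) W"] exI[of _ "a @ l # linv l # b"]) auto
 qed
 moreover have "0 < card U" using U by (auto simp: card_gt_0_iff)
 ultimately obtain W w where "W \<subseteq> U" "card W = card U" "set w \<subseteq> letters m" "length w = 2 * (card U - 1)" "vis st w x = W"
  by (metis Suc_diff_1 le_refl)
 then show ?thesis using card_subset_eq[OF U(1)] by metis
qed

lemma card_conn_sets:
 assumes sym: "sym_act st V" and fin: "finite V"
 shows "card {U. U \<subseteq> V \<and> step_conn st m U \<and> card U = Suc k} \<le> card V * (2 * m) ^ (2 * k)"
proof -
 let ?W = "{w. set w \<subseteq> letters m \<and> length w = 2 * k}"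
 have fw: "finite ?W" "card ?W = (2 * m) ^ (2 * k)"
  using finite_lists_length_eq[of "letters m" "2 * k"] card_lists_length_eq[of "letters m" "2 * k"] by (auto simp: card_letters)
 have "{U. U \<subseteq> V \<and> step_conn st m U \<and> card U = Suc k} \<subseteq> (\<lambda>(x, w). vis st w x) ` (V \<times> ?W)"
 proof
  fix U assume "U \<in> {U. U \<subseteq> V \<and> step_conn st m U \<and> card U = Suc k}"
  then have U: "U \<subseteq> V" "step_conn st m U" "card U = Suc k" by auto
  then obtain x where "x \<in> U" by (metis card_eq_0_iff equals0I nat.distinct(1))
  moreover have "finite U" using U fin finite_subset by blast
  ultimately obtain w where "set w \<subseteq> letters m" "length w = 2 * k" "vis st w x = U"
   using conn_covering_word[OF sym _ _ U(1,2), of x] U(3) by auto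
  then show "U \<in> (\<lambda>(x, w). vis st w x) ` (V \<times> ?W)" using \<open>x \<in> U\<close> U(1) by (intro image_eqI[of _ _ "(x, w)"]) auto
 qed
 then have "card {U. U \<subseteq> V \<and> step_conn st m U \<and> card U = Suc k} \<le> card ((\<lambda>(x, w). vis st w x) ` (V \<times> ?W))"
  using fin fw by (intro card_mono) auto
 also have "\<dots> \<le> card (V \<times> ?W)" using fin fw by (intro card_image_le) auto
 finally show ?thesis by (simp add: card_cartesian_product fw)
qed

section \<open>Expansion of random binary towers\<close>

context letter_group
begin

definition bnd :: "nat \<Rightarrow> nat \<Rightarrow> config \<Rightarrow> nat list set \<Rightarrow> (nat \<times> nat list) set" where
 "bnd M n s A = {q\<in>{..<M} \<times> level d n. (snd q \<in> A) \<noteq> (stp s (fst q, True) (snd q) \<in> A)}"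

definition bad :: "nat \<Rightarrow> nat \<Rightarrow> config \<Rightarrow> nat list set \<Rightarrow> bool" where
 "bad M n s A \<longleftrightarrow> card (bnd M n s A) \<le> card A"

definition fib :: "nat list set \<Rightarrow> nat list \<Rightarrow> nat set" where
 "fib A v = {x. x < d \<and> v @ [x] \<in> A}"

definition fibs :: "nat \<Rightarrow> nat list set \<Rightarrow> nat \<Rightarrow> nat list set" where
 "fibs n A k = {v\<in>level d n. k \<le> card (fib A v)}"

lemma finite_bnd [simp]: "finite (bnd M n s A)"
 by (simp add: bnd_def)

lemma finite_fibs [simp]: "finite (fibs n A k)"
 by (simp add: fibs_def)

lemma finite_fib [simp]: "finite (fib A v)"
 by (simp add: fib_def)

lemma fib_le: "card (fib A v) \<le> d"
proof -
 have "card (fib A v) \<le> card {..<d}" by (rule card_mono) (auto simp: fib_def)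
 then show ?thesis by simp
qed

lemma fibs_mono: "k \<le> k' ==> fibs n A k' \<subseteq> fibs n A k"
 by (auto simp: fibs_def)

lemma fibs_1: "A \<subseteq> level d (Suc n) ==> fibs n A 1 = butlast ` A"
proof (intro equalityI subsetI)
 fix v assume v: "v \<in> fibs n A 1"
 then have "fib A v \<noteq> {}" by (auto simp: fibs_def)
 then obtain x where "v @ [x] \<in> A" by (auto simp: fib_def)
 then show "v \<in> butlast ` A" by (intro image_eqI[of _ _ "v @ [x]"]) simp_all
next
 fix v assume A: "A \<subseteq> level d (Suc n)" and "v \<in> butlast ` A"
 then obtain y where y: "y \<in> A" "v = butlast y" by blast
 then obtain u x where ux: "y = u @ [x]" "u \<in> level d n" "x < d" using A level_SucE by blast
 then have "x \<in> fib A v" using y by (simp add: fib_def)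
 then have "0 < card (fib A v)" using card_gt_0_iff finite_fib by blast
 then show "v \<in> fibs n A 1" using ux y by (simp add: fibs_def)
qed

lemma card_fibs:
 assumes d: "d = 2" and A: "A \<subseteq> level d (Suc n)"
 shows "card A = card (fibs n A 1) + card (fibs n A 2)"
proof -
 have "A = (\<Union>v\<in>level d n. (\<lambda>x. v @ [x]) ` fib A v)"
 proof (intro equalityI subsetI)
  fix y assume y: "y \<in> A"
  then obtain u x where "y = u @ [x]" "u \<in> level d n" "x < d" using A level_SucE by blast
  then show "y \<in> (\<Union>v\<in>level d n. (\<lambda>x. v @ [x]) ` fib A v)" using y by (auto simp: fib_def)
 qed (auto simp: fib_def)
 then have "card A = card (\<Union>v\<in>level d n. (\<lambda>x. v @ [x]) ` fib A v)" by simp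
 also have "\<dots> = (\<Sum>v\<in>level d n. card ((\<lambda>x. v @ [x]) ` fib A v))"
  by (intro card_UN_disjoint) auto
 also have "\<dots> = (\<Sum>v\<in>level d n. card (fib A v))"
  by (intro sum.cong card_image) (auto simp: inj_on_def)
 also have "\<dots> = (\<Sum>v\<in>level d n. of_bool (1 \<le> card (fib A v)) + of_bool (2 \<le> card (fib A v)))"
 proof (intro sum.cong refl)
  fix v show "card (fib A v) = of_bool (1 \<le> card (fib A v)) + of_bool (2 \<le> card (fib A v))"
   using fib_le[of A v] d by (cases "card (fib A v)" rule: nat.exhaust) auto
 qed
 also have "\<dots> = card (fibs n A 1) + card (fibs n A 2)"
  by (simp only: sum.distrib sum_of_bool_eq finite_level of_nat_id fibs_def Int_def mem_Collect_eq)
 finally show ?thesis .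
qed

text \<open>Frustrated edges: one child is occupied at each end, and the label does not carry one to
  the other. Each of them produces two boundary edges one level deeper.\<close>

definition frust :: "nat \<Rightarrow> nat \<Rightarrow> config \<Rightarrow> nat list set \<Rightarrow> (nat \<times> nat list) set" where
 "frust M n s A = {(i, v)\<in>{..<M} \<times> level d n. card (fib A v) = 1 \<and> card (fib A (stp s (i, True) v)) = 1 \<and>
   s (i, v) ` fib A v \<noteq> fib A (stp s (i, True) v)}"

text \<open>Subsets of a two-element set differ at least as much as their sizes do, and two distinct
  singletons differ in both elements.\<close>

lemma edge_count_two:
 fixes P Q :: "nat set"
 assumes "P \<subseteq> {..<2}" "Q \<subseteq> {..<2}"
 shows "of_bool ((1 \<le> card P) \<noteq> (1 \<le> card Q)) + of_bool ((2 \<le> card P) \<noteq> (2 \<le> card Q)) +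
   2 * of_bool (card P = 1 \<and> card Q = 1 \<and> P \<noteq> Q) \<le> card {x. x < 2 \<and> (x \<in> P) \<noteq> (x \<in> Q)}"
proof -
 have two: "{..<2} = {0, 1 :: nat}" by auto
 have *: "R = {} \<or> R = {0} \<or> R = {1} \<or> R = {0, 1}" if "R \<subseteq> {..<2}" for R :: "nat set"
  using that unfolding two by blast
 have x: "{x. x < (2::nat) \<and> (x \<in> P) \<noteq> (x \<in> Q)} = (P - Q) \<union> (Q - P)" using assms by auto
 show ?thesis unfolding x using *[OF assms(1)] *[OF assms(2)] by (elim disjE) simp_all
qed

text \<open>Pull the set of occupied children at the head of an edge back through the label and
  compare it with the one at the tail. The local count for two letters is then summed over the edges
  of level \<open>n\<close>.\<close>

lemma bnd_lift:
 assumes d: "d = 2" and s: "valid s" and A: "A \<subseteq> level d (Suc n)"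
 shows "card (bnd M n s (fibs n A 1)) + card (bnd M n s (fibs n A 2)) + 2 * card (frust M n s A) \<le> card (bnd M (Suc n) s A)"
proof -
 let ?J = "{..<M} \<times> level d n"
 let ?b = "\<lambda>q. stp s (fst q, True) (snd q)"
 define X where "X q = {x. x < d \<and> (snd q @ [x] \<in> A) \<noteq> (?b q @ [s q x] \<in> A)}" for q
 have b: "?b q \<in> level d n" if "q \<in> ?J" for q using that stp_level[OF s] by auto
 have "bnd M (Suc n) s A = (\<Union>q\<in>?J. (\<lambda>x. (fst q, snd q @ [x])) ` X q)"
 proof (intro equalityI subsetI)
  fix q assume "q \<in> bnd M (Suc n) s A"
  then obtain i y where q: "q = (i, y)" "i < M" "y \<in> level d (Suc n)" "(y \<in> A) \<noteq> (stp s (i, True) y \<in> A)"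
   by (cases q) (auto simp: bnd_def)
  then obtain v x where vx: "y = v @ [x]" "v \<in> level d n" "x < d" using level_SucE by blast
  then have "x \<in> X (i, v)" using q by (simp add: X_def stp_snoc lhol_def edg_def)
  then show "q \<in> (\<Union>q\<in>?J. (\<lambda>x. (fst q, snd q @ [x])) ` X q)" using q vx by force
 next
  fix q assume "q \<in> (\<Union>q\<in>?J. (\<lambda>x. (fst q, snd q @ [x])) ` X q)"
  then obtain i v x where "i < M" "v \<in> level d n" "x \<in> X (i, v)" "q = (i, v @ [x])" by auto
  then show "q \<in> bnd M (Suc n) s A" by (auto simp: X_def bnd_def stp_snoc lhol_def edg_def level_snoc)
 qed
 then have "card (bnd M (Suc n) s A) = card (\<Union>q\<in>?J. (\<lambda>x. (fst q, snd q @ [x])) ` X q)" by simp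
 also have "\<dots> = (\<Sum>q\<in>?J. card ((\<lambda>x. (fst q, snd q @ [x])) ` X q))"
  by (intro card_UN_disjoint) (auto simp: X_def)
 also have "\<dots> = (\<Sum>q\<in>?J. card (X q))"
  by (intro sum.cong card_image) (auto simp: inj_on_def)
 finally have bX: "card (bnd M (Suc n) s A) = (\<Sum>q\<in>?J. card (X q))" .
 have "card (bnd M n s (fibs n A 1)) + card (bnd M n s (fibs n A 2)) + 2 * card (frust M n s A) =
   (\<Sum>q\<in>?J. of_bool ((1 \<le> card (fib A (snd q))) \<noteq> (1 \<le> card (fib A (?b q)))) +
    of_bool ((2 \<le> card (fib A (snd q))) \<noteq> (2 \<le> card (fib A (?b q)))) +
    2 * of_bool (card (fib A (snd q)) = 1 \<and> card (fib A (?b q)) = 1 \<and> s q ` fib A (snd q) \<noteq> fib A (?b q)))"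
 proof -
  have 1: "bnd M n s (fibs n A k) = ?J \<inter> {q. (k \<le> card (fib A (snd q))) \<noteq> (k \<le> card (fib A (?b q)))}" for k
  proof (intro Set.set_eqI)
   fix q show "q \<in> bnd M n s (fibs n A k) \<longleftrightarrow> q \<in> ?J \<inter> {q. (k \<le> card (fib A (snd q))) \<noteq> (k \<le> card (fib A (?b q)))}"
    using b[of q] by (cases "q \<in> ?J") (auto simp add: bnd_def fibs_def mem_Times_iff)
  qed
  have 2: "frust M n s A = ?J \<inter> {q. card (fib A (snd q)) = 1 \<and> card (fib A (?b q)) = 1 \<and> s q ` fib A (snd q) \<noteq> fib A (?b q)}"
  proof (intro Set.set_eqI)
   fix q show "q \<in> frust M n s A \<longleftrightarrow> q \<in> ?J \<inter> {q. card (fib A (snd q)) = 1 \<and> card (fib A (?b q)) = 1 \<and> s q ` fib A (snd q) \<noteq> fib A (?b q)}"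
    by (cases q) (simp add: frust_def)
  qed
  have fJ: "finite ?J" by simp
  have 3: "card (?J \<inter> {q. P q}) = (\<Sum>q\<in>?J. of_bool (P q))" for P
   using sum_of_bool_eq[OF fJ, of P, where 'a = nat] by simp
  show ?thesis by (simp only: 1 2 3 sum.distrib sum_distrib_left)
 qed
 also have "\<dots> \<le> (\<Sum>q\<in>?J. card (X q))"
 proof (rule sum_mono)
  fix q assume q: "q \<in> ?J"
  have sH: "s q \<in> H" using s by (rule validD)
  have bij: "bij (s q)" using H_bij[OF sH] .
  define Q where "Q = {x. x < d \<and> s q x \<in> fib A (?b q)}"
  have sQ: "s q ` Q = fib A (?b q)"
  proof (intro equalityI subsetI)
   fix y assume y: "y \<in> fib A (?b q)"
   obtain x where "y = s q x" using surjD[OF bij_is_surj[OF bij], of y] by blast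
   then show "y \<in> s q ` Q" using y sH by (auto simp: Q_def fib_def)
  qed (auto simp: Q_def)
  have cQ: "card Q = card (fib A (?b q))"
   unfolding sQ[symmetric] by (rule card_image[symmetric]) (rule inj_on_subset[OF bij_is_inj[OF bij] subset_UNIV])
  have eqQ: "s q ` fib A (snd q) = fib A (?b q) \<longleftrightarrow> fib A (snd q) = Q"
   unfolding sQ[symmetric] by (rule inj_image_eq_iff[OF bij_is_inj[OF bij]])
  have "X q = {x. x < 2 \<and> (x \<in> fib A (snd q)) \<noteq> (x \<in> Q)}"
  proof -
   have "X q = {x. x < d \<and> (x \<in> fib A (snd q)) \<noteq> (x \<in> Q)}" using sH by (auto simp: X_def Q_def fib_def)
   moreover have "{x. x < d \<and> P x} = {x. x < 2 \<and> P x}" for P using d by simp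
   ultimately show ?thesis by simp
  qed
  moreover have "fib A (snd q) \<subseteq> {..<d}" "Q \<subseteq> {..<d}" by (auto simp: fib_def Q_def)
  moreover have "{..<d} = {..<2}" using d by simp
  ultimately show "of_bool ((1 \<le> card (fib A (snd q))) \<noteq> (1 \<le> card (fib A (?b q)))) +
    of_bool ((2 \<le> card (fib A (snd q))) \<noteq> (2 \<le> card (fib A (?b q)))) +
    2 * of_bool (card (fib A (snd q)) = 1 \<and> card (fib A (?b q)) = 1 \<and> s q ` fib A (snd q) \<noteq> fib A (?b q)) \<le> card (X q)"
   using edge_count_two[of "fib A (snd q)" Q] unfolding cQ eqQ by simp
 qed
 finally show ?thesis unfolding bX .
qed

text \<open>A bad subset of least size is connected: otherwise it falls into two pieces without
  edges between them, sizes and boundaries add up, and one of the pieces is bad already.\<close>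

lemma bad_conn_subset:
 assumes s: "valid s" and A: "A \<subseteq> level d n" "A \<noteq> {}" "bad M n s A"
 obtains B where "B \<subseteq> A" "B \<noteq> {}" "bad M n s B" "step_conn (stp s) M B"
proof -
 let ?P = "\<lambda>B. B \<subseteq> A \<and> B \<noteq> {} \<and> bad M n s B"
 have "?P A" using A by simp
 then obtain B where B: "?P B" "\<And>C. ?P C ==> card B \<le> card C"
  using ex_has_least_nat[of ?P A card] by metis
 have finB: "finite B" using B(1) A finite_subset[OF _ finite_level] by (meson subset_trans)
 have "step_conn (stp s) M B"
  unfolding step_conn_def
 proof (intro allI impI, rule ccontr)
  fix W assume W: "W \<subset> B \<and> W \<noteq> {}" and no: "\<not> (\<exists>y\<in>W. \<exists>l\<in>letters M. stp s l y \<in> B - W)"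
  have WB: "W \<subseteq> B" "W \<noteq> B" "W \<noteq> {}" using W by auto
  have BA: "B \<subseteq> A" using B(1) by simp
  have no2: "stp s l y \<notin> W" if "y \<in> B - W" "l \<in> letters M" for y l
  proof
   assume "stp s l y \<in> W"
   moreover have "stp s (linv l) (stp s l y) = y" using sym_actD(2)[OF sym_act_stp[OF s] UNIV_I] .
   ultimately show False using no that linv_letters[of l M] by (metis)
  qed
  have lM: "(fst q, True) \<in> letters M" if "q \<in> {..<M} \<times> level d n" for q :: "nat \<times> nat list"
   using that by (auto simp: letters_def)
  have "card (bnd M n s W) + card (bnd M n s (B - W)) \<le> card (bnd M n s B)"
  proof -
   have "q \<in> bnd M n s B" "q \<notin> bnd M n s (B - W)" if "q \<in> bnd M n s W" for q
   proof -
    have qJ: "q \<in> {..<M} \<times> level d n" using that unfolding bnd_def by blast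
    then show "q \<in> bnd M n s B" "q \<notin> bnd M n s (B - W)"
     using that no no2[of "snd q" "(fst q, True)"] lM[OF qJ] W unfolding bnd_def by blast+
   qed
   moreover have "q \<in> bnd M n s B" if "q \<in> bnd M n s (B - W)" for q
   proof -
    have qJ: "q \<in> {..<M} \<times> level d n" using that unfolding bnd_def by blast
    then show "q \<in> bnd M n s B"
     using that no no2[of "snd q" "(fst q, True)"] lM[OF qJ] W unfolding bnd_def by blast
   qed
   ultimately have "bnd M n s W \<union> bnd M n s (B - W) \<subseteq> bnd M n s B" "bnd M n s W \<inter> bnd M n s (B - W) = {}" by blast+
   then have "card (bnd M n s W \<union> bnd M n s (B - W)) \<le> card (bnd M n s B)" by (intro card_mono) auto
   then show ?thesis using card_Un_disjoint[of "bnd M n s W" "bnd M n s (B - W)"] \<open>bnd M n s W \<inter> _ = {}\<close> by simp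
  qed
  moreover have "card B = card W + card (B - W)"
   using W finB card_Diff_subset[of W B] card_mono[of B W] finite_subset[of W B] by auto
  moreover have "card (bnd M n s B) \<le> card B" using B(1) by (simp add: bad_def)
  ultimately consider "bad M n s W" | "bad M n s (B - W)" unfolding bad_def by linarith
  then show False
  proof cases
   case 1
   have "?P W" using 1 WB BA by (simp add: subset_trans[OF WB(1) BA])
   then have "card B \<le> card W" by (rule B(2))
   moreover have "card W < card B" using W finB by (intro psubset_card_mono) auto
   ultimately show False by simp
  next
   case 2
   have "B - W \<subseteq> A" using BA by auto
   moreover have "B - W \<noteq> {}" using WB by auto
   ultimately have "?P (B - W)" using 2 by simp
   then have "card B \<le> card (B - W)" by (rule B(2))
   moreover have "card (B - W) < card B" using WB finB by (intro psubset_card_mono) auto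
   ultimately show False by simp
  qed
 qed
 then show thesis using that[of B] B(1) by simp
qed

text \<open>A bad set of this kind has a connected projection over which at most half of the
  vertices carry both children. So it is close to a section, and its small boundary must come from
  an unlikely matching of labels.\<close>

definition Fail :: "nat \<Rightarrow> nat \<Rightarrow> config \<Rightarrow> bool" where
 "Fail M n s \<longleftrightarrow> (\<exists>A. A \<subseteq> level d (Suc n) \<and> A \<noteq> {} \<and> bad M (Suc n) s A \<and> step_conn (stp s) M (fibs n A 1) \<and>
   2 * card (fibs n A 2) \<le> card (fibs n A 1))"

text \<open>The lower bound on the size of bad sets pays for the \<open>2 ^ n\<close> possible
  starting points when connected sets are counted on level \<open>n\<close>.\<close>

definition Qual :: "nat \<Rightarrow> nat \<Rightarrow> config \<Rightarrow> bool" where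
 "Qual M n s \<longleftrightarrow> (\<forall>A. A \<subseteq> level d n --> A \<noteq> {} --> bad M n s A --> (3 / 2) ^ n \<le> real (card A))"

lemma step_conn_fibs:
 assumes s: "valid s" and A: "A \<subseteq> level d (Suc n)" "step_conn (stp s) M A"
 shows "step_conn (stp s) M (fibs n A 1)"
 unfolding fibs_1[OF A(1)] step_conn_def
proof (intro allI impI)
 fix W assume W: "W \<subset> butlast ` A \<and> W \<noteq> {}"
 define W' where "W' = {y\<in>A. butlast y \<in> W}"
 obtain z where z: "z \<in> A" "butlast z \<notin> W" using W by auto
 obtain z' where z': "z' \<in> A" "butlast z' \<in> W" using W by auto
 have "W' \<subset> A" "W' \<noteq> {}" using z z' by (auto simp: W'_def)
 then obtain y l where yl: "y \<in> W'" "l \<in> letters M" "stp s l y \<in> A - W'"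
  using A(2) unfolding step_conn_def by (meson conjI)
 then have y: "y \<in> A" "butlast y \<in> W" "stp s l y \<in> A" "butlast (stp s l y) \<notin> W" by (auto simp: W'_def)
 have "y \<noteq> []" using y(1) A(1) by (auto simp: level_iff)
 then have "butlast (stp s l y) = stp s l (butlast y)"
  using stp_snoc[of s l "butlast y" "last y"] by simp
 then have "stp s l (butlast y) \<in> butlast ` A - W" using y(3,4) by (metis DiffI imageI)
 then show "\<exists>y\<in>W. \<exists>l\<in>letters M. stp s l y \<in> butlast ` A - W" using y(2) yl(2) by (intro bexI)
qed

text \<open>Size is additive and boundary superadditive over the two projections, so a bad set has
  at least one bad projection; \<open>Qual\<close> then bounds the size of that one.\<close>

lemma fibs_bad:
 assumes d: "d = 2" and s: "valid s" and Q: "Qual M n s"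
  and A: "A \<subseteq> level d (Suc n)" "A \<noteq> {}" "bad M (Suc n) s A"
 shows "(fibs n A 2 \<noteq> {} \<and> (3 / 2) ^ n \<le> real (card (fibs n A 2))) \<or> (3 / 2) ^ n \<le> real (card (fibs n A 1))"
proof -
 have sub: "fibs n A k \<subseteq> level d n" for k by (auto simp: fibs_def)
 have ne: "fibs n A 1 \<noteq> {}" using fibs_1[OF A(1)] A(2) by simp
 have "card (bnd M n s (fibs n A 1)) + card (bnd M n s (fibs n A 2)) \<le> card (fibs n A 1) + card (fibs n A 2)"
  using bnd_lift[OF d s A(1), of M] A(3) card_fibs[OF d A(1)] unfolding bad_def by linarith
 then consider "bad M n s (fibs n A 1)" | "bad M n s (fibs n A 2)" "\<not> bad M n s (fibs n A 1)"
  unfolding bad_def by linarith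
 then show ?thesis
 proof cases
  case 1
  then show ?thesis using Q ne sub unfolding Qual_def by blast
 next
  case 2
  have "fibs n A 2 \<noteq> {}"
  proof
   assume "fibs n A 2 = {}"
   then show False using 2(2) \<open>card (bnd M n s (fibs n A 1)) + card (bnd M n s (fibs n A 2)) \<le> card (fibs n A 1) + card (fibs n A 2)\<close>
    unfolding bad_def by simp
  qed
  then show ?thesis using 2(1) Q sub unfolding Qual_def by blast
 qed
qed

text \<open>Origin of the factor \<open>3 / 2\<close>: pass to a connected bad subset
  \<open>A\<close>. Without \<open>Fail\<close>, more than half of the vertices below which
  \<open>A\<close> is nonempty carry both children, so \<open>A\<close> has more than
  \<open>3 / 2\<close> times the size of \<open>fibs n A 1\<close>; it has always at least twice the
  size of \<open>fibs n A 2\<close>. One of these two sets has size at least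
  \<open>(3 / 2) ^ n\<close>.\<close>

lemma Qual_Suc:
 assumes d: "d = 2" and s: "valid s" and Q: "Qual M n s" and nF: "\<not> Fail M n s"
 shows "Qual M (Suc n) s"
 unfolding Qual_def
proof (intro allI impI)
 fix A0 assume A0: "A0 \<subseteq> level d (Suc n)" "A0 \<noteq> {}" "bad M (Suc n) s A0"
 obtain A where A: "A \<subseteq> A0" "A \<noteq> {}" "bad M (Suc n) s A" "step_conn (stp s) M A"
  by (rule bad_conn_subset[OF s A0])
 have As: "A \<subseteq> level d (Suc n)" using A A0 by blast
 have "card (fibs n A 1) < 2 * card (fibs n A 2)"
  using nF As A step_conn_fibs[OF s As A(4)] unfolding Fail_def by (meson not_le)
 moreover have "card (fibs n A 2) \<le> card (fibs n A 1)" by (intro card_mono fibs_mono) auto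
 moreover have "(0::real) \<le> (3 / 2) ^ n" by simp
 ultimately have "(3 / 2) * (3 / 2) ^ n \<le> real (card (fibs n A 1)) + real (card (fibs n A 2))"
  using fibs_bad[OF d s Q As A(2,3)] by linarith
 then have "(3 / 2) ^ Suc n \<le> real (card A)" unfolding card_fibs[OF d As] by simp
 also have "\<dots> \<le> card A0" using A(1) finite_subset[OF A0(1) finite_level] by (simp add: card_mono)
 finally show "(3 / 2) ^ Suc n \<le> real (card A0)" .
qed

lemma Qual_0: "Qual M 0 s"
proof -
 have "1 \<le> real (card A)" if "A \<subseteq> level d 0" "A \<noteq> {}" for A
  using that by (metis Suc_leI card_gt_0_iff finite_level finite_subset of_nat_1 of_nat_le_iff One_nat_def)
 then show ?thesis by (simp add: Qual_def)
qed

text \<open>With at most one child occupied over each vertex, the size condition in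
  \<open>Fail\<close> is automatic, also for a connected bad subset. Its absence becomes an
  isoperimetric inequality for sections.\<close>

lemma no_bad_section:
 assumes s: "valid s" and nF: "\<not> Fail M n s"
  and A: "A \<subseteq> level d (Suc n)" "A \<noteq> {}" "fibs n A 2 = {}"
 shows "card A \<le> card (bnd M (Suc n) s A)"
proof (rule ccontr)
 assume "\<not> card A \<le> card (bnd M (Suc n) s A)"
 then have "bad M (Suc n) s A" by (simp add: bad_def)
 then obtain B where B: "B \<subseteq> A" "B \<noteq> {}" "bad M (Suc n) s B" "step_conn (stp s) M B"
  by (rule bad_conn_subset[OF s A(1,2)])
 have Bs: "B \<subseteq> level d (Suc n)" using A B by blast
 have "fibs n B 2 \<subseteq> fibs n A 2"
 proof
  fix v assume v: "v \<in> fibs n B 2"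
  have "card (fib B v) \<le> card (fib A v)" using B(1) by (intro card_mono) (auto simp: fib_def)
  then show "v \<in> fibs n A 2" using v by (auto simp: fibs_def)
 qed
 then have "fibs n B 2 = {}" using A by simp
 then show False using nF Bs B step_conn_fibs[OF s Bs B(4)] unfolding Fail_def by auto
qed

end

section \<open>From isoperimetry of sections to a spectral gap\<close>

context letter_group
begin

definition energy :: "nat \<Rightarrow> nat \<Rightarrow> config \<Rightarrow> (nat list \<Rightarrow> real) \<Rightarrow> real" where
 "energy M n s f = (\<Sum>q\<in>{..<M} \<times> level d n. (f (snd q) - f (stp s (fst q, True) (snd q)))\<^sup>2)"

text \<open>The constant is that of Cheeger's inequality for \<open>M\<close> generators and
  boundary ratio one; it does not depend on the level.\<close>

definition gap :: "nat \<Rightarrow> config \<Rightarrow> bool" where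
 "gap M s \<longleftrightarrow> (\<forall>n f. (\<Sum>v\<in>level d n. f v) = 0 --> (\<Sum>v\<in>level d n. (f v)\<^sup>2) \<le> 4 * real M * energy M n s f)"

lemma stp_bij_level: "valid s ==> bij_betw (stp s l) (level d n) (level d n)"
 by (rule bij_betw_byWitness[of _ "stp s (linv l)"])
   (simp_all add: sym_actD(2,3)[OF sym_act_stp] stp_level image_subset_iff)

lemma sum_level_Suc: "(\<Sum>y\<in>level d (Suc n). f y) = (\<Sum>v\<in>level d n. \<Sum>x<d. f (v @ [x]))"
proof -
 have "(\<Sum>y\<in>level d (Suc n). f y) = (\<Sum>p\<in>level d n \<times> {..<d}. f (fst p @ [snd p]))"
  unfolding level_Suc by (subst sum.reindex) (auto simp: inj_on_def o_def split_beta)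
 then show ?thesis by (subst sum.cartesian_product) (simp only: case_prod_unfold)
qed

text \<open>The support of \<open>f\<close> contains at most one child of each vertex, so all its
  subsets are sections.\<close>

lemma cheeger_level:
 assumes d: "d = 2" and s: "valid s" and nF: "\<not> Fail M n s" and f0: "\<And>v. 0 \<le> f v"
  and f: "\<And>v. v \<in> level d n ==> f (v @ [0]) = 0 \<or> f (v @ [1]) = 0"
 shows "(\<Sum>v\<in>level d (Suc n). (f v)\<^sup>2) \<le> 4 * real M * energy M (Suc n) s f"
 unfolding energy_def
proof (rule cheeger_support)
 let ?V = "level d (Suc n)"
 have fst_snd: "(\<Sum>q\<in>{..<M} \<times> ?V. h (fst q) (snd q)) = (\<Sum>i<M. \<Sum>v\<in>?V. h i v)" for h :: "nat \<Rightarrow> nat list \<Rightarrow> real"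
  by (subst sum.cartesian_product) (simp only: case_prod_unfold)
 show "(\<Sum>e\<in>{..<M} \<times> ?V. (f (snd e))\<^sup>2) = real M * (\<Sum>v\<in>?V. (f v)\<^sup>2)"
  using fst_snd[of "\<lambda>i v. (f v)\<^sup>2"] by simp
 have "(\<Sum>v\<in>?V. (f (stp s l v))\<^sup>2) = (\<Sum>v\<in>?V. (f v)\<^sup>2)" for l
  by (rule sum.reindex_bij_betw[OF stp_bij_level[OF s]])
 then show "(\<Sum>e\<in>{..<M} \<times> ?V. (f (stp s (fst e, True) (snd e)))\<^sup>2) = real M * (\<Sum>v\<in>?V. (f v)\<^sup>2)"
  using fst_snd[of "\<lambda>i v. (f (stp s (i, True) v))\<^sup>2"] by simp
 fix U assume U: "U \<subseteq> {v \<in> ?V. 0 < f v}" "U \<noteq> {}"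
 have "fibs n U 2 = {}"
 proof (rule ccontr)
  assume "fibs n U 2 \<noteq> {}"
  then obtain v where v: "v \<in> level d n" "2 \<le> card (fib U v)" by (auto simp: fibs_def)
  have sub: "fib U v \<subseteq> {..<d}" by (auto simp: fib_def)
  have "fib U v = {..<d}" using v(2) d by (intro card_subset_eq[OF _ sub] antisym card_mono[OF _ sub]) auto
  then have "0 \<in> fib U v" "1 \<in> fib U v" using d by auto
  then have "v @ [0] \<in> U" "v @ [1] \<in> U" by (auto simp: fib_def)
  then show False using f[OF v(1)] U by force
 qed
 then have "card U \<le> card (bnd M (Suc n) s U)" using U by (intro no_bad_section[OF s nF]) auto
 then show "card U \<le> card {e \<in> {..<M} \<times> ?V. (snd e \<in> U) \<noteq> (stp s (fst e, True) (snd e) \<in> U)}"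
  by (simp add: bnd_def)
qed (use f0 stp_level[OF s] in auto)

text \<open>The positive and the negative part each vanish on one of two siblings. Their energies
  add up to at most that of \<open>f\<close>, because the two parts have disjoint supports and
  nonnegative values.\<close>

lemma cheeger_odd:
 assumes d: "d = 2" and s: "valid s" and nF: "\<not> Fail M n s"
  and f: "\<And>v. v \<in> level d n ==> f (v @ [0]) = - f (v @ [1])"
 shows "(\<Sum>v\<in>level d (Suc n). (f v)\<^sup>2) \<le> 4 * real M * energy M (Suc n) s f"
proof -
 define p where "p v = max (f v) 0" for v
 define m where "m v = max (- f v) 0" for v
 have "(\<Sum>v\<in>level d (Suc n). (p v)\<^sup>2) \<le> 4 * real M * energy M (Suc n) s p"
  by (rule cheeger_level[OF d s nF]) (use f in \<open>auto simp: p_def max_def\<close>)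
 moreover have "(\<Sum>v\<in>level d (Suc n). (m v)\<^sup>2) \<le> 4 * real M * energy M (Suc n) s m"
  by (rule cheeger_level[OF d s nF]) (use f in \<open>auto simp: m_def max_def\<close>)
 moreover have "(f v)\<^sup>2 = (p v)\<^sup>2 + (m v)\<^sup>2" for v by (auto simp: p_def m_def max_def)
 moreover have "energy M (Suc n) s p + energy M (Suc n) s m \<le> energy M (Suc n) s f"
 proof -
  have "(p u - p v)\<^sup>2 + (m u - m v)\<^sup>2 \<le> (f u - f v)\<^sup>2" for u v
  proof -
   have fpm: "f z = p z - m z" for z by (auto simp: p_def m_def max_def)
   have pm0: "p z * m z = 0" "0 \<le> p z" "0 \<le> m z" for z by (auto simp: p_def m_def max_def)
   have "(f u - f v)\<^sup>2 = (p u - p v)\<^sup>2 + (m u - m v)\<^sup>2 + 2 * (p u * m v + p v * m u) - 2 * (p u * m u) - 2 * (p v * m v)"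
    unfolding fpm by (simp add: power2_eq_square algebra_simps)
   moreover have "0 \<le> p u * m v + p v * m u" using pm0 by simp
   ultimately show ?thesis using pm0 by simp
  qed
  then show ?thesis unfolding energy_def sum.distrib[symmetric] by (intro sum_mono)
 qed
 ultimately have "(\<Sum>v\<in>level d (Suc n). (f v)\<^sup>2) \<le> 4 * real M * (energy M (Suc n) s p + energy M (Suc n) s m)"
  by (simp add: sum.distrib distrib_left)
 also have "\<dots> \<le> 4 * real M * energy M (Suc n) s f"
  using \<open>energy M (Suc n) s p + _ \<le> _\<close> by (intro mult_left_mono) auto
 finally show ?thesis .
qed

text \<open>Write a function as the lift \<open>g\<close> of its averages over siblings plus a part
  \<open>k\<close> odd under exchanging siblings. A label on two letters is the identity or the
  exchange, so norms and energies both decouple. The gap on level \<open>n\<close> for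
  \<open>g\<close> and the inequality for odd functions add up with the same constant.\<close>

lemma gap_from_no_Fail:
 assumes d: "d = 2" and s: "valid s" and nF: "\<And>n. \<not> Fail M n s"
 shows "gap M s"
proof -
 have "(\<Sum>v\<in>level d n. (f v)\<^sup>2) \<le> 4 * real M * energy M n s f" if "(\<Sum>v\<in>level d n. f v) = 0" for n f
  using that
 proof (induction n arbitrary: f)
  case 0
  then show ?case by (simp add: energy_def sum_nonneg)
 next
  case (Suc n)
  define g where "g v = (f (v @ [0]) + f (v @ [1])) / 2" for v
  define k where "k y = (if last y = 0 then 1 else - 1) * ((f (butlast y @ [0]) - f (butlast y @ [1])) / 2)" for y
  have two: "(\<Sum>x<d. h x) = h 0 + h 1" for h :: "nat \<Rightarrow> real"
  proof -
   have "{..<d} = {0, 1}" using d by auto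
   then show ?thesis by simp
  qed
  have fk: "f (v @ [0]) = g v + k (v @ [0])" "f (v @ [1]) = g v - k (v @ [0])" "k (v @ [1]) = - k (v @ [0])" for v
   by (simp_all add: g_def k_def field_simps)
  have "(\<Sum>v\<in>level d n. g v) = 0"
  proof -
   have "2 * g v = f (v @ [0]) + f (v @ [1])" for v by (simp add: g_def)
   then have "(\<Sum>v\<in>level d n. 2 * g v) = 0" using Suc.prems unfolding sum_level_Suc two by simp
   then show ?thesis by (simp add: sum_distrib_left[symmetric])
  qed
  then have 1: "(\<Sum>v\<in>level d n. (g v)\<^sup>2) \<le> 4 * real M * energy M n s g" by (rule Suc.IH)
  have 2: "(\<Sum>v\<in>level d (Suc n). (k v)\<^sup>2) \<le> 4 * real M * energy M (Suc n) s k"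
   by (rule cheeger_odd[OF d s nF]) (simp only: fk(3) minus_minus)
  have n2: "(\<Sum>v\<in>level d (Suc n). (f v)\<^sup>2) = 2 * (\<Sum>v\<in>level d n. (g v)\<^sup>2) + (\<Sum>v\<in>level d (Suc n). (k v)\<^sup>2)"
   unfolding sum_level_Suc two fk sum_distrib_left sum.distrib[symmetric]
   by (intro sum.cong) (auto simp: power2_eq_square algebra_simps)
  have en: "energy M (Suc n) s h = (\<Sum>q\<in>{..<M} \<times> level d n. \<Sum>x<d. (h (snd q @ [x]) - h (stp s (fst q, True) (snd q) @ [s q x]))\<^sup>2)" for h
  proof -
   have cp: "(\<Sum>q\<in>{..<M} \<times> level d j. G (fst q) (snd q)) = (\<Sum>i<M. \<Sum>v\<in>level d j. G i v)" for j and G :: "nat \<Rightarrow> nat list \<Rightarrow> real"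
    by (subst sum.cartesian_product) (simp only: case_prod_unfold)
   have "energy M (Suc n) s h = (\<Sum>i<M. \<Sum>v\<in>level d n. \<Sum>x<d. (h (v @ [x]) - h (stp s (i, True) v @ [s (i, v) x]))\<^sup>2)"
    unfolding energy_def cp[of "\<lambda>i v. (h v - h (stp s (i, True) v))\<^sup>2" "Suc n"] sum_level_Suc
    by (simp add: stp_snoc lhol_def edg_def)
   also have "\<dots> = (\<Sum>q\<in>{..<M} \<times> level d n. \<Sum>x<d. (h (snd q @ [x]) - h (stp s (fst q, True) (snd q) @ [s (fst q, snd q) x]))\<^sup>2)"
    by (rule cp[of "\<lambda>i v. \<Sum>x<d. (h (v @ [x]) - h (stp s (i, True) v @ [s (i, v) x]))\<^sup>2" n, symmetric])
   finally show ?thesis by simp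
  qed
  have "energy M (Suc n) s f = 2 * energy M n s g + energy M (Suc n) s k"
   unfolding en unfolding energy_def sum_distrib_left sum.distrib[symmetric] two
  proof (rule sum.cong[OF refl])
   fix q assume "q \<in> {..<M} \<times> level d n"
   have sH: "s q \<in> H" using s by (rule validD)
   then have lt: "s q 0 < 2" "s q 1 < 2" using H_less[OF sH] d by auto
   have ne: "s q 0 \<noteq> s q 1" using bij_is_inj[OF H_bij[OF sH]] by (simp add: inj_eq)
   define v where "v = snd q"
   define v' where "v' = stp s (fst q, True) (snd q)"
   consider "s q 0 = 0" "s q 1 = 1" | "s q 0 = 1" "s q 1 = 0" using lt ne by linarith
   then show "(f (snd q @ [0]) - f (stp s (fst q, True) (snd q) @ [s q 0]))\<^sup>2 + (f (snd q @ [1]) - f (stp s (fst q, True) (snd q) @ [s q 1]))\<^sup>2 =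
    2 * (g (snd q) - g (stp s (fst q, True) (snd q)))\<^sup>2 + ((k (snd q @ [0]) - k (stp s (fst q, True) (snd q) @ [s q 0]))\<^sup>2 +
    (k (snd q @ [1]) - k (stp s (fst q, True) (snd q) @ [s q 1]))\<^sup>2)"
    unfolding v_def[symmetric] v'_def[symmetric]
    by cases (simp_all only: fk, simp_all add: power2_eq_square algebra_simps)
  qed
  then have "4 * real M * energy M (Suc n) s f = 2 * (4 * real M * energy M n s g) + 4 * real M * energy M (Suc n) s k"
   by (simp add: algebra_simps)
  then show ?case using 1 2 unfolding n2 by linarith
 qed
 then show ?thesis by (simp add: gap_def)
qed

section \<open>Probability that expansion fails to lift\<close>

lemma step_conn_upd:
 assumes "U \<subseteq> level d n" "length (snd q) = n"
 shows "step_conn (stp (s(q := h))) M U = step_conn (stp s) M U"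
proof -
 have "stp (s(q := h)) l y = stp s l y" if "y \<in> W" "W \<subset> U" for l y W
  using that assms by (intro stp_upd) (auto simp: level_iff)
 then show ?thesis unfolding step_conn_def by (metis (no_types, lifting))
qed

lemma bnd_upd: "length (snd q) = n ==> bnd M n (s(q := h)) A = bnd M n s A"
 unfolding bnd_def by (intro Collect_cong) (auto simp: stp_upd level_iff)

text \<open>The cost of one vertex of a connected set: \<open>(2 * M)^2\<close> for its share of the
  covering word, 3 for the nonempty sets of children over it, and
  \<open>2 * sqrt (3 / 4) ^ (M - 3)\<close> for badness.\<close>

definition kap :: "nat \<Rightarrow> real" where
 "kap M = 24 * (real M)\<^sup>2 * sqrt (3 / 4) ^ (M - 3)"

lemma card_fibs_eq:
 assumes d: "d = 2" and U: "U \<subseteq> level d n"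
 shows "card {A. A \<subseteq> level d (Suc n) \<and> fibs n A 1 = U} \<le> 3 ^ card U"
proof -
 let ?S = "{A. A \<subseteq> level d (Suc n) \<and> fibs n A 1 = U}"
 let ?T = "U \<rightarrow>\<^sub>E (Pow {..<d} - {{}})"
 have fU: "finite U" using U finite_subset[OF _ finite_level] by blast
 have "inj_on (\<lambda>A. \<lambda>v\<in>U. fib A v) ?S"
 proof (rule inj_onI)
  fix A B assume AB: "A \<in> ?S" "B \<in> ?S" "(\<lambda>v\<in>U. fib A v) = (\<lambda>v\<in>U. fib B v)"
  have sub: "A' \<subseteq> B'" if "A' \<in> ?S" "\<And>v. v \<in> U ==> fib A' v = fib B' v" for A' B'
  proof
   fix y assume y: "y \<in> A'"
   have A': "A' \<subseteq> level d (Suc n)" "fibs n A' 1 = U" using that(1) by simp_all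
   have "y \<in> level d (Suc n)" using A'(1) y by (rule subsetD)
   then obtain v x where vx: "y = v @ [x]" "v \<in> level d n" "x < d" by (rule level_SucE)
   have "butlast y \<in> butlast ` A'" using y by (rule imageI)
   then have "v \<in> U" using fibs_1[OF A'(1)] A'(2) vx(1) by simp
   moreover have "x \<in> fib A' v" using vx y by (simp add: fib_def)
   ultimately show "y \<in> B'" using that(2) vx by (auto simp: fib_def)
  qed
  have "fib A v = fib B v" if "v \<in> U" for v using fun_cong[OF AB(3), of v] that by simp
  then show "A = B" using sub[of A B] sub[of B A] AB by auto
 qed
 moreover have "(\<lambda>A. \<lambda>v\<in>U. fib A v) ` ?S \<subseteq> ?T"
 proof
  fix F assume "F \<in> (\<lambda>A. \<lambda>v\<in>U. fib A v) ` ?S"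
  then obtain A where A: "A \<subseteq> level d (Suc n)" "fibs n A 1 = U" "F = (\<lambda>v\<in>U. fib A v)" by auto
  have "fib A v \<in> Pow {..<d} - {{}}" if "v \<in> U" for v
  proof -
   have "1 \<le> card (fib A v)" using that A(2) by (auto simp: fibs_def)
   then have "fib A v \<noteq> {}" by (intro notI) simp
   moreover have "fib A v \<subseteq> {..<d}" by (auto simp: fib_def)
   ultimately show ?thesis by simp
  qed
  then show "F \<in> ?T" unfolding A(3) by (simp add: PiE_iff)
 qed
 moreover have "finite ?T" using fU by (intro finite_PiE) auto
 ultimately have "card ?S \<le> card ?T" by (rule card_inj_on_le)
 also have "card ?T = 3 ^ card U"
 proof -
  have "card (Pow {..<d} - {{}}) = 3" using d by (simp add: card_Diff_subset card_Pow)
  then show ?thesis using fU by (simp add: card_PiE)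
 qed
 finally show ?thesis .
qed

text \<open>Badness allows at most \<open>card (fibs n A 1)\<close> frustrated edges, so by an
  exponential Markov inequality its indicator is at most \<open>2 ^ card (fibs n A 1)\<close> times
  the product of a factor \<open>1 / 2\<close> per frustrated edge. A candidate edge is frustrated
  with probability one half and contributes \<open>3 / 4\<close> on average. Candidates abound: at
  least half of the vertices of \<open>fibs n A 1\<close> carry one child only, and of the edges
  leaving these all but \<open>card A\<close> lead to another such vertex. Hence twice their number
  is at least \<open>(M - 3) * card (fibs n A 1)\<close>.\<close>

lemma EE_bad_fixed:
 assumes d: "d = 2" and M: "3 \<le> M" and n: "n < N" and A: "A \<subseteq> level d (Suc n)"
  and V: "2 * card (fibs n A 2) \<le> card (fibs n A 1)"
 shows "EE M N (\<lambda>s. of_bool (step_conn (stp s) M (fibs n A 1) \<and> bad M (Suc n) s A)) \<le>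
  EE M N (\<lambda>s. of_bool (step_conn (stp s) M (fibs n A 1)) * (2 * sqrt (3 / 4) ^ (M - 3)) ^ card (fibs n A 1))"
proof -
 let ?J = "{..<M} \<times> level d n"
 let ?b = "\<lambda>s q. stp s (fst q, True) (snd q)"
 let ?U = "fibs n A 1" and ?V = "fibs n A 2"
 \<comment> \<open>The candidate edges. Whether an edge is one depends only on the action on level
   \<open>n\<close>, which labels at this level do not influence.\<close>
 define F where "F s = {q\<in>?J. card (fib A (snd q)) = 1 \<and> card (fib A (?b s q)) = 1}" for s
 define \<phi> where "\<phi> s q h = (if q \<in> ?J \<and> h ` fib A (snd q) \<noteq> fib A (?b s q) then 1 / 2 else (1::real))" for s :: config and q and h :: "nat \<Rightarrow> nat"
 define g where "g s = (of_bool (step_conn (stp s) M ?U \<and> card (bnd M n s ?U) + card (bnd M n s ?V) \<le> card A) :: real)" for s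
 have UV: "card A = card ?U + card ?V" by (rule card_fibs[OF d A])
 have Usub: "?U \<subseteq> level d n" by (auto simp: fibs_def)
 have FJ: "F s \<subseteq> ?J" for s by (auto simp: F_def)
 have fF: "finite (F s)" for s using finite_subset[OF FJ] by simp
 have upd: "F (s(q := h)) = F s \<and> \<phi> (s(q := h)) = \<phi> s \<and> g (s(q := h)) = g s" if q: "q \<in> ?J" for s q h
 proof -
  have len: "length (snd q) = n" using q by (auto simp: level_iff)
  have b: "?b (s(q := h)) p = ?b s p" if "p \<in> ?J" for p using that len by (intro stp_upd) (auto simp: level_iff)
  have "F (s(q := h)) = F s" unfolding F_def using b by (intro Collect_cong) auto
  moreover have "\<phi> (s(q := h)) p k = \<phi> s p k" for p k using b[of p] unfolding \<phi>_def by auto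
  then have "\<phi> (s(q := h)) = \<phi> s" by blast
  moreover have "g (s(q := h)) = g s" unfolding g_def bnd_upd[OF len] step_conn_upd[OF Usub len] ..
  ultimately show ?thesis by blast
 qed
 have "EE M N (\<lambda>s. of_bool (step_conn (stp s) M ?U \<and> bad M (Suc n) s A)) \<le>
   EE M N (\<lambda>s. 2 ^ card ?U * (g s * (\<Prod>q\<in>F s. \<phi> s q (s q))))"
 proof (rule EE_mono)
  fix s assume s: "s \<in> Cfg M N"
  show "of_bool (step_conn (stp s) M ?U \<and> bad M (Suc n) s A) \<le> 2 ^ card ?U * (g s * (\<Prod>q\<in>F s. \<phi> s q (s q)))"
  proof (cases "step_conn (stp s) M ?U \<and> bad M (Suc n) s A")
   case True
   have le: "card (bnd M n s ?U) + card (bnd M n s ?V) + 2 * card (frust M n s A) \<le> card A"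
    using bnd_lift[OF d valid_Cfg[OF s] A, of M] True unfolding bad_def by linarith
   then have g1: "g s = 1" using True by (simp add: g_def)
   have fr: "card (frust M n s A) \<le> card ?U" using le V UV by linarith
   have "(\<Prod>q\<in>F s. \<phi> s q (s q)) = (\<Prod>q\<in>F s. if q \<in> frust M n s A then 1 / 2 else 1)"
    by (intro prod.cong refl) (auto simp: \<phi>_def frust_def F_def)
   also have "\<dots> = (1 / 2) ^ card (F s \<inter> frust M n s A)" using fF by (simp add: prod.If_cases)
   also have "F s \<inter> frust M n s A = frust M n s A" by (auto simp: F_def frust_def)
   finally have pr: "(\<Prod>q\<in>F s. \<phi> s q (s q)) = (1 / 2) ^ card (frust M n s A)" .
   have "(1::real) = 2 ^ card ?U * (1 / 2) ^ card ?U" by (simp add: power_mult_distrib[symmetric])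
   also have "\<dots> \<le> 2 ^ card ?U * (1 / 2) ^ card (frust M n s A)"
    using fr by (intro mult_left_mono power_decreasing) auto
   finally show ?thesis using True g1 pr by simp
  next
   case False
   have "0 \<le> 2 ^ card ?U * (g s * (\<Prod>q\<in>F s. \<phi> s q (s q)))"
    by (intro mult_nonneg_nonneg prod_nonneg) (auto simp: g_def \<phi>_def)
   moreover have "of_bool (step_conn (stp s) M ?U \<and> bad M (Suc n) s A) = (0::real)"
    unfolding of_bool_eq_0_iff by (rule False)
   ultimately show ?thesis by (simp only:)
  qed
 qed
 also have "\<dots> = 2 ^ card ?U * EE M N (\<lambda>s. g s * (\<Prod>q\<in>F s. \<phi> s q (s q)))" by (rule EE_cmult)
 also have "EE M N (\<lambda>s. g s * (\<Prod>q\<in>F s. \<phi> s q (s q))) = EE M N (\<lambda>s. g s * (\<Prod>q\<in>F s. (\<Sum>h\<in>H. \<phi> s q h) / card H))"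
  by (rule EE_prod[of ?J]) (use FJ n upd in \<open>auto simp: Ind_def\<close>)
 also have "\<dots> = EE M N (\<lambda>s. g s * (3 / 4) ^ card (F s))"
 proof (rule EE_cong)
  fix s assume s: "s \<in> Cfg M N"
  have "(\<Sum>h\<in>H. \<phi> s q h) / card H = 3 / 4" if q: "q \<in> F s" for q
  proof -
   obtain x where x: "fib A (snd q) = {x}" using q by (auto simp: F_def card_1_singleton_iff)
   obtain y where y: "fib A (?b s q) = {y}" using q by (auto simp: F_def card_1_singleton_iff)
   have xy: "x < d" "y < d" using x y by (auto simp: fib_def)
   have "\<phi> s q h = 1 / 2 + 1 / 2 * of_bool (h x = y)" for h using q x y by (auto simp: \<phi>_def F_def)
   then have "(\<Sum>h\<in>H. \<phi> s q h) = card H / 2 + 1 / 2 * (\<Sum>h\<in>H. of_bool (h x = y))"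
    by (simp only: sum.distrib sum_distrib_left[symmetric] sum_constant)
   also have "(\<Sum>h\<in>H. of_bool (h x = y)) = real (card H) / 2"
    using card_H_point[OF xy] d by (simp add: sum_of_bool_eq Int_def)
   finally show ?thesis by simp
  qed
  then have "(\<Prod>q\<in>F s. (\<Sum>h\<in>H. \<phi> s q h) / card H) = (\<Prod>q\<in>F s. 3 / 4)" by (rule prod.cong[OF refl])
  then show "g s * (\<Prod>q\<in>F s. (\<Sum>h\<in>H. \<phi> s q h) / card H) = g s * (3 / 4) ^ card (F s)" by simp
 qed
 also have "2 ^ card ?U * \<dots> = EE M N (\<lambda>s. 2 ^ card ?U * (g s * (3 / 4) ^ card (F s)))" by (rule EE_cmult[symmetric])
 also have "\<dots> \<le> EE M N (\<lambda>s. of_bool (step_conn (stp s) M ?U) * (2 * sqrt (3 / 4) ^ (M - 3)) ^ card ?U)"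
 proof (rule EE_mono)
  fix s assume s: "s \<in> Cfg M N"
  show "2 ^ card ?U * (g s * (3 / 4) ^ card (F s)) \<le> of_bool (step_conn (stp s) M ?U) * (2 * sqrt (3 / 4) ^ (M - 3)) ^ card ?U"
  proof (cases "g s = 0")
   case False
   then have g: "g s = 1" "step_conn (stp s) M ?U" "card (bnd M n s ?U) + card (bnd M n s ?V) \<le> card A"
    by (auto simp: g_def split: if_splits)
   let ?A1 = "?U - ?V"
   have VU: "?V \<subseteq> ?U" by (rule fibs_mono) simp
   \<comment> \<open>An edge from a vertex with one occupied child either ends at another such
     vertex or lies on the boundary of one of the two projections.\<close>
   have "{q\<in>?J. snd q \<in> ?A1} \<subseteq> F s \<union> (bnd M n s ?U \<union> bnd M n s ?V)"
   proof
    fix q assume q: "q \<in> {q\<in>?J. snd q \<in> ?A1}"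
    then have bq: "?b s q \<in> level d n" using stp_level[OF valid_Cfg[OF s]] by auto
    show "q \<in> F s \<union> (bnd M n s ?U \<union> bnd M n s ?V)"
    proof (cases "?b s q \<in> ?A1")
     case True
     have "card (fib A v) = 1" if "v \<in> ?A1" for v using that by (auto simp: fibs_def)
     then show ?thesis using True q by (auto simp: F_def)
    next
     case False
     then show ?thesis using q VU unfolding bnd_def by blast
    qed
   qed
   then have "card {q\<in>?J. snd q \<in> ?A1} \<le> card (F s \<union> (bnd M n s ?U \<union> bnd M n s ?V))"
    using fF by (intro card_mono) auto
   also have "\<dots> \<le> card (F s) + (card (bnd M n s ?U) + card (bnd M n s ?V))"
    by (meson add_left_mono card_Un_le order_trans)
   also have "{q\<in>?J. snd q \<in> ?A1} = {..<M} \<times> ?A1" using Usub by auto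
   finally have "M * card ?A1 \<le> card (F s) + card A" using g(3) by (simp add: card_cartesian_product)
   moreover have "card ?A1 = card ?U - card ?V" using VU by (intro card_Diff_subset) auto
   ultimately have "M * (card ?U - card ?V) \<le> card (F s) + card A" by simp
   then have "2 * (M * (card ?U - card ?V)) \<le> 2 * card (F s) + 3 * card ?U" using UV V by linarith
   moreover have "M * card ?U \<le> M * (2 * (card ?U - card ?V))" using V by (intro mult_le_mono2) linarith
   ultimately have "M * card ?U \<le> 2 * card (F s) + 3 * card ?U" by (simp add: algebra_simps)
   then have cF: "(M - 3) * card ?U \<le> 2 * card (F s)" by (simp add: diff_mult_distrib)
   have "(3 / 4 :: real) ^ card (F s) = sqrt (3 / 4) ^ (2 * card (F s))" by (simp add: power_mult)
   also have "\<dots> \<le> sqrt (3 / 4) ^ ((M - 3) * card ?U)" using cF by (intro power_decreasing) auto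
   also have "\<dots> = (sqrt (3 / 4) ^ (M - 3)) ^ card ?U" by (rule power_mult)
   finally show ?thesis using g by (simp add: power_mult_distrib)
  qed simp
 qed
 finally show ?thesis .
qed

text \<open>Union bound over the connected projections \<open>U\<close> and over the sets above each
  of them. Because \<open>Qual\<close> forces \<open>U\<close> to have at least
  \<open>(n + 2) / 2\<close> vertices, geometric decay in the size of \<open>U\<close> becomes decay
  in \<open>n\<close>.\<close>

lemma EE_Fail:
 assumes d: "d = 2" and M: "3 \<le> M" and n: "n < N" and k: "kap M \<le> 1 / 64"
 shows "EE M N (\<lambda>s. of_bool (Qual M n s \<and> Fail M n s)) \<le> 2 * kap M * (1 / 2) ^ n"
proof -
 let ?L = "level d n"
 define c where "c = 2 * sqrt (3 / 4) ^ (M - 3)"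
 define \<A> where "\<A> = {A. A \<subseteq> level d (Suc n) \<and> n + 2 \<le> 2 * card (fibs n A 1) \<and> 2 * card (fibs n A 2) \<le> card (fibs n A 1)}"
 have fA: "finite \<A>" unfolding \<A>_def by (rule finite_subset[of _ "Pow (level d (Suc n))"]) auto
 have c0: "0 \<le> c" by (simp add: c_def)
 have kc: "kap M = (2 * real M)\<^sup>2 * (3 * c)" by (simp add: kap_def c_def power_mult_distrib)
 have k0: "0 \<le> kap M" by (simp add: kap_def)
 have "EE M N (\<lambda>s. of_bool (Qual M n s \<and> Fail M n s)) \<le>
   EE M N (\<lambda>s. \<Sum>A\<in>\<A>. of_bool (step_conn (stp s) M (fibs n A 1) \<and> bad M (Suc n) s A))"
 proof (rule EE_mono)
  fix s assume s: "s \<in> Cfg M N"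
  show "of_bool (Qual M n s \<and> Fail M n s) \<le> (\<Sum>A\<in>\<A>. of_bool (step_conn (stp s) M (fibs n A 1) \<and> bad M (Suc n) s A) :: real)"
  proof (cases "Qual M n s \<and> Fail M n s")
   case True
   then obtain A where A: "A \<subseteq> level d (Suc n)" "A \<noteq> {}" "bad M (Suc n) s A" "step_conn (stp s) M (fibs n A 1)"
    "2 * card (fibs n A 2) \<le> card (fibs n A 1)" unfolding Fail_def by auto
   have "(3 / 2) ^ n \<le> real (card (fibs n A 1))"
    using fibs_bad[OF d valid_Cfg[OF s] _ A(1-3)] True A(5) by auto
   \<comment> \<open>Only linear growth is kept from \<open>(3 / 2) ^ n\<close>; it suffices against
     costs that are geometric in \<open>card U\<close>.\<close>
   moreover have "1 + real n * (1 / 2) \<le> (1 + 1 / 2) ^ n" by (rule Bernoulli_inequality) simp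
   ultimately have "real (n + 2) \<le> real (2 * card (fibs n A 1))" by simp
   then have "n + 2 \<le> 2 * card (fibs n A 1)" by (simp only: of_nat_le_iff)
   then have "A \<in> \<A>" using A by (simp add: \<A>_def)
   then have "of_bool (step_conn (stp s) M (fibs n A 1) \<and> bad M (Suc n) s A) \<le>
     (\<Sum>A\<in>\<A>. of_bool (step_conn (stp s) M (fibs n A 1) \<and> bad M (Suc n) s A) :: real)"
    by (intro member_le_sum fA) auto
   then show ?thesis using A True by simp
  next
   case False
   have "of_bool (Qual M n s \<and> Fail M n s) = (0::real)" unfolding of_bool_eq_0_iff by (rule False)
   moreover have "(0::real) \<le> (\<Sum>A\<in>\<A>. of_bool (step_conn (stp s) M (fibs n A 1) \<and> bad M (Suc n) s A))"
    by (rule sum_nonneg) simp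
   ultimately show ?thesis by (simp only:)
  qed
 qed
 also have "\<dots> = (\<Sum>A\<in>\<A>. EE M N (\<lambda>s. of_bool (step_conn (stp s) M (fibs n A 1) \<and> bad M (Suc n) s A)))" by (rule EE_sum)
 also have "\<dots> \<le> (\<Sum>A\<in>\<A>. EE M N (\<lambda>s. of_bool (step_conn (stp s) M (fibs n A 1)) * c ^ card (fibs n A 1)))"
  unfolding c_def by (intro sum_mono EE_bad_fixed[OF d M n]) (auto simp: \<A>_def)
 also have "\<dots> = EE M N (\<lambda>s. \<Sum>A\<in>\<A>. of_bool (step_conn (stp s) M (fibs n A 1)) * c ^ card (fibs n A 1))" by (rule EE_sum[symmetric])
 also have "\<dots> \<le> EE M N (\<lambda>s. 2 * kap M * (1 / 2) ^ n)"
 proof (rule EE_mono)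
  fix s assume s: "s \<in> Cfg M N"
  define P where "P U \<longleftrightarrow> U \<subseteq> ?L \<and> step_conn (stp s) M U \<and> n + 2 \<le> 2 * card U" for U
  have fP: "finite {U. P U}" by (rule finite_subset[of _ "Pow ?L"]) (auto simp: P_def)
  have "(\<Sum>A\<in>\<A>. of_bool (step_conn (stp s) M (fibs n A 1)) * c ^ card (fibs n A 1)) =
    (\<Sum>A\<in>{A\<in>\<A>. P (fibs n A 1)}. c ^ card (fibs n A 1))"
  proof -
   have "of_bool (step_conn (stp s) M (fibs n A 1)) * c ^ card (fibs n A 1) = (if P (fibs n A 1) then c ^ card (fibs n A 1) else 0)" if "A \<in> \<A>" for A
    using that by (auto simp: P_def \<A>_def fibs_def)
   then have "(\<Sum>A\<in>\<A>. of_bool (step_conn (stp s) M (fibs n A 1)) * c ^ card (fibs n A 1)) =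
     (\<Sum>A\<in>\<A>. if P (fibs n A 1) then c ^ card (fibs n A 1) else 0)" by (rule sum.cong[OF refl])
   also have "\<dots> = (\<Sum>A\<in>{A\<in>\<A>. P (fibs n A 1)}. c ^ card (fibs n A 1))" by (rule sum.inter_filter[OF fA, symmetric])
   finally show ?thesis .
  qed
  also have "\<dots> = (\<Sum>U\<in>{U. P U}. \<Sum>A\<in>{A\<in>{A\<in>\<A>. P (fibs n A 1)}. fibs n A 1 = U}. c ^ card (fibs n A 1))"
   by (rule sum.group[symmetric]) (use fA fP in auto)
  also have "\<dots> \<le> (\<Sum>U\<in>{U. P U}. (3 * c) ^ card U)"
  proof (rule sum_mono)
   fix U assume "U \<in> {U. P U}"
   then have U: "U \<subseteq> ?L" by (simp add: P_def)
   let ?S = "{A\<in>{A\<in>\<A>. P (fibs n A 1)}. fibs n A 1 = U}"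
   have "card ?S \<le> card {A. A \<subseteq> level d (Suc n) \<and> fibs n A 1 = U}"
    by (rule card_mono) (auto simp: \<A>_def intro: finite_subset[of _ "Pow (level d (Suc n))"])
   then have "card ?S \<le> 3 ^ card U" using card_fibs_eq[OF d U] by linarith
   then have cS: "real (card ?S) \<le> 3 ^ card U" using of_nat_mono[where ?'a = real] by fastforce
   have "(\<Sum>A\<in>?S. c ^ card (fibs n A 1)) = (\<Sum>A\<in>?S. c ^ card U)" by (rule sum.cong) auto
   also have "\<dots> = real (card ?S) * c ^ card U" by simp
   also have "\<dots> \<le> 3 ^ card U * c ^ card U" using cS c0 by (intro mult_right_mono) auto
   finally show "(\<Sum>A\<in>?S. c ^ card (fibs n A 1)) \<le> (3 * c) ^ card U" by (simp add: power_mult_distrib)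
  qed
  also have "\<dots> = (\<Sum>i<2 ^ n. \<Sum>U\<in>{U\<in>{U. P U}. card U - 1 = i}. (3 * c) ^ card U)"
  proof (rule sum.group[symmetric])
   show "(\<lambda>U. card U - 1) ` {U. P U} \<subseteq> {..<2 ^ n}"
   proof clarsimp
    fix U assume "P U"
    then have "U \<subseteq> ?L" "1 \<le> card U" by (auto simp: P_def)
    then have "1 \<le> card U" "card U \<le> 2 ^ n" using card_mono[of ?L U] d by auto
    then show "card U - Suc 0 < 2 ^ n" by linarith
   qed
  qed (use fP in auto)
  also have "\<dots> \<le> (\<Sum>i<2 ^ n. kap M * (1 / 2) ^ n * (1 / 4) ^ i)"
  proof (rule sum_mono)
   fix i assume "i \<in> {..<(2::nat) ^ n}"
   let ?S = "{U\<in>{U. P U}. card U - 1 = i}"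
   have pos: "0 \<le> kap M * (1 / 2) ^ n * (1 / 4) ^ i" using k0 by simp
   show "(\<Sum>U\<in>?S. (3 * c) ^ card U) \<le> kap M * (1 / 2) ^ n * (1 / 4) ^ i"
   proof (cases "n \<le> 2 * i")
    case False
    have "?S = {}" using False by (auto simp: P_def)
    then show ?thesis using pos by (simp only: sum.empty)
   next
    case True
    have cU: "card U = Suc i" if "U \<in> ?S" for U using that by (auto simp: P_def)
    have "card ?S \<le> card {U. U \<subseteq> ?L \<and> step_conn (stp s) M U \<and> card U = Suc i}"
     by (rule card_mono) (use cU in \<open>auto simp: P_def intro: finite_subset[of _ "Pow ?L"]\<close>)
    also have "\<dots> \<le> card ?L * (2 * M) ^ (2 * i)" by (rule card_conn_sets[OF sym_act_level[OF valid_Cfg[OF s]]]) simp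
    finally have "card ?S \<le> 2 ^ n * (2 * M) ^ (2 * i)" using d by simp
    then have "real (card ?S) \<le> real (2 ^ n * (2 * M) ^ (2 * i))" by (simp only: of_nat_le_iff)
    then have cS: "real (card ?S) \<le> 2 ^ n * (2 * real M) ^ (2 * i)" by simp
    have "(\<Sum>U\<in>?S. (3 * c) ^ card U) = (\<Sum>U\<in>?S. (3 * c) ^ Suc i)" using cU by (intro sum.cong) auto
    also have "\<dots> = real (card ?S) * (3 * c) ^ Suc i" by simp
    also have "\<dots> \<le> (2 ^ n * (2 * real M) ^ (2 * i)) * (3 * c) ^ Suc i" using cS c0 by (intro mult_right_mono) auto
    \<comment> \<open>A covering word has only \<open>2 * i\<close> letters for \<open>Suc i\<close>
      vertices; the missing factor is inserted to reach a full power of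
      \<open>kap M\<close>.\<close>
    also have "\<dots> \<le> 2 ^ n * (2 * real M) ^ (2 * i) * (3 * c) ^ Suc i * (2 * real M)\<^sup>2"
    proof -
     have "0 \<le> 2 ^ n * (2 * real M) ^ (2 * i) * (3 * c) ^ Suc i" using c0 by simp
     moreover have "1 \<le> (2 * real M)\<^sup>2" using M by (intro one_le_power) simp
     ultimately show ?thesis using mult_left_mono[of 1 "(2 * real M)\<^sup>2" "2 ^ n * (2 * real M) ^ (2 * i) * (3 * c) ^ Suc i"] by simp
    qed
    also have "\<dots> = 2 ^ n * kap M ^ Suc i" unfolding kc power_mult_distrib power_mult[symmetric] by (simp add: power_mult power_add power_mult_distrib power2_eq_square mult_ac)
    also have "\<dots> = 2 ^ n * kap M * kap M ^ i" by simp
    also have "\<dots> \<le> 2 ^ n * kap M * (1 / 64) ^ i" using k k0 by (intro mult_left_mono power_mono) auto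
    \<comment> \<open>Why the threshold is \<open>1 / 64\<close>: since
      \<open>n \<le> 2 * i\<close>, the part \<open>(1 / 4) ^ (2 * i)\<close> pays for the
      \<open>2 ^ n\<close> base points and leaves \<open>(1 / 2) ^ n\<close>, and
      \<open>(1 / 4) ^ i\<close> makes the sum over the sizes converge.\<close>
    also have "(1 / 64 :: real) ^ i = (1 / 4) ^ (2 * i) * (1 / 4) ^ i" by (simp only: power_mult power_mult_distrib[symmetric]) (simp add: power2_eq_square)
    also have "2 ^ n * kap M * ((1 / 4) ^ (2 * i) * (1 / 4) ^ i) \<le> 2 ^ n * kap M * ((1 / 4) ^ n * (1 / 4) ^ i)"
     using True k0 by (intro mult_left_mono mult_right_mono power_decreasing) auto
    also have "\<dots> = kap M * (2 * (1 / 4)) ^ n * (1 / 4) ^ i" unfolding power_mult_distrib by (simp only: mult_ac)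
    finally show ?thesis by simp
   qed
  qed
  also have "\<dots> = kap M * (1 / 2) ^ n * (\<Sum>i<2 ^ n. (1 / 4) ^ i)" by (rule sum_distrib_left[symmetric])
  also have "\<dots> \<le> kap M * (1 / 2) ^ n * 2"
  proof (rule mult_left_mono)
   have "(\<Sum>i<2 ^ n. (1 / 4 :: real) ^ i) = ((1 / 4) ^ (2 ^ n) - 1) / (1 / 4 - 1)" by (rule geometric_sum) simp
   moreover have "(x - 1) / (1 / 4 - 1) \<le> 4 / 3" if "0 \<le> x" for x :: real using that by (simp add: field_simps)
   ultimately have "(\<Sum>i<2 ^ n. (1 / 4 :: real) ^ i) \<le> 4 / 3" by simp
   then show "(\<Sum>i<2 ^ n. (1 / 4 :: real) ^ i) \<le> 2" by linarith
  qed (use k0 in simp)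
  finally show "(\<Sum>A\<in>\<A>. of_bool (step_conn (stp s) M (fibs n A 1)) * c ^ card (fibs n A 1)) \<le> 2 * kap M * (1 / 2) ^ n"
   by (simp add: mult_ac)
 qed
 finally show ?thesis by simp
qed

lemma bnd_restr:
 assumes "valid s" "n \<le> N"
 shows "bnd M n (restr M N s) A = bnd M n s A"
proof -
 have "stp (restr M N s) (i, True) v = stp s (i, True) v" if "i < M" "v \<in> level d n" for i v
  using that assms by (intro stp_restr) (auto simp: letters_def)
 then show ?thesis unfolding bnd_def by auto
qed

lemma step_conn_restr:
 assumes "valid s" "n \<le> N" "U \<subseteq> level d n"
 shows "step_conn (stp (restr M N s)) M U = step_conn (stp s) M U"
proof -
 have eq: "stp (restr M N s) l y = stp s l y" if "y \<in> W" "l \<in> letters M" "W \<subset> U" for l y W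
  using that assms by (intro stp_restr) auto
 have "(\<exists>y\<in>W. \<exists>l\<in>letters M. stp (restr M N s) l y \<in> U - W) = (\<exists>y\<in>W. \<exists>l\<in>letters M. stp s l y \<in> U - W)" if "W \<subset> U" for W
  using eq[OF _ _ that] by (intro bex_cong refl) simp
 then show ?thesis unfolding step_conn_def by auto
qed

lemma dep_Qual_Fail: "dep M (Suc n) (\<lambda>s. Qual M n s \<and> Fail M n s)"
 unfolding dep_def
proof (intro allI impI)
 fix s assume s: "valid s"
 have "bad M n (restr M (Suc n) s) A = bad M n s A" "bad M (Suc n) (restr M (Suc n) s) A = bad M (Suc n) s A" for A
  unfolding bad_def using bnd_restr[OF s] by simp_all
 moreover have "step_conn (stp (restr M (Suc n) s)) M (fibs n A 1) = step_conn (stp s) M (fibs n A 1)" for A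
  by (rule step_conn_restr[OF s, of n]) (auto simp: fibs_def)
 ultimately show "(Qual M n (restr M (Suc n) s) \<and> Fail M n (restr M (Suc n) s)) = (Qual M n s \<and> Fail M n s)"
  unfolding Qual_def Fail_def by simp
qed

text \<open>As long as \<open>Qual\<close> and \<open>Fail\<close> never hold on the same level,
  \<open>Qual\<close> propagates from level 0 and \<open>Fail\<close> does not occur. The factor 64
  makes the bound trivial when \<open>kap M\<close> exceeds the threshold.\<close>

lemma haar_Fail:
 assumes d: "d = 2" and h: "haar M0 M S" and M: "3 \<le> M"
 obtains A where "A \<in> sets M0" "{\<omega>\<in>space M0. \<exists>n. Fail M n (S \<omega>)} \<subseteq> A" "measure M0 A \<le> 64 * kap M"
proof (cases "kap M \<le> 1 / 64")
 case False
 interpret prob_space M0 by (rule haar_prob_space[OF h])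
 have "measure M0 (space M0) \<le> 64 * kap M" using False prob_le_1[of "space M0"] by linarith
 then show ?thesis by (intro that[of "space M0"]) auto
next
 case True
 interpret prob_space M0 by (rule haar_prob_space[OF h])
 let ?B = "\<lambda>n. {\<omega>\<in>space M0. Qual M n (S \<omega>) \<and> Fail M n (S \<omega>)}"
 have k0: "0 \<le> kap M" by (simp add: kap_def)
 have meas: "?B n \<in> sets M0" for n by (rule haar_event(1)[OF h dep_Qual_Fail])
 have le: "measure M0 (?B n) \<le> 2 * kap M * (1 / 2) ^ n" for n
  using haar_event(2)[OF h dep_Qual_Fail[of M n]] EE_Fail[OF d M lessI True, of n] by simp
 have sm: "summable (\<lambda>n. 2 * kap M * (1 / 2 :: real) ^ n)" by (intro summable_mult summable_geometric) simp
 have sm': "summable (\<lambda>n. measure M0 (?B n))" by (rule summable_comparison_test'[OF sm, of 0]) (use le in simp)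
 have "measure M0 (\<Union>n. ?B n) \<le> (\<Sum>n. measure M0 (?B n))"
  by (rule finite_measure_subadditive_countably[OF _ sm']) (use meas in auto)
 also have "\<dots> \<le> (\<Sum>n. 2 * kap M * (1 / 2 :: real) ^ n)" by (rule suminf_le[OF le sm' sm])
 also have "\<dots> = 4 * kap M" by (simp add: suminf_mult suminf_geometric)
 also have "\<dots> \<le> 64 * kap M" using k0 by simp
 finally have "measure M0 (\<Union>n. ?B n) \<le> 64 * kap M" .
 moreover have "{\<omega>\<in>space M0. \<exists>n. Fail M n (S \<omega>)} \<subseteq> (\<Union>n. ?B n)"
 proof
  fix \<omega> assume "\<omega> \<in> {\<omega>\<in>space M0. \<exists>n. Fail M n (S \<omega>)}"
  then obtain n where n: "\<omega> \<in> space M0" "Fail M n (S \<omega>)" by auto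
  have "Qual M n (S \<omega>) \<or> \<omega> \<in> (\<Union>n. ?B n)" for n
  proof (induction n)
   case (Suc n)
   then show ?case using Qual_Suc[OF d haar_valid[OF h n(1)], of M n] n(1) by auto
  qed (simp add: Qual_0)
  then show "\<omega> \<in> (\<Union>n. ?B n)" using n by auto
 qed
 ultimately show ?thesis using meas by (intro that[of "\<Union>n. ?B n"]) auto
qed

section \<open>Transitivity and gap together, with a geometric error bound\<close>

definition Good :: "nat \<Rightarrow> config \<Rightarrow> bool" where
 "Good M s \<longleftrightarrow> (\<forall>n. conn M n s) \<and> (d = 2 --> gap M s)"

definition \<epsilon>good :: "nat \<Rightarrow> real" where
 "\<epsilon>good M = 2 * (1 / 2) ^ (M - d) + 64 * kap M"

lemma haar_Good:
 assumes h: "haar M0 M S" and M: "d < M"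
 obtains A where "A \<in> sets M0" "{\<omega>\<in>space M0. \<not> Good M (S \<omega>)} \<subseteq> A" "measure M0 A \<le> \<epsilon>good M"
proof -
 interpret prob_space M0 by (rule haar_prob_space[OF h])
 have k0: "0 \<le> kap M" by (simp add: kap_def)
 define B where "B = {\<omega>\<in>space M0. \<not> (\<forall>n. conn M n (S \<omega>))}"
 have B: "B \<in> sets M0" "measure M0 B \<le> 2 * (1 / 2) ^ (M - d)" using haar_conn[OF h M] by (simp_all add: B_def)
 show thesis
 proof (cases "d = 2")
  case False
  have "measure M0 B \<le> \<epsilon>good M" using B(2) k0 by (simp add: \<epsilon>good_def)
  moreover have "{\<omega>\<in>space M0. \<not> Good M (S \<omega>)} \<subseteq> B" using False by (auto simp: Good_def B_def)
  ultimately show ?thesis by (intro that[OF B(1)])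
 next
  case True
  obtain A where A: "A \<in> sets M0" "{\<omega>\<in>space M0. \<exists>n. Fail M n (S \<omega>)} \<subseteq> A" "measure M0 A \<le> 64 * kap M"
   using haar_Fail[OF True h] M True by auto
  have "{\<omega>\<in>space M0. \<not> Good M (S \<omega>)} \<subseteq> B \<union> A"
  proof
   fix \<omega> assume w: "\<omega> \<in> {\<omega>\<in>space M0. \<not> Good M (S \<omega>)}"
   then have sp: "\<omega> \<in> space M0" by simp
   show "\<omega> \<in> B \<union> A"
   proof (cases "\<exists>n. Fail M n (S \<omega>)")
    case False
    then have "gap M (S \<omega>)" using sp by (intro gap_from_no_Fail[OF True haar_valid[OF h]]) auto
    then show ?thesis using w unfolding Good_def B_def by blast
   qed (use A(2) sp in blast)
  qed
  moreover have "measure M0 (B \<union> A) \<le> \<epsilon>good M"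
   using measure_Un_le[OF B(1) A(1)] B(2) A(3) by (simp add: \<epsilon>good_def)
  ultimately show ?thesis using A(1) B(1) by (intro that[of "B \<union> A"]) auto
 qed
qed

text \<open>The error is at most \<open>C * \<rho> ^ M\<close>, where \<open>\<rho>\<close> is
  slightly larger than the square root of \<open>3 / 4\<close>: two factors \<open>95 / 100\<close>
  are split off to absorb the square of \<open>M\<close> in \<open>kap\<close>. Then
  \<open>R\<close> is chosen with \<open>real d * \<rho> ^ R\<close> below one half.\<close>

lemma \<epsilon>good_decay: "\<exists>R\<ge>1. \<forall>R'\<ge>R. (\<lambda>k. real d ^ k * \<epsilon>good (R' * k)) \<longlonglongrightarrow> 0"
proof -
 define \<theta> :: real where "\<theta> = sqrt (3 / 4)"
 define \<rho> where "\<rho> = \<theta> / (95 / 100)\<^sup>2"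
 have \<theta>: "0 < \<theta>" "\<theta> \<le> 87 / 100" "1 / 2 \<le> \<theta>"
 proof -
  show "0 < \<theta>" by (simp add: \<theta>_def)
  show "\<theta> \<le> 87 / 100" unfolding \<theta>_def by (rule real_le_lsqrt) (simp_all add: power2_eq_square)
  show "1 / 2 \<le> \<theta>" unfolding \<theta>_def by (rule real_le_rsqrt) (simp add: power2_eq_square)
 qed
 have \<rho>: "0 < \<rho>" "\<rho> < 1" "1 / 2 \<le> \<rho>" using \<theta> by (auto simp: \<rho>_def power2_eq_square)
 have "(\<lambda>n. real n * (95 / 100) ^ n) \<longlonglongrightarrow> 0" by (rule powser_times_n_limit_0) simp
 then have "Bseq (\<lambda>n. real n * (95 / 100) ^ n)" by (intro convergent_imp_Bseq) (auto simp: convergent_def)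
 then obtain K where K: "0 < K" "\<And>n. norm (real n * (95 / 100) ^ n) \<le> K" unfolding Bseq_def by auto
 define C where "C = 2 * 2 ^ d + 64 * 24 * K\<^sup>2 / \<theta> ^ 3"
 have kapM: "kap M \<le> 24 * K\<^sup>2 / \<theta> ^ 3 * \<rho> ^ M" for M
 proof -
  have "\<theta> ^ 3 * \<theta> ^ (M - 3) \<le> \<theta> ^ M" unfolding power_add[symmetric] using \<theta> by (intro power_decreasing) auto
  then have "\<theta> ^ (M - 3) \<le> \<theta> ^ M / \<theta> ^ 3" using \<theta> by (simp add: field_simps)
  then have "kap M \<le> 24 * (real M)\<^sup>2 * (\<theta> ^ M / \<theta> ^ 3)" unfolding kap_def \<theta>_def[symmetric] by (intro mult_left_mono) auto
  also have "\<theta> = (95 / 100)\<^sup>2 * \<rho>" by (simp add: \<rho>_def)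
  then have "\<theta> ^ M = ((95 / 100) ^ M)\<^sup>2 * \<rho> ^ M" by (simp only: power_mult_distrib power_mult[symmetric] mult.commute)
  also have "24 * (real M)\<^sup>2 * (((95 / 100) ^ M)\<^sup>2 * \<rho> ^ M / \<theta> ^ 3) = 24 / \<theta> ^ 3 * \<rho> ^ M * (real M * (95 / 100) ^ M)\<^sup>2"
   by (simp only: power_mult_distrib) (simp add: field_simps)
  also have "\<dots> \<le> 24 / \<theta> ^ 3 * \<rho> ^ M * K\<^sup>2" using K(2)[of M] \<theta> \<rho> by (intro mult_left_mono power_mono) auto
  finally show ?thesis by (simp add: mult_ac)
 qed
 have \<epsilon>: "\<epsilon>good M \<le> C * \<rho> ^ M" for M
 proof -
  have "(1 / 2 :: real) ^ d * (1 / 2) ^ (M - d) \<le> (1 / 2) ^ M" unfolding power_add[symmetric] by (intro power_decreasing) auto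
  then have "(1 / 2 :: real) ^ (M - d) \<le> 2 ^ d * (1 / 2) ^ M" by (simp add: field_simps)
  also have "\<dots> \<le> 2 ^ d * \<rho> ^ M" using \<rho> by (intro mult_left_mono power_mono) auto
  finally have "2 * (1 / 2 :: real) ^ (M - d) \<le> 2 * 2 ^ d * \<rho> ^ M" by simp
  moreover have "64 * kap M \<le> 64 * (24 * K\<^sup>2 / \<theta> ^ 3 * \<rho> ^ M)" by (intro mult_left_mono kapM) simp
  ultimately have "\<epsilon>good M \<le> 2 * 2 ^ d * \<rho> ^ M + 64 * (24 * K\<^sup>2 / \<theta> ^ 3 * \<rho> ^ M)" by (simp add: \<epsilon>good_def)
  also have "\<dots> = C * \<rho> ^ M" unfolding C_def by (simp only: distrib_right times_divide_eq_right mult.assoc)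
  finally show ?thesis .
 qed
 have \<epsilon>0: "0 \<le> \<epsilon>good M" for M by (simp add: \<epsilon>good_def kap_def)
 obtain R where R: "\<rho> ^ R < 1 / (2 * real d)" using real_arch_pow_inv[of "1 / (2 * real d)" \<rho>] \<rho> d2 by auto
 have R1: "1 \<le> R" using R d2 by (cases R) (auto simp: field_simps)
 have "(\<lambda>k. real d ^ k * \<epsilon>good (R' * k)) \<longlonglongrightarrow> 0" if R': "R \<le> R'" for R'
 proof -
  have "\<rho> ^ R' \<le> \<rho> ^ R" using R' \<rho> by (intro power_decreasing) auto
  then have "\<rho> ^ R' < 1 / (2 * real d)" using R by linarith
  then have "real d * \<rho> ^ R' < 1" using d2 by (simp add: field_simps)
  moreover have "0 \<le> real d * \<rho> ^ R'" using \<rho> by simp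
  ultimately have "(\<lambda>k. C * (real d * \<rho> ^ R') ^ k) \<longlonglongrightarrow> C * 0" by (intro tendsto_mult tendsto_const LIMSEQ_power_zero) simp
  then have lim: "(\<lambda>k. C * (real d * \<rho> ^ R') ^ k) \<longlonglongrightarrow> 0" by simp
  have "real d ^ k * \<epsilon>good (R' * k) \<le> C * (real d * \<rho> ^ R') ^ k" for k
  proof -
   have "real d ^ k * \<epsilon>good (R' * k) \<le> real d ^ k * (C * \<rho> ^ (R' * k))" using \<epsilon> by (intro mult_left_mono) auto
   then show ?thesis by (simp add: power_mult_distrib power_mult mult_ac)
  qed
  then have up: "\<forall>\<^sub>F k in sequentially. real d ^ k * \<epsilon>good (R' * k) \<le> C * (real d * \<rho> ^ R') ^ k" by simp
  have lo: "\<forall>\<^sub>F k in sequentially. 0 \<le> real d ^ k * \<epsilon>good (R' * k)" using \<epsilon>0 by simp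
  show ?thesis by (rule tendsto_sandwich[OF lo up tendsto_const lim])
 qed
 then show ?thesis using R1 by auto
qed

end

section \<open>Finite graphs of rank at least two\<close>

declare split_paired_All [simp del] split_paired_Ex [simp del]

lemma tr_letters: "set (tr st w v) \<subseteq> {..<m} \<times> V ==> set w \<subseteq> letters m"
 by (induction w arbitrary: v) (auto simp: edg_def letters_def mem_Times_iff)

definition drt :: "(nat \<times> bool \<Rightarrow> 'v \<Rightarrow> 'v) \<Rightarrow> (nat \<times> 'v) set \<Rightarrow> 'v \<Rightarrow> (nat \<times> bool) set" where
 "drt st E v = {l. edg st l v \<in> E}"

text \<open>A finite connected graph of rank at least two: one edge less than the number of vertices
  would give a tree, an equal number a single cycle with trees attached.\<close>

definition core :: "(nat \<times> bool \<Rightarrow> 'v \<Rightarrow> 'v) \<Rightarrow> nat \<Rightarrow> 'v set \<Rightarrow> (nat \<times> 'v) set \<Rightarrow> bool" where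
 "core st m V E \<longleftrightarrow> finite V \<and> V \<noteq> {} \<and> E \<subseteq> {..<m} \<times> V \<and> (\<forall>v\<in>V. \<forall>l. edg st l v \<in> E --> st l v \<in> V) \<and>
   (\<forall>W. W \<subset> V --> W \<noteq> {} --> (\<exists>v\<in>W. \<exists>l. edg st l v \<in> E \<and> st l v \<in> V - W)) \<and> card V < card E"

lemma coreD:
 assumes "core st m V E"
 shows "finite V" "V \<noteq> {}" "E \<subseteq> {..<m} \<times> V" "\<And>v l. v \<in> V ==> edg st l v \<in> E ==> st l v \<in> V"
  "\<And>W. W \<subset> V ==> W \<noteq> {} ==> \<exists>v\<in>W. \<exists>l. edg st l v \<in> E \<and> st l v \<in> V - W" "card V < card E" "finite E"
proof -
 show "finite V" "V \<noteq> {}" "E \<subseteq> {..<m} \<times> V" "card V < card E" using assms by (simp_all add: core_def)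
 then show "finite E" by (metis finite_SigmaI finite_lessThan finite_subset)
 show "\<And>v l. v \<in> V ==> edg st l v \<in> E ==> st l v \<in> V" using assms unfolding core_def by blast
 show "\<And>W. W \<subset> V ==> W \<noteq> {} ==> \<exists>v\<in>W. \<exists>l. edg st l v \<in> E \<and> st l v \<in> V - W" using assms unfolding core_def by blast
qed

lemma drt_letters: "E \<subseteq> {..<m} \<times> V ==> drt st E v \<subseteq> letters m"
 by (auto simp: drt_def edg_def letters_def mem_Times_iff)

text \<open>Removing a leaf together with its edge lowers both counts by one and keeps the rest
  connected.\<close>

lemma core_leaf:
 assumes sym: "sym_act st UNIV" and c: "core st m V E" and v0: "v0 \<in> V" "card (drt st E v0) < 2"
 shows "\<exists>e. e \<in> E \<and> core st m (V - {v0}) (E - {e})"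
proof -
 note cD = coreD[OF c]
 have fD: "finite (drt st E v0)" by (rule finite_subset[OF drt_letters[OF cD(3)]]) simp
 have ne: "drt st E v0 \<noteq> {}"
 proof
  assume e: "drt st E v0 = {}"
  then have no: "edg st l v0 \<notin> E" for l unfolding drt_def by blast
  show False
  \<comment> \<open>A vertex without darts is isolated, so by connectivity it is the only vertex;
    then there is no edge, against the edge count.\<close>
  proof (cases "V = {v0}")
   case True
   have "E = {}"
   proof (rule ccontr)
    assume "E \<noteq> {}"
    then obtain i where "(i, v0) \<in> E" using cD(3) True by auto
    then show False using no[of "(i, True)"] by (simp add: edg_def)
   qed
   then show False using cD(6) by simp
  next
   case False
   then have "{v0} \<subset> V" using v0(1) by auto
   from cD(5)[OF this] show False using no by auto
  qed
 qed
 then have "card (drt st E v0) = 1" using v0(2) fD by (metis One_nat_def card_gt_0_iff less_2_cases_iff less_irrefl)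
 then obtain l0 where l0: "drt st E v0 = {l0}" by (auto simp: card_1_singleton_iff)
 define e0 where "e0 = edg st l0 v0"
 define y where "y = st l0 v0"
 have e0: "e0 \<in> E" using l0 by (auto simp: drt_def e0_def)
 have uniq: "l = l0" if "edg st l v0 \<in> E" for l
 proof -
  have "l \<in> drt st E v0" using that by (simp add: drt_def)
  then show ?thesis using l0 by simp
 qed
 have bk: "edg st (linv l) (st l v) = edg st l v" for l v by (rule edg_linv[OF sym]) simp
 have yv: "y \<noteq> v0"
 proof
  assume "y = v0"
  then have "edg st (linv l0) v0 \<in> E" using bk[of l0 v0] e0 by (simp add: y_def e0_def)
  then show False using uniq[of "linv l0"] by simp
 qed
 have yV: "y \<in> V" using cD(4)[OF v0(1)] e0 by (simp add: y_def e0_def)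
 have into: "l = linv l0 \<and> v = y" if "edg st l v \<in> E" "st l v = v0" for l v
 proof -
  have "edg st (linv l) v0 \<in> E" using bk[of l v] that by simp
  then have "linv l = l0" by (rule uniq)
  moreover have "st (linv l) (st l v) = v" using sym_actD(2)[OF sym] by simp
  ultimately show ?thesis using that(2) by (auto simp: y_def)
 qed
 have "core st m (V - {v0}) (E - {e0})"
  unfolding core_def
 proof (intro conjI allI ballI impI)
  show "finite (V - {v0})" "V - {v0} \<noteq> {}" using cD(1) yV yv by auto
  show "E - {e0} \<subseteq> {..<m} \<times> (V - {v0})"
  proof
   fix p assume p: "p \<in> E - {e0}"
   obtain i v where iv: "p = (i, v)" by fastforce
   have "v \<noteq> v0"
   proof
    assume "v = v0"
    then have ed: "edg st (i, True) v0 = p" by (simp add: edg_def iv)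
    then have "(i, True) = l0" using p by (intro uniq) simp
    then show False using p ed by (simp add: e0_def)
   qed
   then show "p \<in> {..<m} \<times> (V - {v0})" using cD(3) p iv by auto
  qed
  fix v l assume v: "v \<in> V - {v0}" "edg st l v \<in> E - {e0}"
  have "st l v \<noteq> v0"
  proof
   assume "st l v = v0"
   then have "l = linv l0" "v = y" using into[of l v] v(2) by auto
   then show False using v(2) bk[of l0 v0] by (simp add: e0_def y_def)
  qed
  then show "st l v \<in> V - {v0}" using cD(4)[of v l] v by auto
 next
  fix W assume W: "W \<subset> V - {v0}" "W \<noteq> {}"
  show "\<exists>v\<in>W. \<exists>l. edg st l v \<in> E - {e0} \<and> st l v \<in> V - {v0} - W"
  proof (cases "y \<in> W")
   case True
   have "insert v0 W \<subset> V" using W v0(1) by auto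
   then obtain v l where vl: "v \<in> insert v0 W" "edg st l v \<in> E" "st l v \<in> V - insert v0 W" using cD(5)[of "insert v0 W"] by auto
   have "v \<noteq> v0"
   proof
    assume "v = v0"
    then have "st l v = y" using uniq[of l] vl(2) by (auto simp: y_def)
    then show False using vl(3) True by auto
   qed
   moreover have "edg st l v \<noteq> e0"
   proof
    assume "edg st l v = e0"
    then consider "l = l0" "v = v0" | "l = linv l0" "v = y"
     using edg_eq_iff[OF sym, of v v0 l l0] by (auto simp: e0_def y_def)
    then show False
    proof cases
     case 2
     then have "st l v = v0" using sym_actD(2)[OF sym] by (simp add: y_def)
     then show False using vl(3) by auto
    qed (use \<open>v \<noteq> v0\<close> in auto)
   qed
   ultimately show ?thesis using vl by (intro bexI[of _ v] exI[of _ l]) auto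
  next
   case False
   have "W \<subset> V" using W by auto
   then obtain v l where vl: "v \<in> W" "edg st l v \<in> E" "st l v \<in> V - W" using cD(5) W(2) by blast
   have n0: "st l v \<noteq> v0" using into[OF vl(2)] False vl(1) by auto
   moreover have "edg st l v \<noteq> e0"
   proof
    assume "edg st l v = e0"
    then consider "v = v0" | "v = y"
     using edg_eq_iff[OF sym, of v v0 l l0] by (auto simp: e0_def y_def)
    then show False using vl(1) False W(1) by cases auto
   qed
   ultimately show ?thesis using vl by (intro bexI[of _ v] exI[of _ l]) auto
  qed
 next
  have "0 < card V" using cD(1,2) by (simp add: card_gt_0_iff)
  then show "card (V - {v0}) < card (E - {e0})" using cD(6) e0 v0(1) cD(1,7) by (simp add: card_Diff_singleton)
 qed
 then show ?thesis using e0 by (intro exI[of _ e0] conjI)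
qed

lemma core_prune:
 assumes sym: "sym_act st UNIV" and c: "core st m V E"
 shows "\<exists>V' E'. V' \<subseteq> V \<and> E' \<subseteq> E \<and> core st m V' E' \<and> (\<forall>v\<in>V'. 2 \<le> card (drt st E' v))"
 using c
proof (induction "card V" arbitrary: V E rule: less_induct)
 case less
 show ?case
 proof (cases "\<forall>v\<in>V. 2 \<le> card (drt st E v)")
  case True
  then show ?thesis using less.prems by blast
 next
  case False
  then obtain v0 where v0: "v0 \<in> V" "card (drt st E v0) < 2" by (auto simp: not_le)
  obtain e where e: "core st m (V - {v0}) (E - {e})" using core_leaf[OF sym less.prems v0] by blast
  have "card (V - {v0}) < card V" using coreD(1)[OF less.prems] v0(1) by (intro psubset_card_mono) auto
  from less.hyps[OF this e] obtain V' E' where "V' \<subseteq> V - {v0}" "E' \<subseteq> E - {e}" "core st m V' E'" "\<forall>v\<in>V'. 2 \<le> card (drt st E' v)"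
   by blast
  then show ?thesis by (intro exI[of _ V'] exI[of _ E']) auto
 qed
qed

section \<open>Exponential growth of reduced paths in a leafless core\<close>

locale pruned_core =
 fixes st :: "nat \<times> bool \<Rightarrow> 'v \<Rightarrow> 'v" and m :: nat and V :: "'v set" and E :: "(nat \<times> 'v) set"
 assumes sym: "sym_act st UNIV" and core: "core st m V E" and deg: "\<And>v. v \<in> V ==> 2 \<le> card (drt st E v)"
begin

definition adm :: "(nat \<times> bool) list \<Rightarrow> 'v \<Rightarrow> bool" where
 "adm w v \<longleftrightarrow> reduced w \<and> set (tr st w v) \<subseteq> E"

lemmas cD = coreD[OF core]

lemma tr_E_V: "v \<in> V ==> set (tr st w v) \<subseteq> E ==> wk st w v \<in> V"
 by (induction w arbitrary: v) (auto intro: cD(4))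

lemma tr_E_letters: "set (tr st w v) \<subseteq> E ==> set w \<subseteq> letters m"
 by (rule tr_letters[of _ _ _ m V]) (use cD(3) in auto)

lemma finite_drt: "finite (drt st E v)"
 by (rule finite_subset[OF drt_letters[OF cD(3)]]) simp

lemma other_dart: "v \<in> V ==> \<exists>l\<in>drt st E v. l \<noteq> l0"
proof (rule ccontr)
 assume v: "v \<in> V" and "\<not> (\<exists>l\<in>drt st E v. l \<noteq> l0)"
 then have "drt st E v \<subseteq> {l0}" by auto
 then have "card (drt st E v) \<le> card {l0}" by (intro card_mono) auto
 then show False using deg[OF v] by simp
qed

lemma adm_snoc: "adm (w @ [l]) v \<longleftrightarrow> adm w v \<and> l \<in> drt st E (wk st w v) \<and> (w = [] \<or> l \<noteq> linv (last w))"
 by (auto simp: adm_def reduced_append drt_def)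

lemma adm_extend:
 assumes "v \<in> V" "adm w v" "length w \<le> k"
 shows "\<exists>x. length (w @ x) = k \<and> adm (w @ x) v"
 using assms(3)
proof (induction k)
 case 0
 then show ?case using assms(2) by (intro exI[of _ "[]"]) simp
next
 case (Suc k)
 show ?case
 proof (cases "length w = Suc k")
  case True
  then show ?thesis using assms(2) by (intro exI[of _ "[]"]) simp
 next
  case False
  then have "length w \<le> k" using Suc.prems by linarith
  then obtain x where x: "length (w @ x) = k" "adm (w @ x) v" using Suc.IH by blast
  have "wk st (w @ x) v \<in> V" using x(2) by (intro tr_E_V assms(1)) (simp add: adm_def)
  then obtain l where l: "l \<in> drt st E (wk st (w @ x) v)" "l \<noteq> linv (last (w @ x))" using other_dart by blast
  then have "adm ((w @ x) @ [l]) v" using x(2) unfolding adm_snoc by blast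
  then show ?thesis using x(1) by (intro exI[of _ "x @ [l]"]) simp
 qed
qed

text \<open>Every edge yields two darts, one at either end; a loop gives both of them to the same
  vertex.\<close>

lemma degree_sum: "2 * card E \<le> (\<Sum>v\<in>V. card (drt st E v))"
proof -
 have "card (E \<times> (UNIV :: bool set)) \<le> card (Sigma V (drt st E))"
 proof (rule card_inj_on_le)
  let ?f = "\<lambda>p. (if snd p then snd (fst p) else st (fst (fst p), True) (snd (fst p)), (fst (fst p), snd p))"
  have inj: "u = v" if "st l u = st l v" for l u v using that st_inj[OF sym] by simp
  show "inj_on ?f (E \<times> UNIV)" by (rule inj_onI) (auto simp: prod_eq_iff split: if_splits dest: inj)
  have "?f p \<in> Sigma V (drt st E)" if "p \<in> E \<times> UNIV" for p
  proof -
   obtain i u b where p: "p = ((i, u), b)" by (metis prod.exhaust)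
   have e: "edg st (i, True) u \<in> E" "u \<in> V" using that p cD(3) by (auto simp: edg_def)
   have "edg st (linv (i, True)) (st (i, True) u) = edg st (i, True) u" by (rule edg_linv[OF sym]) simp
   then have "edg st (i, False) (st (i, True) u) \<in> E" using e(1) by (simp add: linv_def)
   then show ?thesis using e cD(4)[OF e(2,1)] p by (auto simp: drt_def)
  qed
  then show "?f ` (E \<times> UNIV) \<subseteq> Sigma V (drt st E)" by blast
  show "finite (Sigma V (drt st E))" using cD(1) finite_drt by auto
 qed
 also have "\<dots> = (\<Sum>v\<in>V. card (drt st E v))" using cD(1) finite_drt by (simp add: card_SigmaI)
 finally show ?thesis by (simp add: card_cartesian_product)
qed

abbreviation "bl \<equiv> card V * (2 * m) + 1"

text \<open>With a single admissible continuation of length \<open>bl\<close> the path is forced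
  and, having more positions than there are darts, runs around a cycle. No dart leaves this cycle,
  so it is the whole graph. All degrees are then at most two, which is too little for more edges
  than vertices.\<close>

lemma branching:
 assumes v: "v \<in> V" and l: "l \<in> drt st E v"
 obtains x y where "x \<noteq> y" "length x = bl" "length y = bl" "adm (l # x) v" "adm (l # y) v"
proof -
 have "\<exists>x y. x \<noteq> y \<and> length x = bl \<and> length y = bl \<and> adm (l # x) v \<and> adm (l # y) v"
 proof (rule ccontr)
  assume neg: "\<not> ?thesis"
  have "adm [l] v" using l by (simp add: adm_def drt_def)
  from adm_extend[OF v this, of "Suc bl"] obtain x where x: "length x = bl" "adm (l # x) v" by auto
  define W where "W = l # x"
  define p where "p j = wk st (take j W) v" for j
  have W: "length W = Suc bl" "adm W v" using x by (simp_all add: W_def)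
  have trW: "set (tr st (take j W) v) \<subseteq> E" for j
  proof -
   have "tr st W v = tr st (take j W) v @ tr st (drop j W) (wk st (take j W) v)" by (metis append_take_drop_id tr_append)
   then show ?thesis using W(2) by (auto simp: adm_def)
  qed
  have admW: "adm (take j W) v" for j
  proof -
   have "reduced (take j W)" using W(2) by (metis adm_def append_take_drop_id reduced_append)
   then show ?thesis using trW by (simp add: adm_def)
  qed
  have pV: "p j \<in> V" for j unfolding p_def by (rule tr_E_V[OF v trW])
  have take_Suc: "take (Suc j) W = take j W @ [W ! j]" if "j \<le> bl" for j
   using that W(1) by (simp add: take_Suc_conv_app_nth)
  have pS: "p (Suc j) = st (W ! j) (p j)" if "j \<le> bl" for j using that by (simp add: p_def take_Suc)
  have Wd: "W ! j \<in> drt st E (p j)" if "j \<le> bl" for j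
   using admW[of "Suc j"] unfolding take_Suc[OF that] adm_snoc p_def by blast
  \<comment> \<open>A third dart would start another continuation, which can be prolonged to the
    full length since no vertex is a dead end.\<close>
  have only: "drt st E (p (Suc t)) \<subseteq> {linv (W ! t), W ! Suc t}" if t: "Suc t \<le> bl" for t
  proof
   fix k assume k: "k \<in> drt st E (p (Suc t))"
   show "k \<in> {linv (W ! t), W ! Suc t}"
   proof (rule ccontr)
    assume nk: "k \<notin> {linv (W ! t), W ! Suc t}"
    let ?u = "take (Suc t) W @ [k]"
    have "last (take (Suc t) W) = W ! t" using take_Suc[of t] t by simp
    then have "adm ?u v" using k nk admW[of "Suc t"] unfolding adm_snoc p_def by auto
    moreover have "length ?u \<le> Suc bl" using t W(1) by simp
    ultimately obtain z where z: "length (?u @ z) = Suc bl" "adm (?u @ z) v" using adm_extend[OF v] by blast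
    obtain y where y: "?u @ z = l # y" by (simp add: W_def)
    have "(?u @ z) ! Suc t = k" using t W(1) by (simp add: nth_append)
    then have "y \<noteq> x" using nk y by (auto simp: W_def)
    moreover have "length y = bl" using arg_cong[OF y, of length] z(1) by simp
    moreover have "adm (l # y) v" using z(2) unfolding y .
    ultimately show False using neg x by blast
   qed
  qed
  have Wl: "W ! j \<in> letters m" if "j \<le> bl" for j by (rule subsetD[OF drt_letters[OF cD(3)] Wd[OF that]])
  \<comment> \<open>Pigeonhole over darts rather than vertices: a repeated dart makes the path
    periodic in both directions of travel.\<close>
  have "\<not> inj_on (\<lambda>j. (p j, W ! j)) {..bl}"
  proof
   assume "inj_on (\<lambda>j. (p j, W ! j)) {..bl}"
   then have "card {..bl} \<le> card (V \<times> letters m)"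
    by (rule card_inj_on_le) (use pV Wl cD(1) in auto)
   then show False by (simp add: card_cartesian_product card_letters)
  qed
  then obtain a b where ab: "a \<le> bl" "b \<le> bl" "a \<noteq> b" "p a = p b" "W ! a = W ! b" unfolding inj_on_def by auto
  have "\<exists>i j. i < j \<and> j \<le> bl \<and> p i = p j \<and> W ! i = W ! j"
  proof (cases "a < b")
   case True
   then show ?thesis using ab by (intro exI[of _ a] exI[of _ b] conjI) simp_all
  next
   case False
   then have "b < a" using ab(3) by linarith
   then show ?thesis using ab by (intro exI[of _ b] exI[of _ a] conjI) simp_all
  qed
  then obtain i j where ij: "i < j" "j \<le> bl" "p i = p j" "W ! i = W ! j" by blast
  define S where "S = p ` {Suc i..j}"
  have nb: "st k u \<in> S \<and> card (drt st E u) \<le> 2" if u: "u \<in> S" "k \<in> drt st E u \<or> k = k" and k: "k \<in> drt st E u" for u k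
  proof -
   obtain t' where t': "u = p t'" "Suc i \<le> t'" "t' \<le> j" using u(1) unfolding S_def by auto
   then obtain t where "t' = Suc t" by (cases t') auto
   then have t: "u = p (Suc t)" "i \<le> t" "Suc t \<le> j" using t' by simp_all
   have bt: "Suc t \<le> bl" using t ij by linarith
   note on = only[OF bt]
   have "card (drt st E u) \<le> card {linv (W ! t), W ! Suc t}" unfolding t(1) by (rule card_mono[OF _ on]) simp
   also have "\<dots> \<le> 2" by (simp add: card_insert_if)
   finally have c2: "card (drt st E u) \<le> 2" .
   consider "k = linv (W ! t)" | "k = W ! Suc t" using on k t(1) by blast
   then have "st k u \<in> S"
   proof cases
    case 1
    have "st k u = p t" using 1 t(1) pS[of t] bt sym_actD(2)[OF sym] by simp
    then show ?thesis using t ij(1,3) unfolding S_def by (cases "t = i") auto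
   next
    case 2
    then have e: "st k u = p (Suc (Suc t))" using t(1) pS[OF bt] by simp
    show ?thesis
    proof (cases "Suc t = j")
     case True
     have "p (Suc j) = p (Suc i)" using pS[of j] pS[of i] ij by simp
     then show ?thesis using e True ij(1) unfolding S_def by auto
    qed (use e t in \<open>auto simp: S_def\<close>)
   qed
   then show ?thesis using c2 by blast
  qed
  have SV: "S \<subseteq> V" using pV by (auto simp: S_def)
  \<comment> \<open>By connectivity a proper part of the graph would have an outgoing dart.\<close>
  have "S = V"
  proof (rule ccontr)
   assume "S \<noteq> V"
   then have "S \<subset> V" "S \<noteq> {}" using SV ij(1) by (auto simp: S_def)
   from cD(5)[OF this] obtain u k where "u \<in> S" "edg st k u \<in> E" "st k u \<in> V - S" by auto
   then show False using nb[of u k] by (auto simp: drt_def)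
  qed
  have "card (drt st E u) \<le> 2" if u: "u \<in> V" for u
  proof -
   obtain k where "k \<in> drt st E u" using other_dart[OF u] by blast
   then show ?thesis using nb[of u k] u \<open>S = V\<close> by blast
  qed
  then have "(\<Sum>v\<in>V. card (drt st E v)) \<le> (\<Sum>v\<in>V. 2)" by (rule sum_mono)
  then show False using degree_sum cD(6) by simp
 qed
 then show thesis using that by blast
qed

definition aw :: "nat \<Rightarrow> 'v \<Rightarrow> nat \<times> bool \<Rightarrow> (nat \<times> bool) list set" where
 "aw k v l = {w. length w = k \<and> adm w v \<and> w \<noteq> [] \<and> hd w = l}"

lemma finite_aw: "finite (aw k v l)"
 by (rule finite_subset[OF _ finite_lists_length_eq[OF finite_letters[of m], of k]])
   (use tr_E_letters in \<open>auto simp: aw_def adm_def\<close>)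

lemma aw_growth:
 assumes v: "v \<in> V" and l: "l \<in> drt st E v"
 shows "2 ^ q \<le> card (aw (q * bl + 1) v l)"
proof (induction q)
 case 0
 have "[l] \<in> aw 1 v l" using l by (simp add: aw_def adm_def drt_def)
 then have "aw 1 v l \<noteq> {}" by blast
 then have "0 < card (aw 1 v l)" using finite_aw by (simp add: card_gt_0_iff)
 then show ?case by simp
next
 case (Suc q)
 let ?A = "aw (q * bl + 1) v l"
 have split: "\<exists>f. inj_on f (UNIV :: bool set) \<and> (\<forall>b. length (f b) = bl \<and> adm (w @ f b) v)" if w: "w \<in> ?A" for w
 proof -
  have "w \<noteq> []" using w by (simp add: aw_def)
  then obtain w0 l' where w0: "w = w0 @ [l']" by (cases w rule: rev_cases) auto
  have aw0: "adm (w0 @ [l']) v" using w by (simp add: aw_def w0)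
  have a: "adm w0 v" "l' \<in> drt st E (wk st w0 v)" "w0 = [] \<or> l' \<noteq> linv (last w0)" using aw0 unfolding adm_snoc by auto
  have "wk st w0 v \<in> V" using a(1) by (intro tr_E_V[OF v]) (simp add: adm_def)
  then obtain x y where xy: "x \<noteq> y" "length x = bl" "length y = bl" "adm (l' # x) (wk st w0 v)" "adm (l' # y) (wk st w0 v)"
   by (rule branching[OF _ a(2)])
  have "adm (w @ z) v" if "adm (l' # z) (wk st w0 v)" for z
   using that a by (auto simp: adm_def w0 reduced_append)
  then show ?thesis using xy by (intro exI[of _ "\<lambda>b. if b then x else y"]) (auto simp: inj_on_def)
 qed
 then have "\<forall>w\<in>?A. \<exists>f. inj_on f (UNIV :: bool set) \<and> (\<forall>b. length (f b) = bl \<and> adm (w @ f b) v)" by blast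
 from bchoice[OF this] obtain f where "\<forall>w\<in>?A. inj_on (f w) (UNIV :: bool set) \<and> (\<forall>b. length (f w b) = bl \<and> adm (w @ f w b) v)" ..
 then have f: "\<And>w. w \<in> ?A ==> inj_on (f w) (UNIV :: bool set)"
  "\<And>w b. w \<in> ?A ==> length (f w b) = bl" "\<And>w b. w \<in> ?A ==> adm (w @ f w b) v" by simp_all
 have "card (?A \<times> (UNIV :: bool set)) \<le> card (aw (Suc q * bl + 1) v l)"
 proof (rule card_inj_on_le)
  show "inj_on (\<lambda>p. fst p @ f (fst p) (snd p)) (?A \<times> UNIV)"
  proof (rule inj_onI)
   fix p r assume pr: "p \<in> ?A \<times> (UNIV :: bool set)" "r \<in> ?A \<times> (UNIV :: bool set)" "fst p @ f (fst p) (snd p) = fst r @ f (fst r) (snd r)"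
   have len: "length (fst p) = length (fst r)" using pr(1,2) by (simp add: mem_Times_iff aw_def)
   have ee: "fst p = fst r \<and> f (fst p) (snd p) = f (fst r) (snd r)"
    by (rule iffD1[OF append_eq_append_conv[OF disjI1[OF len]] pr(3)])
   note e = ee[THEN conjunct1] ee[THEN conjunct2]
   have pA: "fst p \<in> ?A" using pr(1) by (simp add: mem_Times_iff)
   have "f (fst p) (snd p) = f (fst p) (snd r)" using e by simp
   then have "snd p = snd r" using inj_onD[OF f(1)[OF pA]] by blast
   then show "p = r" using e(1) by (simp add: prod_eq_iff)
  qed
  show "(\<lambda>p. fst p @ f (fst p) (snd p)) ` (?A \<times> UNIV) \<subseteq> aw (Suc q * bl + 1) v l"
  proof (rule image_subsetI)
   fix p assume "p \<in> ?A \<times> (UNIV :: bool set)"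
   then have p: "fst p \<in> ?A" by (simp add: mem_Times_iff)
   then show "fst p @ f (fst p) (snd p) \<in> aw (Suc q * bl + 1) v l"
    using f(2)[OF p, of "snd p"] f(3)[OF p, of "snd p"] by (simp add: aw_def hd_append2)
  qed
 qed (rule finite_aw)
 then show ?case using Suc by (simp add: card_cartesian_product)
qed

text \<open>One radius \<open>\<rho>\<close> must serve all darts. With \<open>t\<close> as
  parameter the radius is linear, so the left side is at most quadratic in \<open>t\<close>, against
  \<open>2 ^ (2 * t)\<close> words. The constant \<open>K\<close> will be
  \<open>4 * (card V)^2\<close>.\<close>

lemma aw_superlinear: "\<exists>\<rho>\<ge>1. \<forall>v\<in>V. \<forall>l\<in>drt st E v. K * (2 * \<rho> + 1) < card (aw \<rho> v l)"
proof -
 define t where "t = K * (4 * bl + 3)"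
 define \<rho> where "\<rho> = (2 * t) * bl + 1"
 have "K * (2 * \<rho> + 1) < 2 ^ (2 * t)"
 proof -
  have "2 * \<rho> + 1 \<le> (4 * bl + 3) * (t + 1)" by (simp add: \<rho>_def algebra_simps)
  then have "K * (2 * \<rho> + 1) \<le> t * (t + 1)" unfolding t_def by (metis mult.assoc mult_le_mono2)
  also have "\<dots> < 2 ^ t * 2 ^ t"
  proof -
   have "t + 1 \<le> 2 ^ t" "t < 2 ^ t" using less_exp[of t] by (simp_all add: Suc_le_eq)
   then show ?thesis by (metis mult_less_le_imp_less zero_le zero_less_Suc Suc_eq_plus1)
  qed
  also have "\<dots> = 2 ^ (2 * t)" by (simp add: power_add[symmetric] mult_2)
  finally show ?thesis .
 qed
 then show ?thesis using aw_growth[where q = "2 * t"] by (intro exI[of _ \<rho>]) (force simp: \<rho>_def)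
qed

end

text \<open>The word property \<open>P\<close> will be membership of the value of the word in a cyclic group.\<close>

lemma one_chord:
 assumes sym: "sym_act st UNIV"
  and tree: "\<tau> b = []" "\<And>y l. y \<in> reach st E b ==> edg st l y \<in> T ==> \<tau> (st l y) = \<tau> y @ [l] \<or> \<tau> y = \<tau> (st l y) @ [linv l]"
  and ET: "E \<subseteq> insert (edg st l0 y0) T"
  and \<zeta>: "\<zeta> = \<tau> y0 @ [l0] @ winv (\<tau> (st l0 y0))"
  and P: "P []" "\<And>w. P w ==> P (w @ \<zeta>)" "\<And>w. P w ==> P (w @ winv \<zeta>)" "\<And>a x c. P (a @ x @ winv x @ c) \<longleftrightarrow> P (a @ c)"
  and w: "set (tr st w b) \<subseteq> E"
 shows "P (w @ winv (\<tau> (wk st w b)))"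
 using w
proof (induction w rule: rev_induct)
 case (snoc l w)
 define y where "y = wk st w b"
 have yR: "y \<in> reach st E b" using snoc.prems by (auto simp: y_def reach_def)
 have IH: "P (w @ winv (\<tau> y))" using snoc by (simp add: y_def)
 \<comment> \<open>Crossing a tree edge changes the closed-up word by free cancellation only;
   crossing the chord inserts \<open>\<zeta>\<close> or its inverse.\<close>
 have "P (w @ [l] @ winv (\<tau> (st l y)))"
 proof (cases "edg st l y \<in> T")
  case True
  from tree(2)[OF yR this] show ?thesis
  proof
   assume "\<tau> (st l y) = \<tau> y @ [l]"
   then show ?thesis using IH P(4)[of w "[l]" "winv (\<tau> y)"] by simp
  next
   assume "\<tau> y = \<tau> (st l y) @ [linv l]"
   then show ?thesis using IH by simp
  qed
 next
  case False
  then have "edg st l y = edg st l0 y0" using ET snoc.prems by (auto simp: y_def)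
  then consider "l = l0" "y = y0" | "l = linv l0" "y = st l0 y0" using edg_eq_iff[OF sym, of y y0 l l0] by auto
  then show ?thesis
  proof cases
   case 1
   have "P (w @ winv (\<tau> y) @ \<zeta>)" using P(2)[OF IH] by simp
   then show ?thesis using 1 P(4)[of w "winv (\<tau> y)" "[l] @ winv (\<tau> (st l y))"] by (simp add: \<zeta>)
  next
   case 2
   have "st l y = y0" using 2 sym_actD(2)[OF sym] by simp
   moreover have "P (w @ winv (\<tau> y) @ winv \<zeta>)" using P(3)[OF IH] by simp
   ultimately show ?thesis using 2 P(4)[of w "winv (\<tau> y)" "[l] @ winv (\<tau> (st l y))"] by (simp add: \<zeta>)
  qed
 qed
 then show ?case by (simp add: y_def)
qed (simp add: tree P)

text \<open>The edges traversed by the loops form a finite connected graph. With at most one edge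
  outside a spanning tree, every loop would be a power of a single word \<open>\<zeta>\<close> up to
  free cancellation, which \<open>nc\<close> forbids. The tree with two further edges has one edge
  more than vertices.\<close>

lemma core_from_loops:
 fixes st :: "nat \<times> bool \<Rightarrow> 'v \<Rightarrow> 'v"
 assumes sym: "sym_act st UNIV" and ws: "finite ws" "\<And>w. w \<in> ws ==> set w \<subseteq> letters m \<and> wk st w b = b"
  and nc: "\<And>\<zeta>. set \<zeta> \<subseteq> letters m ==> wk st \<zeta> b = b ==> \<exists>w\<in>ws. \<exists>P. P [] \<and> (\<forall>w. P w --> P (w @ \<zeta>) \<and> P (w @ winv \<zeta>)) \<and>
   (\<forall>a x c. P (a @ x @ winv x @ c) \<longleftrightarrow> P (a @ c)) \<and> \<not> P w"
 shows "\<exists>V E. core st m V E \<and> b \<in> V \<and> (\<forall>y\<in>V. \<exists>p. set p \<subseteq> letters m \<and> wk st p b = y)"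
proof -
 define E where "E = (\<Union>w\<in>ws. set (tr st w b))"
 let ?R = "reach st E b"
 have fE: "finite E" using ws(1) by (auto simp: E_def)
 have el: "fst e < m" if "e \<in> E" for e
 proof -
  have "set (tr st w v) \<subseteq> {..<m} \<times> UNIV" if "set w \<subseteq> letters m" for w v
   using that by (induction w arbitrary: v) (auto simp: edg_def letters_def)
  then show ?thesis using that ws(2) by (force simp: E_def)
 qed
 have bk: "edg st (linv l) (st l v) = edg st l v" for l v by (rule edg_linv[OF sym]) simp
 have "?R \<subseteq> insert b ((\<lambda>e. snd e) ` E \<union> (\<lambda>e. st (fst e, True) (snd e)) ` E)"
 proof (rule reach_closed_subset)
  fix y l assume "edg st l y \<in> E"
  moreover have "st l y = (if snd l then st (fst l, True) (snd (edg st l y)) else snd (edg st l y))"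
   by (cases l) (auto simp: edg_def)
  ultimately show "st l y \<in> insert b ((\<lambda>e. snd e) ` E \<union> (\<lambda>e. st (fst e, True) (snd e)) ` E)"
   by (cases l) (force simp: edg_def)
 qed simp
 then have fR: "finite ?R" using fE by (auto intro: finite_subset)
 obtain T \<tau> where T: "T \<subseteq> E" "finite T" "Suc (card T) = card ?R" and \<tau>: "\<tau> b = []"
  "\<And>y. y \<in> ?R ==> wk st (\<tau> y) b = y" "\<And>y. y \<in> ?R ==> set (tr st (\<tau> y) b) \<subseteq> T"
  "\<And>y l. y \<in> ?R ==> edg st l y \<in> T ==> \<tau> (st l y) = \<tau> y @ [l] \<or> \<tau> y = \<tau> (st l y) @ [linv l]"
  by (rule spanning_tree[OF sym UNIV_I fR]) (rule that)
 have ends: "\<exists>l y. e = edg st l y \<and> y \<in> ?R" if eE: "e \<in> E" for e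
 proof -
  obtain w where w: "w \<in> ws" "e \<in> set (tr st w b)" using eE unfolding E_def by blast
  from tr_split_first[OF w(2)] obtain u l t where u: "w = u @ l # t" "edg st l (wk st u b) = e" by blast
  have "set (tr st w b) \<subseteq> E" using w(1) by (auto simp: E_def)
  then have "wk st u b \<in> ?R" using u(1) by (auto simp: reach_def)
  then show ?thesis using u(2) by blast
 qed
 have \<tau>l: "set (\<tau> y) \<subseteq> letters m" if "y \<in> ?R" for y
  by (rule tr_letters[of st _ b m UNIV]) (use \<tau>(3)[OF that] T(1) el in \<open>force simp: mem_Times_iff\<close>)
 have "\<not> card (E - T) \<le> 1"
 proof
  assume "card (E - T) \<le> 1"
  then have "E - T = {} \<or> (\<exists>f. E - T = {f})" using fE by (metis One_nat_def card_0_eq card_1_singletonE finite_Diff le_Suc_eq le_zero_eq)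
  moreover have "E \<noteq> {}"
  proof
   assume "E = {}"
   \<comment> \<open>For the empty word as \<open>\<zeta>\<close>, some loop violates a property of
     the empty word, so this loop is not empty.\<close>
   obtain w P where "w \<in> ws" "P []" "\<not> P w" using nc[of "[]"] by auto
   then have "w \<noteq> []" by auto
   then show False using \<open>w \<in> ws\<close> \<open>E = {}\<close> by (cases w) (auto simp: E_def)
  qed
  ultimately obtain f where f: "f \<in> E" "E \<subseteq> insert f T" by blast
  obtain l0 y0 where y0: "f = edg st l0 y0" "y0 \<in> ?R" using ends[OF f(1)] by blast
  have y1: "st l0 y0 \<in> ?R" using reach_step[OF y0(2)] f(1) y0(1) by blast
  define \<zeta> where "\<zeta> = \<tau> y0 @ [l0] @ winv (\<tau> (st l0 y0))"
  have "l0 \<in> letters m" using el[OF f(1)] y0(1) by (cases l0) (simp add: edg_def letters_def)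
  then have \<zeta>l: "set \<zeta> \<subseteq> letters m" using \<tau>l y0(2) y1 by (simp add: \<zeta>_def)
  have \<zeta>b: "wk st \<zeta> b = b" using \<tau>(2)[OF y0(2)] \<tau>(2)[OF y1] wk_winv[OF sym UNIV_I, of "\<tau> (st l0 y0)" b] by (simp add: \<zeta>_def)
  obtain w P where w: "w \<in> ws" "P []" "\<And>w. P w ==> P (w @ \<zeta>)" "\<And>w. P w ==> P (w @ winv \<zeta>)" "\<And>a x c. P (a @ x @ winv x @ c) \<longleftrightarrow> P (a @ c)" "\<not> P w"
   using nc[OF \<zeta>l \<zeta>b] by auto
  have wE: "set (tr st w b) \<subseteq> E" using w(1) by (auto simp: E_def)
  have ET: "E \<subseteq> insert (edg st l0 y0) T" using f(2) y0(1) by simp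
  have "P (w @ winv (\<tau> (wk st w b)))" by (rule one_chord[OF sym \<tau>(1,4) ET \<zeta>_def w(2-5) wE])
  then show False using w(6) ws(2)[OF w(1)] \<tau>(1) by simp
 qed
 then obtain F where F: "F \<subseteq> E - T" "card F = 2" by (metis One_nat_def Suc_1 not_less_eq_eq obtain_subset_with_card_n)
 have fF: "finite F" using F(2) card.infinite by fastforce
 have "card (T \<union> F) = card T + card F" using F(1) T(2) fF by (intro card_Un_disjoint) auto
 then have cTF: "card ?R < card (T \<union> F)" using T(3) F(2) by simp
 have TF: "T \<union> F \<subseteq> E" using T(1) F(1) by auto
 have reT: "reach st (T \<union> F) b = ?R"
 proof
  show "reach st (T \<union> F) b \<subseteq> ?R" using TF by (auto simp: reach_def)
  show "?R \<subseteq> reach st (T \<union> F) b"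
  proof
   fix y assume y: "y \<in> ?R"
   then show "y \<in> reach st (T \<union> F) b" using \<tau>(2,3)[OF y] unfolding reach_def by (intro CollectI exI[of _ "\<tau> y"]) auto
  qed
 qed
 have "core st m ?R (T \<union> F)"
  unfolding core_def
 proof (intro conjI allI ballI impI)
  show "?R \<noteq> {}" using reach_self[of b st E] by blast
  show "T \<union> F \<subseteq> {..<m} \<times> ?R"
  proof
   fix e assume "e \<in> T \<union> F"
   then have e: "e \<in> E" using TF by auto
   obtain l y where ly: "e = edg st l y" "y \<in> ?R" using ends[OF e] by blast
   then have "snd e \<in> ?R" using reach_step[OF ly(2), of l] e by (auto simp: edg_def)
   then show "e \<in> {..<m} \<times> ?R" using el[OF e] by (simp add: mem_Times_iff)
  qed
  fix v l assume "v \<in> ?R" "edg st l v \<in> T \<union> F"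
  then show "st l v \<in> ?R" using reach_step[of v st E b l] TF by blast
 next
  fix W assume W: "W \<subset> ?R" "W \<noteq> {}"
  show "\<exists>v\<in>W. \<exists>l. edg st l v \<in> T \<union> F \<and> st l v \<in> ?R - W"
  proof (rule ccontr)
   assume neg: "\<not> ?thesis"
   have st: "st l v \<in> ?R" if "v \<in> ?R" "edg st l v \<in> T \<union> F" for l v using reach_step[OF that(1), of l] that(2) TF by blast
   show False
   proof (cases "b \<in> W")
    case True
    have "reach st (T \<union> F) b \<subseteq> W" by (rule reach_closed_subset[OF True]) (use neg st W in blast)
    then show False using W reT by auto
   next
    case False
    have "reach st (T \<union> F) b \<subseteq> ?R - W"
    proof (rule reach_closed_subset)
     fix y l assume y: "y \<in> ?R - W" "edg st l y \<in> T \<union> F"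
     show "st l y \<in> ?R - W"
     proof (rule ccontr)
      assume "st l y \<notin> ?R - W"
      then have "st l y \<in> W" using st[of y l] y by auto
      moreover have "edg st (linv l) (st l y) \<in> T \<union> F" using bk[of l y] y(2) by simp
      moreover have "st (linv l) (st l y) \<in> ?R - W" using y(1) sym_actD(2)[OF sym] by simp
      ultimately show False using neg by blast
     qed
    qed (use False in auto)
    then show False using W reT by auto
   qed
  qed
 qed (use fR cTF in auto)
 moreover have "\<exists>p. set p \<subseteq> letters m \<and> wk st p b = y" if "y \<in> ?R" for y using \<tau>l[OF that] \<tau>(2)[OF that] by blast
 ultimately show ?thesis by (intro exI[of _ ?R] exI[of _ "T \<union> F"] conjI ballI reach_self)
qed

section \<open>Closed words crossing an edge exactly once\<close>

text \<open>The first factor will be a core of the coset graph, the second a level of the tree. An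
  edge of the product is coloured by its edge in the second factor, and to avoid an edge always
  means to avoid its colour. The constant in the growth hypothesis is the one against which balls
  are compared in \<open>recurrent_edge\<close>.\<close>

locale product_graph = pruned_core st m V E
 for st :: "nat \<times> bool \<Rightarrow> 'c \<Rightarrow> 'c" and m :: nat and V :: "'c set" and E :: "(nat \<times> 'c) set" +
 fixes sx :: "nat \<times> bool \<Rightarrow> 'x \<Rightarrow> 'x" and X :: "'x set" and \<rho> :: nat
 assumes symx: "sym_act sx X" and finX: "finite X"
  and growth: "\<And>v l. v \<in> V ==> l \<in> drt st E v ==> (4 * (card V)\<^sup>2) * (2 * \<rho> + 1) < card (aw \<rho> v l)"
  and girth: "girth_gt sx m X (2 * \<rho>)"
begin

definition sk :: "nat \<times> bool \<Rightarrow> 'c \<times> 'x \<Rightarrow> 'c \<times> 'x" where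
 "sk l z = (st l (fst z), sx l (snd z))"

definition av :: "nat \<times> 'x \<Rightarrow> (nat \<times> bool) list \<Rightarrow> 'c \<times> 'x \<Rightarrow> bool" where
 "av e w z \<longleftrightarrow> set (tr st w (fst z)) \<subseteq> E \<and> e \<notin> set (tr sx w (snd z))"

definition comp :: "nat \<times> 'x \<Rightarrow> 'c \<times> 'x \<Rightarrow> ('c \<times> 'x) set" where
 "comp e z = {wk sk w z | w. av e w z}"

definition full :: "'c \<times> 'x \<Rightarrow> ('c \<times> 'x) set" where
 "full z = {wk sk w z | w. set (tr st w (fst z)) \<subseteq> E}"

lemma wk_sk: "wk sk w z = (wk st w (fst z), wk sx w (snd z))"
 by (induction w arbitrary: z) (simp_all add: sk_def)

lemma sym_sk: "sym_act sk (V' \<times> X)" if "V' = UNIV"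
 unfolding sym_act_def using that by (auto simp: sk_def sym_actD[OF symx] sym_actD[OF sym])

lemma av_append: "av e (u @ w) z \<longleftrightarrow> av e u z \<and> av e w (wk sk u z)"
 by (auto simp: av_def wk_sk)

lemma wk_VX: "z \<in> V \<times> X ==> set (tr st w (fst z)) \<subseteq> E ==> wk sk w z \<in> V \<times> X"
 using tr_E_V sym_act_wk[OF symx] by (auto simp: wk_sk mem_Times_iff)

lemma comp_VX: "comp e z \<subseteq> V \<times> X" if z: "z \<in> V \<times> X"
proof
 fix y assume "y \<in> comp e z"
 then obtain w where "y = wk sk w z" "set (tr st w (fst z)) \<subseteq> E" unfolding comp_def av_def by blast
 then show "y \<in> V \<times> X" using wk_VX[OF z] by simp
qed

lemma comp_full: "comp e z \<subseteq> full z"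
 by (auto simp: comp_def full_def av_def)

lemma full_VX: "full z \<subseteq> V \<times> X" if z: "z \<in> V \<times> X"
proof
 fix y assume "y \<in> full z"
 then obtain w where "y = wk sk w z" "set (tr st w (fst z)) \<subseteq> E" unfolding full_def by blast
 then show "y \<in> V \<times> X" using wk_VX[OF z] by simp
qed

lemma finite_comp: "z \<in> V \<times> X ==> finite (comp e z)"
 by (rule finite_subset[OF comp_VX]) (use cD(1) finX in auto)

lemma comp_self: "z \<in> comp e z"
 unfolding comp_def by (intro CollectI exI[of _ "[]"]) (simp add: av_def)

lemma comp_step: "y \<in> comp e z ==> l \<in> drt st E (fst y) ==> edg sx l (snd y) \<noteq> e ==> sk l y \<in> comp e z"
proof -
 assume y: "y \<in> comp e z" and l: "l \<in> drt st E (fst y)" "edg sx l (snd y) \<noteq> e"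
 obtain w where w: "y = wk sk w z" "av e w z" using y by (auto simp: comp_def)
 have "av e (w @ [l]) z" using w l by (auto simp: av_def drt_def wk_sk)
 then show ?thesis using w(1) unfolding comp_def by (intro CollectI exI[of _ "w @ [l]"]) simp
qed

lemma comp_trans: "y \<in> comp e z ==> x \<in> comp e y ==> x \<in> comp e z"
proof -
 assume y: "y \<in> comp e z" and x: "x \<in> comp e y"
 obtain w where w: "y = wk sk w z" "av e w z" using y by (auto simp: comp_def)
 obtain u where u: "x = wk sk u y" "av e u y" using x by (auto simp: comp_def)
 have "av e (w @ u) z" using w u by (simp add: av_append)
 then show ?thesis using w(1) u(1) unfolding comp_def by (intro CollectI exI[of _ "w @ u"]) simp
qed

lemma full_trans: "y \<in> full z ==> x \<in> full y ==> x \<in> full z"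
proof -
 assume y: "y \<in> full z" and x: "x \<in> full y"
 obtain w where w: "y = wk sk w z" "set (tr st w (fst z)) \<subseteq> E" using y by (auto simp: full_def)
 obtain u where u: "x = wk sk u y" "set (tr st u (fst y)) \<subseteq> E" using x by (auto simp: full_def)
 show ?thesis using w u unfolding full_def by (intro CollectI exI[of _ "w @ u"]) (simp add: wk_sk)
qed

lemma av_winv: "z \<in> V \<times> X ==> av e w z ==> av e (winv w) (wk sk w z)"
 using tr_winv[OF sym UNIV_I, of w "fst z"] tr_winv[OF symx, of "snd z" w] by (auto simp: av_def wk_sk)

lemma wk_sk_winv: "z \<in> V \<times> X ==> wk sk (winv w) (wk sk w z) = z"
 using wk_winv[OF sym UNIV_I] wk_winv[OF symx] by (auto simp: wk_sk)

lemma comp_sym: "z \<in> V \<times> X ==> y \<in> comp e z ==> z \<in> comp e y"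
proof -
 assume z: "z \<in> V \<times> X" and y: "y \<in> comp e z"
 obtain w where w: "y = wk sk w z" "av e w z" using y by (auto simp: comp_def)
 show ?thesis using av_winv[OF z w(2)] wk_sk_winv[OF z] w(1) unfolding comp_def by (intro CollectI exI[of _ "winv w"]) simp
qed

text \<open>Two routes to \<open>e\<close> within distance \<open>\<rho>\<close> that begin
  differently would give distinct short words with a common endpoint, against the girth. If they
  meet \<open>e\<close> from opposite ends, one route would already have crossed \<open>e\<close>
  before its first crossing.\<close>

lemma unique_blocked:
 assumes x: "x \<in> X"
  and w: "reduced w1" "set w1 \<subseteq> letters m" "length w1 \<le> \<rho>" "e \<in> set (tr sx w1 x)"
   "reduced w2" "set w2 \<subseteq> letters m" "length w2 \<le> \<rho>" "e \<in> set (tr sx w2 x)"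
 shows "hd w1 = hd w2"
proof -
 obtain u1 l1 t1 where 1: "w1 = u1 @ l1 # t1" "edg sx l1 (wk sx u1 x) = e" "e \<notin> set (tr sx u1 x)" by (rule tr_split_first[OF w(4)])
 obtain u2 l2 t2 where 2: "w2 = u2 @ l2 # t2" "edg sx l2 (wk sx u2 x) = e" "e \<notin> set (tr sx u2 x)" by (rule tr_split_first[OF w(8)])
 have inj: "a = b" if "reduced a" "reduced b" "set a \<subseteq> letters m" "set b \<subseteq> letters m" "length a \<le> \<rho>" "length b \<le> \<rho>" "wk sx a x = wk sx b x" for a b
  by (rule girth_inj[OF symx girth x that])
 have r: "reduced u1" "reduced (u1 @ [l1])" "reduced u2" "reduced (u2 @ [l2])"
  using w(1,5) unfolding 1(1) 2(1) by (auto simp: reduced_append reduced_Cons)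
 have L: "set u1 \<subseteq> letters m" "set (u1 @ [l1]) \<subseteq> letters m" "set u2 \<subseteq> letters m" "set (u2 @ [l2]) \<subseteq> letters m"
  "length u1 \<le> \<rho>" "length (u1 @ [l1]) \<le> \<rho>" "length u2 \<le> \<rho>" "length (u2 @ [l2]) \<le> \<rho>"
  using w unfolding 1(1) 2(1) by auto
 have X: "wk sx u1 x \<in> X" "wk sx u2 x \<in> X" using sym_act_wk[OF symx x] by auto
 consider "l1 = l2" "wk sx u1 x = wk sx u2 x" | "l1 = linv l2" "wk sx u1 x = sx l2 (wk sx u2 x)"
  using edg_eq_iff[OF symx X, of l1 l2] 1(2) 2(2) by auto
 then show ?thesis
 proof cases
  case 1
  then have "u1 = u2" using inj[of u1 u2] r L by simp
  then show ?thesis using 1(1) \<open>w1 = _\<close> \<open>w2 = _\<close> by (cases u1) auto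
 next
  case 2
  then have "u1 = u2 @ [l2]" using inj[of u1 "u2 @ [l2]"] r L by simp
  then have "e \<in> set (tr sx u1 x)" using \<open>edg sx l2 (wk sx u2 x) = e\<close> by simp
  then show ?thesis using 1(3) by simp
 qed
qed

text \<open>At most one initial letter leads to \<open>e\<close> within distance
  \<open>\<rho>\<close>, and each vertex of the core has a second dart.\<close>

lemma unblocked:
 assumes z: "z \<in> V \<times> X"
 obtains l where "l \<in> drt st E (fst z)" "\<And>w. w \<in> aw \<rho> (fst z) l ==> av e w z"
proof -
 have c: "fst z \<in> V" and x: "snd z \<in> X" using z by (auto simp: mem_Times_iff)
 show thesis
 proof (cases "\<exists>w0. reduced w0 \<and> set w0 \<subseteq> letters m \<and> length w0 \<le> \<rho> \<and> e \<in> set (tr sx w0 (snd z))")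
  case True
  then obtain w0 where w0: "reduced w0" "set w0 \<subseteq> letters m" "length w0 \<le> \<rho>" "e \<in> set (tr sx w0 (snd z))" by blast
  obtain l where l: "l \<in> drt st E (fst z)" "l \<noteq> hd w0" using other_dart[OF c] by blast
  have "av e w z" if w: "w \<in> aw \<rho> (fst z) l" for w
  proof -
   have w': "reduced w" "set (tr st w (fst z)) \<subseteq> E" "length w = \<rho>" "hd w = l" using w by (auto simp: aw_def adm_def)
   have "e \<notin> set (tr sx w (snd z))"
    using unique_blocked[OF x w'(1) tr_E_letters[OF w'(2)] _ _ w0] w'(3,4) l(2) by auto
   then show ?thesis using w'(2) by (simp add: av_def)
  qed
  then show ?thesis using that l(1) by blast
 next
  case False
  obtain l where l: "l \<in> drt st E (fst z)" using other_dart[OF c] by blast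
  have "av e w z" if w: "w \<in> aw \<rho> (fst z) l" for w
  proof -
   have w': "reduced w" "set (tr st w (fst z)) \<subseteq> E" "length w = \<rho>" using w by (auto simp: aw_def adm_def)
   then show ?thesis using False tr_E_letters[OF w'(2)] by (auto simp: av_def)
  qed
  then show ?thesis using that l by blast
 qed
qed

lemma aw_inj: "z \<in> V \<times> X ==> inj_on (\<lambda>w. wk sk w z) (aw \<rho> (fst z) l)"
proof (rule inj_onI)
 fix w1 w2 assume z: "z \<in> V \<times> X" and w: "w1 \<in> aw \<rho> (fst z) l" "w2 \<in> aw \<rho> (fst z) l" "wk sk w1 z = wk sk w2 z"
 have w': "reduced w1" "reduced w2" "set w1 \<subseteq> letters m" "set w2 \<subseteq> letters m" "length w1 \<le> \<rho>" "length w2 \<le> \<rho>"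
  using w(1,2) tr_E_letters by (auto simp: aw_def adm_def)
 have x: "snd z \<in> X" using z by (simp add: mem_Times_iff)
 show "w1 = w2" by (rule girth_inj[OF symx girth x w']) (use w(3) in \<open>simp add: wk_sk\<close>)
qed

text \<open>The vertices at which a walk that avoids the colour \<open>e\<close> may be stopped;
  called terminals below.\<close>

definition trm :: "nat \<times> 'x \<Rightarrow> 'c \<times> 'x \<Rightarrow> bool" where
 "trm e y \<longleftrightarrow> (\<exists>l\<in>drt st E (fst y). edg sx l (snd y) = e)"

lemma trm_ends: "x \<in> X ==> edg sx l x = e ==> x \<in> {snd e, sx (fst e, True) (snd e)}"
 using sym_actD(3)[OF symx, of x "(fst l, True)"] by (cases l) (auto simp: edg_def linv_def split: if_splits)

lemma card_trm: "card {y\<in>V \<times> X. trm e y} \<le> 2 * card V"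
proof -
 have "{y\<in>V \<times> X. trm e y} \<subseteq> V \<times> {snd e, sx (fst e, True) (snd e)}"
  using trm_ends by (fastforce simp: trm_def mem_Times_iff)
 then have "card {y\<in>V \<times> X. trm e y} \<le> card (V \<times> {snd e, sx (fst e, True) (snd e)})"
  using cD(1) by (intro card_mono) auto
 also have "\<dots> \<le> card V * 2" by (simp add: card_cartesian_product card_insert_if)
 finally show ?thesis by simp
qed

lemma card_V_pos: "0 < card V"
 using cD(1,2) by (simp add: card_gt_0_iff)

text \<open>Without such a loop the admissible words avoiding \<open>e\<close> have distinct
  endpoints, so they are finitely many, and each nonempty one extends to a word that ends at a
  terminal. Distinct words of length \<open>\<rho>\<close> then lead to distinct terminals, but
  there are more of these words than terminals.\<close>

lemma nontrivial_loop:
 assumes z: "z \<in> V \<times> X"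
 obtains h where "reduced h" "h \<noteq> []" "av e h z" "wk sk h z = z"
proof -
 define R where "R = {w. adm w (fst z) \<and> av e w z}"
 have "\<not> inj_on (\<lambda>w. wk sk w z) R"
 proof
  assume inj: "inj_on (\<lambda>w. wk sk w z) R"
  have "finite ((\<lambda>w. wk sk w z) ` R)"
   by (rule finite_subset[OF _ finite_comp[OF z, of e]]) (auto simp: R_def comp_def)
  then have fR: "finite R" using inj by (rule finite_imageD)
  obtain l where l: "l \<in> drt st E (fst z)" "\<And>w. w \<in> aw \<rho> (fst z) l ==> av e w z" using unblocked[OF z] by blast
  \<comment> \<open>The core always offers a dart without backtracking, so only the forbidden colour
    can stop an extension of greatest length.\<close>
  have ext: "\<exists>x. w @ x \<in> R \<and> trm e (wk sk (w @ x) z)" if w: "w \<in> R" "w \<noteq> []" for w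
  proof -
   let ?S = "{x. w @ x \<in> R}"
   have "?S \<subseteq> (\<lambda>u. drop (length w) u) ` R"
   proof
    fix x assume "x \<in> ?S"
    then show "x \<in> (\<lambda>u. drop (length w) u) ` R" by (intro image_eqI[of _ _ "w @ x"]) simp_all
   qed
   then have fin: "finite ?S" using fR by (rule finite_surj[rotated])
   have "[] \<in> ?S" using w by simp
   then have "length ` ?S \<noteq> {}" by blast
   then have "Max (length ` ?S) \<in> length ` ?S" by (rule Max_in[OF finite_imageI[OF fin]])
   then obtain x where x0: "x \<in> ?S" "Max (length ` ?S) = length x" by blast
   have x: "x \<in> ?S" "\<And>y. y \<in> ?S ==> length y \<le> length x" using x0 fin by (auto simp flip: x0(2))
   have a: "adm (w @ x) (fst z)" "av e (w @ x) z" using x(1) by (auto simp: R_def)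
   have VX: "wk sk (w @ x) z \<in> V \<times> X" using a(2) by (intro wk_VX[OF z]) (simp add: av_def)
   then have "fst (wk sk (w @ x) z) \<in> V" unfolding mem_Times_iff by blast
   then obtain k where k: "k \<in> drt st E (fst (wk sk (w @ x) z))" "k \<noteq> linv (last (w @ x))" using other_dart by blast
   have "adm ((w @ x) @ [k]) (fst z)" using a(1) k unfolding adm_snoc by (simp add: wk_sk)
   moreover have "w @ x @ [k] \<notin> R" using x(2)[of "x @ [k]"] by auto
   ultimately have "\<not> av e ((w @ x) @ [k]) z" by (simp add: R_def)
   then have "edg sx k (snd (wk sk (w @ x) z)) = e" using a(2) k(1) unfolding av_append[of e "w @ x"] by (auto simp: av_def drt_def)
   then have "trm e (wk sk (w @ x) z)" using k(1) unfolding trm_def by blast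
   then show ?thesis using x(1) by (intro exI[of _ x] conjI) simp_all
  qed
  have "\<exists>f. \<forall>w\<in>aw \<rho> (fst z) l. w @ f w \<in> R \<and> trm e (wk sk (w @ f w) z)"
  proof (rule bchoice, rule ballI)
   fix w assume w: "w \<in> aw \<rho> (fst z) l"
   then have "w \<in> R" "w \<noteq> []" using l(2)[OF w] by (auto simp: R_def aw_def)
   then show "\<exists>x. w @ x \<in> R \<and> trm e (wk sk (w @ x) z)" by (rule ext)
  qed
  then obtain f where f: "\<And>w. w \<in> aw \<rho> (fst z) l ==> w @ f w \<in> R" "\<And>w. w \<in> aw \<rho> (fst z) l ==> trm e (wk sk (w @ f w) z)" by blast
  have "card (aw \<rho> (fst z) l) \<le> card {y\<in>V \<times> X. trm e y}"
  proof (rule card_inj_on_le)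
   show "inj_on (\<lambda>w. wk sk (w @ f w) z) (aw \<rho> (fst z) l)"
   proof (rule inj_onI)
    fix w1 w2 assume w: "w1 \<in> aw \<rho> (fst z) l" "w2 \<in> aw \<rho> (fst z) l" "wk sk (w1 @ f w1) z = wk sk (w2 @ f w2) z"
    have "w1 @ f w1 = w2 @ f w2" by (rule inj_onD[OF inj w(3) f(1)[OF w(1)] f(1)[OF w(2)]])
    moreover have "length w1 = length w2" using w by (simp add: aw_def)
    ultimately show "w1 = w2" by simp
   qed
   show "(\<lambda>w. wk sk (w @ f w) z) ` aw \<rho> (fst z) l \<subseteq> {y\<in>V \<times> X. trm e y}"
   proof (rule image_subsetI)
    fix w assume w: "w \<in> aw \<rho> (fst z) l"
    have "av e (w @ f w) z" using f(1)[OF w] by (simp add: R_def)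
    then show "wk sk (w @ f w) z \<in> {y\<in>V \<times> X. trm e y}" using f(2)[OF w] wk_VX[OF z, of "w @ f w"] by (simp add: av_def)
   qed
  qed (use cD(1) finX in simp)
  then have "card (aw \<rho> (fst z) l) \<le> 2 * card V" using card_trm[of e] by linarith
  moreover have "2 * card V \<le> 4 * (card V)\<^sup>2 * (2 * \<rho> + 1)"
  proof -
   have "card V \<le> card V * card V" by (rule le_square)
   then have "2 * card V \<le> 4 * (card V)\<^sup>2 * 1" unfolding power2_eq_square by linarith
   also have "\<dots> \<le> 4 * (card V)\<^sup>2 * (2 * \<rho> + 1)" by (rule mult_le_mono2) simp
   finally show ?thesis .
  qed
  ultimately show False using growth[of "fst z" l] l(1) z by (auto simp: mem_Times_iff)
 qed
 then obtain w1 w2 where w: "w1 \<in> R" "w2 \<in> R" "w1 \<noteq> w2" "wk sk w1 z = wk sk w2 z" unfolding inj_on_def by blast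
 have red: "reduced w1" "reduced w2" using w by (auto simp: R_def adm_def)
 have zU: "z \<in> UNIV \<times> X" using z by (simp add: mem_Times_iff)
 obtain a b t where abt: "w1 = a @ t" "w2 = b @ t" "reduced (a @ winv b)" "a @ winv b \<noteq> []" "wk sk (a @ winv b) z = z"
  by (rule reduced_words_distinct_ends[OF sym_sk[OF refl] w(3) zU red w(4)])
 have ab: "av e a z" "av e b z" using w(1,2) unfolding R_def abt(1,2) by (auto simp: av_append)
 have "wk sk a z = wk sk b z"
 proof -
  have "wk sk (winv b) (wk sk a z) = z" using abt(5) by simp
  then have "wk sk b z = wk sk b (wk sk (winv b) (wk sk a z))" by simp
  also have "\<dots> = wk sk a z"
   using wk_winv'[OF sym_sk[OF refl], of "wk sk a z" b] sym_act_wk[OF sym_sk[OF refl] zU] by blast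
  finally show ?thesis by simp
 qed
 then have "av e (winv b) (wk sk a z)" using av_winv[OF z ab(2)] by simp
 then have "av e (a @ winv b) z" using ab(1) by (simp add: av_append)
 then show thesis using that abt by blast
qed

text \<open>Suppose that each edge separates its ends when its colour is removed. Take a smallest
  component \<open>S\<close> among those left by removing a colour at a terminal, and shortest paths
  from \<open>t0\<close> to the terminals in \<open>S\<close>, with greatest length
  \<open>D\<close>. Minimality restricts the colours in \<open>S\<close> to \<open>e\<close> and
  those on the chosen paths, so the size of \<open>S\<close> is at most linear in \<open>D\<close>.
  Yet the unblocked balls around the points of a longest chosen path lie in \<open>S\<close> and
  overlap too little to fit.\<close>

lemma recurrent_edge:
 assumes z0: "z0 \<in> V \<times> X"
 shows "\<exists>y\<in>full z0. \<exists>l\<in>drt st E (fst y). sk l y \<in> comp (edg sx l (snd y)) y"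
proof (rule ccontr)
 assume "\<not> ?thesis"
 then have N: "sk l y \<notin> comp (edg sx l (snd y)) y" if "y \<in> full z0" "l \<in> drt st E (fst y)" for y l using that by blast
 have QVX: "full z0 \<subseteq> V \<times> X" by (rule full_VX[OF z0])
 define C where "C = {p. snd p \<in> full z0 \<and> trm (fst p) (snd p)}"
 have "C \<noteq> {}"
 proof -
  have "z0 \<in> full z0" unfolding full_def by (intro CollectI exI[of _ "[]"]) simp
  moreover have "fst z0 \<in> V" using z0 unfolding mem_Times_iff by blast
  then obtain l where "l \<in> drt st E (fst z0)" using other_dart by blast
  then have "trm (edg sx l (snd z0)) z0" unfolding trm_def by blast
  ultimately have "(edg sx l (snd z0), z0) \<in> C" by (simp add: C_def)
  then show ?thesis by blast
 qed
 then obtain q where q: "q \<in> C" "\<And>r. r \<in> C ==> card (comp (fst q) (snd q)) \<le> card (comp (fst r) (snd r))"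
  using ex_has_least_nat[of "\<lambda>p. p \<in> C" _ "\<lambda>p. card (comp (fst p) (snd p))"] by blast
 define e where "e = fst q"
 define t0 where "t0 = snd q"
 define S where "S = comp e t0"
 have t0: "t0 \<in> full z0" "trm e t0" "t0 \<in> V \<times> X" using q(1) QVX by (auto simp: C_def e_def t0_def)
 have SVX: "S \<subseteq> V \<times> X" unfolding S_def by (rule comp_VX[OF t0(3)])
 have fS: "finite S" unfolding S_def by (rule finite_comp[OF t0(3)])
 have SQ: "S \<subseteq> full z0" using comp_full[of e t0] full_trans[OF t0(1)] by (auto simp: S_def)
 have mini: "card S \<le> card (comp e' y)" if "y \<in> full z0" "trm e' y" for e' y
  using q(2)[of "(e', y)"] that by (simp add: C_def S_def e_def t0_def)
 define Tm where "Tm = {y\<in>S. trm e y}"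
 have t0T: "t0 \<in> Tm" using t0 comp_self by (simp add: Tm_def S_def)
 have fT: "finite Tm" using fS by (simp add: Tm_def)
 have cT: "card Tm \<le> 2 * card V"
 proof -
  have "card Tm \<le> card {y\<in>V \<times> X. trm e y}" using SVX cD(1) finX by (intro card_mono) (auto simp: Tm_def)
  then show ?thesis using card_trm[of e] by linarith
 qed
 define dst where "dst y = (LEAST k. \<exists>w. length w = k \<and> av e w t0 \<and> wk sk w t0 = y)" for y
 have dst_ex: "\<exists>w. length w = dst y \<and> av e w t0 \<and> wk sk w t0 = y" if y: "y \<in> S" for y
 proof -
  obtain w where "av e w t0" "wk sk w t0 = y" using y unfolding S_def comp_def by blast
  then have "\<exists>k w. length w = k \<and> av e w t0 \<and> wk sk w t0 = y" by blast
  then show ?thesis unfolding dst_def by (rule LeastI_ex)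
 qed
 have dst_le: "dst (wk sk w t0) \<le> length w" if "av e w t0" for w
  unfolding dst_def by (rule Least_le) (use that in blast)
 obtain p where p: "\<And>y. y \<in> S ==> length (p y) = dst y" "\<And>y. y \<in> S ==> av e (p y) t0" "\<And>y. y \<in> S ==> wk sk (p y) t0 = y"
  using dst_ex by metis
 define D where "D = Max (dst ` Tm)"
 have D: "dst t \<le> D" if "t \<in> Tm" for t using that fT by (simp add: D_def)
 define Co where "Co = (\<Union>t\<in>Tm. set (tr sx (p t) (snd t0)))"
 have cCo: "card Co \<le> 2 * card V * D"
 proof -
  have "card Co \<le> (\<Sum>t\<in>Tm. card (set (tr sx (p t) (snd t0))))" unfolding Co_def by (rule card_UN_le[OF fT])
  also have "\<dots> \<le> (\<Sum>t\<in>Tm. D)"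
  proof (rule sum_mono)
   fix t assume t: "t \<in> Tm"
   then have "t \<in> S" by (simp add: Tm_def)
   have "card (set (tr sx (p t) (snd t0))) \<le> length (tr sx (p t) (snd t0))" by (rule card_length)
   then show "card (set (tr sx (p t) (snd t0))) \<le> D" using p(1)[OF \<open>t \<in> S\<close>] D[OF t] by simp
  qed
  also have "\<dots> \<le> 2 * card V * D" using cT by simp
  finally show ?thesis .
 qed
 have fCo: "finite Co" using fT by (simp add: Co_def)
 \<comment> \<open>Removing a colour \<open>e'\<close> off the chosen paths leaves the terminals
   together but separates the two ends of the \<open>e'\<close>-edge. One end therefore loses
   contact with the terminals; its component cannot leave \<open>S\<close> and misses
   \<open>t0\<close>, against minimality.\<close>
 have colour: "edg sx l (snd y) \<in> Co" if y: "y \<in> S" and l: "l \<in> drt st E (fst y)" and ne: "edg sx l (snd y) \<noteq> e" for y l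
 proof (rule ccontr)
  assume nC: "edg sx l (snd y) \<notin> Co"
  define e' where "e' = edg sx l (snd y)"
  define y' where "y' = sk l y"
  have y'S: "y' \<in> S" using comp_step y l ne unfolding S_def y'_def by blast
  have yX: "snd y \<in> X" "y \<in> UNIV \<times> X" using y SVX by (auto simp: mem_Times_iff)
  have tm: "trm e' y" "trm e' y'"
  proof -
   show "trm e' y" using l unfolding trm_def e'_def by blast
   have "linv l \<in> drt st E (fst y')" using l edg_linv[OF sym UNIV_I, of l "fst y"] by (simp add: drt_def y'_def sk_def)
   moreover have "edg sx (linv l) (snd y') = e'" using edg_linv[OF symx yX(1), of l] by (simp add: y'_def e'_def sk_def)
   ultimately show "trm e' y'" unfolding trm_def by blast
  qed
  have t0t: "t \<in> comp e' t0" if "t \<in> Tm" for t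
  proof -
   have tS: "t \<in> S" using that by (simp add: Tm_def)
   have "e' \<notin> set (tr sx (p t) (snd t0))" using nC that by (auto simp: Co_def e'_def)
   then have "av e' (p t) t0" using p(2)[OF tS] by (simp add: av_def)
   then show ?thesis using p(3)[OF tS] unfolding comp_def by (intro CollectI exI[of _ "p t"] conjI) simp_all
  qed
  have "\<exists>y2\<in>{y, y'}. comp e' y2 \<inter> Tm = {}"
  proof (rule ccontr)
   assume "\<not> ?thesis"
   then obtain t1 t2 where t: "t1 \<in> comp e' y" "t1 \<in> Tm" "t2 \<in> comp e' y'" "t2 \<in> Tm" by auto
   have TV: "t1 \<in> V \<times> X" "t2 \<in> V \<times> X" "y \<in> V \<times> X" "y' \<in> V \<times> X" using t SVX y y'S by (auto simp: Tm_def)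
   have "t0 \<in> comp e' t1" by (rule comp_sym[OF t0(3) t0t[OF t(2)]])
   then have "t0 \<in> comp e' y" by (rule comp_trans[OF t(1)])
   then have "t2 \<in> comp e' y" using t0t[OF t(4)] by (rule comp_trans)
   moreover have "y' \<in> comp e' t2" by (rule comp_sym[OF TV(4) t(3)])
   ultimately have "y' \<in> comp e' y" by (rule comp_trans)
   then show False using N[of y l] SQ y l by (auto simp: e'_def y'_def)
  qed
  then obtain y2 where y2: "y2 \<in> {y, y'}" "comp e' y2 \<inter> Tm = {}" by blast
  have y2S: "y2 \<in> S" using y2(1) y y'S by auto
  have "wk sk w y2 \<in> S" if "av e' w y2" for w
   using that
  proof (induction w rule: rev_induct)
   case (snoc k w)
   then have a: "av e' w y2" "k \<in> drt st E (fst (wk sk w y2))" by (auto simp: av_def drt_def wk_sk)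
   have IH: "wk sk w y2 \<in> S" using snoc.IH a(1) by blast
   have "wk sk w y2 \<in> comp e' y2" using a(1) by (auto simp: comp_def)
   then have "wk sk w y2 \<notin> Tm" using y2(2) by blast
   then have "edg sx k (snd (wk sk w y2)) \<noteq> e" using IH a(2) by (auto simp: Tm_def trm_def)
   then show ?case using comp_step[OF IH[unfolded S_def] a(2)] by (simp add: S_def)
  qed (use y2S in simp)
  then have "comp e' y2 \<subseteq> S" by (auto simp: comp_def)
  moreover have "t0 \<notin> comp e' y2" using y2(2) t0T by blast
  moreover have "t0 \<in> S" using t0T by (simp add: Tm_def)
  ultimately have "comp e' y2 \<subset> S" by blast
  then have "card (comp e' y2) < card S" by (rule psubset_card_mono[OF fS])
  moreover have "card S \<le> card (comp e' y2)" using y2(1) tm y2S SQ by (intro mini) auto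
  ultimately show False by linarith
 qed
 \<comment> \<open>There are at most \<open>1 + 2 * card V * D\<close> colours, each with at most
   \<open>2 * card V\<close> terminals, and every vertex is a terminal for the colour of one of its
   darts.\<close>
 have upper: "card S \<le> 4 * (card V)\<^sup>2 * (D + 1)"
 proof -
  let ?G = "\<lambda>e'. {y\<in>V \<times> X. trm e' y}"
  have "S \<subseteq> (\<Union>e'\<in>insert e Co. ?G e')"
  proof
   fix y assume y: "y \<in> S"
   then have yV: "y \<in> V \<times> X" using SVX by blast
   have "fst y \<in> V" using yV unfolding mem_Times_iff by blast
   then obtain l where l: "l \<in> drt st E (fst y)" using other_dart by blast
   have "trm (edg sx l (snd y)) y" using l unfolding trm_def by blast
   moreover have "edg sx l (snd y) \<in> insert e Co" using colour[OF y l] by blast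
   ultimately show "y \<in> (\<Union>e'\<in>insert e Co. ?G e')" using yV by blast
  qed
  then have "card S \<le> card (\<Union>e'\<in>insert e Co. ?G e')" using fCo cD(1) finX by (intro card_mono) auto
  also have "\<dots> \<le> (\<Sum>e'\<in>insert e Co. card (?G e'))" using fCo by (intro card_UN_le) simp
  also have "\<dots> \<le> (\<Sum>e'\<in>insert e Co. 2 * card V)" by (intro sum_mono card_trm)
  also have "\<dots> = card (insert e Co) * (2 * card V)" by simp
  also have "\<dots> \<le> Suc (2 * card V * D) * (2 * card V)"
   using cCo fCo by (intro mult_le_mono1) (simp add: card_insert_if)
  also have "\<dots> \<le> (2 * card V * (D + 1)) * (2 * card V)"
   using card_V_pos by (intro mult_le_mono1) (simp add: algebra_simps)
  also have "\<dots> = 4 * (card V)\<^sup>2 * (D + 1)" by (simp add: power2_eq_square algebra_simps)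
  finally show ?thesis .
 qed
 have "D \<in> dst ` Tm" unfolding D_def using fT t0T by (intro Max_in) auto
 then obtain t where t: "t \<in> Tm" "dst t = D" by auto
 have tS: "t \<in> S" using t(1) by (simp add: Tm_def)
 define zz where "zz i = wk sk (take i (p t)) t0" for i
 have lp: "length (p t) = D" using p(1)[OF tS] t(2) by simp
 have avt: "av e (take i (p t)) t0" for i
  using p(2)[OF tS] av_append[of e "take i (p t)" "drop i (p t)"] by simp
 have zS: "zz i \<in> S" for i using avt by (auto simp: zz_def S_def comp_def)
 \<comment> \<open>Initial segments of a shortest path are shortest, so the centres of the balls
   have distances \<open>0, ..., D\<close> from \<open>t0\<close>.\<close>
 have dz: "dst (zz i) = i" if "i \<le> D" for i
 proof (rule antisym)
  show "dst (zz i) \<le> i" using dst_le[OF avt[of i]] lp that by (simp add: zz_def)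
  have "av e (drop i (p t)) (zz i)" using p(2)[OF tS] av_append[of e "take i (p t)" "drop i (p t)"] by (simp add: zz_def)
  then have "av e (p (zz i) @ drop i (p t)) t0" using p(2,3)[OF zS] by (simp add: av_append)
  moreover have "wk sk (p (zz i) @ drop i (p t)) t0 = t"
  proof -
   have "wk sk (p (zz i) @ drop i (p t)) t0 = wk sk (drop i (p t)) (zz i)" using p(3)[OF zS] by simp
   also have "\<dots> = wk sk (take i (p t) @ drop i (p t)) t0" by (simp only: wk_append zz_def)
   also have "\<dots> = t" using p(3)[OF tS] by simp
   finally show ?thesis .
  qed
  ultimately have "D \<le> length (p (zz i) @ drop i (p t))" using dst_le t(2) by metis
  then show "i \<le> dst (zz i)" using p(1)[OF zS] lp that by simp
 qed
 have "\<exists>l. l \<in> drt st E (fst (zz i)) \<and> (\<forall>w\<in>aw \<rho> (fst (zz i)) l. av e w (zz i))" for i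
 proof -
  have "zz i \<in> V \<times> X" using zS SVX by blast
  then show ?thesis using unblocked[of "zz i" e] by metis
 qed
 then obtain L where L: "\<And>i. L i \<in> drt st E (fst (zz i))" "\<And>i w. w \<in> aw \<rho> (fst (zz i)) (L i) ==> av e w (zz i)" by metis
 define B where "B i = (\<lambda>w. wk sk w (zz i)) ` aw \<rho> (fst (zz i)) (L i)" for i
 have zV: "zz i \<in> V \<times> X" for i using zS SVX by blast
 have BS: "B i \<subseteq> S" for i
 proof -
  have "wk sk w (zz i) \<in> S" if "w \<in> aw \<rho> (fst (zz i)) (L i)" for w
  proof -
   have "wk sk w (zz i) \<in> comp e (zz i)" using L(2)[OF that] by (auto simp: comp_def)
   then show ?thesis using comp_trans[OF zS[unfolded S_def]] by (simp add: S_def)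
  qed
  then show ?thesis by (auto simp: B_def)
 qed
 have cB: "4 * (card V)\<^sup>2 * (2 * \<rho> + 1) \<le> card (B i)" for i
 proof -
  have "card (B i) = card (aw \<rho> (fst (zz i)) (L i))" unfolding B_def by (rule card_image[OF aw_inj[OF zV]])
  then show ?thesis using growth[OF _ L(1)] zV[of i] by (metis less_imp_le mem_Times_iff)
 qed
 have cB1: "4 * (card V)\<^sup>2 * (2 * \<rho> + 1) < card (B 0)"
 proof -
  have "card (B 0) = card (aw \<rho> (fst (zz 0)) (L 0))" unfolding B_def by (rule card_image[OF aw_inj[OF zV]])
  then show ?thesis using growth[OF _ L(1)] zV[of 0] by (metis mem_Times_iff)
 qed
 \<comment> \<open>Distances within the \<open>i\<close>-th ball deviate from \<open>i\<close> by at
   most \<open>\<rho>\<close>; hence a vertex belongs to at most \<open>2 * \<rho> + 1\<close>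
   balls.\<close>
 have near: "i \<le> dst u + \<rho> \<and> dst u \<le> i + \<rho>" if i: "i \<le> D" and u: "u \<in> B i" for i u
 proof -
  obtain w where w: "w \<in> aw \<rho> (fst (zz i)) (L i)" "u = wk sk w (zz i)" using u by (auto simp: B_def)
  have lw: "length w = \<rho>" using w(1) by (simp add: aw_def)
  have uS: "u \<in> S" using BS u by blast
  have "av e (take i (p t) @ w) t0" using avt L(2)[OF w(1)] by (simp add: av_append zz_def)
  then have "dst u \<le> length (take i (p t) @ w)" using dst_le[of "take i (p t) @ w"] w(2) by (simp add: zz_def)
  then have 1: "dst u \<le> i + \<rho>" using lw lp i by simp
  have "av e (winv w) u" using av_winv[OF zV L(2)[OF w(1)]] w(2) by simp
  then have "av e (p u @ winv w) t0" using p(2,3)[OF uS] by (simp add: av_append)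
  then have "dst (zz i) \<le> length (p u @ winv w)" using dst_le[of "p u @ winv w"] p(3)[OF uS] wk_sk_winv[OF zV, of w i] w(2) by simp
  then show ?thesis using 1 dz[OF i] lw p(1)[OF uS] by simp
 qed
 have "(\<Sum>i\<le>D. card (B i)) = (\<Sum>i\<le>D. \<Sum>u\<in>S. of_bool (u \<in> B i))"
 proof (rule sum.cong[OF refl])
  fix i
  have "S \<inter> {u. u \<in> B i} = B i" using BS by blast
  then show "card (B i) = (\<Sum>u\<in>S. of_bool (u \<in> B i))" using fS by (simp add: sum_of_bool_eq)
 qed
 also have "\<dots> = (\<Sum>u\<in>S. \<Sum>i\<le>D. of_bool (u \<in> B i))" by (rule sum.swap)
 also have "\<dots> \<le> (\<Sum>u\<in>S. 2 * \<rho> + 1)"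
 proof (rule sum_mono)
  fix u assume "u \<in> S"
  have "(\<Sum>i\<le>D. of_bool (u \<in> B i)) = card ({..D} \<inter> {i. u \<in> B i})" by (simp add: sum_of_bool_eq)
  also have "\<dots> \<le> card {dst u - \<rho>..dst u + \<rho>}"
   by (rule card_mono) (use near in \<open>fastforce\<close>)+
  also have "\<dots> \<le> 2 * \<rho> + 1" by simp
  finally show "(\<Sum>i\<le>D. of_bool (u \<in> B i)) \<le> 2 * \<rho> + 1" .
 qed
 also have "\<dots> = card S * (2 * \<rho> + 1)" by simp
 also have "\<dots> \<le> (4 * (card V)\<^sup>2 * (D + 1)) * (2 * \<rho> + 1)" by (rule mult_le_mono1[OF upper])
 also have "\<dots> = (\<Sum>i\<le>D. 4 * (card V)\<^sup>2 * (2 * \<rho> + 1))" by (simp add: algebra_simps)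
 also have "\<dots> < (\<Sum>i\<le>D. card (B i))"
  by (rule sum_strict_mono_ex1) (use cB cB1 in auto)
 finally show False by simp
qed

text \<open>Cross the recurrent edge and return along a path that avoids its colour. A nontrivial
  loop at the same vertex avoiding this colour is the second word.\<close>

lemma crossing_pair:
 assumes z0: "z0 \<in> V \<times> X"
 shows "\<exists>p g h e. set (p @ g @ h) \<subseteq> letters m \<and> wk st g (wk st p (fst z0)) = wk st p (fst z0) \<and>
  wk st h (wk st p (fst z0)) = wk st p (fst z0) \<and> wk sx g (wk sx p (snd z0)) = wk sx p (snd z0) \<and>
  wk sx h (wk sx p (snd z0)) = wk sx p (snd z0) \<and> count_list (tr sx g (wk sx p (snd z0))) e = 1 \<and>
  reduced h \<and> h \<noteq> [] \<and> e \<notin> set (tr sx h (wk sx p (snd z0)))"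
proof -
 obtain y l where y: "y \<in> full z0" "l \<in> drt st E (fst y)" "sk l y \<in> comp (edg sx l (snd y)) y" using recurrent_edge[OF z0] by blast
 define e where "e = edg sx l (snd y)"
 have yV: "y \<in> V \<times> X" using full_VX[OF z0] y(1) by blast
 then have yX: "snd y \<in> X" by (simp add: mem_Times_iff)
 obtain p where p: "y = wk sk p z0" "set (tr st p (fst z0)) \<subseteq> E" using y(1) by (auto simp: full_def)
 obtain w where w: "sk l y = wk sk w y" "av e w y" using y(3) by (auto simp: comp_def e_def)
 obtain h where h: "reduced h" "h \<noteq> []" "av e h y" "wk sk h y = y" by (rule nontrivial_loop[OF yV])
 have pl: "set p \<subseteq> letters m" by (rule tr_E_letters[OF p(2)])
 have wl: "set w \<subseteq> letters m" "set h \<subseteq> letters m" using w(2) h(3) tr_E_letters unfolding av_def by blast+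
 have ll: "l \<in> letters m" using y(2) drt_letters[OF cD(3)] by blast
 have wy: "st l (fst y) = wk st w (fst y)" "sx l (snd y) = wk sx w (snd y)" using w(1) by (simp_all add: sk_def wk_sk)
 let ?g = "l # winv w"
 have "tr sx ?g (snd y) = e # rev (tr sx w (snd y))" using tr_winv[OF symx yX, of w] wy(2) by (simp add: e_def)
 then have cnt: "count_list (tr sx ?g (snd y)) e = 1" using w(2) by (simp add: av_def count_notin)
 have "wk st ?g (fst y) = fst y" "wk sx ?g (snd y) = snd y" using wy wk_winv[OF sym UNIV_I, of w "fst y"] wk_winv[OF symx yX, of w] by simp_all
 moreover have "wk st h (fst y) = fst y" "wk sx h (snd y) = snd y" using h(4) by (auto simp: wk_sk prod_eq_iff)
 moreover have "e \<notin> set (tr sx h (snd y))" using h(3) by (simp add: av_def)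
 ultimately show ?thesis using pl wl ll cnt h(1,2) p(1)
  by (intro exI[of _ p] exI[of _ ?g] exI[of _ h] exI[of _ e]) (simp add: wk_sk)
qed

end

declare split_paired_All [simp] split_paired_Ex [simp]

section \<open>Two random automorphisms\<close>

context letter_group
begin

definition orb :: "config \<Rightarrow> nat \<Rightarrow> nat list \<Rightarrow> nat list set" where
 "orb s n u = reach (stp s) ({..<2} \<times> level d n) u"

lemma orb_iff:
 assumes "valid s" "u \<in> level d n"
 shows "y \<in> orb s n u \<longleftrightarrow> (\<exists>w. set w \<subseteq> letters 2 \<and> wks s w u = y)"
proof
 assume "y \<in> orb s n u"
 then obtain w where w: "y = wks s w u" "set (tr (stp s) w u) \<subseteq> {..<2} \<times> level d n" by (auto simp: orb_def reach_def)
 then show "\<exists>w. set w \<subseteq> letters 2 \<and> wks s w u = y" using tr_letters[OF w(2)] by auto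
next
 assume "\<exists>w. set w \<subseteq> letters 2 \<and> wks s w u = y"
 then obtain w where w: "set w \<subseteq> letters 2" "wks s w u = y" by blast
 show "y \<in> orb s n u" unfolding orb_def reach_def
  by (intro CollectI exI[of _ w] conjI w(2)[symmetric] tr_level[OF assms w(1)])
qed

lemma orb_level: "valid s ==> u \<in> level d n ==> orb s n u \<subseteq> level d n"
 unfolding orb_def by (rule reach_subset[OF sym_act_level])

lemma finite_orb: "valid s ==> u \<in> level d n ==> finite (orb s n u)"
 by (rule finite_subset[OF orb_level]) auto

lemma self_orb: "u \<in> orb s n u"
 by (simp add: orb_def)

lemma card_orb_pos: "valid s ==> u \<in> level d n ==> 0 < card (orb s n u)"
 using finite_orb[of s u n] self_orb[of u s n] by (auto simp: card_gt_0_iff)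

lemma orb_upd: "length u \<le> length (snd q) ==> orb (s(q := h)) n u = orb s n u"
 unfolding orb_def reach_def by (simp add: wks_upd tr_upd)

lemma orb_restr:
 assumes "valid s" "u \<in> level d n" "n \<le> N"
 shows "orb (restr 2 N s) n u = orb s n u"
proof (rule Set.set_eqI)
 fix y
 have "wks (restr 2 N s) w u = wks s w u" if "set w \<subseteq> letters 2" for w by (rule wks_restr[OF assms that])
 then show "y \<in> orb (restr 2 N s) n u \<longleftrightarrow> y \<in> orb s n u"
  unfolding orb_iff[OF assms(1,2)] orb_iff[OF valid_restr[OF assms(1)] assms(2)] by auto
qed

text \<open>On an orbit of size \<open>c\<close> two generators give \<open>2 * c\<close> edges, and
  a spanning tree uses \<open>c - 1\<close> of them, leaving \<open>c + 1\<close> chords. The loop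
  through one chord meets no other chord, so the pattern is even diagonal.\<close>

lemma chord_words:
 assumes s: "valid s" and u: "u \<in> level d n" and L: "L \<le> card (orb s n u) + 1"
 obtains g e where "\<And>j. j < L ==> set (g j) \<subseteq> letters 2" "tri s L g u e"
proof -
 let ?E = "{..<2::nat} \<times> level d n" and ?O = "orb s n u"
 have sym: "sym_act (stp s) (level d n)" by (rule sym_act_level[OF s])
 have fO: "finite ?O" by (rule finite_orb[OF s u])
 obtain T \<tau> where T: "T \<subseteq> ?E" "finite T" "Suc (card T) = card ?O" and "\<tau> u = []"
  and \<tau>: "\<And>y. y \<in> ?O ==> wks s (\<tau> y) u = y" "\<And>y. y \<in> ?O ==> set (tr (stp s) (\<tau> y) u) \<subseteq> T"
  and "\<And>y l. y \<in> ?O ==> edg (stp s) l y \<in> T ==> \<tau> (stp s l y) = \<tau> y @ [l] \<or> \<tau> y = \<tau> (stp s l y) @ [linv l]"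
  by (rule spanning_tree[OF sym u fO[unfolded orb_def], folded orb_def]) (rule that)
 define Ch where "Ch = ({..<2} \<times> ?O) - T"
 have fC: "finite Ch" using fO by (simp add: Ch_def)
 have "card ({..<2::nat} \<times> ?O) \<le> card Ch + card T"
  unfolding Ch_def using diff_card_le_card_Diff[OF T(2), of "{..<2} \<times> ?O"] by linarith
 then have "L \<le> card Ch" using L T(3) by (simp add: card_cartesian_product)
 moreover obtain f where f: "bij_betw f {0..<card Ch} Ch" using ex_bij_betw_nat_finite[OF fC] ..
 ultimately have fj: "f j \<in> Ch" if "j < L" for j using that by (auto simp: bij_betw_def)
 have finj: "f j \<noteq> f k" if "j < L" "k < L" "j \<noteq> k" for j k
  using that f \<open>L \<le> card Ch\<close> by (auto simp: bij_betw_def inj_on_def)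
 define z where "z p = stp s (fst p, True) (snd p)" for p
 define g where "g j = \<tau> (snd (f j)) @ [(fst (f j), True)] @ winv (\<tau> (z (f j)))" for j
 have zO: "z p \<in> ?O" if "p \<in> Ch" for p
 proof -
  have "snd p \<in> ?O" "fst p < 2" using that by (auto simp: Ch_def)
  then have "edg (stp s) (fst p, True) (snd p) \<in> ?E" using orb_level[OF s u] by (auto simp: edg_def mem_Times_iff)
  from reach_step[OF \<open>snd p \<in> ?O\<close>[unfolded orb_def] this] show ?thesis by (simp only: orb_def z_def)
 qed
 have trg: "tr (stp s) (g j) u = tr (stp s) (\<tau> (snd (f j))) u @ [f j] @ rev (tr (stp s) (\<tau> (z (f j))) u)" if "j < L" for j
 proof -
  have O: "snd (f j) \<in> ?O" using fj[OF that] by (auto simp: Ch_def)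
  have "tr (stp s) (winv (\<tau> (z (f j)))) (z (f j)) = rev (tr (stp s) (\<tau> (z (f j))) u)"
   using tr_winv[OF sym u, of "\<tau> (z (f j))"] \<tau>(1)[OF zO[OF fj[OF that]]] by simp
  then show ?thesis using \<tau>(1)[OF O] by (simp add: g_def edg_def z_def)
 qed
 have sub: "set (tr (stp s) (g j) u) \<subseteq> insert (f j) T" if "j < L" for j
  using fj[OF that] \<tau>(2)[OF zO[OF fj[OF that]]] \<tau>(2)[of "snd (f j)"] trg[OF that] by (auto simp: Ch_def)
 have "set (g j) \<subseteq> letters 2" if "j < L" for j
 proof (rule tr_letters)
  show "set (tr (stp s) (g j) u) \<subseteq> {..<2} \<times> UNIV" using sub[OF that] T(1) fj[OF that] by (auto simp: Ch_def)
 qed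
 moreover have "tri s L g u f"
  unfolding tri_def
 proof (intro allI impI conjI)
  fix j assume j: "j < L"
  have O: "snd (f j) \<in> ?O" using fj[OF j] by (auto simp: Ch_def)
  show "wks s (g j) u = u"
   using \<tau>(1)[OF O] wk_winv[OF sym u, of "\<tau> (z (f j))"] \<tau>(1)[OF zO[OF fj[OF j]]] by (simp add: g_def z_def)
  have "f j \<notin> T" using fj[OF j] by (simp add: Ch_def)
  then have "f j \<notin> set (tr (stp s) (\<tau> (snd (f j))) u)" "f j \<notin> set (tr (stp s) (\<tau> (z (f j))) u)"
   using \<tau>(2)[OF O] \<tau>(2)[OF zO[OF fj[OF j]]] by auto
  then show "count_list (tr (stp s) (g j) u) (f j) = 1" unfolding trg[OF j] by (simp add: count_notin)
  fix k assume k: "k < L" "j < k"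
  then show "f j \<notin> set (tr (stp s) (g k) u)" using sub[OF k(1)] \<open>f j \<notin> T\<close> finj[of j k] j by auto
 qed
 ultimately show thesis by (rule that)
qed

text \<open>First resample the edge \<open>e s 0\<close>, which the second word avoids, and then
  \<open>e s 1\<close>; each resampling contributes a factor \<open>1 / d\<close>.\<close>

lemma EE_two_fixed:
 assumes v: "v \<in> level d k" and k: "k < N" and x: "x < d"
  and g: "\<And>s j. valid s ==> j < 2 ==> set (g s j) \<subseteq> letters m"
  and t: "\<And>s. valid s ==> tri s 2 (g s) v (e s)"
  and inv: "\<And>s q h. s \<in> Cfg m N ==> length (snd q) = k ==> h \<in> H ==>
   g (s(q := h)) = g s \<and> e (s(q := h)) = e s \<and> W (s(q := h)) = W s"
 shows "EE m N (\<lambda>s. W s * (of_bool (whol s (g s 0) v x = x) * of_bool (whol s (g s 1) v x = x))) = (1 / d)\<^sup>2 * EE m N W"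
proof -
 have lv: "length v = k" using v by (simp add: level_iff)
 have once: "count_list (tr (stp s) (g s j) v) (e s j) = 1" if "s \<in> Cfg m N" "j < 2" for s j
  using t[OF valid_Cfg[OF that(1)]] that(2) by (auto simp: tri_def)
 have eI: "e s j \<in> {..<m} \<times> level d k" if "s \<in> Cfg m N" "j < 2" for s j
 proof -
  have "e s j \<in> set (tr (stp s) (g s j) v)" using once[OF that] by (metis count_notin zero_neq_one)
  then show ?thesis using tr_level[OF valid_Cfg[OF that(1)] v g[OF valid_Cfg[OF that(1)] that(2)]] by auto
 qed
 have eInd: "e s j \<in> Ind m N" if "s \<in> Cfg m N" "j < 2" for s j
  using eI[OF that] k by (auto simp: Ind_def)
 have el: "length (snd (e s j)) = k" if "s \<in> Cfg m N" "j < 2" for s j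
  using eI[OF that] by (auto simp: level_iff)
 have hol: "(\<Sum>h\<in>H. of_bool (whol (s(e s j := h)) (g s j) v x = x)) = card H / d" if "s \<in> Cfg m N" "j < 2" for s j
  using card_hol_once[OF valid_Cfg[OF that(1)] once[OF that] x x] by (simp add: sum_of_bool_eq Int_def)
 have "EE m N (\<lambda>s. W s * (of_bool (whol s (g s 0) v x = x) * of_bool (whol s (g s 1) v x = x))) =
  EE m N (\<lambda>s. 1 / d * (W s * of_bool (whol s (g s 1) v x = x)))"
 proof (subst EE_resample[where e = "\<lambda>s. e s 0"])
  fix s assume s: "s \<in> Cfg m N"
  show "e s 0 \<in> Ind m N" using eInd[OF s] by simp
  fix h assume "h \<in> H"
  then show "e (s(e s 0 := h)) 0 = e s 0" using inv[OF s, of "e s 0"] el[OF s] by simp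
 next
  show "EE m N (\<lambda>s. (\<Sum>h\<in>H. W (s(e s 0 := h)) * (of_bool (whol (s(e s 0 := h)) (g (s(e s 0 := h)) 0) v x = x) *
    of_bool (whol (s(e s 0 := h)) (g (s(e s 0 := h)) 1) v x = x))) / card H) =
   EE m N (\<lambda>s. 1 / d * (W s * of_bool (whol s (g s 1) v x = x)))"
  proof (rule EE_cong)
   fix s assume s: "s \<in> Cfg m N"
   have len: "length (snd (e s 0)) = k" using el[OF s] by simp
   have "e s 0 \<notin> set (tr (stp s) (g s 1) v)" using t[OF valid_Cfg[OF s]] by (auto simp: tri_def)
   then have "whol (s(e s 0 := h)) (g s 1) v = whol s (g s 1) v" for h using len lv by (intro whol_upd) auto
   then have "(\<Sum>h\<in>H. W (s(e s 0 := h)) * (of_bool (whol (s(e s 0 := h)) (g (s(e s 0 := h)) 0) v x = x) *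
     of_bool (whol (s(e s 0 := h)) (g (s(e s 0 := h)) 1) v x = x))) =
    (\<Sum>h\<in>H. W s * of_bool (whol s (g s 1) v x = x) * of_bool (whol (s(e s 0 := h)) (g s 0) v x = x))"
    using inv[OF s len] by (intro sum.cong refl) simp
   also have "\<dots> = W s * of_bool (whol s (g s 1) v x = x) * (card H / d)"
    using hol[OF s, of 0] by (simp only: sum_distrib_left[symmetric])
   finally show "(\<Sum>h\<in>H. W (s(e s 0 := h)) * (of_bool (whol (s(e s 0 := h)) (g (s(e s 0 := h)) 0) v x = x) *
     of_bool (whol (s(e s 0 := h)) (g (s(e s 0 := h)) 1) v x = x))) / card H = 1 / d * (W s * of_bool (whol s (g s 1) v x = x))"
    using card_H_pos by simp
  qed
 qed
 also have "\<dots> = 1 / d * EE m N (\<lambda>s. W s * of_bool (whol s (g s 1) v x = x))" by (rule EE_cmult)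
 also have "EE m N (\<lambda>s. W s * of_bool (whol s (g s 1) v x = x)) = EE m N (\<lambda>s. 1 / d * W s)"
 proof (subst EE_resample[where e = "\<lambda>s. e s 1"])
  fix s assume s: "s \<in> Cfg m N"
  show "e s 1 \<in> Ind m N" using eInd[OF s] by simp
  fix h assume "h \<in> H"
  then show "e (s(e s 1 := h)) 1 = e s 1" using inv[OF s, of "e s 1"] el[OF s] by simp
 next
  show "EE m N (\<lambda>s. (\<Sum>h\<in>H. W (s(e s 1 := h)) * of_bool (whol (s(e s 1 := h)) (g (s(e s 1 := h)) 1) v x = x)) / card H) =
   EE m N (\<lambda>s. 1 / d * W s)"
  proof (rule EE_cong)
   fix s assume s: "s \<in> Cfg m N"
   have len: "length (snd (e s 1)) = k" using el[OF s] by simp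
   have "(\<Sum>h\<in>H. W (s(e s 1 := h)) * of_bool (whol (s(e s 1 := h)) (g (s(e s 1 := h)) 1) v x = x)) =
    (\<Sum>h\<in>H. W s * of_bool (whol (s(e s 1 := h)) (g s 1) v x = x))"
    using inv[OF s len] by (intro sum.cong refl) simp
   also have "\<dots> = W s * (card H / d)"
    using hol[OF s, of 1] by (simp only: sum_distrib_left[symmetric])
   finally show "(\<Sum>h\<in>H. W (s(e s 1 := h)) * of_bool (whol (s(e s 1 := h)) (g (s(e s 1 := h)) 1) v x = x)) / card H = 1 / d * W s"
    using card_H_pos by simp
  qed
 qed
 also have "\<dots> = 1 / d * EE m N W" by (rule EE_cmult)
 finally show ?thesis by (simp add: power2_eq_square)
qed

text \<open>Transport along words keeps at least one child of every orbit point. If a loop at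
  \<open>u\<close> moves the letter \<open>x\<close>, running through it first reaches a second
  child of each of them.\<close>

lemma orb_child:
 assumes s: "valid s" and u: "u \<in> level d k" and x: "x < d"
 shows "card (orb s k u) \<le> card (orb s (Suc k) (u @ [x]))"
  and "set g \<subseteq> letters 2 ==> wks s g u = u ==> whol s g u x \<noteq> x ==> 2 * card (orb s k u) \<le> card (orb s (Suc k) (u @ [x]))"
proof -
 have ux: "u @ [x] \<in> level d (Suc k)" using u x by (simp add: level_snoc)
 have "\<exists>w. set w \<subseteq> letters 2 \<and> wks s w u = y" if "y \<in> orb s k u" for y using that orb_iff[OF s u] by blast
 then obtain t where t: "\<And>y. y \<in> orb s k u ==> set (t y) \<subseteq> letters 2 \<and> wks s (t y) u = y" by metis
 have mem: "wks s (t y) (u @ [x']) = y @ [whol s (t y) u x']" if "y \<in> orb s k u" for y x' using t[OF that] by (simp add: wks_snoc)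
 show "card (orb s k u) \<le> card (orb s (Suc k) (u @ [x]))"
 proof (rule card_inj_on_le)
  show "inj_on (\<lambda>y. wks s (t y) (u @ [x])) (orb s k u)" by (rule inj_onI) (simp add: mem)
  show "(\<lambda>y. wks s (t y) (u @ [x])) ` orb s k u \<subseteq> orb s (Suc k) (u @ [x])"
  proof (rule image_subsetI)
   fix y assume "y \<in> orb s k u"
   then have "set (t y) \<subseteq> letters 2" using t by blast
   then show "wks s (t y) (u @ [x]) \<in> orb s (Suc k) (u @ [x])" unfolding orb_iff[OF s ux] by (intro exI[of _ "t y"] conjI refl)
  qed
 qed (rule finite_orb[OF s ux])
 assume g: "set g \<subseteq> letters 2" "wks s g u = u" "whol s g u x \<noteq> x"
 let ?f = "\<lambda>p. wks s ((if snd p then g else []) @ t (fst p)) (u @ [x])"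
 have f: "?f p = fst p @ [whol s (t (fst p)) u (if snd p then whol s g u x else x)]" if "fst p \<in> orb s k u" for p
  using mem[OF that] g(2) by (simp add: wks_snoc)
 have "card (orb s k u \<times> (UNIV :: bool set)) \<le> card (orb s (Suc k) (u @ [x]))"
 proof (rule card_inj_on_le)
  show "inj_on ?f (orb s k u \<times> UNIV)"
  proof (rule inj_onI)
   fix p q assume pq: "p \<in> orb s k u \<times> UNIV" "q \<in> orb s k u \<times> UNIV" "?f p = ?f q"
   then have e: "fst p = fst q" "whol s (t (fst p)) u (if snd p then whol s g u x else x) = whol s (t (fst q)) u (if snd q then whol s g u x else x)"
   proof -
    have m: "fst p \<in> orb s k u" "fst q \<in> orb s k u" using pq(1,2) by (simp_all add: mem_Times_iff)
    have "fst p @ [whol s (t (fst p)) u (if snd p then whol s g u x else x)] = fst q @ [whol s (t (fst q)) u (if snd q then whol s g u x else x)]"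
     using pq(3) unfolding f[OF m(1)] f[OF m(2)] .
    then have c: "fst p = fst q \<and> whol s (t (fst p)) u (if snd p then whol s g u x else x) = whol s (t (fst q)) u (if snd q then whol s g u x else x)"
     by (rule iffD1[OF append1_eq_conv])
    show "fst p = fst q" "whol s (t (fst p)) u (if snd p then whol s g u x else x) = whol s (t (fst q)) u (if snd q then whol s g u x else x)"
     by (rule conjunct1[OF c], rule conjunct2[OF c])
   qed
   have "inj (whol s (t (fst p)) u)" using H_bij[OF whol_in_H[OF s]] by (rule bij_is_inj)
   from injD[OF this e(2)[folded e(1)]] have "(if snd p then whol s g u x else x) = (if snd q then whol s g u x else x)" .
   then have "snd p = snd q" using g(3) by (auto split: if_splits)
   then show "p = q" using e(1) by (simp add: prod_eq_iff)
  qed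
  show "?f ` (orb s k u \<times> UNIV) \<subseteq> orb s (Suc k) (u @ [x])"
  proof (rule image_subsetI)
   fix p assume "p \<in> orb s k u \<times> (UNIV :: bool set)"
   then have "fst p \<in> orb s k u" by (simp add: mem_Times_iff)
   then have "set ((if snd p then g else []) @ t (fst p)) \<subseteq> letters 2" using t[of "fst p"] g(1) by (cases "snd p") simp_all
   then show "?f p \<in> orb s (Suc k) (u @ [x])" unfolding orb_iff[OF s ux]
    by (intro exI[of _ "(if snd p then g else []) @ t (fst p)"] conjI refl)
  qed
 qed (rule finite_orb[OF s ux])
 then show "2 * card (orb s k u) \<le> card (orb s (Suc k) (u @ [x]))" by (simp add: card_cartesian_product)
qed

text \<open>A high moment of the reciprocal orbit sizes. The exponent makes
  \<open>d * (1 / 2) ^ (3 * d)\<close> at most one quarter, so that doubling an orbit outweighs the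
  branching of the tree.\<close>

definition pot :: "nat \<Rightarrow> config \<Rightarrow> real" where
 "pot k s = (\<Sum>u\<in>level d k. (1 / real (card (orb s k u))) ^ (3 * d))"

text \<open>At every vertex two loops in triangular position exist. Both fix a given child with
  probability \<open>1 / d^2\<close>, and otherwise the orbit of that child at least doubles. Over
  the \<open>d\<close> children this gives the factor
  \<open>d * (1 / d^2 + (1 / 2) ^ (3 * d))\<close>, at most \<open>1 / 2 + 1 / 4\<close>. A single
  loop would only give \<open>d * (1 / d)\<close>, which is not less than one.\<close>

lemma EE_pot_Suc:
 assumes k: "k < N"
 shows "EE 2 N (pot (Suc k)) \<le> 3 / 4 * EE 2 N (pot k)"
proof -
 let ?p = "3 * d"
 define W where "W u s = (1 / real (card (orb s k u))) ^ ?p" for u s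
 have W0: "0 \<le> W u s" for u s by (simp add: W_def)
 have "\<exists>ge. (\<forall>j<2. set (fst ge j) \<subseteq> letters 2) \<and> tri s 2 (fst ge) u (snd ge)" if vu: "valid s" "u \<in> level d k" for s u
 proof -
  have "2 \<le> card (orb s k u) + 1" using card_orb_pos[OF vu] by simp
  then obtain g e where "\<And>j. j < 2 ==> set (g j) \<subseteq> letters 2" "tri s 2 g u e" by (rule chord_words[OF vu]) (rule that)
  then show ?thesis by (intro exI[of _ "(g, e)"]) simp
 qed
 then obtain ge where ge: "\<And>s u. valid s ==> u \<in> level d k ==> (\<forall>j<2. set (fst (ge s u) j) \<subseteq> letters 2) \<and> tri s 2 (fst (ge s u)) u (snd (ge s u))"
  by metis
 \<comment> \<open>The words are chosen from the truncation to levels below \<open>k\<close>, so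
   resampling a label of level \<open>k\<close> does not change them.\<close>
 define g where "g u s = fst (ge (restr 2 k s) u)" for u s
 define e where "e u s = snd (ge (restr 2 k s) u)" for u s
 have g: "set (g u s j) \<subseteq> letters 2" if "valid s" "u \<in> level d k" "j < 2" for u s j
  using ge[OF valid_restr[OF that(1)] that(2)] that(3) by (auto simp: g_def)
 have t: "tri s 2 (g u s) u (e u s)" if "valid s" "u \<in> level d k" for u s
 proof -
  have "tri (restr 2 k s) 2 (g u s) u (e u s)" using ge[OF valid_restr[OF that(1)] that(2)] by (auto simp: g_def e_def)
  then show ?thesis using depD[OF dep_tri[OF that(2) order_refl, of 2 "g u s" 2 "e u s"] that(1)] g[OF that] by simp
 qed
 have inv: "g u (s(q := h)) = g u s \<and> e u (s(q := h)) = e u s \<and> W u (s(q := h)) = W u s" if "length (snd q) = k" "u \<in> level d k" for u s q h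
 proof -
  have "q \<notin> Ind 2 k" using that(1) by (cases q) (auto simp: Ind_iff)
  then show ?thesis using that by (simp add: g_def e_def W_def restr_upd orb_upd level_iff)
 qed
 define F where "F u x s = (of_bool (whol s (g u s 0) u x = x) * of_bool (whol s (g u s 1) u x = x) :: real)" for u x s
 have F: "EE 2 N (\<lambda>s. W u s * F u x s) = (1 / d)\<^sup>2 * EE 2 N (W u)" if u: "u \<in> level d k" and x: "x < d" for u x
  unfolding F_def
 proof (rule EE_two_fixed[OF u k x, where g = "g u" and e = "e u"])
  fix s and j :: nat assume "valid s" "j < 2"
  then show "set (g u s j) \<subseteq> letters 2" by (rule g[OF _ u])
 next
  fix s assume "valid s"
  then show "tri s 2 (g u s) u (e u s)" by (rule t[OF _ u])
 next
  fix s :: config and q :: "nat \<times> nat list" and h :: "nat \<Rightarrow> nat" assume "length (snd q) = k"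
  then show "g u (s(q := h)) = g u s \<and> e u (s(q := h)) = e u s \<and> W u (s(q := h)) = W u s" by (rule inv[OF _ u])
 qed
 have "EE 2 N (pot (Suc k)) \<le> EE 2 N (\<lambda>s. \<Sum>u\<in>level d k. \<Sum>x<d. W u s * F u x s + (1 / 2) ^ ?p * W u s)"
 proof (rule EE_mono)
  fix s assume "s \<in> Cfg 2 N"
  then have s: "valid s" by (rule valid_Cfg)
  show "pot (Suc k) s \<le> (\<Sum>u\<in>level d k. \<Sum>x<d. W u s * F u x s + (1 / 2) ^ ?p * W u s)"
   unfolding pot_def sum_level_Suc
  proof (intro sum_mono)
   fix u x assume u: "u \<in> level d k" and "x \<in> {..<d}"
   then have x: "x < d" by simp
   let ?c = "real (card (orb s k u))" and ?c' = "real (card (orb s (Suc k) (u @ [x])))"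
   have c0: "0 < ?c" using card_orb_pos[OF s u] by simp
   have t': "wks s (g u s j) u = u" if "j < 2" for j using t[OF s u] that by (auto simp: tri_def)
   show "(1 / ?c') ^ ?p \<le> W u s * F u x s + (1 / 2) ^ ?p * W u s"
   proof (cases "F u x s = 1")
    case True
    have "?c \<le> ?c'" using orb_child(1)[OF s u x] by simp
    then have "1 / ?c' \<le> 1 / ?c" using c0 by (simp add: frac_le)
    then have "(1 / ?c') ^ ?p \<le> W u s" unfolding W_def by (intro power_mono) auto
    moreover have "0 \<le> (1 / 2) ^ ?p * W u s" using W0 by simp
    ultimately show ?thesis using True by simp
   next
    case False
    then have "whol s (g u s 0) u x \<noteq> x \<or> whol s (g u s 1) u x \<noteq> x" by (auto simp: F_def)
    then obtain j where j: "j < 2" "whol s (g u s j) u x \<noteq> x" by (metis one_less_numeral_iff pos2 semiring_norm(76))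
    have "2 * ?c \<le> ?c'" using orb_child(2)[OF s u x g[OF s u j(1)] t'[OF j(1)] j(2)] by linarith
    then have "1 / ?c' \<le> 1 / (2 * ?c)" using c0 by (intro frac_le) auto
    then have "(1 / ?c') ^ ?p \<le> (1 / (2 * ?c)) ^ ?p" by (intro power_mono) auto
    also have "\<dots> = (1 / 2) ^ ?p * W u s" unfolding W_def by (simp add: power_mult_distrib[symmetric])
    finally have "(1 / ?c') ^ ?p \<le> (1 / 2) ^ ?p * W u s" .
    moreover have "0 \<le> W u s * F u x s" using W0[of u s] by (simp add: F_def)
    ultimately show ?thesis by linarith
   qed
  qed
 qed
 also have "\<dots> = (\<Sum>u\<in>level d k. \<Sum>x<d. EE 2 N (\<lambda>s. W u s * F u x s) + (1 / 2) ^ ?p * EE 2 N (W u))"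
  by (simp add: EE_sum EE_add EE_cmult)
 also have "\<dots> = (\<Sum>u\<in>level d k. \<Sum>x<d. (1 / d)\<^sup>2 * EE 2 N (W u) + (1 / 2) ^ ?p * EE 2 N (W u))"
  using F by (intro sum.cong refl) auto
 also have "\<dots> = (\<Sum>u\<in>level d k. (real d * ((1 / d)\<^sup>2 + (1 / 2) ^ ?p)) * EE 2 N (W u))"
  by (simp add: algebra_simps)
 also have "\<dots> \<le> (\<Sum>u\<in>level d k. 3 / 4 * EE 2 N (W u))"
 proof (intro sum_mono mult_right_mono EE_nonneg W0)
  have "real d * (1 / d)\<^sup>2 \<le> 1 / 2" using d2 by (simp add: power2_eq_square field_simps)
  moreover have "real d * (1 / 2) ^ ?p \<le> 1 / 4"
  proof -
   have "real d \<le> 2 ^ d" by (metis less_exp less_imp_le of_nat_le_iff of_nat_numeral of_nat_power)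
   then have "real d * (1 / 2) ^ ?p \<le> 2 ^ d * (1 / 2) ^ ?p" by (intro mult_right_mono) auto
   also have "\<dots> = (2 * (1 / 2) ^ 3) ^ d" by (simp only: power_mult power_mult_distrib)
   also have "\<dots> = (1 / 4) ^ d" by (simp add: power3_eq_cube)
   also have "\<dots> \<le> (1 / 4) ^ 1" using d2 by (intro power_decreasing) auto
   finally show ?thesis by simp
  qed
  ultimately show "real d * ((1 / d)\<^sup>2 + (1 / 2) ^ ?p) \<le> 3 / 4" by (simp add: distrib_left)
 qed
 also have "\<dots> = 3 / 4 * EE 2 N (pot k)" unfolding pot_def EE_sum sum_distrib_left[symmetric] W_def ..
 finally show ?thesis .
qed

lemma EE_pot: "k \<le> N ==> EE 2 N (pot k) \<le> (3 / 4) ^ k"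
proof (induction k)
 case 0
 have "orb s 0 [] = {[]}" for s
  unfolding orb_def reach_def by (auto intro!: exI[of _ "[]"])
 then show ?case by (simp add: pot_def)
next
 case (Suc k)
 then show ?case using EE_pot_Suc[of k N] by simp
qed

text \<open>Two elements need not be good themselves; what holds almost surely is that every subtree
  at some common depth carries good cocycles of words in them.\<close>

definition Gen :: "config \<Rightarrow> bool" where
 "Gen s \<longleftrightarrow> (\<exists>k. \<forall>u\<in>level d k. \<exists>M g. (\<forall>j<M. set (g j) \<subseteq> letters 2 \<and> wks s (g j) u = u) \<and> Good M (derv s g u))"

text \<open>Fix the truncation to level \<open>k\<close>. Unless some orbit has at most
  \<open>M\<close> points, there are \<open>M\<close> words in triangular position at every vertex,
  and conditionally their cocycles form a Haar family, good up to probability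
  \<open>\<epsilon>good M\<close>. The last term is the union bound over the \<open>d ^ k\<close>
  vertices.\<close>

lemma haar_Gen_approx:
 assumes h: "haar M0 2 S" and M: "d < M"
 obtains B where "B \<in> sets M0" "{\<omega>\<in>space M0. \<not> Gen (S \<omega>)} \<subseteq> B"
  "measure M0 B \<le> real M ^ (3 * d) * (3 / 4) ^ k + real d ^ k * \<epsilon>good M"
proof -
 interpret prob_space M0 by (rule haar_prob_space[OF h])
 let ?p = "3 * d"
 define small where "small s \<longleftrightarrow> (\<exists>u\<in>level d k. card (orb s k u) \<le> M)" for s
 have dep: "dep 2 k small" unfolding dep_def small_def using orb_restr[of _ _ k k] by simp
 define B0 where "B0 = {\<omega>\<in>space M0. small (S \<omega>)}"
 have B0: "B0 \<in> sets M0" unfolding B0_def by (rule haar_event(1)[OF h dep])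
 have "measure M0 B0 = EE 2 k (\<lambda>s. of_bool (small s))" unfolding B0_def by (rule haar_event(2)[OF h dep])
 \<comment> \<open>Markov's inequality for \<open>pot\<close>: an orbit with at most
   \<open>M\<close> points alone contributes at least \<open>1 / M ^ (3 * d)\<close>.\<close>
 also have "\<dots> \<le> EE 2 k (\<lambda>s. real M ^ ?p * pot k s)"
 proof (rule EE_mono)
  fix s assume "s \<in> Cfg 2 k"
  then have s: "valid s" by (rule valid_Cfg)
  show "of_bool (small s) \<le> real M ^ ?p * pot k s"
  proof (cases "small s")
   case True
   then obtain u where u: "u \<in> level d k" "card (orb s k u) \<le> M" by (auto simp: small_def)
   have "0 < card (orb s k u)" by (rule card_orb_pos[OF s u(1)])
   then have "1 \<le> real M * (1 / card (orb s k u))" using u(2) by (simp add: field_simps)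
   then have "1 \<le> (real M * (1 / card (orb s k u))) ^ ?p" by (rule one_le_power)
   also have "\<dots> = real M ^ ?p * (1 / card (orb s k u)) ^ ?p" by (rule power_mult_distrib)
   also have "\<dots> \<le> real M ^ ?p * pot k s" unfolding pot_def
    by (intro mult_left_mono member_le_sum[OF u(1)]) auto
   finally show ?thesis by simp
  qed (simp add: pot_def sum_nonneg)
 qed
 also have "\<dots> = real M ^ ?p * EE 2 k (pot k)" by (rule EE_cmult)
 also have "\<dots> \<le> real M ^ ?p * (3 / 4) ^ k" by (intro mult_left_mono EE_pot) auto
 finally have mB0: "measure M0 B0 \<le> real M ^ ?p * (3 / 4) ^ k" .
 define A where "A c = {\<omega>\<in>space M0. restr 2 k (S \<omega>) = c}" for c
 define Cs where "Cs = {c\<in>Cfg 2 k. \<not> small c}"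
 have A: "A c \<in> sets M0" "measure M0 (A c) = 1 / card (Cfg 2 k)" if "c \<in> Cs" for c
 proof -
  have "c \<in> Cfg 2 k" using that by (simp add: Cs_def)
  then have "{\<omega>\<in>space M0. restr 2 k (S \<omega>) = c} \<in> sets M0 \<and> measure M0 {\<omega>\<in>space M0. restr 2 k (S \<omega>) = c} = 1 / card (Cfg 2 k)"
   using h unfolding haar_def by simp
  then show "A c \<in> sets M0" "measure M0 (A c) = 1 / card (Cfg 2 k)" by (simp_all add: A_def)
 qed
 define works where "works u s \<longleftrightarrow> (\<exists>g. (\<forall>j<M. set (g j) \<subseteq> letters 2 \<and> wks s (g j) u = u) \<and> Good M (derv s g u))" for u s
 define PP where "PP c u B \<longleftrightarrow> {\<omega>\<in>A c. \<not> works u (S \<omega>)} \<subseteq> B \<and> B \<in> sets M0 \<and> measure M0 B \<le> \<epsilon>good M * measure M0 (A c)" for c u B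
 have ex: "\<exists>B. PP c u B" if c: "c \<in> Cs" and u: "u \<in> level d k" for c u
 proof -
  have cC0: "c \<in> Cfg 2 k" "\<not> small c" using c by (simp_all add: Cs_def)
  note cC = cC0(1) valid_Cfg[OF cC0(1)]
  have "\<not> card (orb c k u) \<le> M" using cC0(2) u unfolding small_def by blast
  then have "M \<le> card (orb c k u) + 1" by linarith
  from chord_words[OF cC(2) u this] obtain g e where g: "\<And>j. j < M ==> set (g j) \<subseteq> letters 2" and tri: "tri c M g u e" by blast
  define \<Psi> where "\<Psi> s \<longleftrightarrow> restr 2 k s = c" for s
  have d1: "dep 2 k \<Psi>" by (simp add: dep_def \<Psi>_def restr_restr)
  have t: "tri s M g u e" if "valid s" "\<Psi> s" for s
   using depD[OF dep_tri[OF u order_refl, of M g 2 e] that(1)] that(2) tri g by (simp add: \<Psi>_def)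
  have AA: "A c = {\<omega>\<in>space M0. \<Psi> (S \<omega>)}" by (simp add: A_def \<Psi>_def)
  have pos: "0 < measure M0 (A c)" using A(2)[OF c] by simp
  have hd: "haar (uniform_measure M0 (A c)) M (\<lambda>\<omega>. derv (S \<omega>) g u)"
   by (rule haar_derv[OF h u g _ d1 t AA pos]) auto
  obtain B where B: "B \<in> sets (uniform_measure M0 (A c))"
    "{\<omega>\<in>space (uniform_measure M0 (A c)). \<not> Good M (derv (S \<omega>) g u)} \<subseteq> B" "measure (uniform_measure M0 (A c)) B \<le> \<epsilon>good M"
   by (rule haar_Good[OF hd M])
  have Bs: "B \<in> sets M0" using B(1) by simp
  have "measure M0 (A c \<inter> B) / measure M0 (A c) \<le> \<epsilon>good M"
   using B(3) pos A(1)[OF c] Bs by (subst (asm) measure_uniform_measure) (auto simp: emeasure_eq_measure)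
  then have "measure M0 (A c \<inter> B) \<le> \<epsilon>good M * measure M0 (A c)" using pos by (simp add: field_simps)
  moreover have "{\<omega>\<in>A c. \<not> works u (S \<omega>)} \<subseteq> A c \<inter> B"
  proof
   fix \<omega> assume w: "\<omega> \<in> {\<omega>\<in>A c. \<not> works u (S \<omega>)}"
   then have sp: "\<omega> \<in> space M0" and ps: "\<Psi> (S \<omega>)" by (auto simp: AA)
   have "tri (S \<omega>) M g u e" by (rule t[OF haar_valid[OF h sp] ps])
   then have "\<forall>j<M. set (g j) \<subseteq> letters 2 \<and> wks (S \<omega>) (g j) u = u" using g by (auto simp: tri_def)
   moreover have "\<not> works u (S \<omega>)" using w by simp
   ultimately have "\<not> Good M (derv (S \<omega>) g u)" unfolding works_def by blast
   then show "\<omega> \<in> A c \<inter> B" using B(2) sp w by auto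
  qed
  moreover have "A c \<inter> B \<in> sets M0" using A(1)[OF c] Bs by (rule sets.Int)
  ultimately have "PP c u (A c \<inter> B)" unfolding PP_def by (intro conjI)
  then show ?thesis ..
 qed
 define B where "B c u = (SOME B. PP c u B)" for c u
 have PB: "PP c u (B c u)" if "c \<in> Cs" "u \<in> level d k" for c u unfolding B_def by (rule someI_ex[OF ex[OF that]])
 note B = PB[unfolded PP_def, THEN conjunct2, THEN conjunct1] PB[unfolded PP_def, THEN conjunct1]
  PB[unfolded PP_def, THEN conjunct2, THEN conjunct2]
 have fin: "finite Cs" by (simp add: Cs_def)
 have \<epsilon>0: "0 \<le> \<epsilon>good M" by (simp add: \<epsilon>good_def kap_def)
 let ?U = "\<Union>p\<in>Cs \<times> level d k. B (fst p) (snd p)"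
 have "measure M0 ?U \<le> (\<Sum>p\<in>Cs \<times> level d k. measure M0 (B (fst p) (snd p)))"
  by (rule finite_measure_subadditive_finite) (use fin B(1) in auto)
 also have "\<dots> \<le> (\<Sum>p\<in>Cs \<times> level d k. \<epsilon>good M * (1 / card (Cfg 2 k)))"
 proof (rule sum_mono)
  fix p assume "p \<in> Cs \<times> level d k"
  then have "fst p \<in> Cs" "snd p \<in> level d k" by (simp_all add: mem_Times_iff)
  then show "measure M0 (B (fst p) (snd p)) \<le> \<epsilon>good M * (1 / card (Cfg 2 k))" using B(3)[of "fst p" "snd p"] A(2) by simp
 qed
 also have "\<dots> = real (card Cs) / card (Cfg 2 k) * (real d ^ k * \<epsilon>good M)" using fin by (simp add: card_cartesian_product)
 also have "\<dots> \<le> 1 * (real d ^ k * \<epsilon>good M)"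
 proof (rule mult_right_mono)
  have "card Cs \<le> card (Cfg 2 k)" by (rule card_mono) (auto simp: Cs_def)
  then show "real (card Cs) / card (Cfg 2 k) \<le> 1" by (simp add: divide_le_eq_1)
 qed (use \<epsilon>0 in simp)
 finally have mU: "measure M0 ?U \<le> real d ^ k * \<epsilon>good M" by simp
 have Us: "?U \<in> sets M0" using fin B(1) by (intro sets.finite_UN) auto
 show thesis
 proof (rule that[of "B0 \<union> ?U"])
  show "B0 \<union> ?U \<in> sets M0" using B0 Us by (rule sets.Un)
  show "measure M0 (B0 \<union> ?U) \<le> real M ^ (3 * d) * (3 / 4) ^ k + real d ^ k * \<epsilon>good M"
   using measure_Un_le[OF B0 Us] mB0 mU by linarith
  show "{\<omega>\<in>space M0. \<not> Gen (S \<omega>)} \<subseteq> B0 \<union> ?U"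
  proof
   fix \<omega> assume "\<omega> \<in> {\<omega>\<in>space M0. \<not> Gen (S \<omega>)}"
   then have sp: "\<omega> \<in> space M0" and nG: "\<not> Gen (S \<omega>)" by auto
   have v: "valid (S \<omega>)" by (rule haar_valid[OF h sp])
   obtain u where u: "u \<in> level d k" "\<not> works u (S \<omega>)" using nG unfolding Gen_def works_def by blast
   show "\<omega> \<in> B0 \<union> ?U"
   proof (cases "small (S \<omega>)")
    case True
    then show ?thesis using sp by (simp add: B0_def)
   next
    case False
    let ?c = "restr 2 k (S \<omega>)"
    have "?c \<in> Cs" using False depD[OF dep v] restr_Cfg[OF v] by (simp add: Cs_def)
    moreover have "\<omega> \<in> A ?c" using sp by (simp add: A_def)
    ultimately have "\<omega> \<in> B ?c u" using B(2)[of ?c u] u by auto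
    then have "\<exists>p\<in>Cs \<times> level d k. \<omega> \<in> B (fst p) (snd p)" using \<open>?c \<in> Cs\<close> u(1) by (intro bexI[of _ "(?c, u)"]) auto
    then show ?thesis by auto
   qed
  qed
 qed
qed

text \<open>For \<open>M\<close> proportional to \<open>k\<close> the first error is a polynomial in
  \<open>k\<close> times \<open>(3 / 4) ^ k\<close>, and the second tends to 0 by the decay of
  \<open>\<epsilon>good\<close>.\<close>

lemma haar_Gen:
 assumes h: "haar M0 2 S"
 shows "AE \<omega> in M0. Gen (S \<omega>)"
proof -
 interpret prob_space M0 by (rule haar_prob_space[OF h])
 obtain R where R: "\<And>R'. R \<le> R' ==> (\<lambda>k. real d ^ k * \<epsilon>good (R' * k)) \<longlonglongrightarrow> 0" using \<epsilon>good_decay by auto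
 define R' where "R' = R + d + 1"
 let ?p = "3 * d"
 define b where "b k = real (R' * k) ^ ?p * (3 / 4) ^ k + real d ^ k * \<epsilon>good (R' * k)" for k
 have lim: "b \<longlonglongrightarrow> 0"
 proof -
  \<comment> \<open>With this root, the polynomial error is a constant times a power of
    \<open>k * y ^ k\<close>.\<close>
  define y where "y = root ?p (3 / 4)"
  have y: "y ^ ?p = 3 / 4" "0 \<le> y" "y < 1" using d2 by (auto simp: y_def)
  have "(\<lambda>k. real k * y ^ k) \<longlonglongrightarrow> 0" using y by (intro powser_times_n_limit_0) simp
  then have "(\<lambda>k. real R' ^ ?p * (real k * y ^ k) ^ ?p) \<longlonglongrightarrow> real R' ^ ?p * 0 ^ ?p"
   by (intro tendsto_mult tendsto_const tendsto_power)
  moreover have "real R' ^ ?p * (real k * y ^ k) ^ ?p = real (R' * k) ^ ?p * (3 / 4) ^ k" for k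
  proof -
   have "(y ^ k) ^ ?p = (3 / 4) ^ k" unfolding y(1)[symmetric] by (simp only: power_mult[symmetric] mult.commute)
   then show ?thesis by (simp add: power_mult_distrib)
  qed
  ultimately have "(\<lambda>k. real (R' * k) ^ ?p * (3 / 4) ^ k) \<longlonglongrightarrow> 0" using d2 by (simp add: power_0_left)
  moreover have "(\<lambda>k. real d ^ k * \<epsilon>good (R' * k)) \<longlonglongrightarrow> 0" by (rule R) (simp add: R'_def)
  ultimately have "(\<lambda>k. real (R' * k) ^ ?p * (3 / 4) ^ k + real d ^ k * \<epsilon>good (R' * k)) \<longlonglongrightarrow> 0 + 0" by (rule tendsto_add)
  then show ?thesis by (simp add: b_def[abs_def])
 qed
 have "\<exists>B. B \<in> sets M0 \<and> {\<omega>\<in>space M0. \<not> Gen (S \<omega>)} \<subseteq> B \<and> measure M0 B \<le> b (Suc k)" for k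
 proof -
  have "d < R' * Suc k" by (simp add: R'_def)
  then obtain B where "B \<in> sets M0" "{\<omega>\<in>space M0. \<not> Gen (S \<omega>)} \<subseteq> B" "measure M0 B \<le> b (Suc k)"
   unfolding b_def by (rule haar_Gen_approx[OF h])
  then show ?thesis by (intro exI[of _ B] conjI)
 qed
 then have "\<forall>k. \<exists>B. B \<in> sets M0 \<and> {\<omega>\<in>space M0. \<not> Gen (S \<omega>)} \<subseteq> B \<and> measure M0 B \<le> b (Suc k)" ..
 from choice[OF this] obtain B where "\<forall>k. B k \<in> sets M0 \<and> {\<omega>\<in>space M0. \<not> Gen (S \<omega>)} \<subseteq> B k \<and> measure M0 (B k) \<le> b (Suc k)" ..
 then have B: "\<And>k. B k \<in> sets M0" "\<And>k. {\<omega>\<in>space M0. \<not> Gen (S \<omega>)} \<subseteq> B k" "\<And>k. measure M0 (B k) \<le> b (Suc k)"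
  by simp_all
 have Bs: "(\<Inter>k. B k) \<in> sets M0" using B(1) by auto
 have "measure M0 (\<Inter>k. B k) \<le> b (Suc k)" for k
  using finite_measure_mono[of "\<Inter>k. B k" "B k"] B(1,3)[of k] by fastforce
 then have "measure M0 (\<Inter>k. B k) \<le> 0" using LIMSEQ_Suc[OF lim] by (intro LIMSEQ_le_const) auto
 then have "measure M0 (\<Inter>k. B k) = 0" by (simp add: measure_le_0_iff)
 then show ?thesis using B(2) Bs by (intro AE_I[of _ _ "\<Inter>k. B k"]) (auto simp: emeasure_eq_measure)
qed

text \<open>Conditionally on a triangular crossing pattern the two cocycles are Haar-distributed, and there are only countably many patterns.\<close>

lemma haar_tri_Gen:
 assumes h: "haar M0 m S" and m: "0 < m"
 shows "AE \<omega> in M0. \<forall>n. \<forall>v\<in>level d n. \<forall>g0 g1 e0 e1. set g0 \<subseteq> letters m --> set g1 \<subseteq> letters m -->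
  tri (S \<omega>) 2 (case_nat g0 (\<lambda>_. g1)) v (case_nat e0 (\<lambda>_. e1)) --> Gen (derv (S \<omega>) (case_nat g0 (\<lambda>_. g1)) v)"
proof -
 interpret prob_space M0 by (rule haar_prob_space[OF h])
 have "AE \<omega> in M0. v \<in> level d (length v) --> set g0 \<subseteq> letters m --> set g1 \<subseteq> letters m -->
  tri (S \<omega>) 2 (case_nat g0 (\<lambda>_. g1)) v (case_nat e0 (\<lambda>_. e1)) --> Gen (derv (S \<omega>) (case_nat g0 (\<lambda>_. g1)) v)" for v g0 g1 e0 e1
 proof (cases "v \<in> level d (length v) \<and> set g0 \<subseteq> letters m \<and> set g1 \<subseteq> letters m")
  case True
  let ?g = "case_nat g0 (\<lambda>_. g1)" and ?e = "case_nat e0 (\<lambda>_. e1)"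
  let ?\<Psi> = "\<lambda>s. tri s 2 ?g v ?e"
  have v: "v \<in> level d (length v)" and g: "\<And>j. j < 2 ==> set (?g j) \<subseteq> letters m"
   using True by (auto split: nat.split)
  have d1: "dep m (length v) ?\<Psi>" by (rule dep_tri[OF v order_refl g])
  define A where "A = {\<omega>\<in>space M0. ?\<Psi> (S \<omega>)}"
  have As: "A \<in> sets M0" unfolding A_def by (rule haar_event(1)[OF h d1])
  have "AE \<omega> in M0. \<omega> \<in> A --> Gen (derv (S \<omega>) ?g v)"
  proof (cases "measure M0 A = 0")
   case True
   then have "AE \<omega> in M0. \<omega> \<notin> A" using As by (intro AE_not_in) (auto simp: null_sets_def emeasure_eq_measure)
   then show ?thesis by eventually_elim auto
  next
   case False
   then have pos: "0 < measure M0 A" by (simp add: zero_less_measure_iff)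
   have hd: "haar (uniform_measure M0 A) 2 (\<lambda>\<omega>. derv (S \<omega>) ?g v)"
    by (rule haar_derv[OF h v g m d1 _ A_def pos]) auto
   have "AE \<omega> in uniform_measure M0 A. Gen (derv (S \<omega>) ?g v)" by (rule haar_Gen[OF hd])
   then show ?thesis using As by (subst (asm) AE_uniform_measure) (use pos in \<open>auto simp: emeasure_eq_measure\<close>)
  qed
  then show ?thesis using AE_space by eventually_elim (auto simp: A_def)
 qed auto
 then have "AE \<omega> in M0. \<forall>v g0 g1 e0 e1. v \<in> level d (length v) --> set g0 \<subseteq> letters m --> set g1 \<subseteq> letters m -->
  tri (S \<omega>) 2 (case_nat g0 (\<lambda>_. g1)) v (case_nat e0 (\<lambda>_. e1)) --> Gen (derv (S \<omega>) (case_nat g0 (\<lambda>_. g1)) v)"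
  by (simp only: AE_all_countable simp_thms)
 then show ?thesis
 proof eventually_elim
  case (elim \<omega>)
  show ?case
  proof (intro allI ballI impI)
   fix n v g0 g1 e0 e1
   assume "v \<in> level d n" and a: "set g0 \<subseteq> letters m" "set g1 \<subseteq> letters m" "tri (S \<omega>) 2 (case_nat g0 (\<lambda>_. g1)) v (case_nat e0 (\<lambda>_. e1))"
   then have "v \<in> level d (length v)" by (auto simp: level_iff)
   then show "Gen (derv (S \<omega>) (case_nat g0 (\<lambda>_. g1)) v)" using elim a by blast
  qed
 qed
qed

end

section \<open>Triangular pairs at all deeper vertices, and the resulting good subtrees\<close>

lemma count_list_1I:
 assumes "p < length xs" "xs ! p = a" "\<And>j. j < length xs ==> xs ! j = a ==> j = p"
 shows "count_list xs a = 1"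
proof -
 have "a \<notin> set (take p xs)"
 proof
  assume "a \<in> set (take p xs)"
  then obtain j where "j < p" "xs ! j = a" by (auto simp: in_set_conv_nth)
  then show False using assms(1) assms(3)[of j] by simp
 qed
 moreover have "a \<notin> set (drop (Suc p) xs)"
 proof
  assume "a \<in> set (drop (Suc p) xs)"
  then obtain j where "j < length xs - Suc p" "xs ! (Suc p + j) = a" by (auto simp: in_set_conv_nth)
  moreover from this have "Suc p + j < length xs" by linarith
  ultimately show False using assms(3)[of "Suc p + j"] by simp
 qed
 ultimately have "count_list (take p xs @ xs ! p # drop (Suc p) xs) a = 1" using assms(2) by (simp add: count_notin)
 then show ?thesis using id_take_nth_drop[OF assms(1)] by simp
qed

lemma tri_2I:
 assumes "wks s g0 v = v" "wks s g1 v = v" "count_list (tr (stp s) g0 v) e0 = 1" "count_list (tr (stp s) g1 v) e1 = 1"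
  "e0 \<notin> set (tr (stp s) g1 v)"
 shows "tri s 2 (case_nat g0 (\<lambda>_. g1)) v (case_nat e0 (\<lambda>_. e1))"
 using assms unfolding tri_def by (auto simp: less_Suc_eq numeral_2_eq_2)

context letter_group
begin

text \<open>The word \<open>g\<close> permutes the vertices above \<open>x\<close>, and from each
  such \<open>y\<close> it crosses exactly one lift \<open>\<kappa> y\<close> of \<open>e\<close>,
  different for different \<open>y\<close>. The power of \<open>g\<close> that closes up at
  \<open>v\<close> crosses each lift along the cycle of \<open>v\<close> once. The loop
  \<open>h\<close> moves \<open>v\<close> to some \<open>y\<close> without touching lifts of
  \<open>e\<close>. If \<open>y\<close> lies on another cycle, conjugate the power closing that
  cycle by \<open>h\<close>. If \<open>y\<close> lies on the same cycle, return to \<open>v\<close>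
  backwards along it: this crosses \<open>\<kappa> v\<close> but not
  \<open>\<kappa> y\<close>.\<close>

lemma lifted_pair:
 assumes s: "valid s" and sym: "sym_act st UNIV" and n: "n \<le> n1" and v: "v \<in> level d n1" and x: "take n v = x"
  and let_gh: "set g \<subseteq> letters m" "set h \<subseteq> letters m"
  and c: "wk st g c = c" "wk st h c = c" and gx: "wks s g x = x" and hx: "wks s h x = x"
  and once: "count_list (tr (stp s) g x) e = 1" and noth: "e \<notin> set (tr (stp s) h x)" and hv: "wks s h v \<noteq> v"
 shows "\<exists>g0 g1 e0 e1. set g0 \<subseteq> letters m \<and> set g1 \<subseteq> letters m \<and> wk st g0 c = c \<and> wk st g1 c = c \<and>
  tri s 2 (case_nat g0 (\<lambda>_. g1)) v (case_nat e0 (\<lambda>_. e1))"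
proof -
 have sU: "sym_act (stp s) UNIV" by (rule sym_act_stp[OF s])
 define \<pi> where "\<pi> q = (fst q, take n (snd q))" for q :: "nat \<times> nat list"
 have tr\<pi>: "map \<pi> (tr (stp s) w y) = tr (stp s) w (take n y)" if "length y = n1" for w y
  unfolding \<pi>_def using tr_take[of n y s w] that n by simp
 have "e \<in> set (tr (stp s) g x)" by (rule ccontr) (use once in \<open>simp add: count_notin\<close>)
 then obtain p where p: "p < length g" "tr (stp s) g x ! p = e" unfolding in_set_conv_nth by auto
 define \<kappa> where "\<kappa> y = tr (stp s) g y ! p" for y
 define Y where "Y = {y. length y = n1 \<and> take n y = x}"
 have nth\<pi>: "\<pi> (tr (stp s) g y ! j) = tr (stp s) g x ! j" if "y \<in> Y" "j < length g" for y j
  using arg_cong[OF tr\<pi>[of y g], of "\<lambda>xs. xs ! j"] that by (simp add: Y_def)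
 have \<pi>\<kappa>: "\<pi> (\<kappa> y) = e" if "y \<in> Y" for y using nth\<pi>[OF that p(1)] p(2) by (simp add: \<kappa>_def)
 have pos: "j = p" if "y \<in> Y" "j < length g" "\<pi> (tr (stp s) g y ! j) = e" for y j
 proof (rule count_list_1_nth_eq[OF once])
  show "j < length (tr (stp s) g x)" "p < length (tr (stp s) g x)" using that(2) p(1) by simp_all
  show "tr (stp s) g x ! j = e" using that(3) unfolding nth\<pi>[OF that(1,2)] .
  show "tr (stp s) g x ! p = e" by (rule p(2))
 qed
 have \<kappa>inj: "y = y'" if "\<kappa> y = \<kappa> y'" for y y'
  by (rule tr_nth_inj[OF sU p(1) UNIV_I UNIV_I]) (use that in \<open>simp add: \<kappa>_def\<close>)
 have cnt1: "count_list (tr (stp s) g y) a = of_bool (\<kappa> y = a)" if "y \<in> Y" "\<pi> a = e" for y a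
 proof (cases "\<kappa> y = a")
  case True
  have "count_list (tr (stp s) g y) a = 1"
  proof (rule count_list_1I[of p])
   show "p < length (tr (stp s) g y)" using p(1) by simp
   show "tr (stp s) g y ! p = a" using True by (simp only: \<kappa>_def)
   fix j assume "j < length (tr (stp s) g y)" "tr (stp s) g y ! j = a"
   then show "j = p" using that(2) by (intro pos[OF that(1)]) simp_all
  qed
  then show ?thesis using True by simp
 next
  case False
  have "a \<notin> set (tr (stp s) g y)"
  proof
   assume "a \<in> set (tr (stp s) g y)"
   then obtain j where j: "j < length g" "tr (stp s) g y ! j = a" by (auto simp: in_set_conv_nth)
   then have "j = p" using pos[OF that(1)] that(2) by simp
   then show False using j False by (simp add: \<kappa>_def)
  qed
  then show ?thesis using False by (simp add: count_notin)
 qed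
 define G where "G = wks s g"
 have GY: "G y \<in> Y" if "y \<in> Y" for y using that gx take_wks[of n s g y] by (simp add: Y_def G_def)
 have GkY: "(G ^^ k) y \<in> Y" if "y \<in> Y" for k y using that by (induction k) (auto intro: GY)
 have Ginj: "inj G" unfolding G_def by (rule injI) (use wk_inj[OF sU] in simp)
 define pw where "pw k = concat (replicate k g)" for k
 have wpw: "wks s (pw k) y = (G ^^ k) y" for k y by (simp add: pw_def G_def wk_pow)
 have pwS: "pw (Suc k) = pw k @ g" for k
  unfolding pw_def by (induction k) auto
 have cntpw: "count_list (tr (stp s) (pw k) y) a = card {i. i < k \<and> \<kappa> ((G ^^ i) y) = a}" if y: "y \<in> Y" and a: "\<pi> a = e" for k y a
 proof (induction k)
  case 0
  then show ?case by (simp add: pw_def)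
 next
  case (Suc k)
  have "{i. i < Suc k \<and> \<kappa> ((G ^^ i) y) = a} = {i. i < k \<and> \<kappa> ((G ^^ i) y) = a} \<union> (if \<kappa> ((G ^^ k) y) = a then {k} else {})"
   by (auto simp: less_Suc_eq)
  then have "card {i. i < Suc k \<and> \<kappa> ((G ^^ i) y) = a} = card {i. i < k \<and> \<kappa> ((G ^^ i) y) = a} + of_bool (\<kappa> ((G ^^ k) y) = a)"
   by simp
  then show ?case using Suc cnt1[OF GkY[OF y] a, of k] by (simp add: pwS wpw)
 qed
 have cyc: "\<exists>r>0. (G ^^ r) y = y \<and> (\<forall>i j. i < r --> j < r --> (G ^^ i) y = (G ^^ j) y --> i = j)" if "y \<in> level d n1" for y
 proof -
  have lev: "(G ^^ k) y \<in> level d n1" for k using that by (induction k) (auto simp: G_def wks_level[OF s])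
  have "\<not> inj (\<lambda>k. (G ^^ k) y)"
  proof
   assume "inj (\<lambda>k. (G ^^ k) y)"
   then have "infinite (range (\<lambda>k. (G ^^ k) y))" by (simp add: finite_image_iff)
   moreover have "range (\<lambda>k. (G ^^ k) y) \<subseteq> level d n1" using lev by auto
   ultimately show False using finite_subset finite_level by blast
  qed
  have can: "(G ^^ (j - i)) y = y" if "i < j" "(G ^^ i) y = (G ^^ j) y" for i j
  proof -
   have "i + (j - i) = j" using that(1) by simp
   then have "(G ^^ j) y = (G ^^ i) ((G ^^ (j - i)) y)" using funpow_add[of i "j - i" G] by simp
   then have "(G ^^ i) ((G ^^ (j - i)) y) = (G ^^ i) y" using that(2) by simp
   then show ?thesis using inj_fn[OF Ginj, of i] by (simp add: inj_eq)
  qed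
  obtain i j where "i \<noteq> j" "(G ^^ i) y = (G ^^ j) y" using \<open>\<not> inj _\<close> unfolding inj_def by blast
  then have "\<exists>r. 0 < r \<and> (G ^^ r) y = y" using can[of i j] can[of j i] by (metis linorder_neqE_nat zero_less_diff)
  then obtain r where r: "0 < r \<and> (G ^^ r) y = y" "\<And>k. k < r ==> \<not> (0 < k \<and> (G ^^ k) y = y)"
   using exists_least_iff[of "\<lambda>r. 0 < r \<and> (G ^^ r) y = y"] by blast
  have no: "\<not> (i < j \<and> j < r \<and> (G ^^ i) y = (G ^^ j) y)" for i j
   using can[of i j] r(2)[of "j - i"] by auto
  have "i = j" if "i < r" "j < r" "(G ^^ i) y = (G ^^ j) y" for i j
   using no[of i j] no[of j i] that by (metis linorder_neqE_nat)
  then show ?thesis using r(1) by blast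
 qed
 have vY: "v \<in> Y" using v x by (simp add: Y_def level_iff)
 define y where "y = wks s h v"
 have yl: "y \<in> level d n1" unfolding y_def by (rule wks_level[OF s v])
 have yY: "y \<in> Y" using yl take_wks[of n s h v] x hx by (simp add: Y_def y_def level_iff)
 have hno: "a \<notin> set (tr (stp s) h v)" if "\<pi> a = e" for a
 proof
  assume "a \<in> set (tr (stp s) h v)"
  then have "\<pi> a \<in> \<pi> ` set (tr (stp s) h v)" by (rule imageI)
  moreover have "map \<pi> (tr (stp s) h v) = tr (stp s) h x" using tr\<pi>[of v h] v x by (simp add: level_iff)
  then have "\<pi> ` set (tr (stp s) h v) = set (tr (stp s) h x)" by (metis set_map)
  ultimately show False using noth that by simp
 qed
 have pwl: "set (pw k) \<subseteq> letters m" for k using let_gh(1) by (auto simp: pw_def)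
 have pwc: "wk st (pw k) c = c" for k unfolding pw_def wk_pow by (induction k) (simp_all add: c)
 have win: "wk st (winv w) c = c" if "wk st w c = c" for w using wk_winv[OF sym UNIV_I, of w c] that by simp
 obtain r where r: "0 < r" "(G ^^ r) v = v" "\<And>i j. i < r ==> j < r ==> (G ^^ i) v = (G ^^ j) v ==> i = j" using cyc[OF v] by blast
 have cr: "count_list (tr (stp s) (pw r) v) (\<kappa> ((G ^^ i) v)) = 1" if "i < r" for i
 proof -
  have "{k. k < r \<and> \<kappa> ((G ^^ k) v) = \<kappa> ((G ^^ i) v)} = {i}" using that r(3) \<kappa>inj by blast
  then show ?thesis using cntpw[OF vY \<pi>\<kappa>[OF GkY[OF vY]], of r i] by simp
 qed
 show ?thesis
 proof (cases "\<exists>i. y = (G ^^ i) v")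
  case False
  obtain r' where r': "0 < r'" "(G ^^ r') y = y" "\<And>i j. i < r' ==> j < r' ==> (G ^^ i) y = (G ^^ j) y ==> i = j" using cyc[OF yl] by blast
  let ?g1 = "h @ pw r' @ winv h"
  have trg: "tr (stp s) ?g1 v = tr (stp s) h v @ tr (stp s) (pw r') y @ rev (tr (stp s) h v)"
   using tr_winv[OF sU UNIV_I, of h v] r'(2) by (simp add: y_def[symmetric] wpw)
  have "{k. k < r' \<and> \<kappa> ((G ^^ k) y) = \<kappa> y} = {0}"
   using r'(1) r'(3)[of _ 0] \<kappa>inj[of _ y] by (auto dest: \<kappa>inj)
  then have "count_list (tr (stp s) (pw r') y) (\<kappa> y) = 1" using cntpw[OF yY \<pi>\<kappa>[OF yY], of r'] by simp
  then have 1: "count_list (tr (stp s) ?g1 v) (\<kappa> y) = 1" unfolding trg using hno[OF \<pi>\<kappa>[OF yY]] by (simp add: count_notin)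
  have "\<kappa> ((G ^^ k) y) \<noteq> \<kappa> v" if "k < r'" for k
  proof
   assume "\<kappa> ((G ^^ k) y) = \<kappa> v"
   then have "(G ^^ k) y = v" by (rule \<kappa>inj)
   then have "(G ^^ (r' - k)) v = (G ^^ (r' - k + k)) y" by (simp add: funpow_add)
   then have "(G ^^ (r' - k)) v = y" using that r'(2) by simp
   then show False using False by blast
  qed
  then have "{k. k < r' \<and> \<kappa> ((G ^^ k) y) = \<kappa> v} = {}" by blast
  then have "count_list (tr (stp s) (pw r') y) (\<kappa> v) = 0" using cntpw[OF yY \<pi>\<kappa>[OF vY], of r'] by simp
  then have 2: "\<kappa> v \<notin> set (tr (stp s) ?g1 v)" unfolding trg using hno[OF \<pi>\<kappa>[OF vY]] by (simp add: count_list_0_iff)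
  have "tri s 2 (case_nat (pw r) (\<lambda>_. ?g1)) v (case_nat (\<kappa> v) (\<lambda>_. \<kappa> y))"
  proof (rule tri_2I[OF _ _ _ 1 2])
   show "wks s (pw r) v = v" using r(2) by (simp add: wpw)
   show "wks s ?g1 v = v" using r'(2) wk_winv[OF sU UNIV_I, of h v] by (simp add: wpw y_def[symmetric])
   show "count_list (tr (stp s) (pw r) v) (\<kappa> v) = 1" using cr[OF r(1)] by simp
  qed
  then show ?thesis using pwl let_gh pwc c(2) win[OF c(2)] by (intro exI[of _ "pw r"] exI[of _ ?g1] exI) auto
 next
  case True
  then obtain i where i: "y = (G ^^ i) v" "\<And>k. k < i ==> y \<noteq> (G ^^ k) v"
   using exists_least_iff[of "\<lambda>i. y = (G ^^ i) v"] by blast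
  have i0: "0 < i" using hv i(1) by (cases i) (simp_all add: y_def)
  have ir: "i < r"
  proof (rule ccontr)
   assume "\<not> i < r"
   then have "(G ^^ i) v = (G ^^ (i - r)) ((G ^^ r) v)" by (metis add_diff_cancel_right' comp_apply funpow_add le_add_diff_inverse2 not_less)
   then show False using i(2)[of "i - r"] i(1) r(1,2) i0 by simp
  qed
  let ?g1 = "h @ winv (pw i)"
  have wy: "wks s (pw i) v = y" using i(1) by (simp add: wpw)
  have trg: "tr (stp s) ?g1 v = tr (stp s) h v @ rev (tr (stp s) (pw i) v)"
   using tr_winv[OF sU UNIV_I, of "pw i" v] wy by (simp add: y_def[symmetric])
  have "{k. k < i \<and> \<kappa> ((G ^^ k) v) = \<kappa> v} = {0}"
  proof -
   have "k = 0" if "k < i" "\<kappa> ((G ^^ k) v) = \<kappa> v" for k using r(3)[of k 0] \<kappa>inj[OF that(2)] that(1) ir by simp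
   then show ?thesis using i0 by auto
  qed
  then have "count_list (tr (stp s) (pw i) v) (\<kappa> v) = 1" using cntpw[OF vY \<pi>\<kappa>[OF vY], of i] by simp
  then have 1: "count_list (tr (stp s) ?g1 v) (\<kappa> v) = 1" unfolding trg using hno[OF \<pi>\<kappa>[OF vY]] by (simp add: count_notin)
  have "{k. k < i \<and> \<kappa> ((G ^^ k) v) = \<kappa> y} = {}" using i(2) \<kappa>inj by blast
  then have "count_list (tr (stp s) (pw i) v) (\<kappa> y) = 0" using cntpw[OF vY \<pi>\<kappa>[OF yY], of i] by simp
  then have 2: "\<kappa> y \<notin> set (tr (stp s) ?g1 v)" unfolding trg using hno[OF \<pi>\<kappa>[OF yY]] by (simp add: count_list_0_iff)
  \<comment> \<open>The two lifts exchange their roles compared with the other case, since now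
    \<open>?g1\<close> misses the lift at \<open>y\<close>.\<close>
  have "tri s 2 (case_nat (pw r) (\<lambda>_. ?g1)) v (case_nat (\<kappa> y) (\<lambda>_. \<kappa> v))"
  proof (rule tri_2I[OF _ _ _ 1 2])
   show "wks s (pw r) v = v" using r(2) by (simp add: wpw)
   show "wks s ?g1 v = v" using wk_winv[OF sU UNIV_I, of "pw i" v] wy by (simp add: y_def[symmetric])
   show "count_list (tr (stp s) (pw r) v) (\<kappa> y) = 1" using cr[OF ir] i(1) by simp
  qed
  then show ?thesis using pwl let_gh pwc c(2) win[OF pwc] by (intro exI[of _ "pw r"] exI[of _ ?g1] exI) auto
 qed
qed

lemma stp_cong: "(\<And>w. s (fst l, w) = s' (fst l, w)) ==> stp s l v = stp s' l v"
 by (simp add: stp_def)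

lemma wks_cong: "(\<And>j w. j < M ==> s (j, w) = s' (j, w)) ==> set x \<subseteq> letters M ==> wks s x v = wks s' x v"
proof (induction x arbitrary: v)
 case (Cons l x)
 have "stp s l v = stp s' l v" using Cons.prems by (intro stp_cong) (auto simp: letters_def)
 then show ?case using Cons by simp
qed simp

lemma Good_cong:
 assumes "\<And>j w. j < M ==> s (j, w) = s' (j, w)"
 shows "Good M s = Good M s'"
proof -
 have "conn M n s = conn M n s'" for n
 proof -
  have "(\<exists>w. set w \<subseteq> letters M \<and> wks s w u = v) = (\<exists>w. set w \<subseteq> letters M \<and> wks s' w u = v)" for u v
   using wks_cong[of M s s', OF assms] by (intro ex_cong) simp
  then show ?thesis unfolding conn_def by simp
 qed
 moreover have "energy M n s f = energy M n s' f" for n f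
 proof -
  have "stp s (i, True) v = stp s' (i, True) v" if "i < M" for i v by (rule stp_cong) (use assms that in simp)
  then show ?thesis unfolding energy_def by (intro sum.cong refl) (simp add: mem_Times_iff)
 qed
 ultimately show ?thesis unfolding Good_def gap_def by (simp only:)
qed

lemma wk_subw:
 assumes sym: "sym_act st UNIV" and g: "\<And>j. j < M ==> wk st (g j) c = c" and x: "set x \<subseteq> letters M"
 shows "wk st (subw g x) c = c"
 using x
proof (induction x)
 case (Cons l x)
 have "wk st (if snd l then g (fst l) else winv (g (fst l))) c = c"
  using g[of "fst l"] wk_winv[OF sym UNIV_I, of "g (fst l)" c] Cons.prems by (auto simp: letters_def)
 then show ?case using Cons by (simp add: subw_def)
qed (simp add: subw_def)

text \<open>The loops \<open>f j\<close> are based at the vertex \<open>wk st q b\<close>, for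
  instance a coset, and not at \<open>b\<close>. Conjugation by \<open>q\<close> turns them into
  loops at \<open>b\<close> that act on the subtree at \<open>u\<close> as the original ones act on
  the subtree at \<open>wks s q u\<close>.\<close>

definition tile :: "config \<Rightarrow> nat \<Rightarrow> (nat \<times> bool \<Rightarrow> 'c \<Rightarrow> 'c) \<Rightarrow> 'c \<Rightarrow> nat list \<Rightarrow> bool" where
 "tile s m st b u \<longleftrightarrow> (\<exists>M q f. set q \<subseteq> letters m \<and> (\<forall>j<M. set (f j) \<subseteq> letters m \<and> wk st (f j) (wk st q b) = wk st q b \<and>
   wks s (f j) (wks s q u) = wks s q u) \<and> Good M (derv s f (wks s q u)))"

text \<open>Deriving twice is deriving once along substituted words: inside the subtree, words in
  the two cocycles are words in the generators, with the same cocycles further down.\<close>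

lemma tile_from_Gen:
 assumes s: "valid s" and sym: "sym_act st UNIV" and y: "y \<in> level d n"
  and q: "set q \<subseteq> letters m" and g: "\<And>j. j < 2 ==> set (g j) \<subseteq> letters m" "\<And>j. j < 2 ==> wk st (g j) (wk st q b) = wk st q b"
   "\<And>j. j < 2 ==> wks s (g j) (wks s q y) = wks s q y"
  and Gn: "Gen (derv s g (wks s q y))"
 shows "\<exists>k. \<forall>u\<in>level d k. tile s m st b (y @ u)"
proof -
 let ?v = "wks s q y"
 let ?s = "derv s g ?v"
 obtain k where k: "\<And>u. u \<in> level d k ==> \<exists>M g'. (\<forall>j<M. set (g' j) \<subseteq> letters 2 \<and> wks ?s (g' j) u = u) \<and> Good M (derv ?s g' u)"
  using Gn unfolding Gen_def by blast
 have "tile s m st b (y @ u)" if u: "u \<in> level d k" for u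
 proof -
  have "y @ u \<in> level d (n + k)" using y u by (simp add: level_iff)
  then have lev: "wks s q (y @ u) \<in> level d (n + k)" by (rule wks_level[OF s])
  define u' where "u' = drop n (wks s q (y @ u))"
  have "take n (wks s q (y @ u)) = ?v" using y take_wks[of n s q "y @ u"] by (simp add: level_iff)
  then have yu: "wks s q (y @ u) = ?v @ u'" using append_take_drop_id[of n "wks s q (y @ u)"] by (simp add: u'_def)
  have "u' \<in> level d k" using lev set_drop_subset[of n "wks s q (y @ u)"] by (auto simp: u'_def level_iff)
  from k[OF this] obtain M g' where g': "\<And>j. j < M ==> set (g' j) \<subseteq> letters 2" "\<And>j. j < M ==> wks ?s (g' j) u' = u'" "Good M (derv ?s g' u')"
   by blast
  have sub: "wks s (subw g (g' j)) (?v @ w) = ?v @ wks ?s (g' j) w" if "j < M" for j w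
   by (rule wks_subw[OF s g(3) g'(1)[OF that]])
  have "derv s (\<lambda>j. subw g (g' j)) (?v @ u') (j, w) = derv ?s g' u' (j, w)" if j: "j < M" for j w
  proof
   fix a
   have "wks s (subw g (g' j)) ((?v @ u' @ w) @ [a]) = ?v @ wks ?s (g' j) ((u' @ w) @ [a])"
    using sub[OF j, of "(u' @ w) @ [a]"] by simp
   then have "wks s (subw g (g' j)) (?v @ u' @ w) @ [whol s (subw g (g' j)) (?v @ u' @ w) a] =
     ?v @ wks ?s (g' j) (u' @ w) @ [whol ?s (g' j) (u' @ w) a]" unfolding wks_snoc .
   from arg_cong[OF this, of last] have "whol s (subw g (g' j)) (?v @ u' @ w) a = whol ?s (g' j) (u' @ w) a" by simp
   then show "derv s (\<lambda>j. subw g (g' j)) (?v @ u') (j, w) a = derv ?s g' u' (j, w) a"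
    by (simp add: derv_def[of s "\<lambda>j. subw g (g' j)"] derv_def[of ?s])
  qed
  then have Gd: "Good M (derv s (\<lambda>j. subw g (g' j)) (wks s q (y @ u)))" unfolding yu using Good_cong[of M] g'(3) by blast
  show ?thesis
   unfolding tile_def
  proof (intro exI[of _ M] exI[of _ q] exI[of _ "\<lambda>j. subw g (g' j)"] conjI allI impI q Gd)
   fix j assume j: "j < M"
   show "set (subw g (g' j)) \<subseteq> letters m" by (rule set_subw[OF g(1) g'(1)[OF j]])
   show "wk st (subw g (g' j)) (wk st q b) = wk st q b" by (rule wk_subw[OF sym g(2) g'(1)[OF j]])
   show "wks s (subw g (g' j)) (wks s q (y @ u)) = wks s q (y @ u)" unfolding yu sub[OF j] g'(2)[OF j] ..
  qed
 qed
 then show ?thesis by blast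
qed

text \<open>On a level of large girth a crossing pair is found over each vertex. The next level is
  chosen so deep that none of the finitely many words \<open>h x\<close> fixes a vertex there, as
  lifting the pair requires. Below its vertices \<open>Gen\<close> holds with depths of their own,
  so the subtrees in \<open>Z\<close> may have different depths.\<close>

lemma tiles_exist:
 fixes st :: "nat \<times> bool \<Rightarrow> 'c \<Rightarrow> 'c"
 assumes s: "valid s" and sym: "sym_act st UNIV"
  and gir: "\<And>k. \<exists>n. girth_gt (stp s) m (level d n) k"
  and Gn: "\<And>n v g0 g1 e0 e1. v \<in> level d n ==> set g0 \<subseteq> letters m ==> set g1 \<subseteq> letters m ==>
   tri s 2 (case_nat g0 (\<lambda>_. g1)) v (case_nat e0 (\<lambda>_. e1)) ==> Gen (derv s (case_nat g0 (\<lambda>_. g1)) v)"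
  and C: "\<exists>V E. core st m V E \<and> b \<in> V \<and> (\<forall>y\<in>V. \<exists>p. set p \<subseteq> letters m \<and> wk st p b = y)"
 obtains N Z where "finite Z" "\<And>y. y \<in> level d N ==> \<exists>u\<in>Z. \<exists>w. y = u @ w" "\<And>u. u \<in> Z ==> tile s m st b u"
proof -
 obtain V0 E0 where V0: "core st m V0 E0" "\<And>y. y \<in> V0 ==> \<exists>p. set p \<subseteq> letters m \<and> wk st p b = y" using C by blast
 obtain V E where VE: "V \<subseteq> V0" "core st m V E" "\<And>v. v \<in> V ==> 2 \<le> card (drt st E v)" using core_prune[OF sym V0(1)] by blast
 interpret pc: pruned_core st m V E by (rule pruned_core.intro[OF sym VE(2) VE(3)])
 obtain c0 where c0: "c0 \<in> V" using coreD(2)[OF VE(2)] by blast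
 obtain p0 where p0: "set p0 \<subseteq> letters m" "wk st p0 b = c0" using V0(2) VE(1) c0 by blast
 obtain \<rho> where \<rho>: "\<forall>v\<in>V. \<forall>l\<in>drt st E v. 4 * (card V)\<^sup>2 * (2 * \<rho> + 1) < card (pc.aw \<rho> v l)" using pc.aw_superlinear by blast
 obtain n where n: "girth_gt (stp s) m (level d n) (2 * \<rho>)" using gir by blast
 interpret pg: product_graph st m V E "stp s" "level d n" \<rho>
  by unfold_locales (use sym_act_level[OF s] n \<rho> in auto)
 have "\<exists>q g h e. set (q @ g @ h) \<subseteq> letters m \<and> wk st g (wk st q b) = wk st q b \<and> wk st h (wk st q b) = wk st q b \<and>
   wks s g (wks s q x) = wks s q x \<and> wks s h (wks s q x) = wks s q x \<and> count_list (tr (stp s) g (wks s q x)) e = 1 \<and>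
   reduced h \<and> h \<noteq> [] \<and> e \<notin> set (tr (stp s) h (wks s q x))" if x: "x \<in> level d n" for x
 proof -
  have "(c0, wks s p0 x) \<in> V \<times> level d n" using c0 wks_level[OF s x] by simp
  from pg.crossing_pair[OF this] obtain p g h e where "set (p @ g @ h) \<subseteq> letters m" "wk st g (wk st p c0) = wk st p c0"
   "wk st h (wk st p c0) = wk st p c0" "wks s g (wks s p (wks s p0 x)) = wks s p (wks s p0 x)"
   "wks s h (wks s p (wks s p0 x)) = wks s p (wks s p0 x)" "count_list (tr (stp s) g (wks s p (wks s p0 x))) e = 1"
   "reduced h" "h \<noteq> []" "e \<notin> set (tr (stp s) h (wks s p (wks s p0 x)))" by auto
  then show ?thesis using p0 by (intro exI[of _ "p0 @ p"] exI[of _ g] exI[of _ h] exI[of _ e]) simp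
 qed
 then obtain q g h e where Q: "\<And>x. x \<in> level d n ==> set (q x @ g x @ h x) \<subseteq> letters m \<and> wk st (g x) (wk st (q x) b) = wk st (q x) b \<and>
   wk st (h x) (wk st (q x) b) = wk st (q x) b \<and>
   wks s (g x) (wks s (q x) x) = wks s (q x) x \<and> wks s (h x) (wks s (q x) x) = wks s (q x) x \<and>
   count_list (tr (stp s) (g x) (wks s (q x) x)) (e x) = 1 \<and>
   reduced (h x) \<and> h x \<noteq> [] \<and> e x \<notin> set (tr (stp s) (h x) (wks s (q x) x))" by metis
 define L where "L = Max ((\<lambda>x. length (h x)) ` level d n)"
 have L: "length (h x) \<le> L" if "x \<in> level d n" for x using that by (simp add: L_def)
 obtain n' where n': "girth_gt (stp s) m (level d n') L" using gir by blast
 define n1 where "n1 = max n n'"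
 have n1: "n \<le> n1" "girth_gt (stp s) m (level d n1) L" using girth_level_mono[OF s n', of n1] by (auto simp: n1_def)
 have "\<exists>k. \<forall>u\<in>level d k. tile s m st b (y @ u)" if y: "y \<in> level d n1" for y
 proof -
  define x where "x = take n y"
  have x: "x \<in> level d n" using y n1(1) set_take_subset[of n y] by (auto simp: x_def level_iff)
  note Qx = Q[OF x]
  define v where "v = wks s (q x) y"
  have v: "v \<in> level d n1" unfolding v_def by (rule wks_level[OF s y])
  have tv: "take n v = wks s (q x) x" by (simp add: v_def x_def take_wks)
  have "wks s (h x) v \<noteq> v" using n1(2) v Qx L[OF x] unfolding girth_gt_def by auto
  then have "\<exists>g0 g1 e0 e1. set g0 \<subseteq> letters m \<and> set g1 \<subseteq> letters m \<and> wk st g0 (wk st (q x) b) = wk st (q x) b \<and>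
    wk st g1 (wk st (q x) b) = wk st (q x) b \<and> tri s 2 (case_nat g0 (\<lambda>_. g1)) v (case_nat e0 (\<lambda>_. e1))"
   using Qx by (intro lifted_pair[OF s sym n1(1) v tv, where g = "g x" and h = "h x" and e = "e x"]) auto
  then obtain g0 g1 e0 e1 where G: "set g0 \<subseteq> letters m" "set g1 \<subseteq> letters m" "wk st g0 (wk st (q x) b) = wk st (q x) b"
    "wk st g1 (wk st (q x) b) = wk st (q x) b" "tri s 2 (case_nat g0 (\<lambda>_. g1)) v (case_nat e0 (\<lambda>_. e1))" by blast
  have GG: "Gen (derv s (case_nat g0 (\<lambda>_. g1)) v)" by (rule Gn[OF v G(1,2,5)])
  have fix01: "wks s (case_nat g0 (\<lambda>_. g1) j) v = v" if "j < 2" for j using G(5) that by (simp add: tri_def)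
  show ?thesis
   by (rule tile_from_Gen[OF s sym y, of "q x" m "case_nat g0 (\<lambda>_. g1)"])
     (use Qx G(1-4) GG fix01 in \<open>auto simp: v_def split: nat.split\<close>)
 qed
 then obtain k where k: "\<And>y u. y \<in> level d n1 ==> u \<in> level d (k y) ==> tile s m st b (y @ u)" by metis
 define K where "K = Max (k ` level d n1)"
 have K: "k y \<le> K" if "y \<in> level d n1" for y using that by (simp add: K_def)
 define Z where "Z = (\<Union>y\<in>level d n1. (\<lambda>u. y @ u) ` level d (k y))"
 show thesis
 proof (rule that[of Z "n1 + K"])
  show "finite Z" by (simp add: Z_def)
  show "tile s m st b u" if "u \<in> Z" for u using that k by (auto simp: Z_def)
  fix z assume z: "z \<in> level d (n1 + K)"
  have y: "take n1 z \<in> level d n1" using z set_take_subset[of n1 z] by (auto simp: level_iff)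
  let ?u = "take (k (take n1 z)) (drop n1 z)"
  have "set ?u \<subseteq> set z" by (meson set_drop_subset set_take_subset subset_trans)
  then have "?u \<in> level d (k (take n1 z))" using z K[OF y] by (auto simp: level_iff)
  then have "take n1 z @ ?u \<in> Z" using y by (auto simp: Z_def)
  moreover have "z = (take n1 z @ ?u) @ drop (k (take n1 z)) (drop n1 z)" by (simp only: append_assoc append_take_drop_id)
  ultimately show "\<exists>u\<in>Z. \<exists>w. z = u @ w" by blast
 qed
qed

end

section \<open>From good subtrees to components and expansion\<close>

context letter_group
begin

text \<open>Configurations move all lists, whereas an automorphism must be the identity outside the
  tree for \<open>permutes\<close>.\<close>

definition evf :: "config \<Rightarrow> (nat \<times> bool) list \<Rightarrow> nat list \<Rightarrow> nat list" where
 "evf s w v = (if v \<in> tree_verts d then wks s w v else v)"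

lemma tree_verts_iff: "v \<in> tree_verts d \<longleftrightarrow> v \<in> level d (length v)"
 by (simp add: level_def)

lemma level_tree: "v \<in> level d n ==> v \<in> tree_verts d"
 by (simp add: level_def)

lemma wks_tree: "valid s ==> wks s w v \<in> tree_verts d \<longleftrightarrow> v \<in> tree_verts d"
 using wks_level[of s v "length v" w] wks_level[of s "wks s w v" "length v" "winv w"] wk_winv[OF sym_act_stp UNIV_I, of s w v]
 by (auto simp: tree_verts_iff)

lemma evf_Nil: "evf s [] = id"
 by (auto simp: evf_def)

lemma evf_append: "valid s ==> evf s (u @ w) = evf s w \<circ> evf s u"
 by (auto simp: evf_def wks_tree)

lemma evf_winv: "valid s ==> evf s (winv w) \<circ> evf s w = id" "valid s ==> evf s w \<circ> evf s (winv w) = id"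
 using wk_winv[OF sym_act_stp UNIV_I, of s w] wk_winv'[OF sym_act_stp UNIV_I, of s w] by (auto simp: evf_def wks_tree)

text \<open>Started at the carrier of the subgroup, this spans its Schreier coset graph; a coset is
  kept as a set of functions, and reading a letter composes all of them with it afterwards.\<close>

definition cst :: "config \<Rightarrow> nat \<times> bool \<Rightarrow> (nat list \<Rightarrow> nat list) set \<Rightarrow> (nat list \<Rightarrow> nat list) set" where
 "cst s l C = (\<lambda>f. evf s [l] \<circ> f) ` C"

lemma wk_cst: "valid s ==> wk (cst s) w C = (\<lambda>f. evf s w \<circ> f) ` C"
proof (induction w arbitrary: C)
 case Nil
 then show ?case by (simp add: evf_Nil)
next
 case (Cons l w)
 have "evf s (l # w) = evf s w \<circ> evf s [l]" using evf_append[OF Cons.prems, of "[l]" w] by simp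
 then show ?case using Cons by (simp add: cst_def image_image comp_assoc)
qed

lemma sym_cst: "valid s ==> sym_act (cst s) UNIV"
 unfolding sym_act_def
proof (intro allI ballI conjI UNIV_I)
 fix l :: "nat \<times> bool" and C assume s: "valid s"
 have "evf s [linv l] \<circ> evf s [l] = id" using evf_winv(1)[OF s, of "[l]"] by simp
 then have ff: "evf s [linv l] \<circ> (evf s [l] \<circ> f) = f" for f by (simp add: comp_assoc[symmetric])
 show "cst s (linv l) (cst s l C) = C" unfolding cst_def image_image by (simp only: ff image_ident)
qed

definition wgrp :: "config \<Rightarrow> nat \<Rightarrow> (nat list \<Rightarrow> nat list) set \<Rightarrow> bool" where
 "wgrp s m D \<longleftrightarrow> id \<in> D \<and> (\<forall>f\<in>D. \<forall>g\<in>D. g \<circ> f \<in> D) \<and> (\<forall>f\<in>D. \<exists>g\<in>D. g \<circ> f = id \<and> f \<circ> g = id) \<and>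
  (\<forall>f\<in>D. \<exists>w. set w \<subseteq> letters m \<and> f = evf s w)"

lemma wgrpD:
 assumes "wgrp s m D"
 shows "id \<in> D" "\<And>f g. f \<in> D ==> g \<in> D ==> g \<circ> f \<in> D" "\<And>f. f \<in> D ==> \<exists>g\<in>D. g \<circ> f = id \<and> f \<circ> g = id"
  "\<And>f. f \<in> D ==> \<exists>w. set w \<subseteq> letters m \<and> f = evf s w"
 using assms by (auto simp: wgrp_def)

text \<open>Apply the equality of the two cosets to the identity, an element of \<open>D\<close>,
  and cancel \<open>q\<close> on the left of the composition.\<close>

lemma closed_word:
 assumes s: "valid s" and D: "wgrp s m D" and cl: "wk (cst s) f (wk (cst s) q D) = wk (cst s) q D"
 shows "evf s (q @ f @ winv q) \<in> D"
proof -
 have "wk (cst s) (q @ f) D = wk (cst s) q D" using cl by simp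
 then have "(\<lambda>x. evf s (q @ f) \<circ> x) ` D = (\<lambda>x. evf s q \<circ> x) ` D" by (simp only: wk_cst[OF s])
 then have "evf s (q @ f) \<circ> id \<in> (\<lambda>x. evf s q \<circ> x) ` D" using wgrpD(1)[OF D] by blast
 then obtain x where x: "x \<in> D" "evf s (q @ f) = evf s q \<circ> x" by auto
 have "evf s (q @ f @ winv q) = evf s (winv q) \<circ> evf s (q @ f)" using evf_append[OF s, of "q @ f" "winv q"] by simp
 also have "\<dots> = (evf s (winv q) \<circ> evf s q) \<circ> x" by (simp only: x(2) comp_assoc)
 also have "\<dots> = x" by (simp add: evf_winv[OF s])
 finally show ?thesis using x(1) by simp
qed

lemma wgrp_level:
 assumes s: "valid s" and D: "wgrp s m D" and f: "f \<in> D" and v: "v \<in> level d n"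
 shows "f v \<in> level d n" "k \<le> n ==> take k (f v) = f (take k v)"
proof -
 obtain w where w: "f = evf s w" using wgrpD(4)[OF D f] by blast
 have ev: "evf s w v = wks s w v" using level_tree[OF v] by (simp add: evf_def)
 show "f v \<in> level d n" using wks_level[OF s v] by (simp add: w ev)
 assume "k \<le> n"
 then have "take k v \<in> level d k" using v set_take_subset[of k v] by (auto simp: level_iff)
 then have "evf s w (take k v) = wks s w (take k v)" using level_tree by (simp add: evf_def)
 then show "take k (f v) = f (take k v)" by (simp add: w ev take_wks)
qed

lemma wgrp_inj:
 assumes D: "wgrp s m D" and f: "f \<in> D"
 shows "inj f"
proof -
 obtain g where "g \<circ> f = id" using wgrpD(3)[OF D f] by blast
 then show ?thesis by (metis inj_on_id inj_on_imageI2)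
qed

section \<open>Action of the subgroup on a single good subtree\<close>

definition cyl :: "nat \<Rightarrow> nat list \<Rightarrow> nat list set" where
 "cyl n u = {z \<in> level d n. take (length u) z = u}"

lemma cyl_level: "cyl n u \<subseteq> level d n"
 by (auto simp: cyl_def)

lemma finite_cyl [simp]: "finite (cyl n u)"
 by (rule finite_subset[OF cyl_level]) simp

lemma cyl_append: "u \<in> level d l ==> cyl (l + k) u = (\<lambda>w. u @ w) ` level d k"
proof
 assume u: "u \<in> level d l"
 show "cyl (l + k) u \<subseteq> (\<lambda>w. u @ w) ` level d k"
 proof
  fix z assume z: "z \<in> cyl (l + k) u"
  then have tz: "take l z = u" using u by (simp add: cyl_def level_iff)
  have "z = u @ drop l z" using append_take_drop_id[of l z, symmetric] unfolding tz .
  moreover have "drop l z \<in> level d k" using z set_drop_subset[of l z] by (auto simp: cyl_def level_iff)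
  ultimately show "z \<in> (\<lambda>w. u @ w) ` level d k" by (rule image_eqI)
 qed
 show "(\<lambda>w. u @ w) ` level d k \<subseteq> cyl (l + k) u" using u by (auto simp: cyl_def level_iff)
qed

lemma card_cyl: "u \<in> level d l ==> card (cyl (l + k) u) = d ^ k"
 by (simp add: cyl_append card_image inj_on_def)

text \<open>The coordinate \<open>\<beta>\<close> reads the subtree at \<open>wks s q u\<close> and
  comes back by \<open>winv q\<close>. In it, the conjugated loops of the coset graph, which belong
  to \<open>D\<close>, act like words of a good configuration.\<close>

lemma tile_data:
 assumes s: "valid s" and D: "wgrp s m D" and u: "u \<in> level d l" and t: "tile s m (cst s) D u"
 shows "\<exists>M \<beta> s'. valid s' \<and> Good M s' \<and> (\<forall>k. bij_betw \<beta> (level d k) (cyl (l + k) u)) \<and>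
  (\<forall>x. set x \<subseteq> letters M --> (\<exists>\<delta>\<in>D. \<forall>k. \<forall>w\<in>level d k. \<delta> (\<beta> w) = \<beta> (wks s' x w)))"
proof -
 have sU: "sym_act (stp s) UNIV" by (rule sym_act_stp[OF s])
 obtain M q f where q: "set q \<subseteq> letters m" and f: "\<And>j. j < M ==> set (f j) \<subseteq> letters m"
  "\<And>j. j < M ==> wk (cst s) (f j) (wk (cst s) q D) = wk (cst s) q D" "\<And>j. j < M ==> wks s (f j) (wks s q u) = wks s q u"
  and G: "Good M (derv s f (wks s q u))" using t unfolding tile_def by blast
 define v where "v = wks s q u"
 define s' where "s' = derv s f v"
 define \<beta> where "\<beta> w = wks s (winv q) (v @ w)" for w
 have v: "v \<in> level d l" unfolding v_def by (rule wks_level[OF s u])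
 have lu: "length u = l" "length v = l" using u v by (simp_all add: level_iff)
 have \<beta>q: "wks s q (\<beta> w) = v @ w" for w unfolding \<beta>_def by (rule wk_winv'[OF sU UNIV_I])
 have bij: "bij_betw \<beta> (level d k) (cyl (l + k) u)" for k
  unfolding bij_betw_def
 proof
  show "inj_on \<beta> (level d k)" by (rule inj_onI) (metis \<beta>q same_append_eq)
  show "\<beta> ` level d k = cyl (l + k) u"
  proof
   show "\<beta> ` level d k \<subseteq> cyl (l + k) u"
   proof (rule image_subsetI)
    fix w assume "w \<in> level d k"
    then have "v @ w \<in> level d (l + k)" using v by (auto simp: level_iff)
    moreover have "take l (\<beta> w) = u"
     unfolding \<beta>_def take_wks using lu wk_winv[OF sU UNIV_I, of q u] by (simp add: v_def)
    ultimately show "\<beta> w \<in> cyl (l + k) u" using wks_level[OF s] lu by (simp add: cyl_def \<beta>_def)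
   qed
   show "cyl (l + k) u \<subseteq> \<beta> ` level d k"
   proof
    fix z assume z: "z \<in> cyl (l + k) u"
    define y where "y = wks s q z"
    have y: "y \<in> level d (l + k)" unfolding y_def using z by (intro wks_level[OF s]) (simp add: cyl_def)
    have "take l y = v" unfolding y_def take_wks using z lu by (simp add: cyl_def v_def)
    then have yy: "y = v @ drop l y" using append_take_drop_id[of l y] by simp
    have "drop l y \<in> level d k" using y set_drop_subset[of l y] by (auto simp: level_iff)
    moreover have "\<beta> (drop l y) = wks s (winv q) y" by (simp only: \<beta>_def yy[symmetric])
    then have "z = \<beta> (drop l y)" by (simp only: y_def wk_winv[OF sU UNIV_I])
    ultimately show "z \<in> \<beta> ` level d k" by blast
   qed
  qed
 qed
 have ex: "\<exists>\<delta>\<in>D. \<forall>k. \<forall>w\<in>level d k. \<delta> (\<beta> w) = \<beta> (wks s' x w)" if x: "set x \<subseteq> letters M" for x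
 proof (intro bexI allI ballI)
  show "evf s (q @ subw f x @ winv q) \<in> D"
   by (rule closed_word[OF s D wk_subw[OF sym_cst[OF s] f(2) x]])
  fix k w assume w: "w \<in> level d k"
  have "\<beta> w \<in> cyl (l + k) u" using bij w by (auto simp: bij_betw_def)
  then have "\<beta> w \<in> tree_verts d" using level_tree by (auto simp: cyl_def)
  then have "evf s (q @ subw f x @ winv q) (\<beta> w) = wks s (winv q) (wks s (subw f x) (v @ w))" by (simp add: evf_def \<beta>q)
  also have "wks s (subw f x) (v @ w) = v @ wks s' x w" unfolding s'_def v_def by (rule wks_subw[OF s f(3) x])
  finally show "evf s (q @ subw f x @ winv q) (\<beta> w) = \<beta> (wks s' x w)" by (simp add: \<beta>_def)
 qed
 show ?thesis using valid_derv[OF s, of f v] G bij ex unfolding s'_def v_def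
  by (intro exI[of _ M] exI[of _ \<beta>] exI[of _ "derv s f (wks s q u)"] conjI allI impI) (simp_all add: v_def s'_def)
qed

lemma tile_conn:
 assumes s: "valid s" and D: "wgrp s m D" and u: "u \<in> level d l" and t: "tile s m (cst s) D u"
  and z: "z \<in> cyl (l + k) u" "z' \<in> cyl (l + k) u"
 shows "\<exists>\<delta>\<in>D. \<delta> z = z'"
proof -
 obtain M \<beta> s' where T: "valid s'" "Good M s'" "\<And>k. bij_betw \<beta> (level d k) (cyl (l + k) u)"
  "\<And>x. set x \<subseteq> letters M ==> \<exists>\<delta>\<in>D. \<forall>k. \<forall>w\<in>level d k. \<delta> (\<beta> w) = \<beta> (wks s' x w)"
  using tile_data[OF s D u t] by blast
 have im: "\<beta> ` level d k = cyl (l + k) u" using T(3)[of k] by (simp add: bij_betw_def)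
 obtain w where w1: "w \<in> level d k" "z = \<beta> w" using z(1) unfolding im[symmetric] by blast
 obtain w' where w2: "w' \<in> level d k" "z' = \<beta> w'" using z(2) unfolding im[symmetric] by blast
 note w = w1 w2
 have "conn M k s'" using T(2) by (simp add: Good_def)
 then obtain x where x: "set x \<subseteq> letters M" "wks s' x w = w'" using w unfolding conn_def by blast
 then show ?thesis using T(4)[OF x(1)] w by metis
qed

text \<open>Apply the gap to the centred indicator of \<open>B\<close>. Its squared norm is
  \<open>b * (1 - b / N)\<close>, at least \<open>b / 4\<close> when the density of \<open>B\<close>
  is at most \<open>3 / 4\<close>; this turns the constant \<open>4 * M\<close> into
  \<open>16 * M\<close>.\<close>

lemma tile_gap:
 assumes d: "d = 2" and s: "valid s" and D: "wgrp s m D" and u: "u \<in> level d l" and t: "tile s m (cst s) D u"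
 shows "\<exists>M \<delta>. (\<forall>j<M. \<delta> j \<in> D) \<and> (\<forall>k B. 4 * real (card (B \<inter> cyl (l + k) u)) \<le> 3 * real (card (cyl (l + k) u)) -->
  real (card (B \<inter> cyl (l + k) u)) \<le> 16 * real M * (\<Sum>j<M. real (card {z \<in> cyl (l + k) u. (z \<in> B) \<noteq> (\<delta> j z \<in> B)})))"
proof -
 obtain M \<beta> s' where T: "valid s'" "Good M s'" "\<And>k. bij_betw \<beta> (level d k) (cyl (l + k) u)"
  "\<And>x. set x \<subseteq> letters M ==> \<exists>\<delta>\<in>D. \<forall>k. \<forall>w\<in>level d k. \<delta> (\<beta> w) = \<beta> (wks s' x w)"
  using tile_data[OF s D u t] by blast
 have gp: "gap M s'" by (rule T(2)[unfolded Good_def, THEN conjunct2, THEN mp, OF d])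
 have "\<forall>j\<in>{..<M}. \<exists>\<delta>. \<delta> \<in> D \<and> (\<forall>k. \<forall>w\<in>level d k. \<delta> (\<beta> w) = \<beta> (stp s' (j, True) w))"
 proof
  fix j assume "j \<in> {..<M}"
  then have "set [(j, True)] \<subseteq> letters M" by (simp add: letters_def)
  from T(4)[OF this] show "\<exists>\<delta>. \<delta> \<in> D \<and> (\<forall>k. \<forall>w\<in>level d k. \<delta> (\<beta> w) = \<beta> (stp s' (j, True) w))" by auto
 qed
 from bchoice[OF this] obtain \<delta> where \<delta>: "\<forall>j\<in>{..<M}. \<delta> j \<in> D \<and> (\<forall>k. \<forall>w\<in>level d k. \<delta> j (\<beta> w) = \<beta> (stp s' (j, True) w))" ..
 have "real (card (B \<inter> cyl (l + k) u)) \<le> 16 * real M * (\<Sum>j<M. real (card {z \<in> cyl (l + k) u. (z \<in> B) \<noteq> (\<delta> j z \<in> B)}))"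
  if small: "4 * real (card (B \<inter> cyl (l + k) u)) \<le> 3 * real (card (cyl (l + k) u))" for k B
 proof -
  let ?L = "level d k" and ?T = "cyl (l + k) u"
  have inj: "inj_on \<beta> ?L" and im: "\<beta> ` ?L = ?T" using T(3)[of k] by (auto simp: bij_betw_def)
  define i where "i w = (of_bool (\<beta> w \<in> B) :: real)" for w
  define b where "b = real (card (B \<inter> ?T))"
  define N where "N = real (card ?T)"
  have N0: "0 < N" using card_cyl[OF u, of k] d2 by (simp add: N_def)
  have cL: "real (card ?L) = N" using bij_betw_same_card[OF T(3)[of k]] by (simp only: N_def)
  then have cL': "real d ^ k = N" by simp
  have sumi: "(\<Sum>w\<in>?L. i w) = b"
  proof -
   have "(\<Sum>w\<in>?L. i w) = (\<Sum>z\<in>?T. of_bool (z \<in> B))" unfolding i_def im[symmetric] by (rule sum.reindex_cong[OF inj refl refl, symmetric])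
   also have "\<dots> = b" by (simp add: sum_of_bool_eq b_def Int_commute)
   finally show ?thesis .
  qed
  define f where "f w = i w - b / N" for w
  have i2: "(i w)\<^sup>2 = i w" for w by (simp add: i_def)
  have "(\<Sum>w\<in>?L. f w) = 0" using cL N0 by (simp add: f_def sum_subtractf sumi)
  then have g: "(\<Sum>w\<in>?L. (f w)\<^sup>2) \<le> 4 * real M * energy M k s' f" using gp by (simp add: gap_def)
  have "(f w)\<^sup>2 = i w * (1 - 2 * (b / N)) + (b / N)\<^sup>2" for w
   using i2[of w] by (simp add: f_def power2_eq_square algebra_simps)
  then have "(\<Sum>w\<in>?L. (f w)\<^sup>2) = (\<Sum>w\<in>?L. i w) * (1 - 2 * (b / N)) + N * (b / N)\<^sup>2"
   by (simp add: sum.distrib sum_distrib_right cL' del: sum_of_bool_eq)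
  also have "\<dots> = b * (1 - b / N)" unfolding sumi using N0 by (simp add: power2_eq_square field_simps)
  finally have f2: "(\<Sum>w\<in>?L. (f w)\<^sup>2) = b * (1 - b / N)" .
  have "b * (1 / 4) \<le> b * (1 - b / N)"
   using small N0 by (intro mult_left_mono) (simp_all add: b_def N_def field_simps)
  then have "b \<le> 16 * real M * energy M k s' f" using g f2 by linarith
  also have "energy M k s' f = (\<Sum>j<M. real (card {z \<in> ?T. (z \<in> B) \<noteq> (\<delta> j z \<in> B)}))"
  proof -
   have "energy M k s' f = (\<Sum>j<M. \<Sum>w\<in>?L. (f w - f (stp s' (j, True) w))\<^sup>2)"
    unfolding energy_def by (subst sum.cartesian_product) (simp only: case_prod_unfold)
   also have "\<dots> = (\<Sum>j<M. real (card {z \<in> ?T. (z \<in> B) \<noteq> (\<delta> j z \<in> B)}))"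
   proof (rule sum.cong[OF refl])
    fix j assume "j \<in> {..<M}"
    then have dj: "\<And>w. w \<in> ?L ==> \<beta> (stp s' (j, True) w) = \<delta> j (\<beta> w)" using \<delta> by auto
    have "(\<Sum>w\<in>?L. (f w - f (stp s' (j, True) w))\<^sup>2) = (\<Sum>w\<in>?L. of_bool ((\<beta> w \<in> B) \<noteq> (\<delta> j (\<beta> w) \<in> B)))"
     by (rule sum.cong[OF refl]) (auto simp: f_def i_def dj)
    also have "\<dots> = (\<Sum>z\<in>?T. of_bool ((z \<in> B) \<noteq> (\<delta> j z \<in> B)))"
     unfolding im[symmetric] by (rule sum.reindex_cong[OF inj refl refl, symmetric])
    also have "\<dots> = real (card (?T \<inter> {z. (z \<in> B) \<noteq> (\<delta> j z \<in> B)}))" by (simp add: sum_of_bool_eq)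
    also have "?T \<inter> {z. (z \<in> B) \<noteq> (\<delta> j z \<in> B)} = {z \<in> ?T. (z \<in> B) \<noteq> (\<delta> j z \<in> B)}" by blast
    finally show "(\<Sum>w\<in>?L. (f w - f (stp s' (j, True) w))\<^sup>2) = real (card {z \<in> ?T. (z \<in> B) \<noteq> (\<delta> j z \<in> B)})" .
   qed
   finally show ?thesis .
  qed
  finally show ?thesis by (simp only: b_def)
 qed
 then show ?thesis using \<delta> by (intro exI[of _ M] exI[of _ \<delta>]) auto
qed

text \<open>The density in a cylinder is the mean of the densities in its parts. Read
  contrapositively, it leads from a dense subtree of any depth to a dense one at the common depth
  \<open>N\<close>.\<close>

lemma cyl_average:
 assumes u: "length u \<le> N" and n: "N \<le> n"
  and le: "\<And>y. y \<in> cyl N u ==> 4 * card (B \<inter> cyl n y) \<le> 3 * card (cyl n y)"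
 shows "4 * card (B \<inter> cyl n u) \<le> 3 * card (cyl n u)"
proof -
 have eq: "cyl n u = (\<Union>y\<in>cyl N u. cyl n y)"
 proof (rule Set.set_eqI)
  fix z
  show "z \<in> cyl n u \<longleftrightarrow> z \<in> (\<Union>y\<in>cyl N u. cyl n y)"
  proof
   assume z: "z \<in> cyl n u"
   have "set (take N z) \<subseteq> set z" by (rule set_take_subset)
   then have "take N z \<in> cyl N u" using z u n by (auto simp: cyl_def level_iff min_def)
   moreover have "z \<in> cyl n (take N z)" using z n by (auto simp: cyl_def level_iff)
   ultimately show "z \<in> (\<Union>y\<in>cyl N u. cyl n y)" by blast
  next
   assume "z \<in> (\<Union>y\<in>cyl N u. cyl n y)"
   then obtain y where y: "y \<in> cyl N u" "z \<in> cyl n y" by blast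
   then have "take N z = y" "take (length u) y = u" "z \<in> level d n" by (auto simp: cyl_def level_iff)
   moreover have "take (length u) (take N z) = take (length u) z" using u by (simp add: min_def)
   ultimately show "z \<in> cyl n u" by (simp add: cyl_def)
  qed
 qed
 have dj: "cyl n y \<inter> cyl n y' = {}" if "y \<in> cyl N u" "y' \<in> cyl N u" "y \<noteq> y'" for y y'
 proof -
  have "length y = N" "length y' = N" using that by (auto simp: cyl_def level_iff)
  then show ?thesis using that(3) by (auto simp: cyl_def)
 qed
 have c1: "card (cyl n u) = (\<Sum>y\<in>cyl N u. card (cyl n y))"
  unfolding eq by (rule card_UN_disjoint) (use dj in auto)
 have "B \<inter> cyl n u = (\<Union>y\<in>cyl N u. B \<inter> cyl n y)" unfolding eq by blast
 then have c2: "card (B \<inter> cyl n u) = (\<Sum>y\<in>cyl N u. card (B \<inter> cyl n y))"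
  by (simp only:) (rule card_UN_disjoint, use dj in auto)
 show ?thesis unfolding c1 c2 sum_distrib_left by (rule sum_mono[OF le])
qed

definition orbit :: "(nat list \<Rightarrow> nat list) set \<Rightarrow> nat list \<Rightarrow> nat list set" where
 "orbit D x = (\<lambda>\<delta>. \<delta> x) ` D"

lemma orbit_eq:
 assumes D: "wgrp s m D" and "y \<in> orbit D x"
 shows "orbit D y = orbit D x"
proof -
 obtain f where f: "f \<in> D" "y = f x" using assms(2) by (auto simp: orbit_def)
 obtain g where g: "g \<in> D" "g \<circ> f = id" using wgrpD(3)[OF D f(1)] by blast
 have "h y \<in> orbit D x" if "h \<in> D" for h
  using wgrpD(2)[OF D f(1) that] f(2) by (auto simp: orbit_def intro: image_eqI[of _ _ "h \<circ> f"])
 moreover have "h x \<in> orbit D y" if "h \<in> D" for h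
 proof -
  have "h x = (h \<circ> g) y" using g(2) f(2) by (metis comp_apply id_apply)
  then show ?thesis using wgrpD(2)[OF D g(1) that] unfolding orbit_def by (rule image_eqI)
 qed
 ultimately show ?thesis by (auto simp: orbit_def)
qed

text \<open>Each good subtree lies within one orbit on every level it reaches. Levels shallower than
  \<open>N\<close> need not be covered, but have at most \<open>d ^ N\<close> vertices.\<close>

lemma few_orbits:
 assumes s: "valid s" and D: "wgrp s m D"
  and Z: "finite Z" "\<And>y. y \<in> level d N ==> \<exists>u\<in>Z. \<exists>w. y = u @ w" "\<And>u. u \<in> Z ==> tile s m (cst s) D u"
 shows "card (orbit D ` level d n) \<le> card Z + d ^ N"
proof (cases "N \<le> n")
 case False
 have "card (orbit D ` level d n) \<le> d ^ n" using card_image_le[of "level d n" "orbit D"] by simp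
 also have "\<dots> \<le> d ^ N" using False d2 by (intro power_increasing) auto
 finally show ?thesis by simp
next
 case True
 define c where "c u = (SOME z. z \<in> cyl n u)" for u
 have "orbit D ` level d n \<subseteq> (\<lambda>u. orbit D (c u)) ` Z"
 proof (rule image_subsetI)
  fix z assume z: "z \<in> level d n"
  have "take N z \<in> level d N" using z True set_take_subset[of N z] by (auto simp: level_iff)
  then obtain u w where u: "u \<in> Z" "take N z = u @ w" using Z(2) by blast
  have z': "z = u @ w @ drop N z" using append_take_drop_id[of N z] u(2) by (metis append_assoc)
  have ul: "u \<in> level d (length u)" using \<open>take N z \<in> level d N\<close> unfolding u(2) by (simp add: level_iff)
  have zc: "z \<in> cyl n u" using z z' by (metis (mono_tags, lifting) append_eq_conv_conj cyl_def mem_Collect_eq)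
  have ln: "n = length u + (n - length u)" using z z' by (metis append_eq_conv_conj diff_add_inverse le_add_diff_inverse length_append level_iff le_add1)
  have "c u \<in> cyl n u" unfolding c_def by (rule someI[of "\<lambda>z. z \<in> cyl n u", OF zc])
  then have "\<exists>\<delta>\<in>D. \<delta> (c u) = z" using tile_conn[OF s D ul Z(3)[OF u(1)], of "c u" "n - length u" z] zc ln by simp
  then have "z \<in> orbit D (c u)" by (auto simp: orbit_def)
  then show "orbit D z \<in> (\<lambda>u. orbit D (c u)) ` Z" using orbit_eq[OF D] u(1) by blast
 qed
 then have "card (orbit D ` level d n) \<le> card ((\<lambda>u. orbit D (c u)) ` Z)" using Z(1) by (intro card_mono) auto
 also have "\<dots> \<le> card Z" by (rule card_image_le[OF Z(1)])
 finally show ?thesis by simp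
qed

text \<open>The quantity \<open>bd\<close> controls how many points a fixed element moves out of
  \<open>A\<close>, with a constant depending on the element. So all estimates may use only finitely
  many elements: those of the gaps on the subtrees, and one for each pair of level-\<open>N\<close>
  vertices in a common orbit. The bound \<open>3 / 4\<close> on the density is applied to
  \<open>A\<close> and to its complement.\<close>

lemma expansion:
 fixes bd :: "nat list set \<Rightarrow> nat"
 assumes d: "d = 2" and s: "valid s" and D: "wgrp s m D"
  and Z: "finite Z" "\<And>y. y \<in> level d N ==> \<exists>u\<in>Z. \<exists>w. y = u @ w" "\<And>u. u \<in> Z ==> tile s m (cst s) D u"
  and bd: "\<And>\<delta>. \<delta> \<in> D ==> \<exists>K. \<forall>n A. A \<subseteq> level d n --> card {z\<in>A. \<delta> z \<notin> A} \<le> K * bd A"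
 shows "\<exists>C>0. \<forall>n x A. x \<in> level d n --> A \<subset> orbit D x --> A \<noteq> {} -->
  real (min (card A) (card (orbit D x - A))) \<le> C * real (bd A)"
proof -
 \<comment> \<open>Points that enter \<open>A\<close> under an element correspond to points that
   leave \<open>A\<close> under its inverse.\<close>
 have bd2: "\<exists>K. \<forall>n A. A \<subseteq> level d n --> card {z\<in>level d n. (z \<in> A) \<noteq> (\<delta> z \<in> A)} \<le> K * bd A" if \<delta>: "\<delta> \<in> D" for \<delta>
 proof -
  obtain \<gamma> where \<gamma>: "\<gamma> \<in> D" "\<gamma> \<circ> \<delta> = id" using wgrpD(3)[OF D \<delta>] by blast
  obtain K1 where K1: "\<And>n A. A \<subseteq> level d n ==> card {z\<in>A. \<delta> z \<notin> A} \<le> K1 * bd A" using bd[OF \<delta>] by blast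
  obtain K2 where K2: "\<And>n A. A \<subseteq> level d n ==> card {z\<in>A. \<gamma> z \<notin> A} \<le> K2 * bd A" using bd[OF \<gamma>(1)] by blast
  have "card {z\<in>level d n. (z \<in> A) \<noteq> (\<delta> z \<in> A)} \<le> (K1 + K2) * bd A" if A: "A \<subseteq> level d n" for n A
  proof -
   have fA: "finite A" by (rule finite_subset[OF A]) simp
   have "card {z\<in>level d n. (z \<in> A) \<noteq> (\<delta> z \<in> A)} \<le> card ({z\<in>A. \<delta> z \<notin> A} \<union> {z\<in>level d n. z \<notin> A \<and> \<delta> z \<in> A})"
    using fA by (intro card_mono) auto
   also have "\<dots> \<le> card {z\<in>A. \<delta> z \<notin> A} + card {z\<in>level d n. z \<notin> A \<and> \<delta> z \<in> A}" by (rule card_Un_le)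
   also have "card {z\<in>level d n. z \<notin> A \<and> \<delta> z \<in> A} \<le> card {z\<in>A. \<gamma> z \<notin> A}"
   proof (rule card_inj_on_le)
    show "inj_on \<delta> {z\<in>level d n. z \<notin> A \<and> \<delta> z \<in> A}" using wgrp_inj[OF D \<delta>] by (rule inj_on_subset) simp
    have "\<gamma> (\<delta> z) = z" for z using \<gamma>(2) by (metis comp_apply id_apply)
    then show "\<delta> ` {z\<in>level d n. z \<notin> A \<and> \<delta> z \<in> A} \<subseteq> {z\<in>A. \<gamma> z \<notin> A}" by auto
   qed (use fA in simp)
   also have "card {z\<in>A. \<delta> z \<notin> A} + card {z\<in>A. \<gamma> z \<notin> A} \<le> (K1 + K2) * bd A"
    using K1[OF A] K2[OF A] by (simp add: distrib_right)
   finally show ?thesis by simp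
  qed
  then show ?thesis by blast
 qed
 define Z' where "Z' = {u\<in>Z. u \<in> level d (length u) \<and> length u \<le> N}"
 have fZ': "finite Z'" using Z(1) by (simp add: Z'_def)
 have "\<exists>c\<ge>0. \<forall>n A B. N \<le> n --> A \<subseteq> level d n --> B = A \<or> B = level d n - A --> 4 * card (B \<inter> cyl n u) \<le> 3 * card (cyl n u) -->
   real (card (B \<inter> cyl n u)) \<le> c * real (bd A)" if u: "u \<in> Z'" for u
 proof -
  have ul: "u \<in> level d (length u)" "u \<in> Z" "length u \<le> N" using u by (auto simp: Z'_def)
  obtain M \<delta> where M: "\<And>j. j < M ==> \<delta> j \<in> D" "\<And>k B. 4 * real (card (B \<inter> cyl (length u + k) u)) \<le> 3 * real (card (cyl (length u + k) u)) ==>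
    real (card (B \<inter> cyl (length u + k) u)) \<le> 16 * real M * (\<Sum>j<M. real (card {z \<in> cyl (length u + k) u. (z \<in> B) \<noteq> (\<delta> j z \<in> B)}))"
   using tile_gap[OF d s D ul(1) Z(3)[OF ul(2)]] by blast
  have "\<forall>j\<in>{..<M}. \<exists>K. \<forall>n A. A \<subseteq> level d n --> card {z\<in>level d n. (z \<in> A) \<noteq> (\<delta> j z \<in> A)} \<le> K * bd A"
   using bd2 M(1) by blast
  from bchoice[OF this] obtain K where K: "\<forall>j\<in>{..<M}. \<forall>n A. A \<subseteq> level d n --> card {z\<in>level d n. (z \<in> A) \<noteq> (\<delta> j z \<in> A)} \<le> K j * bd A" ..
  define c where "c = 16 * real M * (\<Sum>j<M. real (K j))"
  have "real (card (B \<inter> cyl n u)) \<le> c * real (bd A)"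
   if n: "N \<le> n" and A: "A \<subseteq> level d n" and B: "B = A \<or> B = level d n - A" and small: "4 * card (B \<inter> cyl n u) \<le> 3 * card (cyl n u)" for n A B
  proof -
   have ln: "length u + (n - length u) = n" using n ul(3) by simp
   have "real (4 * card (B \<inter> cyl n u)) \<le> real (3 * card (cyl n u))" using small by (simp only: of_nat_le_iff)
   then have "4 * real (card (B \<inter> cyl n u)) \<le> 3 * real (card (cyl n u))" by simp
   then have "real (card (B \<inter> cyl n u)) \<le> 16 * real M * (\<Sum>j<M. real (card {z \<in> cyl n u. (z \<in> B) \<noteq> (\<delta> j z \<in> B)}))"
    using M(2)[of B "n - length u"] by (simp only: ln)
   also have "\<dots> \<le> 16 * real M * (\<Sum>j<M. real (K j) * real (bd A))"
   proof (intro mult_left_mono sum_mono)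
    fix j assume j: "j \<in> {..<M}"
    have "{z \<in> cyl n u. (z \<in> B) \<noteq> (\<delta> j z \<in> B)} \<subseteq> {z\<in>level d n. (z \<in> A) \<noteq> (\<delta> j z \<in> A)}"
    proof
     fix z assume z: "z \<in> {z \<in> cyl n u. (z \<in> B) \<noteq> (\<delta> j z \<in> B)}"
     then have zl: "z \<in> level d n" using cyl_level by blast
     then have "\<delta> j z \<in> level d n" using wgrp_level(1)[OF s D M(1)] j by blast
     then show "z \<in> {z\<in>level d n. (z \<in> A) \<noteq> (\<delta> j z \<in> A)}" using z zl B by blast
    qed
    then have "card {z \<in> cyl n u. (z \<in> B) \<noteq> (\<delta> j z \<in> B)} \<le> card {z\<in>level d n. (z \<in> A) \<noteq> (\<delta> j z \<in> A)}" by (intro card_mono) auto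
    also have "\<dots> \<le> K j * bd A" using K j A by blast
    finally have "real (card {z \<in> cyl n u. (z \<in> B) \<noteq> (\<delta> j z \<in> B)}) \<le> real (K j * bd A)" by (simp only: of_nat_le_iff)
    then show "real (card {z \<in> cyl n u. (z \<in> B) \<noteq> (\<delta> j z \<in> B)}) \<le> real (K j) * real (bd A)" by simp
   qed simp
   also have "\<dots> = c * real (bd A)" by (simp add: c_def sum_distrib_right)
   finally show ?thesis .
  qed
  moreover have "0 \<le> c" by (simp add: c_def sum_nonneg)
  ultimately show ?thesis by blast
 qed
 then have "\<forall>u\<in>Z'. \<exists>c. 0 \<le> c \<and> (\<forall>n A B. N \<le> n --> A \<subseteq> level d n --> B = A \<or> B = level d n - A --> 4 * card (B \<inter> cyl n u) \<le> 3 * card (cyl n u) -->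
   real (card (B \<inter> cyl n u)) \<le> c * real (bd A))" by blast
 from bchoice[OF this] obtain c where "\<forall>u\<in>Z'. 0 \<le> c u \<and> (\<forall>n A B. N \<le> n --> A \<subseteq> level d n --> B = A \<or> B = level d n - A --> 4 * card (B \<inter> cyl n u) \<le> 3 * card (cyl n u) -->
   real (card (B \<inter> cyl n u)) \<le> c u * real (bd A))" ..
 then have c0: "\<And>u. u \<in> Z' ==> 0 \<le> c u" and c: "\<And>u n A B. u \<in> Z' ==> N \<le> n ==> A \<subseteq> level d n ==> B = A \<or> B = level d n - A ==>
   4 * card (B \<inter> cyl n u) \<le> 3 * card (cyl n u) ==> real (card (B \<inter> cyl n u)) \<le> c u * real (bd A)" by blast+
 define cs where "cs = (\<Sum>u\<in>Z'. c u)"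
 have cs0: "0 \<le> cs" unfolding cs_def by (rule sum_nonneg[OF c0])
 \<comment> \<open>Finitely many pairs, with one element and one constant for each, fixed before the
   level \<open>n\<close> is chosen.\<close>
 define PR where "PR = {p\<in>level d N \<times> level d N. snd p \<in> orbit D (fst p)}"
 have fPR: "finite PR" by (simp add: PR_def)
 have "\<forall>p\<in>PR. \<exists>\<delta>K. fst \<delta>K \<in> D \<and> fst \<delta>K (fst p) = snd p \<and> (\<forall>n A. A \<subseteq> level d n --> card {z\<in>A. fst \<delta>K z \<notin> A} \<le> snd \<delta>K * bd A)"
 proof
  fix p assume "p \<in> PR"
  then obtain \<delta> where \<delta>: "\<delta> \<in> D" "\<delta> (fst p) = snd p" by (auto simp: PR_def orbit_def)
  obtain K where "\<forall>n A. A \<subseteq> level d n --> card {z\<in>A. \<delta> z \<notin> A} \<le> K * bd A" using bd[OF \<delta>(1)] by blast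
  then show "\<exists>\<delta>K. fst \<delta>K \<in> D \<and> fst \<delta>K (fst p) = snd p \<and> (\<forall>n A. A \<subseteq> level d n --> card {z\<in>A. fst \<delta>K z \<notin> A} \<le> snd \<delta>K * bd A)"
   using \<delta> by (intro exI[of _ "(\<delta>, K)"]) simp
 qed
 from bchoice[OF this] obtain P where P: "\<forall>p\<in>PR. fst (P p) \<in> D \<and> fst (P p) (fst p) = snd p \<and> (\<forall>n A. A \<subseteq> level d n --> card {z\<in>A. fst (P p) z \<notin> A} \<le> snd (P p) * bd A)" ..
 define Kp where "Kp = (\<Sum>p\<in>PR. snd (P p))"
 have Kp: "snd (P p) \<le> Kp" if "p \<in> PR" for p unfolding Kp_def by (rule member_le_sum[OF that]) (use fPR in auto)
 \<comment> \<open>The summands cover, in this order, the levels shallower than \<open>N\<close>,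
   the case in which a gap applies on every subtree, and the comparison of two subtrees; the final 1
   gives positivity.\<close>
 define C where "C = real d ^ N + cs + 2 * real d ^ N * real Kp + 1"
 have C0: "0 < C" using cs0 by (simp add: C_def add_nonneg_pos)
 have "real (min (card A) (card (orbit D x - A))) \<le> C * real (bd A)"
  if x: "x \<in> level d n" and A: "A \<subset> orbit D x" "A \<noteq> {}" for n x A
 proof -
  let ?O = "orbit D x"
  have OL: "?O \<subseteq> level d n" using wgrp_level(1)[OF s D _ x] by (auto simp: orbit_def)
  have fO: "finite ?O" by (rule finite_subset[OF OL]) simp
  have AL: "A \<subseteq> level d n" using A(1) OL by blast
  have fA: "finite A" by (rule finite_subset[OF AL]) simp
  have cO: "card ?O \<le> d ^ n" using card_mono[OF _ OL] by simp
  have minA: "min (card A) (card (?O - A)) \<le> card ?O" using card_mono[OF fO, of A] A(1) by auto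
  show ?thesis
  proof (cases "N \<le> n")
   case False
   \<comment> \<open>A proper nonempty part of an orbit is left by some element, so
     \<open>bd A\<close> is positive, while the part has at most \<open>d ^ N\<close>
     points.\<close>
   obtain a y where ay: "a \<in> A" "y \<in> ?O" "y \<notin> A" using A by blast
   have "y \<in> orbit D a" using orbit_eq[OF D, of a x] A(1) ay by blast
   then obtain \<delta> where \<delta>: "\<delta> \<in> D" "\<delta> a = y" by (auto simp: orbit_def)
   obtain K where K: "card {z\<in>A. \<delta> z \<notin> A} \<le> K * bd A" using bd[OF \<delta>(1)] AL by blast
   have "a \<in> {z\<in>A. \<delta> z \<notin> A}" using ay \<delta> by simp
   then have "0 < card {z\<in>A. \<delta> z \<notin> A}" using fA by (auto simp: card_gt_0_iff)
   then have b1: "1 \<le> bd A" using K by (cases "bd A") auto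
   have "d ^ n \<le> d ^ N" using False d2 by (intro power_increasing) auto
   then have "real (min (card A) (card (?O - A))) \<le> real (d ^ N)" using minA cO by (simp only: of_nat_le_iff)
   also have "\<dots> \<le> C" using cs0 by (simp add: C_def)
   also have "\<dots> \<le> C * real (bd A)" using C0 b1 by (simp add: mult_le_cancel_left1)
   finally show ?thesis .
  next
   case True
   define ZO where "ZO = {u\<in>Z'. cyl n u \<subseteq> ?O}"
   have ZZ: "ZO \<subseteq> Z'" "finite ZO" using fZ' by (auto simp: ZO_def)
   have cover: "\<exists>u\<in>ZO. z \<in> cyl n u" if z: "z \<in> ?O" for z
   proof -
    have zl: "z \<in> level d n" using z OL by blast
    have tz: "take N z \<in> level d N" using zl True set_take_subset[of N z] by (auto simp: level_iff)
    then obtain u w where u: "u \<in> Z" "take N z = u @ w" using Z(2) by blast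
    have uN: "u \<in> level d (length u)" "length u \<le> N" using tz u(2) by (auto simp: level_iff)
    have "take (length u) z = take (length u) (take N z)" using uN(2) by (simp add: min_def)
    then have zc: "z \<in> cyl n u" using zl u(2) by (simp add: cyl_def)
    have ln: "length u + (n - length u) = n" using uN(2) True by simp
    have "y \<in> ?O" if y: "y \<in> cyl n u" for y
    proof -
     have "\<exists>\<delta>\<in>D. \<delta> z = y" using tile_conn[OF s D uN(1) Z(3)[OF u(1)], of z "n - length u" y] zc y by (simp only: ln)
     then have "y \<in> orbit D z" by (auto simp: orbit_def)
     then show ?thesis using orbit_eq[OF D z] by simp
    qed
    then show ?thesis using u(1) uN zc by (intro bexI[of _ u]) (auto simp: ZO_def Z'_def)
   qed
   have sumle: "real (card B) \<le> cs * real (bd A)" if B: "B \<subseteq> ?O" "B' = A \<or> B' = level d n - A" "B \<subseteq> B'"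
    and sm: "\<And>u. u \<in> ZO ==> 4 * card (B' \<inter> cyl n u) \<le> 3 * card (cyl n u)" for B B'
   proof -
    have "B \<subseteq> (\<Union>u\<in>ZO. B' \<inter> cyl n u)" using cover B by blast
    then have "card B \<le> card (\<Union>u\<in>ZO. B' \<inter> cyl n u)" using ZZ(2) by (intro card_mono) auto
    also have "\<dots> \<le> (\<Sum>u\<in>ZO. card (B' \<inter> cyl n u))" by (rule card_UN_le[OF ZZ(2)])
    finally have "real (card B) \<le> real (\<Sum>u\<in>ZO. card (B' \<inter> cyl n u))" by (simp only: of_nat_le_iff)
    also have "\<dots> = (\<Sum>u\<in>ZO. real (card (B' \<inter> cyl n u)))" by simp
    also have "\<dots> \<le> (\<Sum>u\<in>ZO. c u * real (bd A))"
     by (rule sum_mono) (rule c[OF _ True AL B(2) sm], use ZZ(1) in auto)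
    also have "\<dots> = (\<Sum>u\<in>ZO. c u) * real (bd A)" by (rule sum_distrib_right[symmetric])
    also have "\<dots> \<le> cs * real (bd A)" unfolding cs_def
     by (intro mult_right_mono sum_mono2[OF fZ' ZZ(1)]) (use c0 in auto)
    finally show ?thesis .
   qed
   have csC: "cs * real (bd A) \<le> C * real (bd A)" by (intro mult_right_mono) (simp_all add: C_def)
   show ?thesis
   proof (cases "\<forall>u\<in>ZO. 4 * card (A \<inter> cyl n u) \<le> 3 * card (cyl n u)")
    case True
    then have "real (card A) \<le> cs * real (bd A)" using A(1) by (intro sumle[of A A]) auto
    then show ?thesis using csC by linarith
   next
    case F1: False
    show ?thesis
    proof (cases "\<forall>u\<in>ZO. 4 * card ((level d n - A) \<inter> cyl n u) \<le> 3 * card (cyl n u)")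
     case True
     then have "real (card (?O - A)) \<le> cs * real (bd A)" using OL by (intro sumle[of "?O - A" "level d n - A"]) auto
     then show ?thesis using csC by linarith
    next
     case False
     \<comment> \<open>Good subtrees of different depths cannot be mapped onto each other, so the
       comparison moves to subtrees at depth \<open>N\<close>.\<close>
     have find: "\<exists>y\<in>level d N. cyl n y \<subseteq> ?O \<and> \<not> 4 * card (B \<inter> cyl n y) \<le> 3 * card (cyl n y)"
      if u: "u \<in> ZO" "\<not> 4 * card (B \<inter> cyl n u) \<le> 3 * card (cyl n u)" for u B
     proof -
      have lu: "length u \<le> N" using u(1) ZZ(1) by (auto simp: Z'_def)
      obtain y where y: "y \<in> cyl N u" "\<not> 4 * card (B \<inter> cyl n y) \<le> 3 * card (cyl n y)"
       using cyl_average[OF lu True, of B] u(2) by blast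
      have "cyl n y \<subseteq> cyl n u"
      proof
       fix z assume z: "z \<in> cyl n y"
       then have "take N z = y" "take (length u) y = u" "z \<in> level d n" using y(1) by (auto simp: cyl_def level_iff)
       moreover have "take (length u) (take N z) = take (length u) z" using lu by (simp add: min_def)
       ultimately show "z \<in> cyl n u" by (simp add: cyl_def)
      qed
      then show ?thesis using u(1) y by (intro bexI[of _ y]) (auto simp: ZO_def cyl_def)
     qed
     obtain y1 where y1: "y1 \<in> level d N" "cyl n y1 \<subseteq> ?O" "\<not> 4 * card (A \<inter> cyl n y1) \<le> 3 * card (cyl n y1)"
      using F1 find by blast
     obtain y2 where y2: "y2 \<in> level d N" "cyl n y2 \<subseteq> ?O" "\<not> 4 * card ((level d n - A) \<inter> cyl n y2) \<le> 3 * card (cyl n y2)"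
      using False find by blast
     have nN: "n = N + (n - N)" using True by simp
     have cc: "card (cyl n y) = d ^ (n - N)" if "y \<in> level d N" for y using card_cyl[OF that, of "n - N"] nN by simp
     have ly: "length y1 = N" "length y2 = N" using y1(1) y2(1) by (auto simp: level_iff)
     have "cyl n y1 \<noteq> {}" "cyl n y2 \<noteq> {}" using cc[OF y1(1)] cc[OF y2(1)] d2 by auto
     then obtain z1 z2 where z12: "z1 \<in> cyl n y1" "z2 \<in> cyl n y2" by blast
     have "z2 \<in> orbit D z1" using orbit_eq[OF D, of z1 x] y1(2) y2(2) z12 by blast
     then obtain \<delta>0 where \<delta>0: "\<delta>0 \<in> D" "\<delta>0 z1 = z2" by (auto simp: orbit_def)
     have "\<delta>0 y1 = y2"
      using wgrp_level(2)[OF s D \<delta>0(1), of z1 n N] z12 ly True \<delta>0(2) by (auto simp: cyl_def)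
     then have pr: "(y1, y2) \<in> PR" using y1(1) y2(1) \<delta>0(1) by (auto simp: PR_def orbit_def)
     define \<delta> where "\<delta> = fst (P (y1, y2))"
     have \<delta>: "\<delta> \<in> D" "\<delta> y1 = y2" "card {z\<in>A. \<delta> z \<notin> A} \<le> snd (P (y1, y2)) * bd A"
      using P pr AL unfolding \<delta>_def by auto
     have "\<delta> ` cyl n y1 \<subseteq> cyl n y2"
     proof (rule image_subsetI)
      fix z assume z: "z \<in> cyl n y1"
      then have zl: "z \<in> level d n" "take N z = y1" using ly by (auto simp: cyl_def)
      show "\<delta> z \<in> cyl n y2" using wgrp_level[OF s D \<delta>(1) zl(1)] zl(2) True \<delta>(2) ly by (simp add: cyl_def)
     qed
     then have "\<delta> ` (A \<inter> cyl n y1) \<subseteq> {z. z \<in> A \<inter> cyl n y2} \<union> \<delta> ` {z\<in>A. \<delta> z \<notin> A}" by blast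
     then have "card (\<delta> ` (A \<inter> cyl n y1)) \<le> card ({z. z \<in> A \<inter> cyl n y2} \<union> \<delta> ` {z\<in>A. \<delta> z \<notin> A})" using fA by (intro card_mono) auto
     also have "\<dots> \<le> card {z. z \<in> A \<inter> cyl n y2} + card (\<delta> ` {z\<in>A. \<delta> z \<notin> A})" by (rule card_Un_le)
     also have "card (\<delta> ` {z\<in>A. \<delta> z \<notin> A}) \<le> card {z\<in>A. \<delta> z \<notin> A}" using fA by (intro card_image_le) simp
     also have "card (\<delta> ` (A \<inter> cyl n y1)) = card (A \<inter> cyl n y1)" by (rule card_image[OF inj_on_subset[OF wgrp_inj[OF D \<delta>(1)]]]) simp
     finally have le: "card (A \<inter> cyl n y1) \<le> card (A \<inter> cyl n y2) + card {z\<in>A. \<delta> z \<notin> A}" by (simp only: Collect_mem_eq)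
     have "card (cyl n y2) = card (A \<inter> cyl n y2) + card ((level d n - A) \<inter> cyl n y2)"
     proof -
      have "cyl n y2 = (A \<inter> cyl n y2) \<union> ((level d n - A) \<inter> cyl n y2)" using cyl_level by blast
      moreover have "(A \<inter> cyl n y2) \<inter> ((level d n - A) \<inter> cyl n y2) = {}" by blast
      ultimately show ?thesis by (metis card_Un_disjoint finite_Int finite_cyl)
     qed
     \<comment> \<open>The density of \<open>A\<close> is above \<open>3 / 4\<close> on the first
       subtree and below \<open>1 / 4\<close> on the second, so at least half of a subtree is moved
       out of \<open>A\<close>.\<close>
     then have "d ^ (n - N) \<le> 2 * card {z\<in>A. \<delta> z \<notin> A}" using le y1(3) y2(3) cc[OF y1(1)] cc[OF y2(1)] by linarith
     also have "\<dots> \<le> 2 * (Kp * bd A)"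
     proof -
      have "snd (P (y1, y2)) * bd A \<le> Kp * bd A" using Kp[OF pr] by simp
      then show ?thesis using \<delta>(3) by linarith
     qed
     finally have "d ^ N * d ^ (n - N) \<le> d ^ N * (2 * (Kp * bd A))" by (rule mult_le_mono2)
     then have "d ^ n \<le> d ^ N * (2 * (Kp * bd A))" using nN by (metis power_add)
     then have "real (min (card A) (card (?O - A))) \<le> real (d ^ N * (2 * (Kp * bd A)))" using minA cO by (simp only: of_nat_le_iff)
     also have "\<dots> = (2 * real d ^ N * real Kp) * real (bd A)" by simp
     also have "\<dots> \<le> C * real (bd A)" using cs0 by (intro mult_right_mono) (simp_all add: C_def)
     finally show ?thesis .
    qed
   qed
  qed
 qed
 then show ?thesis using C0 by blast
qed

end

section \<open>Haar-random elements of the wreath product\<close>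

lemma group_perm_group: "group (perm_group X)"
proof (rule groupI)
 fix p q assume "p \<in> carrier (perm_group X)" "q \<in> carrier (perm_group X)"
 then show "p \<otimes>\<^bsub>perm_group X\<^esub> q \<in> carrier (perm_group X)" by (simp add: perm_group_def permutes_compose)
next
 show "\<one>\<^bsub>perm_group X\<^esub> \<in> carrier (perm_group X)" by (simp add: perm_group_def permutes_id)
next
 fix p assume "p \<in> carrier (perm_group X)"
 then have p: "p permutes X" by (simp add: perm_group_def)
 show "\<exists>q\<in>carrier (perm_group X). q \<otimes>\<^bsub>perm_group X\<^esub> p = \<one>\<^bsub>perm_group X\<^esub>"
  using permutes_inv[OF p] permutes_inv_o[OF p] by (intro bexI[of _ "finv p"]) (simp_all add: perm_group_def)
qed (simp_all add: perm_group_def comp_assoc)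

lemma inv_perm_group: "p permutes X ==> inv\<^bsub>perm_group X\<^esub> p = finv p"
 using permutes_inv[of p X] permutes_inv_o[of p X]
 by (intro group.inv_equality[OF group_perm_group]) (simp_all add: perm_group_def)

lemma letter_group_perm:
 assumes "2 \<le> d" and H: "subgroup H (perm_group {..<d})" and tr: "transitive_on H {..<d}"
 shows "letter_group d H"
proof
 have sub: "h permutes {..<d}" if "h \<in> H" for h using subgroup.subset[OF H] that by (auto simp: perm_group_def)
 show "2 \<le> d" by fact
 show "h permutes {..<d}" if "h \<in> H" for h by (rule sub[OF that])
 show "id \<in> H" using subgroup.one_closed[OF H] by (simp add: perm_group_def)
 show "g \<circ> h \<in> H" if "g \<in> H" "h \<in> H" for g h using subgroup.m_closed[OF H that(2,1)] by (simp add: perm_group_def)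
 show "finv h \<in> H" if "h \<in> H" for h
  using subgroup.m_inv_closed[OF H that] inv_perm_group[OF sub[OF that]] by simp
 show "\<exists>h\<in>H. h x = y" if "x < d" "y < d" for x y using tr that by (auto simp: transitive_on_def)
qed

definition port :: "(nat list \<Rightarrow> nat list) \<Rightarrow> nat list \<Rightarrow> nat \<Rightarrow> nat" where
 "port g v = first_level_action (cocycle g v)"

context letter_group
begin

lemma tree_snoc: "v @ [x] \<in> tree_verts d \<longleftrightarrow> v \<in> tree_verts d \<and> x < d"
 by (simp add: tree_verts_def)

text \<open>The image of a child is a neighbour of the image of its vertex. Going up is impossible,
  since by induction that place is taken by the image of the parent, and the root is fixed.\<close>

lemma tree_aut_snoc:
 assumes g: "g \<in> tree_aut d" and v: "v \<in> tree_verts d"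
 shows "x < d ==> \<exists>y. g (v @ [x]) = g v @ [y]"
 using v
proof (induction v arbitrary: x rule: rev_induct)
 case Nil
 have "tree_adj [] [x]" "[] \<in> tree_verts d" "[x] \<in> tree_verts d" using Nil by (auto simp: tree_adj_def tree_verts_def)
 then have "tree_adj (g []) (g [x])" using g unfolding tree_aut_def by blast
 then show ?case using g by (auto simp: tree_aut_def tree_adj_def)
next
 case (snoc z u)
 have t: "u \<in> tree_verts d" "z < d" "u @ [z] \<in> tree_verts d" "(u @ [z]) @ [x] \<in> tree_verts d"
  using snoc.prems unfolding tree_snoc by auto
 have inj: "inj g" using g permutes_inj by (auto simp: tree_aut_def)
 have "tree_adj (u @ [z]) ((u @ [z]) @ [x])" by (auto simp: tree_adj_def)
 then have "tree_adj (g (u @ [z])) (g ((u @ [z]) @ [x]))" using g t unfolding tree_aut_def by blast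
 then consider y where "g ((u @ [z]) @ [x]) = g (u @ [z]) @ [y]" | y where "g (u @ [z]) = g ((u @ [z]) @ [x]) @ [y]"
  by (auto simp: tree_adj_def)
 then show ?case
 proof cases
  case 2
  obtain z' where "g (u @ [z]) = g u @ [z']" using snoc.IH[OF t(2,1)] by blast
  then have "g ((u @ [z]) @ [x]) = g u" using 2 by simp
  then have "(u @ [z]) @ [x] = u" using inj by (simp only: inj_eq)
  then show ?thesis by simp
 qed blast
qed

lemma tree_aut_length:
 assumes g: "g \<in> tree_aut d"
 shows "v \<in> tree_verts d ==> length (g v) = length v"
proof (induction v rule: rev_induct)
 case Nil
 then show ?case using g by (simp add: tree_aut_def)
next
 case (snoc x v)
 then have v: "v \<in> tree_verts d" "x < d" by (simp_all add: tree_snoc)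
 then show ?case using tree_aut_snoc[OF g v] snoc.IH by auto
qed

lemma port_snoc:
 assumes g: "g \<in> tree_aut d" and v: "v \<in> tree_verts d" and x: "x < d"
 shows "g (v @ [x]) = g v @ [port g v x]"
 using tree_aut_snoc[OF g v x] by (auto simp: port_def first_level_action_def cocycle_def)

lemma port_in_H: "g \<in> wreath d H ==> v \<in> tree_verts d ==> port g v \<in> H"
 by (auto simp: wreath_def port_def)

lemma evf_port:
 assumes s: "valid s" and g: "g \<in> wreath d H" and p: "\<And>v. v \<in> tree_verts d ==> s (i, v) = port g v"
 shows "evf s [(i, True)] = g"
proof
 fix v
 have ga: "g \<in> tree_aut d" using g by (simp add: wreath_def)
 have "stp s (i, True) v = g v" if "v \<in> tree_verts d" for v
  using that
 proof (induction v rule: rev_induct)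
  case Nil
  then show ?case using ga by (simp add: tree_aut_def)
 next
  case (snoc x v)
  then have v: "v \<in> tree_verts d" "x < d" by (simp_all add: tree_snoc)
  then show ?case using snoc.IH port_snoc[OF ga v] p[OF v(1)] by (simp add: stp_snoc lhol_def edg_def)
 qed
 moreover have "g v = v" if "v \<notin> tree_verts d" using ga that by (auto simp: tree_aut_def permutes_def)
 ultimately show "evf s [(i, True)] v = g v" by (simp add: evf_def)
qed

lemma evf_snoc: "v @ [x] \<in> tree_verts d ==> evf s w (v @ [x]) = evf s w v @ [whol s w v x]"
 by (auto simp: evf_def tree_snoc wks_snoc)

lemma evf_wreath:
 assumes s: "valid s"
 shows "evf s w \<in> wreath d H"
proof -
 have ex: "evf s w (v @ [x]) = evf s w v @ [whol s w v x]" if "v @ [x] \<in> tree_verts d" for v x by (rule evf_snoc[OF that])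
 have adj: "tree_adj (evf s w u) (evf s w v)" if uv: "u \<in> tree_verts d" "v \<in> tree_verts d" "tree_adj u v" for u v and w
 proof -
  consider x where "v = u @ [x]" | x where "u = v @ [x]" using uv(3) by (auto simp: tree_adj_def)
  then show ?thesis
  proof cases
   case 1
   then show ?thesis using evf_snoc[of u x s w] uv(2) by (auto simp: tree_adj_def)
  next
   case 2
   then show ?thesis using evf_snoc[of v x s w] uv(1) by (auto simp: tree_adj_def)
  qed
 qed
 have back1: "evf s (winv w) (evf s w v) = v" for v w using evf_winv(1)[OF s, of w] by (metis comp_apply id_apply)
 have back2: "evf s w (evf s (winv w) v) = v" for v w using evf_winv(2)[OF s, of w] by (metis comp_apply id_apply)
 have tv: "evf s w v \<in> tree_verts d \<longleftrightarrow> v \<in> tree_verts d" for v w using wks_tree[OF s, of w v] by (simp add: evf_def)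
 have perm: "evf s w permutes tree_verts d"
 proof (rule bij_imp_permutes)
  show "bij_betw (evf s w) (tree_verts d) (tree_verts d)"
   by (rule bij_betw_byWitness[of _ "evf s (winv w)"]) (simp_all add: back1 back2 image_subset_iff tv)
  show "evf s w v = v" if "v \<notin> tree_verts d" for v using that by (simp add: evf_def)
 qed
 have "evf s w [] = []" by (simp add: evf_def)
 moreover have "tree_adj (evf s w u) (evf s w v) = tree_adj u v" if "u \<in> tree_verts d" "v \<in> tree_verts d" for u v
  using adj[OF that, of w] adj[of "evf s w u" "evf s w v" "winv w"] that by (auto simp: tv back1)
 ultimately have ta: "evf s w \<in> tree_aut d" using perm by (simp add: tree_aut_def)
 have "port (evf s w) v \<in> H" if v: "v \<in> tree_verts d" for v
 proof -
  have "port (evf s w) v x = whol s w v x" for x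
  proof (cases "x < d")
   case True
   then have vx: "v @ [x] \<in> tree_verts d" using v by (simp add: tree_snoc)
   show ?thesis using port_snoc[OF ta v True] evf_snoc[OF vx, of s w] by simp
  next
   case False
   then have "v @ [x] \<notin> tree_verts d" by (simp add: tree_snoc)
   then have "port (evf s w) v x = x"
    using tree_aut_length[OF ta v] by (simp add: port_def first_level_action_def cocycle_def evf_def)
   moreover have "whol s w v x = x" using H_permutes[OF whol_in_H[OF s, of w v]] False by (auto simp: permutes_def)
   ultimately show ?thesis by simp
  qed
  then have "port (evf s w) v = whol s w v" ..
  then show ?thesis using whol_in_H[OF s] by simp
 qed
 then show ?thesis using ta by (simp add: wreath_def port_def)
qed

text \<open>Lets statements about elements of the wreath product be proved for configurations. The
  other indices stay free, so two elements can be placed into one configuration.\<close>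

lemma wreath_evf:
 assumes g: "g \<in> wreath d H"
 obtains s where "valid s" "evf s [(i, True)] = g" "\<And>j v. j \<noteq> i ==> s (j, v) = id"
proof -
 define s where "s q = (if fst q = i \<and> snd q \<in> tree_verts d then port g (snd q) else id)" for q
 have v: "valid s" using port_in_H[OF g] H_id by (auto simp: valid_def s_def)
 have "evf s [(i, True)] = g" by (rule evf_port[OF v g]) (simp add: s_def)
 then show thesis using that[of s] v by (simp add: s_def)
qed

lemma stp_agree: "(\<And>v. s (fst l, v) = s' (fst l, v)) ==> evf s [l] = evf s' [l]"
 by (auto simp: evf_def stp_cong[of s l s'])

lemma subgroup_wreath: "subgroup (wreath d H) (perm_group (tree_verts d))"
proof
 show "wreath d H \<subseteq> carrier (perm_group (tree_verts d))" by (auto simp: wreath_def tree_aut_def perm_group_def)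
 have "evf (\<lambda>_. id) [] \<in> wreath d H" by (rule evf_wreath) (simp add: valid_def H_id)
 then show "\<one>\<^bsub>perm_group (tree_verts d)\<^esub> \<in> wreath d H" by (simp add: evf_Nil perm_group_def)
next
 fix g h assume gh: "g \<in> wreath d H" "h \<in> wreath d H"
 obtain s where s: "valid s" "evf s [(0, True)] = g" by (rule wreath_evf[OF gh(1)])
 obtain s' where s': "valid s'" "evf s' [(1, True)] = h" by (rule wreath_evf[OF gh(2)])
 define t where "t q = (if fst q = 0 then s q else s' q)" for q
 have t: "valid t" using s s' by (auto simp: valid_def t_def)
 have "evf t [(0, True)] = g" using stp_agree[of t "(0, True)" s] s(2) by (simp add: t_def)
 moreover have "evf t [(1, True)] = h" using stp_agree[of t "(1, True)" s'] s'(2) by (simp add: t_def)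
 ultimately have "h \<circ> g = evf t [(0, True), (1, True)]" using evf_append[OF t, of "[(0, True)]" "[(1, True)]"] by simp
 then show "g \<otimes>\<^bsub>perm_group (tree_verts d)\<^esub> h \<in> wreath d H" using evf_wreath[OF t] by (simp add: perm_group_def)
next
 fix g assume g: "g \<in> wreath d H"
 obtain s where s: "valid s" "evf s [(0, True)] = g" by (rule wreath_evf[OF g])
 have gp: "g permutes tree_verts d" using g by (simp add: wreath_def tree_aut_def)
 have "evf s (winv [(0, True)]) \<circ> g = id" using evf_winv(1)[OF s(1), of "[(0, True)]"] s(2) by simp
 then have "evf s (winv [(0, True)]) = finv g" using permutes_inv_o(1)[OF gp]
  by (metis comp_assoc comp_id id_comp)
 then show "inv\<^bsub>perm_group (tree_verts d)\<^esub> g \<in> wreath d H"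
  using inv_perm_group[OF gp] evf_wreath[OF s(1), of "winv [(0, True)]"] by simp
qed

lemma group_wreath: "group (wreath_group d H)"
 unfolding wreath_group_def by (rule subgroup.subgroup_is_group[OF subgroup_wreath group_perm_group])

lemma wreath_group_simps [simp]:
 "carrier (wreath_group d H) = wreath d H" "\<one>\<^bsub>wreath_group d H\<^esub> = id" "g \<otimes>\<^bsub>wreath_group d H\<^esub> h = h \<circ> g"
 by (simp_all add: wreath_group_def perm_group_def)

lemma inv_wreath:
 assumes s: "valid s"
 shows "inv\<^bsub>wreath_group d H\<^esub> (evf s w) = evf s (winv w)"
 by (rule group.inv_equality[OF group_wreath]) (simp_all add: evf_winv[OF s] evf_wreath[OF s])

section \<open>Haar measure in terms of configurations\<close>

definition ballv :: "nat \<Rightarrow> nat list set" where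
 "ballv N = (\<Union>n\<le>N. level d n)"

definition nbhd :: "nat \<Rightarrow> (nat list \<Rightarrow> nat list) \<Rightarrow> (nat list \<Rightarrow> nat list) set" where
 "nbhd N g0 = {g \<in> wreath d H. \<forall>v\<in>ballv N. g v = g0 v}"

lemma topspace_wreath [simp]: "topspace (wreath_topology d H) = wreath d H"
 by (simp add: wreath_topology_def)

lemma nbhd_sets: "nbhd N g0 \<in> sets (borel_of (wreath_topology d H))"
proof -
 define X where "X v = (if v \<in> ballv N then {g0 v} else UNIV)" for v
 have fin: "finite (ballv N)" by (simp add: ballv_def)
 have "openin (product_topology (\<lambda>_. discrete_topology UNIV) UNIV) (PiE UNIV X)"
 proof (rule product_topology_basis)
  show "openin (discrete_topology UNIV) (X v)" for v by simp
  have "{v. X v \<noteq> topspace (discrete_topology UNIV)} \<subseteq> ballv N" by (auto simp: X_def)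
  then show "finite {v. X v \<noteq> topspace (discrete_topology UNIV)}" using fin by (rule finite_subset)
 qed
 moreover have "nbhd N g0 = PiE UNIV X \<inter> wreath d H" by (auto simp: nbhd_def X_def PiE_iff split: if_splits)
 ultimately have "openin (wreath_topology d H) (nbhd N g0)" unfolding wreath_topology_def openin_subtopology by blast
 then show ?thesis unfolding borel_of_def
  by (subst sets_measure_of) (auto simp del: topspace_wreath dest: openin_subset intro: sigma_sets.Basic)
qed

lemma nbhd_translate:
 assumes g0: "g0 \<in> wreath d H"
 shows "nbhd N g0 = (\<lambda>x. g0 \<otimes>\<^bsub>wreath_group d H\<^esub> x) ` nbhd N id"
proof -
 obtain s where s: "valid s" "evf s [(0, True)] = g0" by (rule wreath_evf[OF g0])
 define h where "h = evf s (winv [(0, True)])"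
 have h: "h \<circ> g0 = id" "g0 \<circ> h = id" using evf_winv[OF s(1), of "[(0, True)]"] s(2) by (simp_all add: h_def)
 have hW: "h \<in> wreath d H" unfolding h_def by (rule evf_wreath[OF s(1)])
 have lev: "evf s w v \<in> ballv N" if "v \<in> ballv N" for v w
  using that wks_level[OF s(1)] by (auto simp: ballv_def evf_def level_tree)
 have cl: "y \<circ> x \<in> wreath d H" if "x \<in> wreath d H" "y \<in> wreath d H" for x y
  using subgroup.m_closed[OF subgroup_wreath that] by (simp add: perm_group_def)
 show ?thesis
 proof
  show "nbhd N g0 \<subseteq> (\<lambda>x. g0 \<otimes>\<^bsub>wreath_group d H\<^esub> x) ` nbhd N id"
  proof
   fix y assume y: "y \<in> nbhd N g0"
   have "y \<circ> h \<in> nbhd N id"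
   proof -
    have "y (h v) = v" if v: "v \<in> ballv N" for v
    proof -
     have "h v \<in> ballv N" unfolding h_def by (rule lev[OF v])
     then have "y (h v) = g0 (h v)" using y by (simp add: nbhd_def)
     then show ?thesis using h(2) by (metis comp_apply id_apply)
    qed
    then show ?thesis using cl[OF hW] y by (simp add: nbhd_def)
   qed
   moreover have "y = g0 \<otimes>\<^bsub>wreath_group d H\<^esub> (y \<circ> h)" using h(1) by (simp add: comp_assoc)
   ultimately show "y \<in> (\<lambda>x. g0 \<otimes>\<^bsub>wreath_group d H\<^esub> x) ` nbhd N id" by blast
  qed
  show "(\<lambda>x. g0 \<otimes>\<^bsub>wreath_group d H\<^esub> x) ` nbhd N id \<subseteq> nbhd N g0"
  proof (rule image_subsetI)
   fix x assume x: "x \<in> nbhd N id"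
   have "x (g0 v) = g0 v" if v: "v \<in> ballv N" for v
   proof -
    have "g0 v \<in> ballv N" using lev[OF v, of "[(0, True)]"] s(2) by simp
    then show ?thesis using x by (simp add: nbhd_def)
   qed
   then show "g0 \<otimes>\<^bsub>wreath_group d H\<^esub> x \<in> nbhd N g0" using cl[OF g0] x by (simp add: nbhd_def)
  qed
 qed
qed

lemma evf_agree_iff:
 assumes s: "valid s" and c: "valid c"
 shows "(\<forall>v\<in>ballv N. evf s [(i, True)] v = evf c [(j, True)] v) \<longleftrightarrow> (\<forall>n<N. \<forall>v\<in>level d n. s (i, v) = c (j, v))"
proof
 assume eq: "\<forall>v\<in>ballv N. evf s [(i, True)] v = evf c [(j, True)] v"
 show "\<forall>n<N. \<forall>v\<in>level d n. s (i, v) = c (j, v)"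
 proof (intro allI ballI impI)
  fix n v assume n: "n < N" and v: "v \<in> level d n"
  show "s (i, v) = c (j, v)"
  proof
   fix x
   show "s (i, v) x = c (j, v) x"
   proof (cases "x < d")
    case True
    then have vx: "v @ [x] \<in> level d (Suc n)" using v by (simp add: level_snoc)
    then have "v @ [x] \<in> ballv N" using n by (auto simp: ballv_def intro!: bexI[of _ "Suc n"])
    then have "evf s [(i, True)] (v @ [x]) = evf c [(j, True)] (v @ [x])" using eq by blast
    then show ?thesis using level_tree[OF vx] by (simp add: evf_snoc lhol_def edg_def)
   next
    case False
    have sc: "s (i, v) \<in> H" "c (j, v) \<in> H" using s c by (simp_all add: validD)
    have hx: "h x = x" if "h \<in> H" for h using H_permutes[OF that] False by (simp add: permutes_def)
    show ?thesis using hx[OF sc(1)] hx[OF sc(2)] by simp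
   qed
  qed
 qed
next
 assume eq: "\<forall>n<N. \<forall>v\<in>level d n. s (i, v) = c (j, v)"
 have "stp s (i, True) v = stp c (j, True) v" if "v \<in> level d n" "n \<le> N" for n v
  using that
 proof (induction n arbitrary: v)
  case (Suc n)
  obtain u x where u: "v = u @ [x]" "u \<in> level d n" "x < d" using Suc.prems(1) by (rule level_SucE)
  moreover have "s (i, u) = c (j, u)" using eq u(2) Suc.prems(2) by (simp add: Suc_le_eq)
  ultimately show ?case using Suc.IH[OF u(2)] Suc.prems(2) by (simp add: stp_snoc lhol_def edg_def)
 qed (simp add: stp_def)
 then show "\<forall>v\<in>ballv N. evf s [(i, True)] v = evf c [(j, True)] v" by (auto simp: ballv_def evf_def)
qed

text \<open>The neighbourhoods of depth \<open>N\<close> are left translates of one another and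
  partition the group into as many pieces as there are truncated configurations of one
  generator.\<close>

lemma haar_nbhd:
 assumes \<mu>: "haar_prob (wreath_group d H) (wreath_topology d H) \<mu>" and g0: "g0 \<in> wreath d H"
 shows "measure \<mu> (nbhd N g0) = 1 / card (Cfg 1 N)"
proof -
 interpret prob_space \<mu> using \<mu> by (simp add: haar_prob_def)
 have sets: "nbhd N g \<in> sets \<mu>" for g using \<mu> nbhd_sets by (simp add: haar_prob_def)
 have sp: "space \<mu> = wreath d H" using \<mu> by (simp add: haar_prob_def)
 have eq: "measure \<mu> (nbhd N g) = measure \<mu> (nbhd N id)" if g: "g \<in> wreath d H" for g
 proof -
  have "emeasure \<mu> ((\<lambda>x. g \<otimes>\<^bsub>wreath_group d H\<^esub> x) ` nbhd N id) = emeasure \<mu> (nbhd N id)"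
   using \<mu> g sets[of id] unfolding haar_prob_def by (simp del: wreath_group_simps(3))
  then have "emeasure \<mu> (nbhd N g) = emeasure \<mu> (nbhd N id)" by (simp only: nbhd_translate[OF g])
  then show ?thesis by (simp add: measure_def)
 qed
 define g where "g c = evf c [(0, True)]" for c
 have gW: "g c \<in> wreath d H" if "c \<in> Cfg 1 N" for c unfolding g_def by (rule evf_wreath[OF valid_Cfg[OF that]])
 have dj: "disjoint_family_on (\<lambda>c. nbhd N (g c)) (Cfg 1 N)"
  unfolding disjoint_family_on_def
 proof (intro ballI impI)
  fix c c' assume cc: "c \<in> Cfg 1 N" "c' \<in> Cfg 1 N" "c \<noteq> c'"
  show "nbhd N (g c) \<inter> nbhd N (g c') = {}"
  proof (rule ccontr)
   assume "nbhd N (g c) \<inter> nbhd N (g c') \<noteq> {}"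
   then have "\<forall>v\<in>ballv N. g c v = g c' v" by (auto simp: nbhd_def)
   then have eq': "\<forall>n<N. \<forall>v\<in>level d n. c (0, v) = c' (0, v)"
    using evf_agree_iff[OF valid_Cfg[OF cc(1)] valid_Cfg[OF cc(2)], of N 0 0] by (simp add: g_def)
   have "restr 1 N c q = restr 1 N c' q" for q by (cases q) (use eq' in \<open>auto simp: restr_def Ind_def\<close>)
   then have "restr 1 N c = restr 1 N c'" by (rule ext)
   then show False using restr_id[OF cc(1)] restr_id[OF cc(2)] cc(3) by simp
  qed
 qed
 have cov: "(\<Union>c\<in>Cfg 1 N. nbhd N (g c)) = wreath d H"
 proof
  show "wreath d H \<subseteq> (\<Union>c\<in>Cfg 1 N. nbhd N (g c))"
  proof
   fix h assume h: "h \<in> wreath d H"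
   obtain s where s: "valid s" "evf s [(0, True)] = h" by (rule wreath_evf[OF h])
   have "\<forall>v\<in>ballv N. h v = g (restr 1 N s) v"
    using evf_agree_iff[OF s(1) valid_restr[OF s(1)], of N 0 1 N 0] s(2)
    by (simp add: g_def restr_def Ind_def) blast
   then have "h \<in> nbhd N (g (restr 1 N s))" using h by (simp add: nbhd_def)
   then show "h \<in> (\<Union>c\<in>Cfg 1 N. nbhd N (g c))" using restr_Cfg[OF s(1)] by blast
  qed
 qed (auto simp: nbhd_def)
 have "1 = measure \<mu> (\<Union>c\<in>Cfg 1 N. nbhd N (g c))" using prob_space sp cov by simp
 also have "\<dots> = (\<Sum>c\<in>Cfg 1 N. measure \<mu> (nbhd N (g c)))"
  by (rule finite_measure_finite_Union[OF finite_Cfg _ dj]) (use sets in auto)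
 also have "\<dots> = real (card (Cfg 1 N)) * measure \<mu> (nbhd N id)" using eq[OF gW] by simp
 finally have "measure \<mu> (nbhd N id) = 1 / card (Cfg 1 N)" using card_Cfg_pos[of 1 N] by (simp add: field_simps)
 then show ?thesis using eq[OF g0] by simp
qed

text \<open>The random elements are numbered from 1, the generators of a configuration from
  0.\<close>

definition cfg_of :: "nat \<Rightarrow> (nat \<Rightarrow> nat list \<Rightarrow> nat list) \<Rightarrow> config" where
 "cfg_of m g = (\<lambda>(i, v). if i < m \<and> v \<in> tree_verts d then port (g (Suc i)) v else id)"

lemma valid_cfg_of: "(\<And>i. i < m ==> g (Suc i) \<in> wreath d H) ==> valid (cfg_of m g)"
 using port_in_H H_id by (auto simp: valid_def cfg_of_def)

lemma evf_cfg_of: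
 assumes g: "\<And>i. i < m ==> g (Suc i) \<in> wreath d H" and i: "i < m"
 shows "evf (cfg_of m g) [(i, True)] = g (Suc i)"
proof (rule evf_port)
 show "valid (cfg_of m g)" by (rule valid_cfg_of) (rule g)
 show "g (Suc i) \<in> wreath d H" by (rule g[OF i])
qed (simp add: cfg_of_def i)

text \<open>Prescribing a truncation prescribes one neighbourhood for each random element, so
  independence multiplies their measures.\<close>

lemma haar_cfg_of:
 assumes M: "prob_space M" and m: "1 \<le> m"
  and ind: "prob_space.indep_vars M (\<lambda>_. borel_of (wreath_topology d H)) a {1..m}"
  and h: "\<And>i. i \<in> {1..m} ==> haar_prob (wreath_group d H) (wreath_topology d H) (distr M (borel_of (wreath_topology d H)) (a i))"
 shows "haar M m (\<lambda>\<omega>. cfg_of m (\<lambda>i. a i \<omega>))"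
  and "\<And>\<omega> i. \<omega> \<in> space M ==> i \<in> {1..m} ==> a i \<omega> \<in> wreath d H"
proof -
 interpret prob_space M by (rule M)
 let ?B = "borel_of (wreath_topology d H)"
 let ?S = "\<lambda>\<omega>. cfg_of m (\<lambda>i. a i \<omega>)"
 have rv: "a i \<in> measurable M ?B" if "i \<in> {1..m}" for i using ind that unfolding indep_vars_def by auto
 have spB: "space ?B = wreath d H" by (simp add: borel_of_def space_measure_of_conv)
 have aW: "a i \<omega> \<in> wreath d H" if "\<omega> \<in> space M" "i \<in> {1..m}" for \<omega> i
  using measurable_space[OF rv[OF that(2)] that(1)] spB by simp
 show "\<And>\<omega> i. \<omega> \<in> space M ==> i \<in> {1..m} ==> a i \<omega> \<in> wreath d H" by (rule aW)
 have aW': "a (Suc i) \<omega> \<in> wreath d H" if "\<omega> \<in> space M" "i < m" for \<omega> i using aW[OF that(1), of "Suc i"] that(2) by simp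
 have val: "valid (?S \<omega>)" if "\<omega> \<in> space M" for \<omega> by (rule valid_cfg_of) (rule aW'[OF that])
 have "{\<omega>\<in>space M. restr m N (?S \<omega>) = c} \<in> sets M \<and> measure M {\<omega>\<in>space M. restr m N (?S \<omega>) = c} = 1 / card (Cfg m N)"
  if c: "c \<in> Cfg m N" for N c
 proof -
  have vc: "valid c" by (rule valid_Cfg[OF c])
  define E where "E i = nbhd N (evf c [(i - 1, True)])" for i
  have eW: "evf c [(i - 1, True)] \<in> wreath d H" for i by (rule evf_wreath[OF vc])
  have EB: "E i \<in> sets ?B" for i unfolding E_def by (rule nbhd_sets)
  have iff: "restr m N (?S \<omega>) = c \<longleftrightarrow> (\<forall>i\<in>{1..m}. a i \<omega> \<in> E i)" if w: "\<omega> \<in> space M" for \<omega>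
  proof -
   have "a (Suc i) \<omega> \<in> E (Suc i) \<longleftrightarrow> (\<forall>n<N. \<forall>v\<in>level d n. ?S \<omega> (i, v) = c (i, v))" if i: "i < m" for i
    using evf_agree_iff[OF val[OF w] vc, of N i i] evf_cfg_of[of m "\<lambda>i. a i \<omega>" i] aW'[OF w] i by (simp add: E_def nbhd_def)
   moreover have "{1..m} = Suc ` {..<m}" by (simp add: image_Suc_lessThan)
   then have "(\<forall>i\<in>{1..m}. a i \<omega> \<in> E i) \<longleftrightarrow> (\<forall>i<m. a (Suc i) \<omega> \<in> E (Suc i))" by auto
   ultimately have 1: "(\<forall>i\<in>{1..m}. a i \<omega> \<in> E i) \<longleftrightarrow> (\<forall>i<m. \<forall>n<N. \<forall>v\<in>level d n. ?S \<omega> (i, v) = c (i, v))" by simp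
   have 2: "restr m N (?S \<omega>) = c \<longleftrightarrow> restr m N (?S \<omega>) = restr m N c" using restr_id[OF c] by simp
   have 3: "restr m N s = restr m N s' \<longleftrightarrow> (\<forall>i<m. \<forall>n<N. \<forall>v\<in>level d n. s (i, v) = s' (i, v))" for s s' :: config
   proof
    assume eq: "restr m N s = restr m N s'"
    show "\<forall>i<m. \<forall>n<N. \<forall>v\<in>level d n. s (i, v) = s' (i, v)"
    proof (intro allI impI ballI)
     fix i n v assume "i < m" "n < N" "v \<in> level d n"
     then have "(i, v) \<in> Ind m N" by (auto simp: Ind_def)
     then show "s (i, v) = s' (i, v)" using fun_cong[OF eq, of "(i, v)"] by (simp add: restr_def)
    qed
   next
    assume "\<forall>i<m. \<forall>n<N. \<forall>v\<in>level d n. s (i, v) = s' (i, v)"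
    then show "restr m N s = restr m N s'" unfolding restr_def by (intro ext) (auto simp: Ind_def)
   qed
   show ?thesis unfolding 1 2 3 ..
  qed
  have ev: "{\<omega>\<in>space M. restr m N (?S \<omega>) = c} = (\<Inter>i\<in>{1..m}. a i -` E i \<inter> space M)" using iff m by auto
  have "(\<Inter>i\<in>{1..m}. a i -` E i \<inter> space M) \<in> sets M"
   using m measurable_sets[OF rv EB] by (intro sets.finite_INT) auto
  moreover have "measure M (\<Inter>i\<in>{1..m}. a i -` E i \<inter> space M) = (\<Prod>i\<in>{1..m}. measure M (a i -` E i \<inter> space M))"
   by (rule indep_varsD[OF ind]) (use m EB in auto)
  moreover have "measure M (a i -` E i \<inter> space M) = 1 / card (Cfg 1 N)" if i: "i \<in> {1..m}" for i
  proof -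
   have "measure (distr M ?B (a i)) (E i) = 1 / card (Cfg 1 N)" unfolding E_def by (rule haar_nbhd[OF h[OF i] eW])
   then show ?thesis using measure_distr[OF rv[OF i] EB] by simp
  qed
  moreover have "card (Cfg m N) = card (Cfg 1 N) ^ m"
   unfolding card_Cfg by (simp add: Ind_def card_cartesian_product power_mult[symmetric] mult.commute)
  ultimately show ?thesis unfolding ev by (simp add: power_one_over)
 qed
 then show "haar M m ?S" using M val by (simp add: haar_def)
qed

section \<open>Schreier graphs on the levels\<close>

lemma gen_evf:
 assumes s: "valid s" and A: "\<And>f. f \<in> A ==> \<exists>w. set w \<subseteq> letters m \<and> f = evf s w"
 shows "f \<in> generate (wreath_group d H) A ==> \<exists>w. set w \<subseteq> letters m \<and> f = evf s w"
proof (induction f rule: generate.induct)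
 case one
 show ?case by (intro exI[of _ "[]"]) (simp add: evf_Nil)
next
 case (incl h)
 then show ?case by (rule A)
next
 case (inv h)
 then obtain w where "set w \<subseteq> letters m" "h = evf s w" using A by blast
 then show ?case using inv_wreath[OF s] by (intro exI[of _ "winv w"]) simp
next
 case (eng h1 h2)
 then obtain w1 w2 where "set w1 \<subseteq> letters m" "h1 = evf s w1" "set w2 \<subseteq> letters m" "h2 = evf s w2" by blast
 then show ?case using evf_append[OF s] by (intro exI[of _ "w1 @ w2"]) simp
qed

end

locale level_action = letter_group d H for d H +
 fixes s :: config and m :: nat and \<Delta> :: "(nat list \<Rightarrow> nat list) monoid"
 assumes s: "valid s" and grp: "group \<Delta>"
  and mult_eq: "\<And>f g. f \<otimes>\<^bsub>\<Delta>\<^esub> g = g \<circ> f" and one_eq: "\<one>\<^bsub>\<Delta>\<^esub> = id"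
  and words: "\<And>f. f \<in> carrier \<Delta> ==> \<exists>w. set w \<subseteq> letters m \<and> f = evf s w"
begin

abbreviation "D \<equiv> carrier \<Delta>"

lemma inv_comp: "f \<in> D ==> inv\<^bsub>\<Delta>\<^esub> f \<in> D \<and> inv\<^bsub>\<Delta>\<^esub> f \<circ> f = id \<and> f \<circ> inv\<^bsub>\<Delta>\<^esub> f = id"
 using group.inv_closed[OF grp, of f] group.r_inv[OF grp, of f] group.l_inv[OF grp, of f] by (simp add: mult_eq one_eq)

lemma wgrp: "wgrp s m D"
proof -
 have "id \<in> D" using monoid.one_closed[OF group.is_monoid[OF grp]] by (simp add: one_eq)
 moreover have "g \<circ> f \<in> D" if "f \<in> D" "g \<in> D" for f g using monoid.m_closed[OF group.is_monoid[OF grp] that] by (simp add: mult_eq)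
 moreover have "\<exists>g\<in>D. g \<circ> f = id \<and> f \<circ> g = id" if "f \<in> D" for f using inv_comp[OF that] by blast
 ultimately show ?thesis using words by (simp add: wgrp_def)
qed

lemma coset_closed: "evf s w \<in> D ==> wk (cst s) w D = D"
 unfolding wk_cst[OF s]
proof
 assume w: "evf s w \<in> D"
 show "(\<lambda>f. evf s w \<circ> f) ` D \<subseteq> D" using wgrpD(2)[OF wgrp _ w] by blast
 show "D \<subseteq> (\<lambda>f. evf s w \<circ> f) ` D"
 proof
  fix f assume f: "f \<in> D"
  have "f = evf s w \<circ> (inv\<^bsub>\<Delta>\<^esub> (evf s w) \<circ> f)" using inv_comp[OF w] by (simp add: comp_assoc[symmetric])
  moreover have "inv\<^bsub>\<Delta>\<^esub> (evf s w) \<circ> f \<in> D" using wgrpD(2)[OF wgrp f] inv_comp[OF w] by blast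
  ultimately show "f \<in> (\<lambda>f. evf s w \<circ> f) ` D" by blast
 qed
qed

text \<open>Given a loop word \<open>\<zeta>\<close> with value \<open>z\<close>, the property of
  having a value in the group generated by \<open>z\<close> survives appending
  \<open>\<zeta>\<close> or its inverse and free cancellation. If all generators had it, the
  subgroup would be cyclic.\<close>

lemma core_exists:
 assumes fg: "finitely_generated \<Delta>" and nc: "\<not> cyclic_group \<Delta>"
 shows "\<exists>V E. core (cst s) m V E \<and> D \<in> V \<and> (\<forall>y\<in>V. \<exists>p. set p \<subseteq> letters m \<and> wk (cst s) p D = y)"
proof -
 obtain S where S: "finite S" "S \<subseteq> D" "generate \<Delta> S = D" using fg by (auto simp: finitely_generated_def generating_set_def)
 have "\<forall>f\<in>S. \<exists>w. set w \<subseteq> letters m \<and> f = evf s w" using words S(2) by blast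
 from bchoice[OF this] obtain W where W: "\<forall>f\<in>S. set (W f) \<subseteq> letters m \<and> f = evf s (W f)" ..
 show ?thesis
 proof (rule core_from_loops[OF sym_cst[OF s], of "W ` S"])
  show "finite (W ` S)" using S(1) by simp
  show "set w \<subseteq> letters m \<and> wk (cst s) w D = D" if wS: "w \<in> W ` S" for w
  proof -
   obtain f where f: "f \<in> S" "w = W f" using wS by blast
   then have "evf s w \<in> D" using W S(2) by auto
   then show ?thesis using coset_closed W f by blast
  qed
  fix \<zeta> assume \<zeta>: "set \<zeta> \<subseteq> letters m" "wk (cst s) \<zeta> D = D"
  define z where "z = evf s \<zeta>"
  have zD: "z \<in> D" using closed_word[OF s wgrp, of \<zeta> "[]"] \<zeta>(2) by (simp add: z_def)
  define P where "P w \<longleftrightarrow> evf s w \<in> generate \<Delta> {z}" for w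
  have "\<exists>w\<in>W ` S. \<not> P w"
  proof (rule ccontr)
   assume "\<not> ?thesis"
   then have "S \<subseteq> generate \<Delta> {z}" using W by (auto simp: P_def)
   then have "generate \<Delta> S \<subseteq> generate \<Delta> {z}"
    using group.generate_subgroup_incl[OF grp] group.generate_is_subgroup[OF grp, of "{z}"] zD by blast
   moreover have "generate \<Delta> {z} \<subseteq> D" using group.generate_incl[OF grp, of "{z}"] zD by blast
   ultimately have "generate \<Delta> {z} = D" using S(3) by blast
   then have "subgroup_generated \<Delta> {z} = \<Delta>" using zD by (simp add: subgroup_generated_def)
   then show False using nc zD unfolding cyclic_group_def by blast
  qed
  then obtain w where w: "w \<in> W ` S" "\<not> P w" by blast
  have zg: "z \<in> generate \<Delta> {z}" "inv\<^bsub>\<Delta>\<^esub> z \<in> generate \<Delta> {z}" by (auto intro: generate.incl generate.inv)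
  have "inv\<^bsub>\<Delta>\<^esub> z = evf s (winv \<zeta>)"
  proof -
   have "inv\<^bsub>\<Delta>\<^esub> z = inv\<^bsub>\<Delta>\<^esub> z \<circ> (z \<circ> evf s (winv \<zeta>))" using evf_winv(2)[OF s, of \<zeta>] by (simp add: z_def)
   also have "\<dots> = evf s (winv \<zeta>)" using inv_comp[OF zD] by (simp add: comp_assoc[symmetric])
   finally show ?thesis .
  qed
  then have zi: "evf s (winv \<zeta>) \<in> generate \<Delta> {z}" using zg(2) by simp
  have "P []" using generate.one[of \<Delta> "{z}"] by (simp add: P_def evf_Nil one_eq)
  moreover have "P (w @ \<zeta>) \<and> P (w @ winv \<zeta>)" if "P w" for w
   using generate.eng[OF that[unfolded P_def] zg(1)] generate.eng[OF that[unfolded P_def] zi]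
   by (simp add: P_def evf_append[OF s] mult_eq z_def)
  moreover have "P (a @ x @ winv x @ c) \<longleftrightarrow> P (a @ c)" for a x c
  proof -
   have "evf s (a @ x @ winv x @ c) = evf s c \<circ> (evf s (winv x) \<circ> evf s x) \<circ> evf s a"
    by (simp add: evf_append[OF s] comp_assoc)
   then show ?thesis by (simp add: P_def evf_winv[OF s] evf_append[OF s])
  qed
  ultimately show "\<exists>w\<in>W ` S. \<exists>P. P [] \<and> (\<forall>w. P w --> P (w @ \<zeta>) \<and> P (w @ winv \<zeta>)) \<and>
   (\<forall>a x c. P (a @ x @ winv x @ c) \<longleftrightarrow> P (a @ c)) \<and> \<not> P w"
   using w by (intro bexI[of _ w] exI[of _ P]) auto
 qed
qed

section \<open>Components and Cheeger constants of the level graphs\<close>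

context
 fixes w assumes finw: "finite w" and genw: "generating_set \<Delta> w"
begin

abbreviation "LG n \<equiv> level_graph d \<Delta> w n"

abbreviation "stepv x g b \<equiv> (if b then g else inv\<^bsub>\<Delta>\<^esub> g) x"

lemma wD: "g \<in> w ==> g \<in> D"
 using genw by (auto simp: generating_set_def)

lemma stepv_D: "g \<in> w ==> (if b then g else inv\<^bsub>\<Delta>\<^esub> g) \<in> D"
 using wD inv_comp by auto

lemma stepv_level: "x \<in> level d n ==> g \<in> w ==> stepv x g b \<in> level d n"
 by (rule wgrp_level(1)[OF s wgrp stepv_D])

lemma LG_simps: "verts (LG n) = level d n" "arcs (LG n) = level d n \<times> w \<times> UNIV" "tail (LG n) (x, g, b) = x" "head (LG n) (x, g, b) = stepv x g b"
 by (simp_all add: level_graph_def schreier_graph_def)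

lemma wf_LG: "wf_digraph (LG n)"
 by unfold_locales (auto simp: LG_simps stepv_level split: prod.splits)

lemma dominates_LG: "x \<rightarrow>\<^bsub>LG n\<^esub> y \<longleftrightarrow> x \<in> level d n \<and> (\<exists>g\<in>w. \<exists>b. y = stepv x g b)"
 unfolding arcs_ends_conv by (force simp: LG_simps image_iff)

lemma reachable_orbit: "x \<rightarrow>\<^sup>*\<^bsub>LG n\<^esub> y ==> y \<in> orbit D x"
proof (induction rule: wf_digraph.reachable_induct[OF wf_LG, consumes 1])
 case 1
 then show ?case using wgrpD(1)[OF wgrp] by (auto simp: orbit_def intro: image_eqI[of _ _ id])
next
 case (2 y z)
 obtain g b where g: "g \<in> w" "z = stepv y g b" using 2(2) dominates_LG by blast
 obtain f where f: "f \<in> D" "y = f x" using 2(3) by (auto simp: orbit_def)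
 have "z = ((if b then g else inv\<^bsub>\<Delta>\<^esub> g) \<circ> f) x" using g f by simp
 moreover have "(if b then g else inv\<^bsub>\<Delta>\<^esub> g) \<circ> f \<in> D" by (rule wgrpD(2)[OF wgrp f(1) stepv_D[OF g(1)]])
 ultimately show ?case unfolding orbit_def by (rule image_eqI)
qed

lemma orbit_reachable: "f \<in> D ==> x \<in> level d n ==> x \<rightarrow>\<^sup>*\<^bsub>LG n\<^esub> f x"
proof -
 interpret wf_digraph "LG n" by (rule wf_LG)
 assume f: "f \<in> D" and x: "x \<in> level d n"
 have "f \<in> generate \<Delta> w" using f genw by (simp add: generating_set_def)
 then show ?thesis using x
 proof (induction f arbitrary: x rule: generate.induct)
  case one
  then show ?case by (simp add: one_eq LG_simps)
 next
  case (incl h)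
  have "x \<rightarrow>\<^bsub>LG n\<^esub> h x" unfolding dominates_LG using incl by (auto intro!: bexI[of _ h] exI[of _ True])
  then show ?case by (rule reachable_adjI)
 next
  case (inv h)
  have "x \<rightarrow>\<^bsub>LG n\<^esub> (inv\<^bsub>\<Delta>\<^esub> h) x" unfolding dominates_LG using inv by (auto intro!: bexI[of _ h] exI[of _ False])
  then show ?case by (rule reachable_adjI)
 next
  case (eng h1 h2)
  have "h1 \<in> D" using eng.hyps(1) genw by (simp add: generating_set_def)
  then have "h1 x \<in> level d n" by (rule wgrp_level(1)[OF s wgrp _ eng.prems])
  from reachable_trans[OF eng.IH(1)[OF eng.prems] eng.IH(2)[OF this]] show ?case by (simp add: mult_eq)
 qed
qed

text \<open>Every generator is present with its inverse, so reachability is symmetric and coincides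
  with lying in the same orbit.\<close>

lemma sccs_orbit:
 assumes "S \<in> pre_digraph.sccs_verts (LG n)"
 shows "\<exists>x\<in>level d n. S = orbit D x"
proof -
 interpret wf_digraph "LG n" by (rule wf_LG)
 have S: "S \<noteq> {}" "\<And>u v. u \<in> S ==> v \<in> S ==> u \<rightarrow>\<^sup>*\<^bsub>LG n\<^esub> v"
  "\<And>u v. u \<in> S ==> v \<notin> S ==> \<not> u \<rightarrow>\<^sup>*\<^bsub>LG n\<^esub> v \<or> \<not> v \<rightarrow>\<^sup>*\<^bsub>LG n\<^esub> u"
  using assms unfolding sccs_verts_def by auto
 have SL: "S \<subseteq> level d n" using sccs_verts_subsets[OF assms] by (simp add: LG_simps)
 obtain x where x: "x \<in> S" using S(1) by blast
 have xl: "x \<in> level d n" using x SL by blast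
 have "orbit D x \<subseteq> S"
 proof
  fix y assume y: "y \<in> orbit D x"
  then obtain f where f: "f \<in> D" "y = f x" by (auto simp: orbit_def)
  have 1: "x \<rightarrow>\<^sup>*\<^bsub>LG n\<^esub> y" using orbit_reachable[OF f(1) xl] f(2) by simp
  have yl: "y \<in> level d n" using wgrp_level(1)[OF s wgrp f(1) xl] f(2) by simp
  have "(inv\<^bsub>\<Delta>\<^esub> f) y = x" using inv_comp[OF f(1)] f(2) by (metis comp_apply id_apply)
  then have 2: "y \<rightarrow>\<^sup>*\<^bsub>LG n\<^esub> x" using orbit_reachable[OF _ yl, of "inv\<^bsub>\<Delta>\<^esub> f"] inv_comp[OF f(1)] by simp
  show "y \<in> S" using S(3)[OF x, of y] 1 2 by blast
 qed
 moreover have "S \<subseteq> orbit D x" using S(2)[OF x] reachable_orbit by blast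
 ultimately show ?thesis using xl by blast
qed

lemma card_components: "card (graph_components (LG n)) \<le> card (orbit D ` level d n)"
proof -
 interpret wf_digraph "LG n" by (rule wf_LG)
 have "sccs_verts \<subseteq> orbit D ` level d n" using sccs_orbit by blast
 then have "card sccs_verts \<le> card (orbit D ` level d n)" by (intro card_mono) auto
 then show ?thesis by (simp add: card_sccs_verts)
qed

text \<open>An edge boundary that mentions neither the level nor the component; inside a component
  it agrees with \<open>boundary_edges\<close>.\<close>

definition bdw :: "nat list set \<Rightarrow> nat" where
 "bdw A = card {p \<in> A \<times> w \<times> UNIV. stepv (fst p) (fst (snd p)) (snd (snd p)) \<notin> A}"

text \<open>A point is moved out of \<open>A\<close> by a product only if one of the factors moves a
  point out of \<open>A\<close>, and different points give different witnesses. So the constants add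
  up along a word in the generators.\<close>

lemma bdw_bound: "\<delta> \<in> D ==> \<exists>K. \<forall>n A. A \<subseteq> level d n --> card {z\<in>A. \<delta> z \<notin> A} \<le> K * bdw A"
proof -
 assume "\<delta> \<in> D"
 then have "\<delta> \<in> generate \<Delta> w" using genw by (simp add: generating_set_def)
 have gen1: "card {z\<in>A. stepv z g b \<notin> A} \<le> bdw A" if g: "g \<in> w" and A: "A \<subseteq> level d n" for g b A n
  unfolding bdw_def
 proof (rule card_inj_on_le)
  show "inj_on (\<lambda>z. (z, g, b)) {z\<in>A. stepv z g b \<notin> A}" by (rule inj_onI) simp
  have "finite A" by (rule finite_subset[OF A]) simp
  then show "finite {p \<in> A \<times> w \<times> UNIV. stepv (fst p) (fst (snd p)) (snd (snd p)) \<notin> A}" using finw by simp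
 qed (use g in auto)
 from \<open>\<delta> \<in> generate \<Delta> w\<close> show ?thesis
 proof (induction \<delta> rule: generate.induct)
  case one
  show ?case by (simp add: one_eq)
 next
  case (incl h)
  then show ?case using gen1[of h _ _ True] by (intro exI[of _ 1]) simp
 next
  case (inv h)
  then show ?case using gen1[of h _ _ False] by (intro exI[of _ 1]) simp
 next
  case (eng h1 h2)
  obtain K1 where K1: "\<forall>n A. A \<subseteq> level d n --> card {z\<in>A. h1 z \<notin> A} \<le> K1 * bdw A" using eng.IH(1) by blast
  obtain K2 where K2: "\<forall>n A. A \<subseteq> level d n --> card {z\<in>A. h2 z \<notin> A} \<le> K2 * bdw A" using eng.IH(2) by blast
  have h1: "h1 \<in> D" using eng.hyps(1) genw by (simp add: generating_set_def)
  have "card {z\<in>A. (h2 \<circ> h1) z \<notin> A} \<le> (K1 + K2) * bdw A" if A: "A \<subseteq> level d n" for n A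
  proof -
   have fA: "finite A" by (rule finite_subset[OF A]) simp
   have "card {z\<in>A. (h2 \<circ> h1) z \<notin> A} \<le> card ({z\<in>A. h1 z \<notin> A} \<union> {z\<in>A. h1 z \<in> A \<and> h2 (h1 z) \<notin> A})"
    using fA by (intro card_mono) auto
   also have "\<dots> \<le> card {z\<in>A. h1 z \<notin> A} + card {z\<in>A. h1 z \<in> A \<and> h2 (h1 z) \<notin> A}" by (rule card_Un_le)
   also have "card {z\<in>A. h1 z \<in> A \<and> h2 (h1 z) \<notin> A} \<le> card {z\<in>A. h2 z \<notin> A}"
   proof (rule card_inj_on_le)
    show "inj_on h1 {z\<in>A. h1 z \<in> A \<and> h2 (h1 z) \<notin> A}" using wgrp_inj[OF wgrp h1] by (rule inj_on_subset) simp
   qed (use fA in auto)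
   also have "card {z\<in>A. h1 z \<notin> A} + card {z\<in>A. h2 z \<notin> A} \<le> (K1 + K2) * bdw A"
    unfolding distrib_right using K1 K2 A by (intro add_le_mono) simp_all
   finally show ?thesis by simp
  qed
  then show ?case by (intro exI[of _ "K1 + K2"]) (simp add: mult_eq)
 qed
qed

text \<open>All arcs at a vertex stay in its orbit, so the arcs from \<open>A\<close> to the rest of
  the component are exactly the arcs leaving \<open>A\<close>. For a single vertex the infimum is
  over no sets.\<close>

lemma cheeger_component:
 assumes C: "0 < C" "\<forall>n x A. x \<in> level d n --> A \<subset> orbit D x --> A \<noteq> {} --> real (min (card A) (card (orbit D x - A))) \<le> C * real (bdw A)"
  and Y: "Y \<in> graph_components (LG n)"
 shows "ereal (1 / C) \<le> cheeger Y"
proof -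
 interpret wf_digraph "LG n" by (rule wf_LG)
 have "verts Y \<in> sccs_verts" using Y by (simp add: sccs_verts_conv)
 then obtain x where x: "x \<in> level d n" "verts Y = orbit D x" using sccs_orbit by blast
 have ind: "induced_subgraph Y (LG n)" using Y by (rule in_sccs_imp_induced)
 then have aY: "arcs Y = {e \<in> arcs (LG n). tail (LG n) e \<in> verts Y \<and> head (LG n) e \<in> verts Y}"
  and tY: "tail Y = tail (LG n)" "head Y = head (LG n)"
  by (auto simp: induced_subgraph_def subgraph_def compatible_def)
 have OL: "orbit D x \<subseteq> level d n" using wgrp_level(1)[OF s wgrp _ x(1)] by (auto simp: orbit_def)
 have fO: "finite (orbit D x)" by (rule finite_subset[OF OL]) simp
 show ?thesis unfolding cheeger_def
 proof (rule INF_greatest)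
  fix A assume "A \<in> {A. A \<noteq> {} \<and> A \<subset> verts Y}"
  then have A: "A \<noteq> {}" "A \<subset> orbit D x" using x(2) by auto
  have fA: "finite A" by (rule finite_subset[OF psubset_imp_subset[OF A(2)] fO])
  have nO: "stepv y g b \<in> orbit D x" if "y \<in> orbit D x" "g \<in> w" for y g b
  proof -
   have "stepv y g b \<in> orbit D y" unfolding orbit_def by (rule image_eqI[OF refl stepv_D[OF that(2)]])
   then show ?thesis using orbit_eq[OF wgrp that(1)] by simp
  qed
  have "{e \<in> arcs Y. tail Y e \<in> A \<and> head Y e \<in> verts Y - A} = {p \<in> A \<times> w \<times> UNIV. stepv (fst p) (fst (snd p)) (snd (snd p)) \<notin> A}"
  proof (rule Set.set_eqI)
   fix e :: "nat list \<times> (nat list \<Rightarrow> nat list) \<times> bool"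
   obtain y g b where e: "e = (y, g, b)" by (cases e) auto
   have yo: "y \<in> A ==> y \<in> orbit D x \<and> y \<in> level d n" using A(2) OL by blast
   show "e \<in> {e \<in> arcs Y. tail Y e \<in> A \<and> head Y e \<in> verts Y - A} \<longleftrightarrow> e \<in> {p \<in> A \<times> w \<times> UNIV. stepv (fst p) (fst (snd p)) (snd (snd p)) \<notin> A}"
    unfolding e aY tY x(2) using yo nO[of y g b] by (auto simp: LG_simps)
  qed
  then have bA: "boundary_edges Y A = bdw A" by (simp add: boundary_edges_def bdw_def)
  let ?m = "real (min (card A) (card (verts Y - A)))"
  have "0 < card A" "0 < card (orbit D x - A)" using A fA fO by (auto simp: card_gt_0_iff)
  then have m0: "0 < ?m" using x(2) by simp
  have "?m \<le> C * real (bdw A)" using C(2) x A by metis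
  then have "1 / C \<le> real (boundary_edges Y A) / ?m" using m0 C(1) bA by (simp add: field_simps)
  then show "ereal (1 / C) \<le> ereal (real (boundary_edges Y A) / ?m)" by simp
 qed
qed

end

end

theorem theorem1p3:
  fixes d m :: nat
    and H :: "(nat \<Rightarrow> nat) set"
    and M :: "'w measure"
    and a :: "nat \<Rightarrow> 'w \<Rightarrow> nat list \<Rightarrow> nat list"
  assumes "d \<ge> 2"
    and "subgroup H (perm_group {..<d})"
    and "transitive_on H {..<d}"
    and "m \<ge> 1"
    and "prob_space M"
    and "prob_space.indep_vars M (\<lambda>_. borel_of (wreath_topology d H)) a {1..m}"
    and "\<And>i. i \<in> {1..m} \<Longrightarrow>
      haar_prob (wreath_group d H) (wreath_topology d H)
        (distr M (borel_of (wreath_topology d H)) (a i))"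
  defines "\<Gamma> \<equiv> \<lambda>\<omega>. subgroup_generated (wreath_group d H) ((\<lambda>i. a i \<omega>) ` {1..m})"
  shows "AE \<omega> in M. \<forall>D \<Delta>.
    subgroup D (\<Gamma> \<omega>) \<and> \<Delta> = (\<Gamma> \<omega>)\<lparr>carrier := D\<rparr> \<and>
    finitely_generated \<Delta> \<and> \<not> cyclic_group \<Delta> \<longrightarrow>
      (\<exists>K::nat. \<forall>w. finite w \<and> generating_set \<Delta> w \<longrightarrow>
        (\<forall>n. card (graph_components (level_graph d \<Delta> w n)) \<le> K)) \<and>
      (d = 2 \<longrightarrow> (\<forall>w. finite w \<and> generating_set \<Delta> w \<longrightarrow>
        (\<exists>\<alpha>::real. \<alpha> > 0 \<and>
          (\<forall>n. \<forall>C\<in>graph_components (level_graph d \<Delta> w n). cheeger C \<ge> ereal \<alpha>))))"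
proof -
 interpret letter_group d H by (rule letter_group_perm[OF assms(1-3)])
 let ?S = "\<lambda>\<omega>. cfg_of m (\<lambda>i. a i \<omega>)"
 have hr1: "haar M m ?S" by (rule haar_cfg_of(1)[OF assms(5,4,6)]) (rule assms(7))
 have hr2: "a i \<omega> \<in> wreath d H" if "\<omega> \<in> space M" "i \<in> {1..m}" for \<omega> i
  by (rule haar_cfg_of(2)[OF assms(5,4,6) _ that]) (rule assms(7))
 have m0: "0 < m" using assms(4) by simp
 \<comment> \<open>Neither property mentions a subgroup, so one null set serves all
   \<open>\<Delta>\<close>; the rest of the proof is deterministic.\<close>
 have "AE \<omega> in M. (\<forall>k. \<exists>n. girth_gt (stp (?S \<omega>)) m (level d n) k) \<and>
   (\<forall>n. \<forall>v\<in>level d n. \<forall>g0 g1 e0 e1. set g0 \<subseteq> letters m --> set g1 \<subseteq> letters m -->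
    tri (?S \<omega>) 2 (case_nat g0 (\<lambda>_. g1)) v (case_nat e0 (\<lambda>_. e1)) --> Gen (derv (?S \<omega>) (case_nat g0 (\<lambda>_. g1)) v)) \<and> \<omega> \<in> space M"
  by (intro AE_conjI haar_girth[OF hr1] haar_tri_Gen[OF hr1 m0] AE_space)
 then show ?thesis
 proof (rule AE_mp, intro AE_I2 impI allI)
  fix \<omega> D \<Delta>
  assume ae: "(\<forall>k. \<exists>n. girth_gt (stp (?S \<omega>)) m (level d n) k) \<and>
   (\<forall>n. \<forall>v\<in>level d n. \<forall>g0 g1 e0 e1. set g0 \<subseteq> letters m --> set g1 \<subseteq> letters m -->
    tri (?S \<omega>) 2 (case_nat g0 (\<lambda>_. g1)) v (case_nat e0 (\<lambda>_. e1)) --> Gen (derv (?S \<omega>) (case_nat g0 (\<lambda>_. g1)) v)) \<and> \<omega> \<in> space M"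
  assume "subgroup D (\<Gamma> \<omega>) \<and> \<Delta> = (\<Gamma> \<omega>)\<lparr>carrier := D\<rparr> \<and> finitely_generated \<Delta> \<and> \<not> cyclic_group \<Delta>"
  then have D: "subgroup D (\<Gamma> \<omega>)" and \<Delta>: "\<Delta> = (\<Gamma> \<omega>)\<lparr>carrier := D\<rparr>" and fg: "finitely_generated \<Delta>" and nc: "\<not> cyclic_group \<Delta>" by auto
  define s where "s = ?S \<omega>"
  have sp: "\<omega> \<in> space M" using ae by blast
  have aW: "a (Suc i) \<omega> \<in> wreath d H" if "i < m" for i using hr2[OF sp, of "Suc i"] that by simp
  have s: "valid s" unfolding s_def by (rule valid_cfg_of) (rule aW)
  have grpG: "group (\<Gamma> \<omega>)" unfolding \<Gamma>_def by (rule group.group_subgroup_generated[OF group_wreath])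
  have words: "\<exists>w. set w \<subseteq> letters m \<and> f = evf s w" if "f \<in> D" for f
  proof (rule gen_evf[OF s])
   have "f \<in> carrier (\<Gamma> \<omega>)" using subgroup.subset[OF D] that by blast
   then show "f \<in> generate (wreath_group d H) (wreath d H \<inter> (\<lambda>i. a i \<omega>) ` {1..m})"
    by (simp add: \<Gamma>_def carrier_subgroup_generated)
   fix h assume "h \<in> wreath d H \<inter> (\<lambda>i. a i \<omega>) ` {1..m}"
   then obtain i where "i \<in> {1..m}" "h = a i \<omega>" by blast
   then have "i - 1 < m" "h = a (Suc (i - 1)) \<omega>" by auto
   then show "\<exists>w. set w \<subseteq> letters m \<and> h = evf s w"
    using evf_cfg_of[of m "\<lambda>i. a i \<omega>" "i - 1"] aW by (intro exI[of _ "[(i - 1, True)]"]) (simp add: letters_def s_def)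
  qed
  interpret level_action d H s m \<Delta>
  proof (intro level_action.intro level_action_axioms.intro letter_group_axioms)
   show "valid s" by (rule s)
   show "group \<Delta>" unfolding \<Delta> by (rule subgroup.subgroup_is_group[OF D grpG])
   show "f \<otimes>\<^bsub>\<Delta>\<^esub> g = g \<circ> f" for f g by (simp add: \<Delta> \<Gamma>_def subgroup_generated_def)
   show "\<one>\<^bsub>\<Delta>\<^esub> = id" by (simp add: \<Delta> \<Gamma>_def subgroup_generated_def)
   show "\<exists>w. set w \<subseteq> letters m \<and> f = evf s w" if "f \<in> carrier \<Delta>" for f using words that by (simp add: \<Delta>)
  qed
  obtain N Z where Z: "finite Z" "\<And>y. y \<in> level d N ==> \<exists>u\<in>Z. \<exists>w. y = u @ w" "\<And>u. u \<in> Z ==> tile s m (cst s) (carrier \<Delta>) u"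
  proof (rule tiles_exist[OF s sym_cst[OF s] _ _ core_exists[OF fg nc]])
   show "\<exists>n. girth_gt (stp s) m (level d n) k" for k using ae[THEN conjunct1] unfolding s_def by (rule spec)
   show "Gen (derv s (case_nat g0 (\<lambda>_. g1)) v)" if "v \<in> level d n" "set g0 \<subseteq> letters m" "set g1 \<subseteq> letters m"
    "tri s 2 (case_nat g0 (\<lambda>_. g1)) v (case_nat e0 (\<lambda>_. e1))" for n v g0 g1 e0 e1
    by (rule ae[THEN conjunct2, THEN conjunct1, folded s_def, rule_format, OF that])
  qed (rule that)
  \<comment> \<open>The bound depends on the good subtrees alone and hence is the same for all
    finite generating sets.\<close>
  have "card (graph_components (level_graph d \<Delta> w n)) \<le> card Z + d ^ N" if w: "finite w \<and> generating_set \<Delta> w" for w n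
  proof -
   have "card (orbit (carrier \<Delta>) ` level d n) \<le> card Z + d ^ N"
    by (rule few_orbits[OF s wgrp Z(1)]) (erule Z(2), erule Z(3))
   moreover have "card (graph_components (level_graph d \<Delta> w n)) \<le> card (orbit (carrier \<Delta>) ` level d n)"
    using w by (intro card_components) auto
   ultimately show ?thesis by linarith
  qed
  moreover have "\<exists>\<alpha>::real. \<alpha> > 0 \<and> (\<forall>n. \<forall>C\<in>graph_components (level_graph d \<Delta> w n). cheeger C \<ge> ereal \<alpha>)"
   if d: "d = 2" and w: "finite w \<and> generating_set \<Delta> w" for w
  proof -
   have fw: "finite w" "generating_set \<Delta> w" using w by auto
   obtain C where C: "0 < C" "\<forall>n x A. x \<in> level d n --> A \<subset> orbit (carrier \<Delta>) x --> A \<noteq> {} -->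
     real (min (card A) (card (orbit (carrier \<Delta>) x - A))) \<le> C * real (bdw w A)"
    using expansion[OF d s wgrp Z bdw_bound[OF fw]] by blast
   show ?thesis using cheeger_component[OF fw C] C(1) by (intro exI[of _ "1 / C"]) auto
  qed
  ultimately show "(\<exists>K::nat. \<forall>w. finite w \<and> generating_set \<Delta> w -->
    (\<forall>n. card (graph_components (level_graph d \<Delta> w n)) \<le> K)) \<and>
   (d = 2 --> (\<forall>w. finite w \<and> generating_set \<Delta> w -->
    (\<exists>\<alpha>::real. \<alpha> > 0 \<and>
     (\<forall>n. \<forall>C\<in>graph_components (level_graph d \<Delta> w n). cheeger C \<ge> ereal \<alpha>))))"
   by blast
 qed
qed

end
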